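(* Let $\mathcal C$ be a weakly abelian category and $n\ge0$. The functor $$\underline{\mathcal C^+(\bar\Delta_n^\#)}\;\longrightarrow\;\underline{\mathcal C(\dot\Delta_n)},\qquad X\mapsto X|_{\dot\Delta_n},$$ induced by restriction from $\bar\Delta_n^\#$ to $\dot\Delta_n$, is an equivalence of categories.
   Context: For an additive category $\mathcal A$ and a full additive subcategory $\mathcal B$, $\mathcal A/\mathcal B$ has the objects of $\mathcal A$ and, as morphisms, morphisms of $\mathcal A$ modulo those factoring over an object of $\mathcal B$. For a category $D$, $\mathcal C(D)$ is the category of functors $D\to\mathcal C$; posets are viewed as categories. A weak kernel of $f:X\to Y$ in an additive category is a morphism $i:K\to X$ such that $\mathrm{Hom}(S,K)\to\mathrm{Hom}(S,X)\to\mathrm{Hom}(S,Y)$ is exact at the middle term for all objects $S$; weak cokernels are dual. An additive category is weakly abelian if every morphism has a weak kernel and a weak cokernel, and is itself a weak kernel and a weak cokernel. The Freyd category $\hat{\mathcal C}$ of a weakly abelian category $\mathcal C$ is the quotient of the category of morphisms of $\mathcal C$ (commutative squares as morphisms) by the full subcategory of zero morphisms; it is abelian, and $\mathcal C$ embeds fully faithfully via $X\mapsto \mathrm{id}_X$. A commutative quadrangle $(A,B,C,D)$ in $\mathcal C$ (with morphisms $A\to B$, $A\to C$, $B\to D$, $C\to D$) is a weak square if the sequence $A\to B\oplus C\to D$ (second map with a minus sign on one component) is exact at $B\oplus C$ in $\hat{\mathcal C}$; equivalently, its first morphism is a weak kernel of its second. A morphism is split if it is isomorphic, as an object of the category of morphisms,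 to a morphism $X\oplus Y\to Y\oplus Z$ whose only nonzero component is $\mathrm{id}_Y$. $\Delta_n=\{0<1<\dots<n\}$. $\bar\Delta_n$ is the linearly ordered set consisting of $\mathbb Z$ copies of $\Delta_n$ put in a row: elements $\alpha^{+z}$ ($\alpha\in\Delta_n$, $z\in\mathbb Z$), ordered first by $z$, then by $\alpha$; $\alpha:=\alpha^{+0}$; the shift is $\alpha^{+z}\mapsto\alpha^{+(z+1)}$, written $\xi\mapsto\xi^{+1}$, with inverse $\xi\mapsto\xi^{-1}$. The strip $\bar\Delta_n^\#$ is the poset of symbols $\beta/\alpha$ with $\alpha,\beta\in\bar\Delta_n$, $\beta^{-1}\le\alpha\le\beta\le\alpha^{+1}$, where $\beta/\alpha\le\delta/\gamma$ iff $\alpha\le\gamma$ and $\beta\le\delta$. $\dot\Delta_n=\{1<\dots<n\}$ is regarded as a subposet of $\bar\Delta_n^\#$ via $i\mapsto i/0$. $\mathcal C^+(\bar\Delta_n^\#)$ is the full subcategory of $\mathcal C(\bar\Delta_n^\#)$ of those $X$ with $X_{\alpha/\alpha}=0$, $X_{\alpha^{+1}/\alpha}=0$ for all $\alpha\in\bar\Delta_n$, and such that the quadrangle on $(\gamma/\alpha,\delta/\alpha,\gamma/\beta,\delta/\beta)$ is a weak square whenever $\delta^{-1}\le\alpha\le\beta\le\gamma\le\delta\le\alpha^{+1}$. $\mathcal C^{+,split}(\bar\Delta_n^\#)$ is its full subcategory of diagrams all of whose morphisms are split in $\hat{\mathcal C}$, and $\underline{\mathcal C^+(\bar\Delta_n^\#)}:=\mathcal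 C^+(\bar\Delta_n^\#)/\mathcal C^{+,split}(\bar\Delta_n^\#)$. Similarly $\mathcal C^{split}(\dot\Delta_n)\subseteq\mathcal C(\dot\Delta_n)$ is the full subcategory of diagrams all of whose morphisms are split in $\hat{\mathcal C}$, and $\underline{\mathcal C(\dot\Delta_n)}:=\mathcal C(\dot\Delta_n)/\mathcal C^{split}(\dot\Delta_n)$. *)

theory Defs
  imports "HOL-Algebra.Product_Groups"
begin

text \<open>
  Each \<open>Hom A X Y\<close> is an abelian group in the sense of HOL-Algebra, hence written
  multiplicatively: \<open>\<otimes>\<close> is the addition of morphisms, \<open>\<one>\<close> the zero morphism.
  \<open>Cmp A X Y Z g f\<close> is the composite of \<open>f : X \<rightarrow> Y\<close> followed by \<open>g : Y \<rightarrow> Z\<close>. As composition knows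
  its objects, different Hom sets are not required to be disjoint.
\<close>

record ('o, 'm) precat =
  Obj :: "'o set"
  Hom :: "'o \<Rightarrow> 'o \<Rightarrow> 'm monoid"
  Idm :: "'o \<Rightarrow> 'm"
  Cmp :: "'o \<Rightarrow> 'o \<Rightarrow> 'o \<Rightarrow> 'm \<Rightarrow> 'm \<Rightarrow> 'm"

abbreviation Mor :: "('o, 'm) precat \<Rightarrow> 'o \<Rightarrow> 'o \<Rightarrow> 'm set"
  where "Mor A X Y \<equiv> carrier (Hom A X Y)"

abbreviation Zmor :: "('o, 'm) precat \<Rightarrow> 'o \<Rightarrow> 'o \<Rightarrow> 'm"
  where "Zmor A X Y \<equiv> \<one>\<^bsub>Hom A X Y\<^esub>"

locale preadditive_category =
  fixes A :: "('o, 'm) precat"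
  assumes hom_comm_group:
      "\<lbrakk>X \<in> Obj A; Y \<in> Obj A\<rbrakk> \<Longrightarrow> comm_group (Hom A X Y)"
    and id_closed:
      "X \<in> Obj A \<Longrightarrow> Idm A X \<in> Mor A X X"
    and cmp_closed:
      "\<lbrakk>X \<in> Obj A; Y \<in> Obj A; Z \<in> Obj A; f \<in> Mor A X Y; g \<in> Mor A Y Z\<rbrakk>
        \<Longrightarrow> Cmp A X Y Z g f \<in> Mor A X Z"
    and cmp_id_left:
      "\<lbrakk>X \<in> Obj A; Y \<in> Obj A; f \<in> Mor A X Y\<rbrakk> \<Longrightarrow> Cmp A X Y Y (Idm A Y) f = f"
    and cmp_id_right:
      "\<lbrakk>X \<in> Obj A; Y \<in> Obj A; f \<in> Mor A X Y\<rbrakk> \<Longrightarrow> Cmp A X X Y f (Idm A X) = f"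
    and cmp_assoc:
      "\<lbrakk>W \<in> Obj A; X \<in> Obj A; Y \<in> Obj A; Z \<in> Obj A;
        f \<in> Mor A W X; g \<in> Mor A X Y; h \<in> Mor A Y Z\<rbrakk>
        \<Longrightarrow> Cmp A W X Z (Cmp A X Y Z h g) f = Cmp A W Y Z h (Cmp A W X Y g f)"
    and cmp_add_left:
      "\<lbrakk>X \<in> Obj A; Y \<in> Obj A; Z \<in> Obj A; f \<in> Mor A X Y; g \<in> Mor A Y Z; g' \<in> Mor A Y Z\<rbrakk>
        \<Longrightarrow> Cmp A X Y Z (g \<otimes>\<^bsub>Hom A Y Z\<^esub> g') f
          = Cmp A X Y Z g f \<otimes>\<^bsub>Hom A X Z\<^esub> Cmp A X Y Z g' f"
    and cmp_add_right:
      "\<lbrakk>X \<in> Obj A; Y \<in> Obj A; Z \<in> Obj A; f \<in> Mor A X Y; f' \<in> Mor A X Y; g \<in> Mor A Y Z\<rbrakk>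
        \<Longrightarrow> Cmp A X Y Z g (f \<otimes>\<^bsub>Hom A X Y\<^esub> f')
          = Cmp A X Y Z g f \<otimes>\<^bsub>Hom A X Z\<^esub> Cmp A X Y Z g f'"

definition is_zero_object :: "('o, 'm) precat \<Rightarrow> 'o \<Rightarrow> bool"
  where "is_zero_object A Z \<longleftrightarrow>
    Z \<in> Obj A \<and> (\<forall>X \<in> Obj A. (\<exists>!f. f \<in> Mor A X Z) \<and> (\<exists>!f. f \<in> Mor A Z X))"

text \<open>\<open>P\<close> is a direct sum of \<open>X\<close> and \<open>Y\<close>, with inclusions \<open>i, j\<close> and projections \<open>p, q\<close>.\<close>

definition is_biproduct ::
    "('o, 'm) precat \<Rightarrow> 'o \<Rightarrow> 'o \<Rightarrow> 'o \<Rightarrow> 'm \<Rightarrow> 'm \<Rightarrow> 'm \<Rightarrow> 'm \<Rightarrow> bool"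
  where "is_biproduct A X Y P i j p q \<longleftrightarrow>
    X \<in> Obj A \<and> Y \<in> Obj A \<and> P \<in> Obj A \<and>
    i \<in> Mor A X P \<and> j \<in> Mor A Y P \<and> p \<in> Mor A P X \<and> q \<in> Mor A P Y \<and>
    Cmp A X P X p i = Idm A X \<and> Cmp A Y P Y q j = Idm A Y \<and>
    Cmp A Y P X p j = Zmor A Y X \<and> Cmp A X P Y q i = Zmor A X Y \<and>
    Cmp A P X P i p \<otimes>\<^bsub>Hom A P P\<^esub> Cmp A P Y P j q = Idm A P"

locale additive_category = preadditive_category +
  assumes zero_object_exists: "\<exists>Z. is_zero_object A Z"
    and biproduct_exists:
      "\<lbrakk>X \<in> Obj A; Y \<in> Obj A\<rbrakk> \<Longrightarrow> \<exists>P i j p q. is_biproduct A X Y P i j p q"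

text \<open>\<open>i : K \<rightarrow> X\<close> is a weak kernel of \<open>f : X \<rightarrow> Y\<close>; \<open>c : Y \<rightarrow> Q\<close> is a weak cokernel of \<open>f : X \<rightarrow> Y\<close>.\<close>

definition is_weak_kernel ::
    "('o, 'm) precat \<Rightarrow> 'o \<Rightarrow> 'm \<Rightarrow> 'o \<Rightarrow> 'm \<Rightarrow> 'o \<Rightarrow> bool"
  where "is_weak_kernel A K i X f Y \<longleftrightarrow>
    K \<in> Obj A \<and> X \<in> Obj A \<and> Y \<in> Obj A \<and> i \<in> Mor A K X \<and> f \<in> Mor A X Y \<and>
    (\<forall>S \<in> Obj A. Cmp A S K X i ` Mor A S K = kernel (Hom A S X) (Hom A S Y) (Cmp A S X Y f))"

definition is_weak_cokernel ::
    "('o, 'm) precat \<Rightarrow> 'o \<Rightarrow> 'm \<Rightarrow> 'o \<Rightarrow> 'm \<Rightarrow> 'o \<Rightarrow> bool"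
  where "is_weak_cokernel A X f Y c Q \<longleftrightarrow>
    X \<in> Obj A \<and> Y \<in> Obj A \<and> Q \<in> Obj A \<and> f \<in> Mor A X Y \<and> c \<in> Mor A Y Q \<and>
    (\<forall>S \<in> Obj A. (\<lambda>h. Cmp A Y Q S h c) ` Mor A Q S
        = kernel (Hom A Y S) (Hom A X S) (\<lambda>h. Cmp A X Y S h f))"

locale weakly_abelian_category = additive_category +
  assumes weak_kernel_exists:
      "\<lbrakk>X \<in> Obj A; Y \<in> Obj A; f \<in> Mor A X Y\<rbrakk> \<Longrightarrow> \<exists>K i. is_weak_kernel A K i X f Y"
    and weak_cokernel_exists:
      "\<lbrakk>X \<in> Obj A; Y \<in> Obj A; f \<in> Mor A X Y\<rbrakk> \<Longrightarrow> \<exists>Q c. is_weak_cokernel A X f Y c Q"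
    and is_some_weak_kernel:
      "\<lbrakk>X \<in> Obj A; Y \<in> Obj A; f \<in> Mor A X Y\<rbrakk> \<Longrightarrow> \<exists>Z g. is_weak_kernel A X f Y g Z"
    and is_some_weak_cokernel:
      "\<lbrakk>X \<in> Obj A; Y \<in> Obj A; f \<in> Mor A X Y\<rbrakk> \<Longrightarrow> \<exists>W e. is_weak_cokernel A W e X f Y"

definition isomorphic :: "('o, 'm) precat \<Rightarrow> 'o \<Rightarrow> 'o \<Rightarrow> bool"
  where "isomorphic A X Y \<longleftrightarrow>
    (\<exists>f \<in> Mor A X Y. \<exists>g \<in> Mor A Y X. Cmp A X Y X g f = Idm A X \<and> Cmp A Y X Y f g = Idm A Y)"

definition is_epi :: "('o, 'm) precat \<Rightarrow> 'o \<Rightarrow> 'm \<Rightarrow> 'o \<Rightarrow> bool"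
  where "is_epi A X e Y \<longleftrightarrow> e \<in> Mor A X Y \<and>
    (\<forall>Z \<in> Obj A. \<forall>g \<in> Mor A Y Z. \<forall>h \<in> Mor A Y Z. Cmp A X Y Z g e = Cmp A X Y Z h e \<longrightarrow> g = h)"

definition is_kernel ::
    "('o, 'm) precat \<Rightarrow> 'o \<Rightarrow> 'm \<Rightarrow> 'o \<Rightarrow> 'm \<Rightarrow> 'o \<Rightarrow> bool"
  where "is_kernel A K k Y g Z \<longleftrightarrow>
    K \<in> Obj A \<and> k \<in> Mor A K Y \<and> Cmp A K Y Z g k = Zmor A K Z \<and>
    (\<forall>T \<in> Obj A. \<forall>h \<in> Mor A T Y. Cmp A T Y Z g h = Zmor A T Z
        \<longrightarrow> (\<exists>!u. u \<in> Mor A T K \<and> Cmp A T K Y k u = h))"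

text \<open>
  Exactness of \<open>X \<rightarrow> Y \<rightarrow> Z\<close> at \<open>Y\<close> in an abelian category: the first morphism is an epimorphism
  followed by a kernel of the second, i.e. image and kernel agree as subobjects of \<open>Y\<close>.
\<close>

definition exact_at ::
    "('o, 'm) precat \<Rightarrow> 'o \<Rightarrow> 'm \<Rightarrow> 'o \<Rightarrow> 'm \<Rightarrow> 'o \<Rightarrow> bool"
  where "exact_at A X f Y g Z \<longleftrightarrow>
    X \<in> Obj A \<and> Y \<in> Obj A \<and> Z \<in> Obj A \<and> f \<in> Mor A X Y \<and> g \<in> Mor A Y Z \<and>
    (\<exists>K k e. is_kernel A K k Y g Z \<and> is_epi A X e K \<and> f = Cmp A X K Y k e)"

definition full_subcat :: "('o, 'm) precat \<Rightarrow> 'o set \<Rightarrow> ('o, 'm) precat"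
  where "full_subcat A S = A\<lparr>Obj := Obj A \<inter> S\<rparr>"

definition factoring :: "('o, 'm) precat \<Rightarrow> 'o set \<Rightarrow> 'o \<Rightarrow> 'o \<Rightarrow> 'm set"
  where "factoring A S X Y =
    {Cmp A X W Y v u | W u v. W \<in> S \<and> u \<in> Mor A X W \<and> v \<in> Mor A W Y}"

definition residue_class :: "('o, 'm) precat \<Rightarrow> 'o set \<Rightarrow> 'o \<Rightarrow> 'o \<Rightarrow> 'm \<Rightarrow> 'm set"
  where "residue_class A S X Y f = factoring A S X Y #>\<^bsub>Hom A X Y\<^esub> f"

text \<open>
  The full subcategory is given by its set of objects \<open>S\<close>. The unions over representatives, here
  and in the induced functor further below, are unions of equal residue classes if the operation
  is well-defined.
\<close>

definition quotient_cat :: "('o, 'm) precat \<Rightarrow> 'o set \<Rightarrow> ('o, 'm set) precat"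
  where "quotient_cat A S = \<lparr>
    Obj = Obj A,
    Hom = (\<lambda>X Y. Hom A X Y Mod factoring A S X Y),
    Idm = (\<lambda>X. residue_class A S X X (Idm A X)),
    Cmp = (\<lambda>X Y Z G F. \<Union>g \<in> G. \<Union>f \<in> F. residue_class A S X Z (Cmp A X Y Z g f))\<rparr>"

text \<open>Objects are morphisms \<open>a : X \<rightarrow> X'\<close>, as triples \<open>(X, a, X')\<close>; morphisms are commutative squares.\<close>

definition morphism_cat :: "('o, 'm) precat \<Rightarrow> ('o \<times> 'm \<times> 'o, 'm \<times> 'm) precat"
  where "morphism_cat A = \<lparr>
    Obj = {(X, a, X'). X \<in> Obj A \<and> X' \<in> Obj A \<and> a \<in> Mor A X X'},
    Hom = (\<lambda>(X, a, X') (Y, b, Y').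
      (Hom A X Y \<times>\<times> Hom A X' Y')
        \<lparr>carrier := {(f, f'). f \<in> Mor A X Y \<and> f' \<in> Mor A X' Y' \<and>
                              Cmp A X Y Y' b f = Cmp A X X' Y' f' a}\<rparr>),
    Idm = (\<lambda>(X, a, X'). (Idm A X, Idm A X')),
    Cmp = (\<lambda>(X, a, X') (Y, b, Y') (Z, c, Z') (g, g') (f, f').
      (Cmp A X Y Z g f, Cmp A X' Y' Z' g' f'))\<rparr>"

definition zero_morphisms :: "('o, 'm) precat \<Rightarrow> ('o \<times> 'm \<times> 'o) set"
  where "zero_morphisms A = {(X, a, X'). X \<in> Obj A \<and> X' \<in> Obj A \<and> a = Zmor A X X'}"

definition freyd :: "('o, 'm) precat \<Rightarrow> ('o \<times> 'm \<times> 'o, ('m \<times> 'm) set) precat"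
  where "freyd A = quotient_cat (morphism_cat A) (zero_morphisms A)"

definition freyd_obj :: "('o, 'm) precat \<Rightarrow> 'o \<Rightarrow> 'o \<times> 'm \<times> 'o"
  where "freyd_obj A X = (X, Idm A X, X)"

definition freyd_mor :: "('o, 'm) precat \<Rightarrow> 'o \<Rightarrow> 'o \<Rightarrow> 'm \<Rightarrow> ('m \<times> 'm) set"
  where "freyd_mor A X Y f =
    residue_class (morphism_cat A) (zero_morphisms A) (freyd_obj A X) (freyd_obj A Y) (f, f)"

text \<open>
  \<open>f : V \<rightarrow> W\<close> is split if it is isomorphic, in the category of morphisms, to a morphism
  \<open>m : X \<oplus> Y \<rightarrow> Y \<oplus> Z\<close> whose matrix has the identity of \<open>Y\<close> as its only nonzero entry.
\<close>

definition is_split :: "('o, 'm) precat \<Rightarrow> 'o \<Rightarrow> 'm \<Rightarrow> 'o \<Rightarrow> bool"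
  where "is_split A V f W \<longleftrightarrow>
    (\<exists>X Y Z P iX iY pX pY Q jY jZ qY qZ m.
      is_biproduct A X Y P iX iY pX pY \<and> is_biproduct A Y Z Q jY jZ qY qZ \<and>
      m \<in> Mor A P Q \<and>
      Cmp A X P Y (Cmp A P Q Y qY m) iX = Zmor A X Y \<and>
      Cmp A Y P Y (Cmp A P Q Y qY m) iY = Idm A Y \<and>
      Cmp A X P Z (Cmp A P Q Z qZ m) iX = Zmor A X Z \<and>
      Cmp A Y P Z (Cmp A P Q Z qZ m) iY = Zmor A Y Z \<and>
      isomorphic (morphism_cat A) (V, f, W) (P, m, Q))"

definition freyd_split :: "('o, 'm) precat \<Rightarrow> 'o \<Rightarrow> 'm \<Rightarrow> 'o \<Rightarrow> bool"
  where "freyd_split A V f W \<longleftrightarrow>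
    is_split (freyd A) (freyd_obj A V) (freyd_mor A V W f) (freyd_obj A W)"

text \<open>
  The quadrangle \<open>(U, V, W, X)\<close> has sides \<open>a : U \<rightarrow> V\<close>, \<open>b : U \<rightarrow> W\<close>, \<open>c : V \<rightarrow> X\<close>, \<open>d : W \<rightarrow> X\<close>; the
  morphism \<open>U \<rightarrow> V \<oplus> W\<close> is \<open>(a, b)\<close>, and \<open>V \<oplus> W \<rightarrow> X\<close> is \<open>(c, -d)\<close>.
\<close>

definition is_weak_square ::
    "('o, 'm) precat \<Rightarrow> 'o \<Rightarrow> 'o \<Rightarrow> 'o \<Rightarrow> 'o \<Rightarrow> 'm \<Rightarrow> 'm \<Rightarrow> 'm \<Rightarrow> 'm \<Rightarrow> bool"
  where "is_weak_square A U V W X a b c d \<longleftrightarrow>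
    U \<in> Obj A \<and> V \<in> Obj A \<and> W \<in> Obj A \<and> X \<in> Obj A \<and>
    a \<in> Mor A U V \<and> b \<in> Mor A U W \<and> c \<in> Mor A V X \<and> d \<in> Mor A W X \<and>
    Cmp A U V X c a = Cmp A U W X d b \<and>
    (\<exists>P i j p q. is_biproduct A V W P i j p q \<and>
      exact_at (freyd A)
        (freyd_obj A U)
        (freyd_mor A U P (Cmp A U V P i a \<otimes>\<^bsub>Hom A U P\<^esub> Cmp A U W P j b))
        (freyd_obj A P)
        (freyd_mor A P X (Cmp A P V X c p \<otimes>\<^bsub>Hom A P X\<^esub> inv\<^bsub>Hom A P X\<^esub> Cmp A P W X d q))
        (freyd_obj A X))"

record ('d, 'o, 'm) diagram =
  Vtx :: "'d \<Rightarrow> 'o"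
  Tr :: "'d \<Rightarrow> 'd \<Rightarrow> 'm"

text \<open>
  The category of functors from the poset with carrier \<open>D\<close> and order \<open>leq\<close> to \<open>A\<close>; \<open>Tr X x y\<close> is
  the morphism from \<open>Vtx X x\<close> to \<open>Vtx X y\<close> for \<open>leq x y\<close>. Functors and natural transformations are
  made \<open>undefined\<close> outside the poset, so that equal ones are equal in HOL.
\<close>

definition diagram_cat ::
    "('o, 'm) precat \<Rightarrow> 'd set \<Rightarrow> ('d \<Rightarrow> 'd \<Rightarrow> bool) \<Rightarrow> (('d, 'o, 'm) diagram, 'd \<Rightarrow> 'm) precat"
  where "diagram_cat A D leq = \<lparr>
    Obj = {X. Vtx X \<in> D \<rightarrow>\<^sub>E Obj A \<and>
              (\<forall>x \<in> D. \<forall>y \<in> D. leq x y \<longrightarrow> Tr X x y \<in> Mor A (Vtx X x) (Vtx X y)) \<and>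
              (\<forall>x y. \<not> (x \<in> D \<and> y \<in> D \<and> leq x y) \<longrightarrow> Tr X x y = undefined) \<and>
              (\<forall>x \<in> D. Tr X x x = Idm A (Vtx X x)) \<and>
              (\<forall>x \<in> D. \<forall>y \<in> D. \<forall>z \<in> D. leq x y \<longrightarrow> leq y z \<longrightarrow>
                Cmp A (Vtx X x) (Vtx X y) (Vtx X z) (Tr X y z) (Tr X x y) = Tr X x z)},
    Hom = (\<lambda>X Y.
      (product_group D (\<lambda>x. Hom A (Vtx X x) (Vtx Y x)))
        \<lparr>carrier := {t. t \<in> (\<Pi>\<^sub>E x\<in>D. Mor A (Vtx X x) (Vtx Y x)) \<and>
            (\<forall>x \<in> D. \<forall>y \<in> D. leq x y \<longrightarrow>
              Cmp A (Vtx X x) (Vtx X y) (Vtx Y y) (t y) (Tr X x y)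
                = Cmp A (Vtx X x) (Vtx Y x) (Vtx Y y) (Tr Y x y) (t x))}\<rparr>),
    Idm = (\<lambda>X. \<lambda>x\<in>D. Idm A (Vtx X x)),
    Cmp = (\<lambda>X Y Z s t. \<lambda>x\<in>D. Cmp A (Vtx X x) (Vtx Y x) (Vtx Z x) (s x) (t x))\<rparr>"

definition split_diagrams ::
    "('o, 'm) precat \<Rightarrow> 'd set \<Rightarrow> ('d \<Rightarrow> 'd \<Rightarrow> bool) \<Rightarrow> ('d, 'o, 'm) diagram set"
  where "split_diagrams A D leq = {X \<in> Obj (diagram_cat A D leq).
    \<forall>x \<in> D. \<forall>y \<in> D. leq x y \<longrightarrow> freyd_split A (Vtx X x) (Tr X x y) (Vtx X y)}"

text \<open>\<open>(z, a)\<close> stands for the copy of \<open>a\<close> in the \<open>z\<close>-th copy of \<open>{0, \<dots>, n}\<close>.\<close>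

type_synonym bar = "int \<times> nat"

definition bar_carrier :: "nat \<Rightarrow> bar set"
  where "bar_carrier n = {(z, a). a \<le> n}"

fun bar_le :: "bar \<Rightarrow> bar \<Rightarrow> bool"
  where "bar_le (z, a) (w, b) \<longleftrightarrow> z < w \<or> (z = w \<and> a \<le> b)"

fun shift :: "bar \<Rightarrow> bar"
  where "shift (z, a) = (z + 1, a)"

fun unshift :: "bar \<Rightarrow> bar"
  where "unshift (z, a) = (z - 1, a)"

text \<open>The pair \<open>(\<beta>, \<alpha>)\<close> stands for the symbol \<open>\<beta>/\<alpha>\<close>.\<close>

definition strip :: "nat \<Rightarrow> (bar \<times> bar) set"
  where "strip n = {(\<beta>, \<alpha>). \<beta> \<in> bar_carrier n \<and> \<alpha> \<in> bar_carrier n \<and>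
    bar_le (unshift \<beta>) \<alpha> \<and> bar_le \<alpha> \<beta> \<and> bar_le \<beta> (shift \<alpha>)}"

fun strip_le :: "bar \<times> bar \<Rightarrow> bar \<times> bar \<Rightarrow> bool"
  where "strip_le (\<beta>, \<alpha>) (\<delta>, \<gamma>) \<longleftrightarrow> bar_le \<alpha> \<gamma> \<and> bar_le \<beta> \<delta>"

definition strip_cat ::
    "('o, 'm) precat \<Rightarrow> nat \<Rightarrow> ((bar \<times> bar, 'o, 'm) diagram, bar \<times> bar \<Rightarrow> 'm) precat"
  where "strip_cat A n = diagram_cat A (strip n) strip_le"

definition strip_plus :: "('o, 'm) precat \<Rightarrow> nat \<Rightarrow> (bar \<times> bar, 'o, 'm) diagram set"
  where "strip_plus A n = {X \<in> Obj (strip_cat A n).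
    (\<forall>\<alpha> \<in> bar_carrier n.
      is_zero_object A (Vtx X (\<alpha>, \<alpha>)) \<and> is_zero_object A (Vtx X (shift \<alpha>, \<alpha>))) \<and>
    (\<forall>\<alpha> \<in> bar_carrier n. \<forall>\<beta> \<in> bar_carrier n. \<forall>\<gamma> \<in> bar_carrier n. \<forall>\<delta> \<in> bar_carrier n.
      bar_le (unshift \<delta>) \<alpha> \<and> bar_le \<alpha> \<beta> \<and> bar_le \<beta> \<gamma> \<and> bar_le \<gamma> \<delta> \<and> bar_le \<delta> (shift \<alpha>) \<longrightarrow>
      is_weak_square A
        (Vtx X (\<gamma>, \<alpha>)) (Vtx X (\<delta>, \<alpha>)) (Vtx X (\<gamma>, \<beta>)) (Vtx X (\<delta>, \<beta>))
        (Tr X (\<gamma>, \<alpha>) (\<delta>, \<alpha>)) (Tr X (\<gamma>, \<alpha>) (\<gamma>, \<beta>))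
        (Tr X (\<delta>, \<alpha>) (\<delta>, \<beta>)) (Tr X (\<gamma>, \<beta>) (\<delta>, \<beta>)))}"

definition plus_cat ::
    "('o, 'm) precat \<Rightarrow> nat \<Rightarrow> ((bar \<times> bar, 'o, 'm) diagram, bar \<times> bar \<Rightarrow> 'm) precat"
  where "plus_cat A n = full_subcat (strip_cat A n) (strip_plus A n)"

definition split_plus :: "('o, 'm) precat \<Rightarrow> nat \<Rightarrow> (bar \<times> bar, 'o, 'm) diagram set"
  where "split_plus A n = strip_plus A n \<inter> split_diagrams A (strip n) strip_le"

definition stable_plus_cat ::
    "('o, 'm) precat \<Rightarrow> nat \<Rightarrow> ((bar \<times> bar, 'o, 'm) diagram, (bar \<times> bar \<Rightarrow> 'm) set) precat"
  where "stable_plus_cat A n = quotient_cat (plus_cat A n) (split_plus A n)"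

definition dot_cat :: "('o, 'm) precat \<Rightarrow> nat \<Rightarrow> ((nat, 'o, 'm) diagram, nat \<Rightarrow> 'm) precat"
  where "dot_cat A n = diagram_cat A {1..n} (\<le>)"

definition split_dot :: "('o, 'm) precat \<Rightarrow> nat \<Rightarrow> (nat, 'o, 'm) diagram set"
  where "split_dot A n = split_diagrams A {1..n} (\<le>)"

definition stable_dot_cat ::
    "('o, 'm) precat \<Rightarrow> nat \<Rightarrow> ((nat, 'o, 'm) diagram, (nat \<Rightarrow> 'm) set) precat"
  where "stable_dot_cat A n = quotient_cat (dot_cat A n) (split_dot A n)"

record ('o, 'm, 'p, 'q) functr =
  FObj :: "'o \<Rightarrow> 'p"
  FMor :: "'o \<Rightarrow> 'o \<Rightarrow> 'm \<Rightarrow> 'q"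

definition is_functor ::
    "('o, 'm) precat \<Rightarrow> ('p, 'q) precat \<Rightarrow> ('o, 'm, 'p, 'q) functr \<Rightarrow> bool"
  where "is_functor A B F \<longleftrightarrow>
    (\<forall>X \<in> Obj A. FObj F X \<in> Obj B) \<and>
    (\<forall>X \<in> Obj A. \<forall>Y \<in> Obj A. \<forall>f \<in> Mor A X Y. FMor F X Y f \<in> Mor B (FObj F X) (FObj F Y)) \<and>
    (\<forall>X \<in> Obj A. FMor F X X (Idm A X) = Idm B (FObj F X)) \<and>
    (\<forall>X \<in> Obj A. \<forall>Y \<in> Obj A. \<forall>Z \<in> Obj A. \<forall>f \<in> Mor A X Y. \<forall>g \<in> Mor A Y Z.
      FMor F X Z (Cmp A X Y Z g f)
        = Cmp B (FObj F X) (FObj F Y) (FObj F Z) (FMor F Y Z g) (FMor F X Y f))"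

definition id_functor :: "('o, 'm, 'o, 'm) functr"
  where "id_functor = \<lparr>FObj = (\<lambda>X. X), FMor = (\<lambda>X Y f. f)\<rparr>"

definition comp_functor ::
    "('p, 'q, 'r, 's) functr \<Rightarrow> ('o, 'm, 'p, 'q) functr \<Rightarrow> ('o, 'm, 'r, 's) functr"
  where "comp_functor G F = \<lparr>
    FObj = (\<lambda>X. FObj G (FObj F X)),
    FMor = (\<lambda>X Y f. FMor G (FObj F X) (FObj F Y) (FMor F X Y f))\<rparr>"

definition naturally_isomorphic ::
    "('o, 'm) precat \<Rightarrow> ('p, 'q) precat
      \<Rightarrow> ('o, 'm, 'p, 'q) functr \<Rightarrow> ('o, 'm, 'p, 'q) functr \<Rightarrow> bool"
  where "naturally_isomorphic A B F G \<longleftrightarrow>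
    (\<exists>t s.
      (\<forall>X \<in> Obj A. t X \<in> Mor B (FObj F X) (FObj G X) \<and> s X \<in> Mor B (FObj G X) (FObj F X) \<and>
        Cmp B (FObj F X) (FObj G X) (FObj F X) (s X) (t X) = Idm B (FObj F X) \<and>
        Cmp B (FObj G X) (FObj F X) (FObj G X) (t X) (s X) = Idm B (FObj G X)) \<and>
      (\<forall>X \<in> Obj A. \<forall>Y \<in> Obj A. \<forall>f \<in> Mor A X Y.
        Cmp B (FObj F X) (FObj F Y) (FObj G Y) (t Y) (FMor F X Y f)
          = Cmp B (FObj F X) (FObj G X) (FObj G Y) (FMor G X Y f) (t X)))"

definition is_equivalence ::
    "('o, 'm) precat \<Rightarrow> ('p, 'q) precat \<Rightarrow> ('o, 'm, 'p, 'q) functr \<Rightarrow> bool"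
  where "is_equivalence A B F \<longleftrightarrow> is_functor A B F \<and>
    (\<exists>G. is_functor B A G \<and>
      naturally_isomorphic A A (comp_functor G F) id_functor \<and>
      naturally_isomorphic B B (comp_functor F G) id_functor)"

text \<open>Restriction of diagrams along a monotone map \<open>e\<close> out of the poset \<open>(D, leq)\<close>.\<close>

definition restriction ::
    "'e set \<Rightarrow> ('e \<Rightarrow> 'e \<Rightarrow> bool) \<Rightarrow> ('e \<Rightarrow> 'd)
      \<Rightarrow> (('d, 'o, 'm) diagram, 'd \<Rightarrow> 'm, ('e, 'o, 'm) diagram, 'e \<Rightarrow> 'm) functr"
  where "restriction D leq e = \<lparr>
    FObj = (\<lambda>X. \<lparr>Vtx = (\<lambda>x\<in>D. Vtx X (e x)),
                 Tr = (\<lambda>x y. if x \<in> D \<and> y \<in> D \<and> leq x y then Tr X (e x) (e y) else undefined)\<rparr>),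
    FMor = (\<lambda>X Y t. \<lambda>x\<in>D. t (e x))\<rparr>"

definition induced_functor ::
    "('p, 'q) precat \<Rightarrow> 'p set \<Rightarrow> ('o, 'm, 'p, 'q) functr \<Rightarrow> ('o, 'm set, 'p, 'q set) functr"
  where "induced_functor B T F = \<lparr>
    FObj = FObj F,
    FMor = (\<lambda>X Y \<phi>. \<Union>f \<in> \<phi>. residue_class B T (FObj F X) (FObj F Y) (FMor F X Y f))\<rparr>"

definition dot_embedding :: "nat \<Rightarrow> bar \<times> bar"
  where "dot_embedding i = ((0, i), (0, 0))"

definition stable_restriction ::
    "('o, 'm) precat \<Rightarrow> nat \<Rightarrow>
      ((bar \<times> bar, 'o, 'm) diagram, (bar \<times> bar \<Rightarrow> 'm) set,
       (nat, 'o, 'm) diagram, (nat \<Rightarrow> 'm) set) functr"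
  where "stable_restriction A n =
    induced_functor (dot_cat A n) (split_dot A n) (restriction {1..n} (\<le>) dot_embedding)"

end

theory Submission
  imports Defs
begin

text \<open>
  With \<open>N = n + 1\<close> and integer coordinates, the objects of \<open>\<C>\<^sup>+\<close> of the strip are diagrams \<open>X\<close> on the
  points \<open>(j, i)\<close> with \<open>i \<le> j \<le> i + N\<close> that are zero at the boundary points \<open>(i, i)\<close> and \<open>(i + N, i)\<close> and
  in which all rectangles are weak squares. Their restriction consists of the objects at \<open>(j, 0)\<close>,
  \<open>0 < j < N\<close>, that is, of the inner part of row \<open>0\<close>.

  In a weakly abelian category a square is a weak pullback iff it is a weak pushout
  (\<open>wpb_imp_wpo\<close>). Therefore row \<open>i + 1\<close> is obtained from row \<open>i\<close> by weak pushouts, and row \<open>i - 1\<close> by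
  weak pullbacks: every diagram on row \<open>0\<close> extends to the strip (\<open>plus_extends\<close>). For the same
  reason every morphism of rows extends to the strip (\<open>nt_extend\<close>). So restriction is surjective on
  objects and full already before the passage to quotients, and it preserves split diagrams. What
  remains is faithfulness of the induced functor: a morphism \<open>g : X \<rightarrow> Y\<close> whose restriction factors over
  a split diagram factors itself over a split diagram (\<open>factors_if_row_factors\<close>).

  The split diagrams needed are sums of rectangles. For a point \<open>k\<close> off the boundary, the points
  that can be reached from \<open>k\<close> without passing the boundary form a rectangle, and the diagram that is
  constant on this rectangle and zero elsewhere lies in \<open>\<C>\<^sup>+\<close> and is split. If a morphism \<open>g\<close> vanishes
  at all points before \<open>k\<close>, then its component at \<open>k\<close> kills the objects before \<open>k\<close>. By the weak pushouts
  with a zero corner it factors through the last object of the rectangle of \<open>k\<close>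
  (\<open>factor_through_top\<close>), and so \<open>g\<close> agrees at \<open>k\<close> with a morphism that factors over a rectangle.

  A morphism that vanishes on row \<open>0\<close> factors over a split diagram (\<open>vanishing_factors\<close>): subtracting
  morphisms over rectangles for all points above row \<open>0\<close>, one after the other, and dually for those
  below, exhausts it. If all arrows of row \<open>0\<close> of \<open>S\<close> split, then the identity of \<open>S\<close> factors over a split
  diagram (\<open>id_factors_if_row_regular\<close>): if the rectangle of \<open>k\<close> meets row \<open>0\<close>, the arrow from \<open>k\<close> to
  the last object of the rectangle leads from a weak kernel to a weak cokernel of arrows of row \<open>0\<close>,
  hence splits as well (\<open>regular_kernel_to_cokernel\<close>), and this makes it possible to change the
  identity by morphisms over rectangles until it vanishes on row \<open>0\<close>. In general, extend the split
  diagram over which the restriction of \<open>g\<close> factors to a diagram \<open>S\<close> on the strip, and the two factors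
  to \<open>u : X \<rightarrow> S\<close> and \<open>v : S \<rightarrow> Y\<close>. Then \<open>v u\<close> factors since the identity of \<open>S\<close> does, and \<open>g - v u\<close> since it vanishes on row \<open>0\<close>.

  The Freyd category enters through two facts only. A sequence of objects of \<open>\<C>\<close> is exact in the Freyd
  category iff the first morphism is a weak kernel of the second (\<open>wker_imp_exact_at_freyd\<close>,
  \<open>exact_at_freyd_imp_wker\<close>), and a morphism \<open>f\<close> of \<open>\<C>\<close> is split there iff it is regular, that is,
  \<open>f g f = f\<close> for some \<open>g\<close> (\<open>freyd_split_imp_regular\<close>, \<open>regular_imp_freyd_split\<close>). The argument above thus
  takes place in \<open>\<C>\<close>.
\<close>

section \<open>Additive categories as partial algebras of arrows\<close>

text \<open>
  The arrows of an additive category as one partial algebra: an object is its identity, and a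
  composite or sum that is not defined is an arrow that is not \<open>ok\<close>. Composition and
  addition are total functions that stay undefined once they are undefined, so that associativity and
  distributivity hold without side conditions and serve as rewrite rules. The axioms are self-dual:
  reversing composition gives another instance, so that results come together with their duals.
\<close>

locale additive_arrows =
  fixes ok :: "'a \<Rightarrow> bool"
    and cmp :: "'a \<Rightarrow> 'a \<Rightarrow> 'a"  (infixr "\<cdot>" 70)
    and add :: "'a \<Rightarrow> 'a \<Rightarrow> 'a"  (infixl "\<boxplus>" 65)
    and neg :: "'a \<Rightarrow> 'a"
    and zer :: "'a \<Rightarrow> 'a \<Rightarrow> 'a"
    and dm :: "'a \<Rightarrow> 'a"
    and cd :: "'a \<Rightarrow> 'a"
  assumes ok_cmp [simp]: "ok (g \<cdot> f) \<longleftrightarrow> ok g \<and> ok f \<and> dm g = cd f"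
    and dm_cmp [simp]: "ok g \<Longrightarrow> ok f \<Longrightarrow> dm g = cd f \<Longrightarrow> dm (g \<cdot> f) = dm f"
    and cd_cmp [simp]: "ok g \<Longrightarrow> ok f \<Longrightarrow> dm g = cd f \<Longrightarrow> cd (g \<cdot> f) = cd g"
    and cmp_assoc: "(h \<cdot> g) \<cdot> f = h \<cdot> g \<cdot> f"
    and ok_dm [simp]: "ok f \<Longrightarrow> ok (dm f)"
    and ok_cd [simp]: "ok f \<Longrightarrow> ok (cd f)"
    and dm_dm [simp]: "ok f \<Longrightarrow> dm (dm f) = dm f"
    and cd_dm [simp]: "ok f \<Longrightarrow> cd (dm f) = dm f"
    and dm_cd [simp]: "ok f \<Longrightarrow> dm (cd f) = cd f"
    and cd_cd [simp]: "ok f \<Longrightarrow> cd (cd f) = cd f"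
    and cmp_dm: "ok f \<Longrightarrow> f \<cdot> dm f = f"
    and cmp_cd: "ok f \<Longrightarrow> cd f \<cdot> f = f"
    and ok_add [simp]: "ok (f \<boxplus> g) \<longleftrightarrow> ok f \<and> ok g \<and> dm f = dm g \<and> cd f = cd g"
    and dm_add [simp]: "ok f \<Longrightarrow> ok g \<Longrightarrow> dm f = dm g \<Longrightarrow> cd f = cd g \<Longrightarrow> dm (f \<boxplus> g) = dm g"
    and cd_add [simp]: "ok f \<Longrightarrow> ok g \<Longrightarrow> dm f = dm g \<Longrightarrow> cd f = cd g \<Longrightarrow> cd (f \<boxplus> g) = cd g"
    and add_assoc: "(f \<boxplus> g) \<boxplus> h = f \<boxplus> (g \<boxplus> h)"
    and add_comm: "f \<boxplus> g = g \<boxplus> f"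
    and cmp_add: "h \<cdot> (f \<boxplus> g) = h \<cdot> f \<boxplus> h \<cdot> g"
    and add_cmp: "(f \<boxplus> g) \<cdot> h = f \<cdot> h \<boxplus> g \<cdot> h"
    and ok_neg [simp]: "ok (neg f) \<longleftrightarrow> ok f"
    and dm_neg [simp]: "ok f \<Longrightarrow> dm (neg f) = dm f"
    and cd_neg [simp]: "ok f \<Longrightarrow> cd (neg f) = cd f"
    and add_neg: "ok f \<Longrightarrow> f \<boxplus> neg f = zer (dm f) (cd f)"
    and ok_zer [simp]: "\<lbrakk>ok X; dm X = X; ok Y; dm Y = Y\<rbrakk> \<Longrightarrow> ok (zer X Y)"
    and dm_zer [simp]: "\<lbrakk>ok X; dm X = X; ok Y; dm Y = Y\<rbrakk> \<Longrightarrow> dm (zer X Y) = X"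
    and cd_zer [simp]: "\<lbrakk>ok X; dm X = X; ok Y; dm Y = Y\<rbrakk> \<Longrightarrow> cd (zer X Y) = Y"
    and add_zer: "ok f \<Longrightarrow> f \<boxplus> zer (dm f) (cd f) = f"
begin

lemma dual_additive_arrows: "additive_arrows ok (\<lambda>g f. f \<cdot> g) add neg (\<lambda>X Y. zer Y X) cd dm"
proof
  show "ok (zer Y X)" "cd (zer Y X) = X" "dm (zer Y X) = Y"
    if "ok X" "cd X = X" "ok Y" "cd Y = Y" for X Y
    using that dm_cd[of X] dm_cd[of Y] by simp_all
qed (auto simp: cmp_assoc add_assoc cmp_dm cmp_cd cmp_add add_cmp add_neg add_zer intro: add_comm)

definition obj :: "'a \<Rightarrow> bool"
  where "obj X \<longleftrightarrow> ok X \<and> dm X = X"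

definition arr :: "'a \<Rightarrow> 'a \<Rightarrow> 'a \<Rightarrow> bool"
  where "arr f X Y \<longleftrightarrow> ok f \<and> dm f = X \<and> cd f = Y"

definition isz :: "'a \<Rightarrow> bool"
  where "isz f \<longleftrightarrow> ok f \<and> f = zer (dm f) (cd f)"

definition zobj :: "'a \<Rightarrow> bool"
  where "zobj Z \<longleftrightarrow> obj Z \<and> isz Z"

text \<open>
  Regularity replaces splitness: an arrow of an abelian category splits iff it is regular, but
  regularity does not speak of images and so is the same in a category and in its Freyd category.
\<close>

definition regular :: "'a \<Rightarrow> bool"
  where "regular f \<longleftrightarrow> ok f \<and> (\<exists>g. f \<cdot> g \<cdot> f = f)"

lemma objD [simp]: "obj X \<Longrightarrow> ok X" "obj X \<Longrightarrow> dm X = X" "obj X \<Longrightarrow> cd X = X"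
  unfolding obj_def by (auto dest: cd_dm)

lemma arrD: "arr f X Y \<Longrightarrow> ok f" "arr f X Y \<Longrightarrow> dm f = X" "arr f X Y \<Longrightarrow> cd f = Y"
  by (auto simp: arr_def)

lemma obj_dm [simp]: "ok f \<Longrightarrow> obj (dm f)" and obj_cd [simp]: "ok f \<Longrightarrow> obj (cd f)"
  unfolding obj_def by simp_all

lemma arr_obj: "arr f X Y \<Longrightarrow> obj X" "arr f X Y \<Longrightarrow> obj Y"
  by (auto simp: arr_def)

lemma arr_id: "obj X \<Longrightarrow> arr X X X"
  by (simp add: arr_def)

lemma arr_cmp: "arr f X Y \<Longrightarrow> arr g Y Z \<Longrightarrow> arr (g \<cdot> f) X Z"
  by (auto simp: arr_def)

lemma arr_add: "arr f X Y \<Longrightarrow> arr g X Y \<Longrightarrow> arr (f \<boxplus> g) X Y"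
  by (auto simp: arr_def)

lemma arr_neg: "arr f X Y \<Longrightarrow> arr (neg f) X Y"
  by (auto simp: arr_def)

lemma arr_zer: "obj X \<Longrightarrow> obj Y \<Longrightarrow> arr (zer X Y) X Y"
  by (auto simp: arr_def)

lemma cmp_eqD:
  assumes "c \<cdot> x = d \<cdot> y" "ok (c \<cdot> x)"
  shows "ok d" "ok y" "dm d = cd y" "dm y = dm x" "cd d = cd c"
proof -
  have 1: "ok (d \<cdot> y)" using assms by (simp del: ok_cmp)
  then show "ok d" "ok y" "dm d = cd y" by simp_all
  have "dm (c \<cdot> x) = dm x" "dm (d \<cdot> y) = dm y" "cd (c \<cdot> x) = cd c" "cd (d \<cdot> y) = cd d"
    using assms(2) 1 by simp_all
  then show "dm y = dm x" "cd d = cd c" unfolding assms(1) by simp_all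
qed

lemma id_cmp: "ok f \<Longrightarrow> cd f = Y \<Longrightarrow> Y \<cdot> f = f" and cmp_id: "ok f \<Longrightarrow> dm f = X \<Longrightarrow> f \<cdot> X = f"
  by (auto simp: cmp_dm cmp_cd)

lemma zer_add: "ok f \<Longrightarrow> zer (dm f) (cd f) \<boxplus> f = f"
  by (metis add_comm add_zer)

lemma neg_add_cancel: "ok f \<Longrightarrow> ok g \<Longrightarrow> dm f = dm g \<Longrightarrow> cd f = cd g \<Longrightarrow> neg f \<boxplus> (f \<boxplus> g) = g"
  by (metis add_assoc add_comm add_neg zer_add)

lemma add_left_cancel:
  assumes "f \<boxplus> g = f \<boxplus> h" "ok (f \<boxplus> g)"
  shows "g = h"
proof -
  have "ok (f \<boxplus> h)" using assms by simp
  then show ?thesis using assms neg_add_cancel by (metis ok_add)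
qed

lemma add_self_zer: "f \<boxplus> f = f \<Longrightarrow> ok f \<Longrightarrow> isz f"
  unfolding isz_def using add_left_cancel[of f f "zer (dm f) (cd f)"] add_zer by simp

lemma isz_add_self: "isz f \<Longrightarrow> f \<boxplus> f = f"
  unfolding isz_def by (metis add_zer)

lemma isz_ok: "isz f \<Longrightarrow> ok f" by (simp add: isz_def)

lemma isz_zer: "obj X \<Longrightarrow> obj Y \<Longrightarrow> isz (zer X Y)"
  by (simp add: isz_def)

lemma isz_cmp_right: assumes "isz f" "ok (g \<cdot> f)" shows "isz (g \<cdot> f)"
  using isz_add_self[OF assms(1)] add_self_zer[OF _ assms(2)] by (simp flip: cmp_add)

lemma isz_cmp_left: assumes "isz g" "ok (g \<cdot> f)" shows "isz (g \<cdot> f)"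
  using isz_add_self[OF assms(1)] add_self_zer[OF _ assms(2)] by (simp flip: add_cmp)

lemma isz_eq: "isz f \<Longrightarrow> isz g \<Longrightarrow> dm f = dm g \<Longrightarrow> cd f = cd g \<Longrightarrow> f = g"
  unfolding isz_def by metis

lemma isz_eqI: "arr f X Y \<Longrightarrow> isz f \<Longrightarrow> f = zer X Y"
  by (auto simp: isz_def arr_def)

lemma cmp_zer: "ok g \<Longrightarrow> dm g = Y \<Longrightarrow> obj X \<Longrightarrow> g \<cdot> zer X Y = zer X (cd g)"
  by (rule isz_eq) (auto intro!: isz_cmp_right isz_zer)

lemma zer_cmp: "ok f \<Longrightarrow> cd f = X \<Longrightarrow> obj Y \<Longrightarrow> zer X Y \<cdot> f = zer (dm f) Y"
  by (rule isz_eq) (auto intro!: isz_cmp_left isz_zer)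

lemma add_isz: "isz g \<Longrightarrow> ok (f \<boxplus> g) \<Longrightarrow> f \<boxplus> g = f"
  unfolding isz_def using add_zer by (metis ok_add)

lemma isz_add: "isz g \<Longrightarrow> ok (g \<boxplus> f) \<Longrightarrow> g \<boxplus> f = f"
  unfolding isz_def using zer_add by (metis ok_add)

lemma isz_diff_iff: "isz (f \<boxplus> neg g) \<longleftrightarrow> ok f \<and> f = g"
proof
  assume a: "isz (f \<boxplus> neg g)"
  then have ok: "ok f" "ok g" "dm f = dm g" "cd f = cd g" using isz_ok[OF a] by auto
  have "neg g \<boxplus> f = neg g \<boxplus> g"
    using a ok add_neg[of g] by (metis (no_types) add_comm isz_def dm_add cd_add ok_neg dm_neg cd_neg)
  then show "ok f \<and> f = g" using ok add_left_cancel[of "neg g" f g] by simp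
next
  assume "ok f \<and> f = g"
  then have "ok g" "f = g" by auto
  then show "isz (f \<boxplus> neg g)" by (simp add: add_neg isz_zer)
qed

lemma add_neg_cancel: "ok f \<Longrightarrow> ok g \<Longrightarrow> dm f = dm g \<Longrightarrow> cd f = cd g \<Longrightarrow> (g \<boxplus> neg f) \<boxplus> f = g"
  using add_zer[of g] by (simp add: add_assoc add_comm[of "neg f" f] add_neg)

lemma neg_unique:
  assumes "isz (f \<boxplus> g)" shows "g = neg f"
proof -
  have ok: "ok f" "ok g" "dm f = dm g" "cd f = cd g" using isz_ok[OF assms] by auto
  have "f \<boxplus> g = f \<boxplus> neg f"
    using assms ok add_neg[of f] by (metis isz_def dm_add cd_add)
  then show ?thesis using ok add_left_cancel[of f g "neg f"] by simp
qed

lemma neg_neg: "ok f \<Longrightarrow> neg (neg f) = f"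
  by (rule neg_unique[symmetric]) (simp add: isz_zer add_neg add_comm[of "neg f"])

lemma cmp_neg: assumes "ok (g \<cdot> f)" shows "g \<cdot> neg f = neg (g \<cdot> f)"
proof (rule neg_unique)
  have "g \<cdot> f \<boxplus> g \<cdot> neg f = g \<cdot> zer (dm f) (cd f)"
    using assms by (simp flip: cmp_add add: add_neg)
  then show "isz (g \<cdot> f \<boxplus> g \<cdot> neg f)"
    using assms by (simp add: cmp_zer isz_zer)
qed

lemma neg_cmp: assumes "ok (g \<cdot> f)" shows "neg g \<cdot> f = neg (g \<cdot> f)"
proof (rule neg_unique)
  have "g \<cdot> f \<boxplus> neg g \<cdot> f = zer (dm g) (cd g) \<cdot> f"
    using assms by (simp flip: add_cmp add: add_neg)
  then show "isz (g \<cdot> f \<boxplus> neg g \<cdot> f)"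
    using assms by (simp add: zer_cmp isz_zer)
qed

lemma zobj_obj: "zobj Z \<Longrightarrow> obj Z" by (simp add: zobj_def)

lemma isz_from_zobj: "zobj Z \<Longrightarrow> ok f \<Longrightarrow> dm f = Z \<Longrightarrow> isz f"
  unfolding zobj_def using isz_cmp_right[of Z f] by (metis cmp_dm ok_cmp objD(3))

lemma isz_to_zobj: "zobj Z \<Longrightarrow> ok f \<Longrightarrow> cd f = Z \<Longrightarrow> isz f"
  unfolding zobj_def using isz_cmp_left[of Z f] by (metis cmp_cd ok_cmp objD(2))

lemma isz_through_zobj:
  assumes "zobj Z" "arr f X Z" "arr g Z Y" shows "isz (g \<cdot> f)"
  using isz_cmp_left[OF isz_from_zobj[OF assms(1)]] assms by (auto simp: arr_def)

lemma regular_isz: "isz f \<Longrightarrow> regular f"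
proof -
  assume f: "isz f"
  then have [simp]: "ok f" by (rule isz_ok)
  have "f \<cdot> zer (cd f) (dm f) \<cdot> f = f"
    by (intro isz_eq[OF isz_cmp_left[OF f] f]) simp_all
  then show "regular f" unfolding regular_def using \<open>ok f\<close> by blast
qed

lemma regularE:
  assumes "regular f" obtains g where "arr g (cd f) (dm f)" "f \<cdot> g \<cdot> f = f"
proof -
  from assms obtain g where g: "ok f" "f \<cdot> g \<cdot> f = f" by (auto simp: regular_def)
  then have "ok (f \<cdot> g \<cdot> f)" by simp
  then have "arr g (cd f) (dm f)" using g(1) by (simp add: arr_def)
  with g that show thesis by blast
qed

subsection \<open>Weak squares\<close>

definition wker :: "'a \<Rightarrow> 'a \<Rightarrow> bool"
  where "wker f g \<longleftrightarrow> isz (g \<cdot> f) \<and> (\<forall>h. isz (g \<cdot> h) \<longrightarrow> (\<exists>u. h = f \<cdot> u))"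

definition wcok :: "'a \<Rightarrow> 'a \<Rightarrow> bool"
  where "wcok f g \<longleftrightarrow> isz (g \<cdot> f) \<and> (\<forall>h. isz (h \<cdot> f) \<longrightarrow> (\<exists>u. h = u \<cdot> g))"

definition wpb :: "'a \<Rightarrow> 'a \<Rightarrow> 'a \<Rightarrow> 'a \<Rightarrow> bool"
  where "wpb a b c d \<longleftrightarrow> ok (c \<cdot> a) \<and> c \<cdot> a = d \<cdot> b \<and>
    (\<forall>x y. ok (c \<cdot> x) \<and> c \<cdot> x = d \<cdot> y \<longrightarrow> (\<exists>u. x = a \<cdot> u \<and> y = b \<cdot> u))"

definition wpo :: "'a \<Rightarrow> 'a \<Rightarrow> 'a \<Rightarrow> 'a \<Rightarrow> bool"
  where "wpo a b c d \<longleftrightarrow> ok (c \<cdot> a) \<and> c \<cdot> a = d \<cdot> b \<and>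
    (\<forall>x y. ok (x \<cdot> a) \<and> x \<cdot> a = y \<cdot> b \<longrightarrow> (\<exists>u. x = u \<cdot> c \<and> y = u \<cdot> d))"

definition biprod :: "'a \<Rightarrow> 'a \<Rightarrow> 'a \<Rightarrow> 'a \<Rightarrow> 'a \<Rightarrow> 'a \<Rightarrow> 'a \<Rightarrow> bool"
  where "biprod X Y P i j p q \<longleftrightarrow> arr i X P \<and> arr j Y P \<and> arr p P X \<and> arr q P Y \<and>
    p \<cdot> i = X \<and> q \<cdot> j = Y \<and> p \<cdot> j = zer Y X \<and> q \<cdot> i = zer X Y \<and> i \<cdot> p \<boxplus> j \<cdot> q = P"

lemma isz_sym: "isz (c \<cdot> x \<boxplus> neg (d \<cdot> y)) \<longleftrightarrow> ok (c \<cdot> x) \<and> c \<cdot> x = d \<cdot> y"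
  by (rule isz_diff_iff)

lemma biprod_objs: "biprod X Y P i j p q \<Longrightarrow> obj X \<and> obj Y \<and> obj P"
  unfolding biprod_def using arr_obj by blast

lemma biprod_in:
  assumes "biprod X Y P i j p q" "arr a U X" "arr b U Y"
  shows "arr (i \<cdot> a \<boxplus> j \<cdot> b) U P" "p \<cdot> (i \<cdot> a \<boxplus> j \<cdot> b) = a" "q \<cdot> (i \<cdot> a \<boxplus> j \<cdot> b) = b"
proof -
  note B = assms(1)[unfolded biprod_def]
  note [simp] = arrD[OF assms(2)] arrD[OF assms(3)]
  have [simp]: "ok i" "ok j" "ok p" "ok q" "dm i = X" "dm j = Y" "cd i = P" "cd j = P"
    "dm p = P" "dm q = P" "cd p = X" "cd q = Y" using B by (auto simp: arr_def)
  show "arr (i \<cdot> a \<boxplus> j \<cdot> b) U P" by (simp add: arr_def)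
  have o: "obj X" "obj Y" "obj U" using arr_obj assms(2,3) by blast+
  have "p \<cdot> (i \<cdot> a \<boxplus> j \<cdot> b) = (p \<cdot> i) \<cdot> a \<boxplus> (p \<cdot> j) \<cdot> b" by (simp add: cmp_add cmp_assoc)
  also have "\<dots> = a" using B o add_zer[of a] by (simp add: id_cmp zer_cmp)
  finally show "p \<cdot> (i \<cdot> a \<boxplus> j \<cdot> b) = a" .
  have "q \<cdot> (i \<cdot> a \<boxplus> j \<cdot> b) = (q \<cdot> i) \<cdot> a \<boxplus> (q \<cdot> j) \<cdot> b" by (simp add: cmp_add cmp_assoc)
  also have "\<dots> = b" using B o zer_add[of b] by (simp add: id_cmp zer_cmp)
  finally show "q \<cdot> (i \<cdot> a \<boxplus> j \<cdot> b) = b" .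
qed

lemma dual_biprod:
  "biprod X Y P i j p q \<Longrightarrow> additive_arrows.biprod ok (\<lambda>g f. f \<cdot> g) add (\<lambda>X Y. zer Y X) cd dm X Y P p q i j"
  unfolding biprod_def additive_arrows.biprod_def[OF dual_additive_arrows]
    additive_arrows.arr_def[OF dual_additive_arrows] arr_def by auto

lemma dual_arr: "additive_arrows.arr ok cd dm f X Y \<longleftrightarrow> arr f Y X"
  unfolding additive_arrows.arr_def[OF dual_additive_arrows] arr_def by auto

lemma dual_isz: "additive_arrows.isz ok (\<lambda>X Y. zer Y X) cd dm f \<longleftrightarrow> isz f"
  unfolding additive_arrows.isz_def[OF dual_additive_arrows] isz_def ..

lemma dual_obj: "additive_arrows.obj ok cd X \<longleftrightarrow> obj X"
  unfolding additive_arrows.obj_def[OF dual_additive_arrows] obj_def by (metis cd_dm dm_cd)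

lemma dual_zobj: "additive_arrows.zobj ok (\<lambda>X Y. zer Y X) cd dm X \<longleftrightarrow> zobj X"
  unfolding additive_arrows.zobj_def[OF dual_additive_arrows] zobj_def dual_obj dual_isz ..

lemma dual_wpb: "additive_arrows.wpb ok (\<lambda>g f. f \<cdot> g) a b c d \<longleftrightarrow> wpo c d a b"
  unfolding additive_arrows.wpb_def[OF dual_additive_arrows] wpo_def by auto

lemma dual_wpo: "additive_arrows.wpo ok (\<lambda>g f. f \<cdot> g) a b c d \<longleftrightarrow> wpb c d a b"
  unfolding additive_arrows.wpo_def[OF dual_additive_arrows] wpb_def by auto

lemma dual_regular: "additive_arrows.regular ok (\<lambda>g f. f \<cdot> g) f \<longleftrightarrow> regular f"
  unfolding additive_arrows.regular_def[OF dual_additive_arrows] regular_def by (simp add: cmp_assoc)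

lemma biprod_out:
  assumes "biprod X Y P i j p q" "arr a X U" "arr b Y U"
  shows "arr (a \<cdot> p \<boxplus> b \<cdot> q) P U" "(a \<cdot> p \<boxplus> b \<cdot> q) \<cdot> i = a" "(a \<cdot> p \<boxplus> b \<cdot> q) \<cdot> j = b"
  using additive_arrows.biprod_in[OF dual_additive_arrows dual_biprod[OF assms(1)], unfolded dual_arr, OF assms(2,3)]
  by auto

lemma biprod_decomp:
  assumes "biprod X Y P i j p q" "ok f" "cd f = P" shows "f = i \<cdot> p \<cdot> f \<boxplus> j \<cdot> q \<cdot> f"
proof -
  have "(i \<cdot> p \<boxplus> j \<cdot> q) \<cdot> f = f" using assms by (simp add: biprod_def id_cmp)
  then show ?thesis by (simp add: add_cmp cmp_assoc)
qed

text \<open>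
  A pair \<open>(x, y)\<close> with \<open>c x = d y\<close> is an arrow \<open>h\<close> into
  the direct sum with \<open>(c p - d q) h = 0\<close>.
\<close>

lemma wpb_iff_wker:
  assumes P: "biprod V W P i j p q" and "arr a U V" "arr b U W" "arr c V X" "arr d W X"
  shows "wpb a b c d \<longleftrightarrow> wker (i \<cdot> a \<boxplus> j \<cdot> b) (c \<cdot> p \<boxplus> neg (d \<cdot> q))"
proof -
  note B = P[unfolded biprod_def]
  have [simp]: "ok i" "ok j" "ok p" "ok q" "dm i = V" "dm j = W" "cd i = P" "cd j = P"
    "dm p = P" "dm q = P" "cd p = V" "cd q = W" using B by (auto simp: arr_def)
  note [simp] = arrD[OF assms(2)] arrD[OF assms(3)] arrD[OF assms(4)] arrD[OF assms(5)]
  have diff: "(c \<cdot> p \<boxplus> neg (d \<cdot> q)) \<cdot> h = c \<cdot> p \<cdot> h \<boxplus> neg (d \<cdot> q \<cdot> h)" if "ok h" "cd h = P" for h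
    using that by (simp add: add_cmp neg_cmp cmp_assoc)
  have f: "arr (i \<cdot> a \<boxplus> j \<cdot> b) U P" "p \<cdot> (i \<cdot> a \<boxplus> j \<cdot> b) = a" "q \<cdot> (i \<cdot> a \<boxplus> j \<cdot> b) = b"
    using biprod_in[OF P assms(2,3)] by auto
  have 1: "isz ((c \<cdot> p \<boxplus> neg (d \<cdot> q)) \<cdot> (i \<cdot> a \<boxplus> j \<cdot> b)) \<longleftrightarrow> ok (c \<cdot> a) \<and> c \<cdot> a = d \<cdot> b"
    using f by (simp add: diff isz_sym arr_def)
  have 2: "(\<forall>x y. ok (c \<cdot> x) \<and> c \<cdot> x = d \<cdot> y \<longrightarrow> (\<exists>u. x = a \<cdot> u \<and> y = b \<cdot> u))
    \<longleftrightarrow> (\<forall>h. isz ((c \<cdot> p \<boxplus> neg (d \<cdot> q)) \<cdot> h) \<longrightarrow> (\<exists>u. h = (i \<cdot> a \<boxplus> j \<cdot> b) \<cdot> u))" (is "?L \<longleftrightarrow> ?R")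
  proof
    assume L: ?L
    show ?R
    proof (intro allI impI)
      fix h assume h: "isz ((c \<cdot> p \<boxplus> neg (d \<cdot> q)) \<cdot> h)"
      then have h': "ok h" "cd h = P" using isz_ok[OF h] by auto
      with h obtain u where u: "p \<cdot> h = a \<cdot> u" "q \<cdot> h = b \<cdot> u"
        using L[rule_format, of "p \<cdot> h" "q \<cdot> h"] by (auto simp: diff isz_sym)
      have "h = (i \<cdot> a \<boxplus> j \<cdot> b) \<cdot> u"
        using biprod_decomp[OF P h'] u by (simp add: add_cmp cmp_assoc)
      then show "\<exists>u. h = (i \<cdot> a \<boxplus> j \<cdot> b) \<cdot> u" ..
    qed
  next
    assume R: ?R
    show ?L
    proof (intro allI impI)
      fix x y assume xy: "ok (c \<cdot> x) \<and> c \<cdot> x = d \<cdot> y"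
      then have o: "ok (c \<cdot> x)" "c \<cdot> x = d \<cdot> y" by blast+
      have t: "arr x (dm x) V" "arr y (dm x) W"
        using o(1) cmp_eqD[OF o(2,1)] by (simp_all add: arr_def)
      have h: "arr (i \<cdot> x \<boxplus> j \<cdot> y) (dm x) P" "p \<cdot> (i \<cdot> x \<boxplus> j \<cdot> y) = x" "q \<cdot> (i \<cdot> x \<boxplus> j \<cdot> y) = y"
        using biprod_in[OF P t] by auto
      have "isz ((c \<cdot> p \<boxplus> neg (d \<cdot> q)) \<cdot> (i \<cdot> x \<boxplus> j \<cdot> y))"
        using h xy by (simp add: diff isz_sym arr_def)
      then obtain u where u: "i \<cdot> x \<boxplus> j \<cdot> y = (i \<cdot> a \<boxplus> j \<cdot> b) \<cdot> u" using R by blast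
      have "x = a \<cdot> u" using arg_cong[OF u, of "cmp p"] h f by (simp flip: cmp_assoc)
      moreover have "y = b \<cdot> u" using arg_cong[OF u, of "cmp q"] h f by (simp flip: cmp_assoc)
      ultimately show "\<exists>u. x = a \<cdot> u \<and> y = b \<cdot> u" by blast
    qed
  qed
  show ?thesis unfolding wpb_def wker_def using 1 2 by (simp only: conj_assoc)
qed

lemma wpb_paste:
  assumes "wpb a b c d" "wpb a' c c' d'"
  shows "wpb (a' \<cdot> a) b c' (d' \<cdot> d)"
proof -
  have 1: "ok (c \<cdot> a)" "c \<cdot> a = d \<cdot> b" "\<And>x y. ok (c \<cdot> x) \<Longrightarrow> c \<cdot> x = d \<cdot> y \<Longrightarrow> \<exists>u. x = a \<cdot> u \<and> y = b \<cdot> u"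
    using assms(1) unfolding wpb_def by blast+
  have 2: "ok (c' \<cdot> a')" "c' \<cdot> a' = d' \<cdot> c" "\<And>x y. ok (c' \<cdot> x) \<Longrightarrow> c' \<cdot> x = d' \<cdot> y \<Longrightarrow> \<exists>u. x = a' \<cdot> u \<and> y = c \<cdot> u"
    using assms(2) unfolding wpb_def by blast+
  note e = cmp_eqD[OF 2(2,1)]
  have "c' \<cdot> a' \<cdot> a = d' \<cdot> d \<cdot> b" by (metis 1(2) 2(2) cmp_assoc)
  moreover have "\<exists>u. x = (a' \<cdot> a) \<cdot> u \<and> y = b \<cdot> u" if x: "ok (c' \<cdot> x)" "c' \<cdot> x = (d' \<cdot> d) \<cdot> y" for x y
  proof -
    obtain u where u: "x = a' \<cdot> u" "d \<cdot> y = c \<cdot> u"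
      using 2(3)[OF x(1) x(2)[unfolded cmp_assoc]] by blast
    have "ok (c \<cdot> u)" using x(1) u(1) e 2(1) by simp
    then obtain w where "u = a \<cdot> w" "y = b \<cdot> w" using 1(3)[OF _ u(2)[symmetric]] by blast
    then show ?thesis using u by (auto simp: cmp_assoc)
  qed
  moreover have "ok (c' \<cdot> a' \<cdot> a)" using e 1(1) 2(1) by simp
  ultimately show ?thesis unfolding wpb_def cmp_assoc[of d'] by blast
qed

lemma wpb_sym: "wpb a b c d \<Longrightarrow> wpb b a d c"
  unfolding wpb_def by metis

lemma wpb_id:
  assumes "arr c V X" shows "wpb V c c X"
proof -
  note c = arrD[OF assms] arr_obj[OF assms]
  have "\<exists>u. x = V \<cdot> u \<and> y = c \<cdot> u" if "ok (c \<cdot> x)" "c \<cdot> x = X \<cdot> y" for x y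
  proof (intro exI[of _ x] conjI)
    have x: "ok x" "cd x = V" using that(1) c by simp_all
    then show "x = V \<cdot> x" by (simp add: id_cmp)
    show "y = c \<cdot> x" using cmp_eqD[OF that(2,1)] that(2) c by (simp add: id_cmp)
  qed
  moreover have "ok (c \<cdot> V)" "c \<cdot> V = X \<cdot> c" using c by (simp_all add: id_cmp cmp_id)
  ultimately show ?thesis unfolding wpb_def by blast
qed

end

locale weakly_abelian_arrows = additive_arrows +
  assumes zobj_exists: "\<exists>Z. zobj Z"
    and biprod_exists: "obj X \<Longrightarrow> obj Y \<Longrightarrow> \<exists>P i j p q. biprod X Y P i j p q"
    and wker_exists: "ok g \<Longrightarrow> \<exists>f. wker f g"
    and wcok_exists: "ok f \<Longrightarrow> \<exists>g. wcok f g"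
    and is_wker: "ok f \<Longrightarrow> \<exists>g. wker f g"
    and is_wcok: "ok g \<Longrightarrow> \<exists>f. wcok f g"
begin

lemma dual_weakly_abelian_arrows:
  "weakly_abelian_arrows ok (\<lambda>g f. f \<cdot> g) add neg (\<lambda>X Y. zer Y X) cd dm"
proof (intro weakly_abelian_arrows.intro dual_additive_arrows weakly_abelian_arrows_axioms.intro,
    unfold dual_zobj dual_obj additive_arrows.wker_def[OF dual_additive_arrows]
      additive_arrows.wcok_def[OF dual_additive_arrows] dual_isz)
  show "\<exists>Z. zobj Z" by (rule zobj_exists)
  show "\<exists>P i j p q. additive_arrows.biprod ok (\<lambda>g f. f \<cdot> g) add (\<lambda>X Y. zer Y X) cd dm X Y P i j p q"
    if "obj X" "obj Y" for X Y
    using biprod_exists[OF that] dual_biprod by blast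
qed (insert wker_exists wcok_exists is_wker is_wcok, auto simp: wker_def wcok_def)

text \<open>
  The arrow \<open>g\<close> is a weak cokernel of some \<open>e\<close>. As
  \<open>g e = 0\<close>, \<open>e\<close> factors through the weak kernel \<open>f\<close>, and so
  an arrow that kills \<open>f\<close> kills \<open>e\<close> and factors through \<open>g\<close>.
\<close>

lemma wker_imp_wcok: assumes "wker f g" shows "wcok f g"
proof -
  have fg: "isz (g \<cdot> f)" "\<And>h. isz (g \<cdot> h) \<Longrightarrow> \<exists>u. h = f \<cdot> u" using assms by (auto simp: wker_def)
  then have "ok g" using isz_ok by fastforce
  then obtain e where "wcok e g" using is_wcok by blast
  then have e: "isz (g \<cdot> e)" "\<And>h. isz (h \<cdot> e) \<Longrightarrow> \<exists>u. h = u \<cdot> g"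
    unfolding wcok_def by blast+
  then obtain u where u: "e = f \<cdot> u" using fg by blast
  have "\<exists>v. h = v \<cdot> g" if "isz (h \<cdot> f)" for h
  proof (rule e(2))
    have "ok ((h \<cdot> f) \<cdot> u)" using isz_ok[OF that] isz_ok[OF e(1)] u by auto
    then show "isz (h \<cdot> e)" using isz_cmp_left[OF that] u by (simp add: cmp_assoc)
  qed
  then show ?thesis using fg by (auto simp: wcok_def)
qed

lemma wcok_imp_wker: "wcok f g \<Longrightarrow> wker f g"
  using weakly_abelian_arrows.wker_imp_wcok[OF dual_weakly_abelian_arrows, of g f]
  unfolding additive_arrows.wker_def[OF dual_additive_arrows]
      additive_arrows.wcok_def[OF dual_additive_arrows] dual_isz wker_def wcok_def by auto

text \<open>
  Both properties concern the same pair of arrows through the direct sum of the two middle objects: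
  the first is a weak kernel of the second, and the second a weak cokernel of the first.
\<close>

lemma wpb_imp_wpo: assumes w: "wpb a b c d" shows "wpo a b c d"
proof -
  have ca: "ok (c \<cdot> a)" "c \<cdot> a = d \<cdot> b" using w unfolding wpb_def by blast+
  note db = cmp_eqD[OF ca(2,1)]
  have ac: "ok c" "ok a" "dm c = cd a" using ca(1) by simp_all
  obtain P i j p q where P: "biprod (cd a) (cd b) P i j p q"
    using biprod_exists[OF obj_cd[OF ac(2)] obj_cd[OF db(2)]] by blast
  have t: "arr a (dm a) (cd a)" "arr b (dm a) (cd b)" "arr c (cd a) (cd c)" "arr d (cd b) (cd c)"
    using ac db by (simp_all add: arr_def)
  note B = P[unfolded biprod_def]
  have [simp]: "ok i" "ok j" "ok p" "ok q" "dm i = cd a" "dm j = cd b" "cd i = P" "cd j = P"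
    "dm p = P" "dm q = P" "cd p = cd a" "cd q = cd b" using B by (auto simp: arr_def)
  let ?f = "i \<cdot> a \<boxplus> j \<cdot> b" and ?g = "c \<cdot> p \<boxplus> neg (d \<cdot> q)"
  have "wker ?f ?g" using wpb_iff_wker[OF P t] w by simp
  then have wc: "wcok ?f ?g" by (rule wker_imp_wcok)
  have "\<exists>u. x = u \<cdot> c \<and> y = u \<cdot> d" if xy: "ok (x \<cdot> a)" "x \<cdot> a = y \<cdot> b" for x y
  proof -
    note y = cmp_eqD[OF xy(2,1)]
    have tt: "arr x (cd a) (cd x)" "arr (neg y) (cd b) (cd x)" using xy(1) y by (simp_all add: arr_def)
    let ?h = "x \<cdot> p \<boxplus> neg y \<cdot> q"
    note h = biprod_out[OF P tt]
    have "?h \<cdot> ?f = x \<cdot> a \<boxplus> neg (y \<cdot> b)"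
    proof -
      have "?h \<cdot> ?f = (?h \<cdot> i) \<cdot> a \<boxplus> (?h \<cdot> j) \<cdot> b" by (simp add: cmp_add cmp_assoc)
      also have "\<dots> = x \<cdot> a \<boxplus> neg y \<cdot> b" unfolding h(2,3) ..
      finally show ?thesis using y by (simp add: neg_cmp)
    qed
    moreover have "isz (x \<cdot> a \<boxplus> neg (y \<cdot> b))" unfolding isz_diff_iff using xy by blast
    ultimately have "isz (?h \<cdot> ?f)" by simp
    then obtain u where u: "?h = u \<cdot> ?g" using wc unfolding wcok_def by blast
    have "ok (u \<cdot> ?g)" using u arrD(1)[OF h(1)] by simp
    then have oku: "ok u" "dm u = cd c" using db ac by simp_all
    have g: "?g = c \<cdot> p \<boxplus> neg d \<cdot> q" using db by (simp add: neg_cmp)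
    have tg: "arr (neg d) (cd b) (cd c)" using t by (rule_tac arr_neg)
    have "x = ?h \<cdot> i" using h by simp
    also have "\<dots> = u \<cdot> c" unfolding u g cmp_assoc using biprod_out[OF P t(3) tg] by simp
    finally have 1: "x = u \<cdot> c" .
    have "neg y = ?h \<cdot> j" using h by simp
    also have "\<dots> = u \<cdot> neg d" unfolding u g cmp_assoc using biprod_out[OF P t(3) tg] by simp
    also have "\<dots> = neg (u \<cdot> d)" using oku db by (intro cmp_neg) simp
    finally have "neg (neg y) = neg (neg (u \<cdot> d))" by simp
    then have "y = u \<cdot> d" using oku db y(1) by (simp add: neg_neg)
    with 1 show ?thesis by blast
  qed
  then show ?thesis using ca unfolding wpo_def by blast
qed

lemma wpo_imp_wpb: "wpo a b c d \<Longrightarrow> wpb a b c d"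
  using weakly_abelian_arrows.wpb_imp_wpo[OF dual_weakly_abelian_arrows, of c d a b]
  unfolding dual_wpb dual_wpo .

lemma wpo_exists:
  assumes a: "arr a U V" and b: "arr b U W"
  shows "\<exists>c d. wpo a b c d"
proof -
  obtain P i j p q where P: "biprod V W P i j p q"
    using biprod_exists arr_obj a b by blast
  note B = P[unfolded biprod_def]
  have [simp]: "ok i" "ok j" "ok p" "ok q" "dm i = V" "dm j = W" "cd i = P" "cd j = P"
    "dm p = P" "dm q = P" "cd p = V" "cd q = W" using B by (auto simp: arr_def)
  note [simp] = arrD[OF a] arrD[OF b]
  let ?f = "i \<cdot> a \<boxplus> j \<cdot> b"
  obtain g where g: "wcok ?f g" using wcok_exists[of ?f] biprod_in[OF P a b] arrD by blast
  then have gz: "isz (g \<cdot> ?f)" by (simp add: wcok_def)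
  then have gok: "ok g" "dm g = P" using isz_ok[OF gz] by auto
  let ?c = "g \<cdot> i" and ?d = "neg (g \<cdot> j)"
  have gd: "g = ?c \<cdot> p \<boxplus> neg (?d \<cdot> q)"
  proof -
    have "g = g \<cdot> (i \<cdot> p \<boxplus> j \<cdot> q)" using B gok by (simp add: cmp_id)
    moreover have "neg (?d \<cdot> q) = (g \<cdot> j) \<cdot> q"
    proof -
      have "?d \<cdot> q = neg ((g \<cdot> j) \<cdot> q)" using gok by (intro neg_cmp) auto
      then show ?thesis using gok by (simp add: neg_neg)
    qed
    ultimately show ?thesis by (simp add: cmp_add cmp_assoc)
  qed
  have t: "arr ?c V (cd g)" "arr ?d W (cd g)" using gok by (auto simp: arr_def)
  have "wpb a b ?c ?d"
    unfolding wpb_iff_wker[OF P a b t] using wcok_imp_wker[OF g] gd by simp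
  then show ?thesis using wpb_imp_wpo by blast
qed

end

section \<open>Diagrams on a strip of integer points\<close>

text \<open>
  The strip in integer coordinates: with \<open>N = n + 1\<close>, the element \<open>a\<close> of
  the \<open>z\<close>-th copy becomes \<open>z N + a\<close>, and \<open>(j, i)\<close> stands
  for \<open>j/i\<close>. The points \<open>(j, i)\<close> with fixed \<open>i\<close> form row
  \<open>i\<close>; the boundary consists of the points \<open>(i, i)\<close> and
  \<open>(i + N, i)\<close>.
\<close>

definition zst :: "int \<Rightarrow> (int \<times> int) set"
  where "zst N = {(j, i). i \<le> j \<and> j \<le> i + N}"

definition zle :: "int \<times> int \<Rightarrow> int \<times> int \<Rightarrow> bool"
  where "zle x y \<longleftrightarrow> fst x \<le> fst y \<and> snd x \<le> snd y"

text \<open>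
  An order-reversing symmetry of the strip that maps row \<open>0\<close> to itself. Combined with the
  passage to the opposite category it exchanges the parts of the strip above and below row
  \<open>0\<close>.
\<close>

definition flip :: "int \<Rightarrow> int \<times> int \<Rightarrow> int \<times> int"
  where "flip N x = (N - fst x, - snd x)"

lemma zst_iff [simp]: "(j, i) \<in> zst N \<longleftrightarrow> i \<le> j \<and> j \<le> i + N"
  by (simp add: zst_def)

lemma zle_iff [simp]: "zle (j, i) (j', i') \<longleftrightarrow> j \<le> j' \<and> i \<le> i'"
  by (simp add: zle_def)

lemma flip_pair [simp]: "flip N (j, i) = (N - j, - i)"
  by (simp add: flip_def)

lemma flip_flip [simp]: "flip N (flip N x) = x"
  by (simp add: flip_def)

lemma flip_zst [simp]: "flip N x \<in> zst N \<longleftrightarrow> x \<in> zst N"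
  by (cases x) auto

lemma flip_zle [simp]: "zle (flip N x) (flip N y) \<longleftrightarrow> zle y x"
  by (cases x; cases y) auto

context additive_arrows
begin

text \<open>
  A functor on a preorder is given by its arrows; the object at \<open>x\<close> is the identity
  \<open>X x x\<close>.
\<close>

definition fnc :: "'d set \<Rightarrow> ('d \<Rightarrow> 'd \<Rightarrow> bool) \<Rightarrow> ('d \<Rightarrow> 'd \<Rightarrow> 'a) \<Rightarrow> bool"
  where "fnc D lq X \<longleftrightarrow> (\<forall>x\<in>D. obj (X x x)) \<and>
    (\<forall>x\<in>D. \<forall>y\<in>D. lq x y \<longrightarrow> arr (X x y) (X x x) (X y y)) \<and>
    (\<forall>x\<in>D. \<forall>y\<in>D. \<forall>z\<in>D. lq x y \<longrightarrow> lq y z \<longrightarrow> X y z \<cdot> X x y = X x z)"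

definition nt :: "'d set \<Rightarrow> ('d \<Rightarrow> 'd \<Rightarrow> bool) \<Rightarrow> ('d \<Rightarrow> 'd \<Rightarrow> 'a) \<Rightarrow> ('d \<Rightarrow> 'd \<Rightarrow> 'a) \<Rightarrow> ('d \<Rightarrow> 'a) \<Rightarrow> bool"
  where "nt D lq X Y t \<longleftrightarrow> (\<forall>x\<in>D. arr (t x) (X x x) (Y x x)) \<and>
    (\<forall>x\<in>D. \<forall>y\<in>D. lq x y \<longrightarrow> t y \<cdot> X x y = Y x y \<cdot> t x)"

lemma fncD:
  assumes "fnc D lq X"
  shows "x \<in> D \<Longrightarrow> obj (X x x)"
    and "x \<in> D \<Longrightarrow> y \<in> D \<Longrightarrow> lq x y \<Longrightarrow> arr (X x y) (X x x) (X y y)"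
    and "x \<in> D \<Longrightarrow> y \<in> D \<Longrightarrow> z \<in> D \<Longrightarrow> lq x y \<Longrightarrow> lq y z \<Longrightarrow> X y z \<cdot> X x y = X x z"
  using assms unfolding fnc_def by blast+

lemma ntD:
  assumes "nt D lq X Y t"
  shows "x \<in> D \<Longrightarrow> arr (t x) (X x x) (Y x x)"
    and "x \<in> D \<Longrightarrow> y \<in> D \<Longrightarrow> lq x y \<Longrightarrow> t y \<cdot> X x y = Y x y \<cdot> t x"
  using assms unfolding nt_def by blast+

lemma nt_id: assumes "fnc D lq X" shows "nt D lq X X (\<lambda>x. X x x)"
  unfolding nt_def
proof (intro conjI ballI impI)
  fix x assume "x \<in> D"
  then show "arr (X x x) (X x x) (X x x)" using fncD(1)[OF assms] arr_id by blast
next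
  fix x y assume "x \<in> D" "y \<in> D" "lq x y"
  then have "arr (X x y) (X x x) (X y y)" using fncD(2)[OF assms] by blast
  then show "X y y \<cdot> X x y = X x y \<cdot> X x x" by (simp add: arr_def id_cmp cmp_id)
qed

lemma nt_cmp:
  assumes "nt D lq X Y s" "nt D lq Y Z t" shows "nt D lq X Z (\<lambda>x. t x \<cdot> s x)"
  unfolding nt_def
proof (intro conjI ballI impI)
  fix x assume "x \<in> D"
  then show "arr (t x \<cdot> s x) (X x x) (Z x x)" using ntD(1)[OF assms(1)] ntD(1)[OF assms(2)] arr_cmp by blast
next
  fix x y assume xy: "x \<in> D" "y \<in> D" "lq x y"
  have "(t y \<cdot> s y) \<cdot> X x y = t y \<cdot> Y x y \<cdot> s x" using ntD(2)[OF assms(1) xy] by (simp add: cmp_assoc)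
  also have "\<dots> = Z x y \<cdot> t x \<cdot> s x" using ntD(2)[OF assms(2) xy] by (simp flip: cmp_assoc)
  finally show "(t y \<cdot> s y) \<cdot> X x y = Z x y \<cdot> t x \<cdot> s x" .
qed

lemma nt_add:
  assumes "nt D lq X Y s" "nt D lq X Y t" shows "nt D lq X Y (\<lambda>x. s x \<boxplus> t x)"
  using assms arr_add unfolding nt_def by (auto simp: cmp_add add_cmp)

lemma nt_neg:
  assumes "fnc D lq X" "fnc D lq Y" "nt D lq X Y t" shows "nt D lq X Y (\<lambda>x. neg (t x))"
  unfolding nt_def
proof (intro conjI ballI impI)
  fix x assume "x \<in> D"
  then show "arr (neg (t x)) (X x x) (Y x x)" using ntD(1)[OF assms(3)] arr_neg by blast
next
  fix x y assume xy: "x \<in> D" "y \<in> D" "lq x y"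
  have "ok (t y \<cdot> X x y)" "ok (Y x y \<cdot> t x)"
    using fncD(2)[OF assms(1) xy] fncD(2)[OF assms(2) xy] ntD(1)[OF assms(3)] xy
    by (auto simp: arr_def)
  then show "neg (t y) \<cdot> X x y = Y x y \<cdot> neg (t x)"
    using ntD(2)[OF assms(3) xy] by (simp only: neg_cmp cmp_neg)
qed

lemma natural_trans:
  assumes "fnc D lq X" "fnc D lq Y" and D: "x \<in> D" "y \<in> D" "z \<in> D" "lq x y" "lq y z"
    and xy: "t y \<cdot> X x y = Y x y \<cdot> t x" and yz: "t z \<cdot> X y z = Y y z \<cdot> t y"
  shows "t z \<cdot> X x z = Y x z \<cdot> t x"
proof -
  have "t z \<cdot> X x z = (t z \<cdot> X y z) \<cdot> X x y" unfolding cmp_assoc fncD(3)[OF assms(1) D] ..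
  also have "\<dots> = Y y z \<cdot> Y x y \<cdot> t x" unfolding yz cmp_assoc xy ..
  also have "\<dots> = Y x z \<cdot> t x" unfolding fncD(3)[OF assms(2) D, symmetric] cmp_assoc ..
  finally show ?thesis .
qed

lemma isz_between:
  assumes "fnc D lq X" and D: "x \<in> D" "y \<in> D" "z \<in> D" "lq x y" "lq y z" and "zobj (X y y)"
  shows "isz (X x z)"
  using isz_through_zobj[OF assms(7) fncD(2)[OF assms(1) D(1,2,4)] fncD(2)[OF assms(1) D(2,3,5)]]
    fncD(3)[OF assms(1) D] by simp

lemma dual_fnc:
  assumes "fnc D lq X" "\<And>x. x \<in> E \<Longrightarrow> f x \<in> D" "\<And>x y. lq' x y \<Longrightarrow> lq (f y) (f x)"
  shows "additive_arrows.fnc ok (\<lambda>g f. f \<cdot> g) cd dm E lq' (\<lambda>x y. X (f y) (f x))"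
  unfolding additive_arrows.fnc_def[OF dual_additive_arrows] dual_arr dual_obj
  using assms unfolding fnc_def by simp

lemma dual_nt:
  assumes "nt D lq X Y t" "\<And>x. x \<in> E \<Longrightarrow> f x \<in> D" "\<And>x y. lq' x y \<Longrightarrow> lq (f y) (f x)"
  shows "additive_arrows.nt ok (\<lambda>g f. f \<cdot> g) cd dm E lq'
    (\<lambda>x y. Y (f y) (f x)) (\<lambda>x y. X (f y) (f x)) (\<lambda>x. t (f x))"
  unfolding additive_arrows.nt_def[OF dual_additive_arrows] dual_arr
  using assms unfolding nt_def by simp

lemma nt_flip:
  assumes "additive_arrows.nt ok (\<lambda>g f. f \<cdot> g) cd dm E zle
    (\<lambda>x y. Y (flip N y) (flip N x)) (\<lambda>x y. X (flip N y) (flip N x)) t"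
  shows "nt {x. flip N x \<in> E} zle X Y (\<lambda>x. t (flip N x))"
proof -
  have t: "x \<in> E \<Longrightarrow> arr (t x) (X (flip N x) (flip N x)) (Y (flip N x) (flip N x))"
    "x \<in> E \<Longrightarrow> y \<in> E \<Longrightarrow> zle x y \<Longrightarrow>
      t x \<cdot> X (flip N y) (flip N x) = Y (flip N y) (flip N x) \<cdot> t y" for x y
    using assms[unfolded additive_arrows.nt_def[OF dual_additive_arrows] dual_arr] by metis+
  show ?thesis
    unfolding nt_def
  proof (intro conjI ballI impI)
    fix x assume "x \<in> {x. flip N x \<in> E}"
    then show "arr (t (flip N x)) (X x x) (Y x x)" using t(1)[of "flip N x"] by simp
  next
    fix x y assume "x \<in> {x. flip N x \<in> E}" "y \<in> {x. flip N x \<in> E}" "zle x y"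
    then show "t (flip N y) \<cdot> X x y = Y x y \<cdot> t (flip N x)"
      using t(2)[of "flip N y" "flip N x"] by simp
  qed
qed

definition plus :: "int \<Rightarrow> (int \<times> int \<Rightarrow> int \<times> int \<Rightarrow> 'a) \<Rightarrow> bool"
  where "plus N X \<longleftrightarrow> fnc (zst N) zle X \<and>
    (\<forall>i. zobj (X (i, i) (i, i)) \<and> zobj (X (i + N, i) (i + N, i))) \<and>
    (\<forall>a b c d. a \<le> b \<and> b \<le> c \<and> c \<le> d \<and> d \<le> a + N \<longrightarrow>
      wpb (X (c, a) (d, a)) (X (c, a) (c, b)) (X (d, a) (d, b)) (X (c, b) (d, b)))"

lemma plusD:
  assumes "plus N X"
  shows "fnc (zst N) zle X" "zobj (X (i, i) (i, i))" "zobj (X (i + N, i) (i + N, i))"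
    "\<lbrakk>a \<le> b; b \<le> c; c \<le> d; d \<le> a + N\<rbrakk> \<Longrightarrow>
      wpb (X (c, a) (d, a)) (X (c, a) (c, b)) (X (d, a) (d, b)) (X (c, b) (d, b))"
  using assms unfolding plus_def by blast+

definition row_nt :: "int \<Rightarrow> (int \<times> int \<Rightarrow> int \<times> int \<Rightarrow> 'a) \<Rightarrow> (int \<times> int \<Rightarrow> int \<times> int \<Rightarrow> 'a)
    \<Rightarrow> int \<Rightarrow> (int \<Rightarrow> 'a) \<Rightarrow> bool"
  where "row_nt N X Y i s \<longleftrightarrow>
    (\<forall>j. i \<le> j \<and> j \<le> i + N \<longrightarrow> arr (s j) (X (j, i) (j, i)) (Y (j, i) (j, i))) \<and>
    (\<forall>j j'. i \<le> j \<and> j \<le> j' \<and> j' \<le> i + N \<longrightarrow> s j' \<cdot> X (j, i) (j', i) = Y (j, i) (j', i) \<cdot> s j)"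

end

context weakly_abelian_arrows
begin

lemma plus_wpo:
  assumes "plus N X" "a \<le> b" "b \<le> c" "c \<le> d" "d \<le> a + N"
  shows "wpo (X (c, a) (d, a)) (X (c, a) (c, b)) (X (d, a) (d, b)) (X (c, b) (d, b))"
  using plusD(4)[OF assms] by (rule wpb_imp_wpo)

lemma dual_plus:
  assumes "plus N X"
  shows "additive_arrows.plus ok (\<lambda>g f. f \<cdot> g) (\<lambda>X Y. zer Y X) cd dm N (\<lambda>x y. X (flip N y) (flip N x))"
  unfolding additive_arrows.plus_def[OF dual_additive_arrows] dual_zobj dual_wpb
proof (intro conjI allI impI)
  show "additive_arrows.fnc ok (\<lambda>g f. f \<cdot> g) cd dm (zst N) zle (\<lambda>x y. X (flip N y) (flip N x))"
    by (rule dual_fnc[OF plusD(1)[OF assms]]) auto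
  fix i
  show "zobj (X (flip N (i, i)) (flip N (i, i)))"
    using plusD(3)[OF assms, of "-i"] by (simp add: add.commute)
  show "zobj (X (flip N (i + N, i)) (flip N (i + N, i)))"
    using plusD(2)[OF assms, of "-i"] by simp
next
  fix a b c d :: int assume "a \<le> b \<and> b \<le> c \<and> c \<le> d \<and> d \<le> a + N"
  then have "wpo (X (N - d, - b) (N - c, - b)) (X (N - d, - b) (N - d, - a))
     (X (N - c, - b) (N - c, - a)) (X (N - d, - a) (N - c, - a))"
    by (intro plus_wpo[OF assms]) auto
  then have "wpb (X (N - d, - b) (N - d, - a)) (X (N - d, - b) (N - c, - b))
     (X (N - d, - a) (N - c, - a)) (X (N - c, - b) (N - c, - a))"
    using wpo_imp_wpb wpb_sym by blast
  then show "wpo (X (flip N (d, b)) (flip N (d, a))) (X (flip N (d, b)) (flip N (c, b)))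
     (X (flip N (d, a)) (flip N (c, a))) (X (flip N (c, b)) (flip N (c, a)))"
    by (simp add: wpb_imp_wpo)
qed

subsection \<open>Extension of morphisms\<close>

text \<open>
  The new row is filled from left to right. Its first object is zero. The square that joins the points
  \<open>j\<close> and \<open>j + 1\<close> of the two rows is a weak pushout in \<open>X\<close>,
  which provides the component at \<open>j + 1\<close>, until the last object of the row, which is
  zero again.
\<close>

lemma row_nt_step:
  assumes X: "plus N X" and Y: "plus N Y" and N: "N \<ge> 1" and s: "row_nt N X Y i s"
  shows "\<exists>s'. row_nt N X Y (i + 1) s' \<and>
    (\<forall>j. i < j \<and> j \<le> i + N \<longrightarrow> s' j \<cdot> X (j, i) (j, i + 1) = Y (j, i) (j, i + 1) \<cdot> s j)"
proof -
  note fX = fncD[OF plusD(1)[OF X]] and fY = fncD[OF plusD(1)[OF Y]]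
  have s1: "arr (s j) (X (j, i) (j, i)) (Y (j, i) (j, i))" if "i \<le> j" "j \<le> i + N" for j
    using s that unfolding row_nt_def by blast
  have s2: "s j' \<cdot> X (j, i) (j', i) = Y (j, i) (j', i) \<cdot> s j" if "i \<le> j" "j \<le> j'" "j' \<le> i + N" for j j'
    using s that unfolding row_nt_def by blast
  define J where "J m = i + 1 + int m" for m
  let ?P = "\<lambda>m u. J m \<le> i + 1 + N \<longrightarrow> arr u (X (J m, i + 1) (J m, i + 1)) (Y (J m, i + 1) (J m, i + 1)) \<and>
    (J m \<le> i + N \<longrightarrow> u \<cdot> X (J m, i) (J m, i + 1) = Y (J m, i) (J m, i + 1) \<cdot> s (J m))"
  let ?Q = "\<lambda>m u u'. J m < i + 1 + N \<longrightarrow>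
    u' \<cdot> X (J m, i + 1) (J m + 1, i + 1) = Y (J m, i + 1) (J m + 1, i + 1) \<cdot> u"
  have "\<exists>f. \<forall>m. ?P m (f m) \<and> ?Q m (f m) (f (Suc m))"
  proof (rule dependent_nat_choice)
    let ?x = "X (i + 1, i + 1) (i + 1, i + 1)" and ?y = "Y (i + 1, i + 1) (i + 1, i + 1)"
    have z: "zobj ?x" "zobj ?y" using plusD(2) X Y by blast+
    have xv: "arr (X (i + 1, i) (i + 1, i + 1)) (X (i + 1, i) (i + 1, i)) ?x" using fX(2) N by simp
    have yv: "arr (Y (i + 1, i) (i + 1, i + 1)) (Y (i + 1, i) (i + 1, i)) ?y" using fY(2) N by simp
    have sv: "arr (s (i + 1)) (X (i + 1, i) (i + 1, i)) (Y (i + 1, i) (i + 1, i))" using s1 N by simp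
    have u: "arr (zer ?x ?y) ?x ?y" using z arr_zer zobj_obj by blast
    have "zer ?x ?y \<cdot> X (i + 1, i) (i + 1, i + 1) = Y (i + 1, i) (i + 1, i + 1) \<cdot> s (i + 1)"
      by (rule isz_eq[OF isz_to_zobj[OF z(2)] isz_to_zobj[OF z(2)]])
        (use arrD[OF arr_cmp[OF xv u]] arrD[OF arr_cmp[OF sv yv]] in simp_all)
    then show "\<exists>u. ?P 0 u" using u by (auto simp: J_def)
  next
    fix u m assume P: "?P m u"
    show "\<exists>u'. ?P (Suc m) u' \<and> ?Q m u u'"
    proof (cases "J (Suc m) \<le> i + 1 + N")
      case False
      then show ?thesis by (auto simp: J_def)
    next
      case True
      define j where "j = J m"
      have Js: "J (Suc m) = j + 1" by (simp add: j_def J_def)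
      have j: "i + 1 \<le> j" "j \<le> i + N" using True Js by (auto simp: j_def J_def)
      have u: "arr u (X (j, i + 1) (j, i + 1)) (Y (j, i + 1) (j, i + 1))"
        "u \<cdot> X (j, i) (j, i + 1) = Y (j, i) (j, i + 1) \<cdot> s j"
        using P j unfolding j_def[symmetric] by auto
      have xh: "arr (X (j, i + 1) (j + 1, i + 1)) (X (j, i + 1) (j, i + 1)) (X (j + 1, i + 1) (j + 1, i + 1))"
        using fX(2) j by simp
      have yh: "arr (Y (j, i + 1) (j + 1, i + 1)) (Y (j, i + 1) (j, i + 1)) (Y (j + 1, i + 1) (j + 1, i + 1))"
        using fY(2) j by simp
      show ?thesis
      proof (cases "j = i + N")
        case True
        let ?x = "X (j + 1, i + 1) (j + 1, i + 1)" and ?y = "Y (j + 1, i + 1) (j + 1, i + 1)"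
        have z: "zobj ?x" "zobj ?y" using plusD(3)[OF X, of "i + 1"] plusD(3)[OF Y, of "i + 1"] True
          by (simp_all add: algebra_simps)
        have u': "arr (zer ?x ?y) ?x ?y" using z arr_zer zobj_obj by blast
        have "zer ?x ?y \<cdot> X (j, i + 1) (j + 1, i + 1) = Y (j, i + 1) (j + 1, i + 1) \<cdot> u"
          by (rule isz_eq[OF isz_to_zobj[OF z(2)] isz_to_zobj[OF z(2)]])
            (use arrD[OF arr_cmp[OF xh u']] arrD[OF arr_cmp[OF u(1) yh]] in simp_all)
        then show ?thesis using u' True unfolding Js j_def[symmetric] by auto
      next
        case False
        have jN: "j + 1 \<le> i + N" using False j by simp
        have po: "wpo (X (j, i) (j + 1, i)) (X (j, i) (j, i + 1)) (X (j + 1, i) (j + 1, i + 1)) (X (j, i + 1) (j + 1, i + 1))"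
          by (rule plus_wpo[OF X]) (use j jN in auto)
        have yv: "arr (Y (j + 1, i) (j + 1, i + 1)) (Y (j + 1, i) (j + 1, i)) (Y (j + 1, i + 1) (j + 1, i + 1))"
          using fY(2) j jN by simp
        have sv: "arr (s (j + 1)) (X (j + 1, i) (j + 1, i)) (Y (j + 1, i) (j + 1, i))" using s1 j jN by simp
        have xhi: "arr (X (j, i) (j + 1, i)) (X (j, i) (j, i)) (X (j + 1, i) (j + 1, i))"
          using fX(2) j jN by simp
        let ?p = "Y (j + 1, i) (j + 1, i + 1) \<cdot> s (j + 1)" and ?q = "Y (j, i + 1) (j + 1, i + 1) \<cdot> u"
        have "?p \<cdot> X (j, i) (j + 1, i) = Y (j + 1, i) (j + 1, i + 1) \<cdot> Y (j, i) (j + 1, i) \<cdot> s j"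
          using s2[of j "j + 1"] j jN by (simp add: cmp_assoc)
        also have "\<dots> = Y (j, i) (j + 1, i + 1) \<cdot> s j"
          unfolding cmp_assoc[symmetric] by (subst fY(3)) (use j jN in auto)
        also have "\<dots> = (Y (j, i + 1) (j + 1, i + 1) \<cdot> Y (j, i) (j, i + 1)) \<cdot> s j"
          by (subst fY(3)) (use j jN in auto)
        also have "\<dots> = ?q \<cdot> X (j, i) (j, i + 1)" using u(2) by (simp add: cmp_assoc)
        finally have "?p \<cdot> X (j, i) (j + 1, i) = ?q \<cdot> X (j, i) (j, i + 1)" .
        moreover have "ok (?p \<cdot> X (j, i) (j + 1, i))"
          using arrD(1)[OF arr_cmp[OF xhi arr_cmp[OF sv yv]]] .
        ultimately obtain u' where u': "?p = u' \<cdot> X (j + 1, i) (j + 1, i + 1)" "?q = u' \<cdot> X (j, i + 1) (j + 1, i + 1)"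
          using po unfolding wpo_def by blast
        have "arr u' (X (j + 1, i + 1) (j + 1, i + 1)) (Y (j + 1, i + 1) (j + 1, i + 1))"
          using arrD[OF arr_cmp[OF u(1) yh]] arrD[OF xh] unfolding u'(2) arr_def by simp
        then have "?P (Suc m) u' \<and> ?Q m u u'" unfolding Js j_def[symmetric] using u' by simp
        then show ?thesis by blast
      qed
    qed
  qed
  then obtain f where f: "\<And>m. ?P m (f m)" "\<And>m. ?Q m (f m) (f (Suc m))" by blast
  define s' where "s' j = f (nat (j - i - 1))" for j
  have J: "J (nat (j - i - 1)) = j" if "i + 1 \<le> j" for j using that by (simp add: J_def)
  have 1: "arr (s' j) (X (j, i + 1) (j, i + 1)) (Y (j, i + 1) (j, i + 1))" if "i + 1 \<le> j" "j \<le> i + 1 + N" for j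
    using f(1)[of "nat (j - i - 1)"] that unfolding J[OF that(1)] s'_def by blast
  have 2: "s' j \<cdot> X (j, i) (j, i + 1) = Y (j, i) (j, i + 1) \<cdot> s j" if "i < j" "j \<le> i + N" for j
    using f(1)[of "nat (j - i - 1)"] that J[of j] unfolding s'_def by simp
  have 3: "s' (j + 1) \<cdot> X (j, i + 1) (j + 1, i + 1) = Y (j, i + 1) (j + 1, i + 1) \<cdot> s' j"
    if "i + 1 \<le> j" "j < i + 1 + N" for j
  proof -
    have "nat (j + 1 - i - 1) = Suc (nat (j - i - 1))" using that by simp
    then show ?thesis using f(2)[of "nat (j - i - 1)"] that J[of j] unfolding s'_def by simp
  qed
  have "s' (j + int k) \<cdot> X (j, i + 1) (j + int k, i + 1) = Y (j, i + 1) (j + int k, i + 1) \<cdot> s' j"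
    if "i + 1 \<le> j" "j + int k \<le> i + 1 + N" for j k
    using that
  proof (induction k)
    case 0
    then show ?case using nt_id[OF plusD(1)[OF X]] 1[of j] by (simp add: arr_def id_cmp cmp_id)
  next
    case (Suc k)
    have "(\<lambda>x. s' (fst x)) (j + int k + 1, i + 1) \<cdot> X (j, i + 1) (j + int k + 1, i + 1)
        = Y (j, i + 1) (j + int k + 1, i + 1) \<cdot> (\<lambda>x. s' (fst x)) (j, i + 1)"
      by (rule natural_trans[OF plusD(1)[OF X] plusD(1)[OF Y], where y = "(j + int k, i + 1)"])
        (use Suc 3[of "j + int k"] N in auto)
    then show ?case by (simp add: algebra_simps)
  qed
  note 4 = this
  have 5: "s' j' \<cdot> X (j, i + 1) (j', i + 1) = Y (j, i + 1) (j', i + 1) \<cdot> s' j"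
    if "i + 1 \<le> j" "j \<le> j'" "j' \<le> i + 1 + N" for j j'
    using 4[of j "nat (j' - j)"] that by simp
  have "row_nt N X Y (i + 1) s'" unfolding row_nt_def using 1 5 by blast
  then show ?thesis using 2 by blast
qed

lemma nt_extend_right:
  assumes X: "plus N X" and Y: "plus N Y" and N: "N \<ge> 1" and s: "row_nt N X Y 0 s"
  shows "\<exists>t. nt {x \<in> zst N. snd x \<ge> 0} zle X Y t \<and> (\<forall>j. t (j, 0) = s j)"
proof -
  note fX = fncD[OF plusD(1)[OF X]] and fY = fncD[OF plusD(1)[OF Y]]
  have "\<exists>f. \<forall>m. (row_nt N X Y (int m) (f m) \<and> (m = 0 \<longrightarrow> f m = s)) \<and>
    (\<forall>j. int m < j \<and> j \<le> int m + N \<longrightarrow>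
      f (Suc m) j \<cdot> X (j, int m) (j, int m + 1) = Y (j, int m) (j, int m + 1) \<cdot> f m j)"
  proof (rule dependent_nat_choice)
    show "\<exists>f. row_nt N X Y (int 0) f \<and> (0 = 0 \<longrightarrow> f = s)" using s by auto
    show "\<exists>f'. (row_nt N X Y (int (Suc m)) f' \<and> (Suc m = 0 \<longrightarrow> f' = s)) \<and>
      (\<forall>j. int m < j \<and> j \<le> int m + N \<longrightarrow> f' j \<cdot> X (j, int m) (j, int m + 1) = Y (j, int m) (j, int m + 1) \<cdot> f j)"
      if "row_nt N X Y (int m) f \<and> (m = 0 \<longrightarrow> f = s)" for f m
      using row_nt_step[OF X Y N, of "int m" f] that by (auto simp: add.commute)
  qed
  then obtain f where f: "\<And>m. row_nt N X Y (int m) (f m)" "f 0 = s"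
    "\<And>m j. int m < j \<Longrightarrow> j \<le> int m + N \<Longrightarrow>
      f (Suc m) j \<cdot> X (j, int m) (j, int m + 1) = Y (j, int m) (j, int m + 1) \<cdot> f m j"
    by blast
  define t where "t x = f (nat (snd x)) (fst x)" for x
  have t1: "arr (t (j, i)) (X (j, i) (j, i)) (Y (j, i) (j, i))" if "0 \<le> i" "i \<le> j" "j \<le> i + N" for i j
    using f(1)[of "nat i"] that unfolding row_nt_def t_def by simp
  have t2: "t (j', i) \<cdot> X (j, i) (j', i) = Y (j, i) (j', i) \<cdot> t (j, i)"
    if "0 \<le> i" "i \<le> j" "j \<le> j'" "j' \<le> i + N" for i j j'
    using f(1)[of "nat i"] that unfolding row_nt_def t_def by simp
  have t3: "t (j, i + 1) \<cdot> X (j, i) (j, i + 1) = Y (j, i) (j, i + 1) \<cdot> t (j, i)"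
    if "0 \<le> i" "i < j" "j \<le> i + N" for i j
  proof -
    have "nat (i + 1) = Suc (nat i)" using that by simp
    then show ?thesis using f(3)[of "nat i" j] that unfolding t_def by simp
  qed
  have t4: "t (j', i + int k) \<cdot> X (j, i) (j', i + int k) = Y (j, i) (j', i + int k) \<cdot> t (j, i)"
    if "0 \<le> i" "i \<le> j" "j \<le> i + N" "j \<le> j'" "i + int k \<le> j'" "j' \<le> i + int k + N" for i j j' k
    using that
  proof (induction k arbitrary: i j)
    case 0
    then show ?case using t2 by simp
  next
    case (Suc k)
    define m where "m = max j (i + 1)"
    have m: "j \<le> m" "i + 1 \<le> m" "m \<le> j'" "m \<le> i + N" using Suc.prems N by (auto simp: m_def)
    have IH: "t (j', i + 1 + int k) \<cdot> X (m, i + 1) (j', i + 1 + int k) = Y (m, i + 1) (j', i + 1 + int k) \<cdot> t (m, i + 1)"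
      by (rule Suc.IH) (use Suc.prems m in auto)
    have a: "t (m, i + 1) \<cdot> X (j, i) (m, i + 1) = Y (j, i) (m, i + 1) \<cdot> t (j, i)"
      by (rule natural_trans[OF plusD(1)[OF X] plusD(1)[OF Y], of _ "(m, i)"])
        (use Suc.prems m t2[of i j m] t3[of i m] in auto)
    have "t (j', i + 1 + int k) \<cdot> X (j, i) (j', i + 1 + int k) = Y (j, i) (j', i + 1 + int k) \<cdot> t (j, i)"
      by (rule natural_trans[OF plusD(1)[OF X] plusD(1)[OF Y], of _ "(m, i + 1)"])
        (use Suc.prems m a IH in auto)
    then show ?case by (simp add: algebra_simps)
  qed
  have "nt {x \<in> zst N. snd x \<ge> 0} zle X Y t"
    unfolding nt_def
  proof (intro conjI ballI impI)
    fix x assume "x \<in> {x \<in> zst N. snd x \<ge> 0}"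
    then show "arr (t x) (X x x) (Y x x)" using t1 by (cases x) auto
  next
    fix x y assume xy: "x \<in> {x \<in> zst N. snd x \<ge> 0}" "y \<in> {x \<in> zst N. snd x \<ge> 0}" "zle x y"
    obtain j i j' i' where p: "x = (j, i)" "y = (j', i')" by (metis surj_pair)
    show "t y \<cdot> X x y = Y x y \<cdot> t x"
      using t4[of i j j' "nat (i' - i)"] xy unfolding p by simp
  qed
  moreover have "t (j, 0) = s j" for j by (simp add: t_def f(2))
  ultimately show ?thesis by blast
qed

text \<open>
  Above row \<open>0\<close> the morphism is extended row by row, below row \<open>0\<close> by the
  dual argument. The two halves fit together since an arrow of the strip from the lower to the upper
  half passes through row \<open>0\<close>.
\<close>

lemma nt_extend:
  assumes X: "plus N X" and Y: "plus N Y" and N: "N \<ge> 1" and s: "row_nt N X Y 0 s"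
  shows "\<exists>t. nt (zst N) zle X Y t \<and> (\<forall>j. t (j, 0) = s j)"
proof -
  note fX = plusD(1)[OF X] and fY = plusD(1)[OF Y]
  obtain r where r: "nt {x \<in> zst N. snd x \<ge> 0} zle X Y r" "\<And>j. r (j, 0) = s j"
    using nt_extend_right[OF assms] by blast
  have "additive_arrows.row_nt ok (\<lambda>g f. f \<cdot> g) cd dm N
      (\<lambda>x y. Y (flip N y) (flip N x)) (\<lambda>x y. X (flip N y) (flip N x)) 0 (\<lambda>j. s (N - j))"
    using s unfolding row_nt_def additive_arrows.row_nt_def[OF dual_additive_arrows] dual_arr by simp
  from weakly_abelian_arrows.nt_extend_right[OF dual_weakly_abelian_arrows dual_plus[OF Y] dual_plus[OF X] N this]
  obtain l where l: "additive_arrows.nt ok (\<lambda>g f. f \<cdot> g) cd dm {x \<in> zst N. snd x \<ge> 0} zle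
      (\<lambda>x y. Y (flip N y) (flip N x)) (\<lambda>x y. X (flip N y) (flip N x)) l" "\<And>j. l (j, 0) = s (N - j)"
    by blast
  have l': "nt {x \<in> zst N. snd x \<le> 0} zle X Y (\<lambda>x. l (flip N x))"
    using nt_flip[OF l(1)] unfolding nt_def by (simp add: flip_def)
  have l0: "l (flip N (j, 0)) = s j" for j by (simp add: l(2))
  define t where "t x = (if snd x \<ge> 0 then r x else l (flip N x))" for x
  have tl: "t x = l (flip N x)" if "snd x \<le> 0" for x
    using that r(2) l0 by (cases x) (auto simp: t_def)
  have "nt (zst N) zle X Y t"
    unfolding nt_def
  proof (intro conjI ballI impI)
    fix x assume "x \<in> zst N"
    then show "arr (t x) (X x x) (Y x x)" using ntD(1)[OF r(1), of x] ntD(1)[OF l', of x] by (auto simp: t_def)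
  next
    fix x y assume xy: "x \<in> zst N" "y \<in> zst N" "zle x y"
    consider "snd x \<ge> 0" "snd y \<ge> 0" | "snd x \<le> 0" "snd y \<le> 0" | "snd x \<le> 0" "snd y \<ge> 0"
      using xy(3)[unfolded zle_def] by (meson linear order_trans)
    then show "t y \<cdot> X x y = Y x y \<cdot> t x"
    proof cases
      case 1
      then show ?thesis using ntD(2)[OF r(1), of x y] xy by (simp add: t_def)
    next
      case 2
      then show ?thesis using ntD(2)[OF l', of x y] xy by (simp add: tl)
    next
      case 3
      \<comment> \<open>a point of row \<open>0\<close> between \<open>x\<close> and \<open>y\<close>\<close>
      define z where "z = (max (fst x) 0, 0::int)"
      have z: "z \<in> zst N" "zle x z" "zle z y" "snd z = 0"
        using xy 3 N by (cases x; cases y; auto simp: z_def)+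
      show ?thesis
      proof (rule natural_trans[OF fX fY xy(1) z(1) xy(2) z(2,3)])
        show "t z \<cdot> X x z = Y x z \<cdot> t x"
          using ntD(2)[OF l', of x z] xy 3 z by (simp add: tl)
        show "t y \<cdot> X z y = Y z y \<cdot> t z"
          using ntD(2)[OF r(1), of z y] xy 3 z by (simp add: t_def)
      qed
    qed
  qed
  moreover have "t (j, 0) = s j" for j by (simp add: t_def r(2))
  ultimately show ?thesis by blast
qed

end

subsection \<open>Extension of diagrams\<close>

context additive_arrows
begin

text \<open>
  A row together with zero objects to its left and right: \<open>h j\<close> leads from the
  \<open>j\<close>-th object to the next one. Rows that are infinite in both directions make all rows
  alike.
\<close>

definition seq_row :: "int \<Rightarrow> int \<Rightarrow> (int \<Rightarrow> 'a) \<Rightarrow> bool"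
  where "seq_row N i h \<longleftrightarrow> (\<forall>j. ok (h j) \<and> cd (h j) = dm (h (j + 1))) \<and>
    (\<forall>j. j \<le> i \<or> i + N \<le> j \<longrightarrow> zobj (dm (h j)))"

text \<open>
  A ladder with rungs \<open>v j\<close> from a row to the next one. Only the squares inside the
  strip are weak.
\<close>

definition row_link :: "int \<Rightarrow> int \<Rightarrow> (int \<Rightarrow> 'a) \<Rightarrow> (int \<Rightarrow> 'a) \<Rightarrow> (int \<Rightarrow> 'a) \<Rightarrow> bool"
  where "row_link N i h v h' \<longleftrightarrow> (\<forall>j. arr (v j) (dm (h j)) (dm (h' j))) \<and>
    (\<forall>j. v (j + 1) \<cdot> h j = h' j \<cdot> v j) \<and>
    (\<forall>j. i < j \<and> j < i + N \<longrightarrow> wpb (h j) (v j) (v (j + 1)) (h' j))"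

end

context weakly_abelian_arrows
begin

text \<open>
  The first rung is the zero arrow from the object at \<open>i + 1\<close>, since the new row is
  zero there. Taking weak pushouts along the old row yields the other rungs and the new row.
\<close>

lemma seq_row_next:
  assumes h: "seq_row N i h"
  shows "\<exists>h' v. seq_row N (i + 1) h' \<and> row_link N i h v h'"
proof -
  have h1: "ok (h j)" "cd (h j) = dm (h (j + 1))" for j using h unfolding seq_row_def by blast+
  have h2: "zobj (dm (h j))" if "j \<le> i \<or> i + N \<le> j" for j using h that unfolding seq_row_def by blast
  obtain Z where Z: "zobj Z" using zobj_exists by blast
  have Zo: "obj Z" using Z by (rule zobj_obj)
  let ?J = "\<lambda>m. i + 1 + int m"
  have "\<exists>f. \<forall>m. (ok (fst (f m)) \<and> dm (fst (f m)) = dm (h (?J m)) \<and> (m = 0 \<longrightarrow> fst (f m) = zer (dm (h (i + 1))) Z)) \<and>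
     wpo (h (?J m)) (fst (f m)) (fst (f (Suc m))) (snd (f (Suc m)))"
  proof (rule dependent_nat_choice)
    have "arr (zer (dm (h (i + 1))) Z) (dm (h (i + 1))) Z" using arr_zer Zo h1 obj_dm by blast
    then show "\<exists>x :: 'a \<times> 'a. ok (fst x) \<and> dm (fst x) = dm (h (?J 0)) \<and> (0 = 0 \<longrightarrow> fst x = zer (dm (h (i + 1))) Z)"
      by (intro exI[of _ "(zer (dm (h (i + 1))) Z, Z)"]) (simp add: arr_def)
  next
    fix x :: "'a \<times> 'a" and m assume x: "ok (fst x) \<and> dm (fst x) = dm (h (?J m)) \<and> (m = 0 \<longrightarrow> fst x = zer (dm (h (i + 1))) Z)"
    have "arr (h (?J m)) (dm (h (?J m))) (cd (h (?J m)))" "arr (fst x) (dm (h (?J m))) (cd (fst x))"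
      using x h1 by (simp_all add: arr_def)
    from wpo_exists[OF this] obtain c d where cd: "wpo (h (?J m)) (fst x) c d" by blast
    then have "ok (c \<cdot> h (?J m))" unfolding wpo_def by blast
    then have "ok c" "dm c = dm (h (?J (Suc m)))" using h1(2)[of "?J m"] by (simp_all add: algebra_simps)
    then show "\<exists>y. (ok (fst y) \<and> dm (fst y) = dm (h (?J (Suc m))) \<and> (Suc m = 0 \<longrightarrow> fst y = zer (dm (h (i + 1))) Z)) \<and>
        wpo (h (?J m)) (fst x) (fst y) (snd y)"
      using cd by (intro exI[of _ "(c, d)"]) simp
  qed
  then obtain f where f: "\<And>m. ok (fst (f m))" "\<And>m. dm (fst (f m)) = dm (h (?J m))"
    "fst (f 0) = zer (dm (h (i + 1))) Z" "\<And>m. wpo (h (?J m)) (fst (f m)) (fst (f (Suc m))) (snd (f (Suc m)))"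
    by blast
  define v where "v j = (if i + 1 \<le> j \<and> j \<le> i + N then fst (f (nat (j - i - 1))) else zer (dm (h j)) Z)" for j
  define h' where "h' j = (if i + 1 \<le> j \<and> j < i + N then snd (f (nat (j - i))) else zer (cd (v j)) (cd (v (j + 1))))" for j
  have v: "ok (v j)" "dm (v j) = dm (h j)" for j
  proof -
    have "ok (zer (dm (h j)) Z)" "dm (zer (dm (h j)) Z) = dm (h j)" using h1 Zo by simp_all
    then show "ok (v j)" "dm (v j) = dm (h j)"
      using f(1) f(2)[of "nat (j - i - 1)"] by (auto simp: v_def)
  qed
  have vZ: "cd (v j) = Z" if "j \<le> i + 1 \<or> i + 1 + N \<le> j" for j
  proof -
    have "v j = zer (dm (h j)) Z" using that f(3) by (cases "j = i + 1") (auto simp: v_def)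
    then show ?thesis using Zo h1 by simp
  qed
  have po: "wpo (h j) (v j) (v (j + 1)) (h' j)" if "i < j" "j < i + N" for j
  proof -
    have "nat (j + 1 - i - 1) = Suc (nat (j - i - 1))" "nat (j - i) = Suc (nat (j - i - 1))"
      "?J (nat (j - i - 1)) = j" using that by auto
    then show ?thesis using f(4)[of "nat (j - i - 1)"] that by (simp add: v_def h'_def)
  qed
  have h': "ok (h' j)" "dm (h' j) = cd (v j)" "cd (h' j) = cd (v (j + 1))" "v (j + 1) \<cdot> h j = h' j \<cdot> v j" for j
  proof -
    have "ok (h' j) \<and> dm (h' j) = cd (v j) \<and> cd (h' j) = cd (v (j + 1)) \<and> v (j + 1) \<cdot> h j = h' j \<cdot> v j"
    proof (cases "i < j \<and> j < i + N")
      case True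
      then have "wpo (h j) (v j) (v (j + 1)) (h' j)" using po by blast
      then have "ok (v (j + 1) \<cdot> h j)" "v (j + 1) \<cdot> h j = h' j \<cdot> v j" unfolding wpo_def by blast+
      from cmp_eqD[OF this(2,1)] this(2) show ?thesis by simp
    next
      case False
      then have h'z: "h' j = zer (cd (v j)) (cd (v (j + 1)))" by (auto simp: h'_def)
      then have t: "ok (h' j)" "dm (h' j) = cd (v j)" "cd (h' j) = cd (v (j + 1))" using v by simp_all
      have o: "ok (v (j + 1) \<cdot> h j)" "ok (h' j \<cdot> v j)" using t v h1 by simp_all
      have "isz (h' j \<cdot> v j)" using isz_cmp_left[OF _ o(2)] h'z isz_zer v by simp
      moreover have "isz (v (j + 1) \<cdot> h j)"
      proof (cases "j \<le> i")
        case True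
        then show ?thesis using isz_to_zobj[OF Z o(1)] vZ[of "j + 1"] v h1 by simp
      next
        case F: False
        then have "zobj (dm (h j))" using False h2 by simp
        then show ?thesis using isz_from_zobj[OF _ o(1)] v h1 by simp
      qed
      ultimately show ?thesis using t v h1 isz_eq by simp
    qed
    then show "ok (h' j)" "dm (h' j) = cd (v j)" "cd (h' j) = cd (v (j + 1))" "v (j + 1) \<cdot> h j = h' j \<cdot> v j" by blast+
  qed
  have "seq_row N (i + 1) h'"
    unfolding seq_row_def using h' vZ Z by (simp add: algebra_simps)
  moreover have "row_link N i h v h'"
    unfolding row_link_def arr_def using v h' po wpo_imp_wpb by simp
  ultimately show ?thesis by blast
qed

lemma seq_row_prev:
  assumes h: "seq_row N i h"
  shows "\<exists>h' v. seq_row N (i - 1) h' \<and> row_link N (i - 1) h' v h"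
proof -
  note dual = dual_additive_arrows
  have h1: "ok (h j)" "cd (h j) = dm (h (j + 1))" for j using h unfolding seq_row_def by blast+
  have h2: "zobj (dm (h j))" if "j \<le> i \<or> i + N \<le> j" for j using h that unfolding seq_row_def by blast
  \<comment> \<open>\<open>flip\<close> maps the arrow from \<open>j\<close> to \<open>j + 1\<close> to the one from \<open>N - 1 - j\<close> to \<open>N - j\<close>\<close>
  have "additive_arrows.seq_row ok (\<lambda>X Y. zer Y X) cd dm N (- i) (\<lambda>j. h (N - 1 - j))"
    unfolding additive_arrows.seq_row_def[OF dual] dual_zobj
  proof (intro conjI allI impI)
    fix j show "ok (h (N - 1 - j))" by (rule h1)
    show "dm (h (N - 1 - j)) = cd (h (N - 1 - (j + 1)))" using h1(2)[of "N - 1 - (j + 1)"] by (simp add: algebra_simps)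
  next
    fix j assume "j \<le> - i \<or> - i + N \<le> j"
    then have "zobj (dm (h (N - j)))" using h2[of "N - j"] by auto
    then show "zobj (cd (h (N - 1 - j)))" using h1(2)[of "N - 1 - j"] by (simp add: algebra_simps)
  qed
  from weakly_abelian_arrows.seq_row_next[OF dual_weakly_abelian_arrows this]
  obtain g w where g: "additive_arrows.seq_row ok (\<lambda>X Y. zer Y X) cd dm N (- i + 1) g"
    and w: "additive_arrows.row_link ok (\<lambda>g f. f \<cdot> g) cd dm N (- i) (\<lambda>j. h (N - 1 - j)) w g" by blast
  have g1: "ok (g j)" "dm (g j) = cd (g (j + 1))" for j
    using g unfolding additive_arrows.seq_row_def[OF dual] by blast+
  have g2: "zobj (cd (g j))" if "j \<le> - i + 1 \<or> - i + 1 + N \<le> j" for j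
    using g that unfolding additive_arrows.seq_row_def[OF dual] dual_zobj by blast
  have w1: "arr (w j) (cd (g j)) (cd (h (N - 1 - j)))" for j
    using w unfolding additive_arrows.row_link_def[OF dual] dual_arr by blast
  have w2: "h (N - 1 - j) \<cdot> w (j + 1) = w j \<cdot> g j" for j
    using w unfolding additive_arrows.row_link_def[OF dual] by blast
  have w3: "wpo (w (j + 1)) (g j) (h (N - 1 - j)) (w j)" if "- i < j" "j < - i + N" for j
    using w that unfolding additive_arrows.row_link_def[OF dual] dual_wpb by blast
  let ?h = "\<lambda>j. g (N - 1 - j)" and ?v = "\<lambda>j. w (N - j)"
  have gd: "dm (g (N - 1 - j)) = cd (g (N - j))" for j using g1(2)[of "N - 1 - j"] by simp
  have hd: "cd (h (j - 1)) = dm (h j)" for j using h1(2)[of "j - 1"] by simp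
  have "seq_row N (i - 1) ?h"
    unfolding seq_row_def
  proof (intro conjI allI impI)
    fix j show "ok (?h j)" by (rule g1)
    show "cd (?h j) = dm (?h (j + 1))" using gd[of "j + 1"] by (simp add: algebra_simps)
  next
    fix j assume "j \<le> i - 1 \<or> i - 1 + N \<le> j"
    then show "zobj (dm (?h j))" unfolding gd using g2[of "N - j"] by auto
  qed
  moreover have "row_link N (i - 1) ?h ?v h"
    unfolding row_link_def
  proof (intro conjI allI impI)
    fix j show "arr (?v j) (dm (?h j)) (dm (h j))" using w1[of "N - j"] unfolding gd by (simp add: hd)
    show "?v (j + 1) \<cdot> ?h j = h j \<cdot> ?v j" using w2[of "N - 1 - j"] by (simp add: algebra_simps)
  next
    fix j assume "i - 1 < j \<and> j < i - 1 + N"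
    then have "wpo (w (N - 1 - j + 1)) (g (N - 1 - j)) (h (N - 1 - (N - 1 - j))) (w (N - 1 - j))"
      by (intro w3) auto
    then have "wpo (w (N - j)) (g (N - 1 - j)) (h j) (w (N - (j + 1)))" by (simp add: algebra_simps)
    then show "wpb (?h j) (?v j) (?v (j + 1)) (h j)" using wpo_imp_wpb wpb_sym by blast
  qed
  ultimately show ?thesis by blast
qed

lemma grid_exists:
  assumes "seq_row N 0 h0"
  shows "\<exists>h v. h 0 = h0 \<and> (\<forall>i. seq_row N i (h i) \<and> row_link N i (h i) (v i) (h (i + 1)))"
proof -
  have "\<exists>r. \<forall>m. (seq_row N (int m) (r m) \<and> (m = 0 \<longrightarrow> r m = h0)) \<and> (\<exists>v. row_link N (int m) (r m) v (r (Suc m)))"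
  proof (rule dependent_nat_choice)
    show "\<exists>x. seq_row N (int 0) x \<and> (0 = 0 \<longrightarrow> x = h0)" using assms by simp
    show "\<exists>y. (seq_row N (int (Suc m)) y \<and> (Suc m = 0 \<longrightarrow> y = h0)) \<and> (\<exists>v. row_link N (int m) x v y)"
      if "seq_row N (int m) x \<and> (m = 0 \<longrightarrow> x = h0)" for x m
      using seq_row_next[of N "int m" x] that by (auto simp: add.commute)
  qed
  then obtain r where r: "\<And>m. seq_row N (int m) (r m)" "r 0 = h0" "\<And>m. \<exists>v. row_link N (int m) (r m) v (r (Suc m))"
    by blast
  have "\<exists>l. \<forall>m. (seq_row N (- int m) (l m) \<and> (m = 0 \<longrightarrow> l m = h0)) \<and> (\<exists>v. row_link N (- int m - 1) (l (Suc m)) v (l m))"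
  proof (rule dependent_nat_choice)
    show "\<exists>x. seq_row N (- int 0) x \<and> (0 = 0 \<longrightarrow> x = h0)" using assms by simp
    show "\<exists>y. (seq_row N (- int (Suc m)) y \<and> (Suc m = 0 \<longrightarrow> y = h0)) \<and> (\<exists>v. row_link N (- int m - 1) y v x)"
      if "seq_row N (- int m) x \<and> (m = 0 \<longrightarrow> x = h0)" for x m
    proof -
      have "seq_row N (- int m) x" using that by blast
      from seq_row_prev[OF this]
      obtain y v where "seq_row N (- int m - 1) y" "row_link N (- int m - 1) y v x" by blast
      moreover have "- int m - 1 = - int (Suc m)" by simp
      ultimately have "seq_row N (- int (Suc m)) y" "row_link N (- int m - 1) y v x" by (simp_all only:)
      then show ?thesis by blast
    qed
  qed
  then obtain l where l: "\<And>m. seq_row N (- int m) (l m)" "l 0 = h0" "\<And>m. \<exists>v. row_link N (- int m - 1) (l (Suc m)) v (l m)"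
    by blast
  define h where "h i = (if i \<ge> 0 then r (nat i) else l (nat (- i)))" for i
  have hl: "h i = l (nat (- i))" if "i \<le> 0" for i using that r(2) l(2) by (auto simp: h_def)
  have "\<exists>v. row_link N i (h i) v (h (i + 1))" for i
  proof (cases "i \<ge> 0")
    case True
    then have "nat (i + 1) = Suc (nat i)" by simp
    then show ?thesis using r(3)[of "nat i"] True by (simp add: h_def)
  next
    case False
    then have "h (i + 1) = l (nat (- (i + 1)))" "nat (- i) = Suc (nat (- (i + 1)))" "h i = l (nat (- i))"
      using hl by auto
    then show ?thesis using l(3)[of "nat (- (i + 1))"] False by simp
  qed
  then obtain v where "\<And>i. row_link N i (h i) (v i) (h (i + 1))" by metis
  moreover have "seq_row N i (h i)" for i
    using r(1)[of "nat i"] l(1)[of "nat (- i)"] by (auto simp: h_def)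
  moreover have "h 0 = h0" by (simp add: h_def r(2))
  ultimately show ?thesis by blast
qed

end

context additive_arrows
begin

primrec path :: "(int \<Rightarrow> 'a) \<Rightarrow> int \<Rightarrow> nat \<Rightarrow> 'a"
  where "path h j 0 = dm (h j)"
  | "path h j (Suc k) = h (j + int k) \<cdot> path h j k"

lemma arr_path:
  assumes "\<And>j. ok (h j)" "\<And>j. cd (h j) = dm (h (j + 1))"
  shows "arr (path h j k) (dm (h j)) (dm (h (j + int k)))"
proof (induction k)
  case 0
  then show ?case using assms by (simp add: arr_id)
next
  case (Suc k)
  have "arr (h (j + int k)) (dm (h (j + int k))) (dm (h (j + int k + 1)))" using assms by (simp add: arr_def)
  from arr_cmp[OF Suc this] show ?case by (simp add: algebra_simps)
qed

lemma path_add: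
  assumes "\<And>j. ok (h j)" "\<And>j. cd (h j) = dm (h (j + 1))"
  shows "path h (j + int k) l \<cdot> path h j k = path h j (k + l)"
proof (induction l)
  case 0
  then show ?case using arrD[OF arr_path[of h j k]] assms by (simp add: id_cmp)
next
  case (Suc l)
  then show ?case by (simp add: cmp_assoc algebra_simps)
qed

lemma path_link:
  assumes "\<And>j. arr (v j) (dm (h j)) (dm (h' j))" "\<And>j. v (j + 1) \<cdot> h j = h' j \<cdot> v j"
  shows "v (j + int k) \<cdot> path h j k = path h' j k \<cdot> v j"
proof (induction k)
  case 0
  then show ?case using arrD[OF assms(1)[of j]] by (simp add: id_cmp cmp_id)
next
  case (Suc k)
  have "v (j + int (Suc k)) \<cdot> path h j (Suc k) = (v (j + int k + 1) \<cdot> h (j + int k)) \<cdot> path h j k"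
    by (simp add: cmp_assoc algebra_simps)
  also have "\<dots> = h' (j + int k) \<cdot> path h' j k \<cdot> v j" unfolding assms(2) cmp_assoc Suc ..
  finally show ?case by (simp add: cmp_assoc)
qed

lemma path_wpb:
  assumes "\<And>j. arr (v j) (dm (h j)) (dm (h' j))"
    "\<And>m. m < k \<Longrightarrow> wpb (h (j + int m)) (v (j + int m)) (v (j + int m + 1)) (h' (j + int m))"
  shows "wpb (path h j k) (v j) (v (j + int k)) (path h' j k)"
  using assms(2)
proof (induction k)
  case 0
  then show ?case using wpb_id[OF assms(1)[of j]] by simp
next
  case (Suc k)
  from wpb_paste[OF Suc.IH[OF Suc.prems] Suc.prems[of k]] show ?case by (simp add: algebra_simps)
qed

end

context weakly_abelian_arrows
begin

text \<open>
  A transition runs first along a row and then along a column of the grid. These composites are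
  functorial as the squares of the grid commute, and rectangles are pasted from its weak squares.
\<close>

lemma plus_from_row:
  assumes N: "N \<ge> 1" and h0: "seq_row N 0 h0"
  shows "\<exists>X. plus N X \<and> (\<forall>j j'. j \<le> j' \<longrightarrow> X (j, 0) (j', 0) = path h0 j (nat (j' - j)))"
proof -
  obtain h v where h0': "h 0 = h0" and hr: "\<And>i. seq_row N i (h i)" and hl: "\<And>i. row_link N i (h i) (v i) (h (i + 1))"
    using grid_exists[OF h0] by blast
  have h1: "ok (h i j)" "cd (h i j) = dm (h i (j + 1))" for i j using hr[of i] unfolding seq_row_def by blast+
  have h2: "zobj (dm (h i j))" if "j \<le> i \<or> i + N \<le> j" for i j using hr[of i] that unfolding seq_row_def by blast
  have v1: "arr (v i j) (dm (h i j)) (dm (h (i + 1) j))" for i j using hl[of i] unfolding row_link_def by blast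
  have v2: "v i (j + 1) \<cdot> h i j = h (i + 1) j \<cdot> v i j" for i j using hl[of i] unfolding row_link_def by blast
  have v3: "wpb (h i j) (v i j) (v i (j + 1)) (h (i + 1) j)" if "i < j" "j < i + N" for i j
    using hl[of i] that unfolding row_link_def by blast
  have vd: "ok (v i j)" "dm (v i j) = dm (h i j)" "cd (v i j) = dm (v (i + 1) j)" for i j
    using v1[of i j] v1[of "i + 1" j] by (auto simp: arr_def)
  let ?V = "\<lambda>j i. v i j"
  define T where "T x y = path (?V (fst y)) (snd x) (nat (snd y - snd x)) \<cdot> path (h (snd x)) (fst x) (nat (fst y - fst x))" for x y
  have Tp: "T (j, i) (j', i') = path (?V j') i (nat (i' - i)) \<cdot> path (h i) j (nat (j' - j))" for j i j' i'
    by (simp add: T_def)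
  have pH: "arr (path (h i) j k) (dm (h i j)) (dm (h i (j + int k)))" for i j k
    using arr_path[of "h i"] h1 by blast
  have pV: "arr (path (?V j) i k) (dm (h i j)) (dm (h (i + int k) j))" for i j k
    using arr_path[of "?V j" i k] vd by simp
  have aH: "path (h i) (j + int k) l \<cdot> path (h i) j k = path (h i) j (k + l)" for i j k l
    using path_add[of "h i"] h1 by blast
  have aV: "path (?V j) (i + int k) l \<cdot> path (?V j) i k = path (?V j) i (k + l)" for i j k l
    using path_add[of "?V j" i k l] vd by simp
  have lH: "arr (path (h i) j k) (dm (v i j)) (dm (v i (j + int k)))" for i j k
    using pH[of i j k] vd by simp
  have swap: "path (h (i + int l)) j k \<cdot> path (?V j) i l = path (?V (j + int k)) i l \<cdot> path (h i) j k" for i j k l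
  proof -
    have "path (h (i + 1)) j k \<cdot> v i j = v i (j + int k) \<cdot> path (h i) j k" for i
      using path_link[of "v i" "h i" "h (i + 1)" j k] v1 v2 by simp
    from path_link[of "\<lambda>i. path (h i) j k" "?V j" "?V (j + int k)" i l, OF lH this]
    show ?thesis .
  qed
  have sq: "wpb (path (h i) j k) (path (?V j) i l) (path (?V (j + int k)) i l) (path (h (i + int l)) j k)"
    if "i + int l \<le> j" "j + int k \<le> i + N" for i j k l
  proof -
    have "wpb (path (?V j) i l) (path (h i) j k) (path (h (i + int l)) j k) (path (?V (j + int k)) i l)"
    proof (rule path_wpb[of "\<lambda>i. path (h i) j k" "?V j" "?V (j + int k)"])
      show "arr (path (h i) j k) (dm (v i j)) (dm (v i (j + int k)))" for i by (rule lH)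
      show "wpb (v (i + int m) j) (path (h (i + int m)) j k) (path (h (i + int m + 1)) j k) (v (i + int m) (j + int k))"
        if "m < l" for m
        by (rule wpb_sym, rule path_wpb[OF v1], rule v3)
          (use that \<open>i + int l \<le> j\<close> \<open>j + int k \<le> i + N\<close> in auto)
    qed
    then show ?thesis by (rule wpb_sym)
  qed
  have To: "T x x = dm (h (snd x) (fst x))" for x
    using h1 vd[of "snd x" "fst x"] by (simp add: T_def id_cmp)
  have Ta: "arr (T x y) (T x x) (T y y)" if "zle x y" for x y
  proof -
    have "fst x + int (nat (fst y - fst x)) = fst y" "snd x + int (nat (snd y - snd x)) = snd y"
      using that by (auto simp: zle_def)
    then show ?thesis
      unfolding To using arr_cmp[OF pH[of "snd x" "fst x" "nat (fst y - fst x)"], of "path (?V (fst y)) (snd x) (nat (snd y - snd x))"]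
        pV[of "fst y" "snd x" "nat (snd y - snd x)"] by (simp add: T_def)
  qed
  have "fnc (zst N) zle T"
    unfolding fnc_def
  proof (intro conjI ballI impI)
    fix x show "obj (T x x)" unfolding To using h1 by simp
  next
    fix x y assume "zle x y" then show "arr (T x y) (T x x) (T y y)" by (rule Ta)
  next
    fix x y z assume xyz: "zle x y" "zle y z"
    define a where "a = nat (fst y - fst x)" define b where "b = nat (snd y - snd x)"
    define c where "c = nat (fst z - fst y)" define d where "d = nat (snd z - snd y)"
    have e: "fst y = fst x + int a" "snd y = snd x + int b" "fst z = fst x + int a + int c" "snd z = snd x + int b + int d"
      using xyz by (auto simp: zle_def a_def b_def c_def d_def)
    let ?j = "fst x" and ?i = "snd x"
    have xz: "T x z = path (?V (fst z)) ?i (b + d) \<cdot> path (h ?i) ?j (a + c)"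
      using e by (simp add: T_def nat_add_distrib flip: of_nat_add) 
    have "T y z \<cdot> T x y = path (?V (fst z)) (?i + int b) d \<cdot> (path (h (?i + int b)) (?j + int a) c \<cdot> path (?V (?j + int a)) ?i b) \<cdot> path (h ?i) ?j a"
      by (simp add: T_def e cmp_assoc)
    also have "\<dots> = (path (?V (fst z)) (?i + int b) d \<cdot> path (?V (fst z)) ?i b) \<cdot> path (h ?i) (?j + int a) c \<cdot> path (h ?i) ?j a"
      unfolding swap by (simp add: e cmp_assoc)
    also have "\<dots> = T x z" unfolding aH aV xz ..
    finally show "T y z \<cdot> T x y = T x z" .
  qed
  moreover have "wpb (T (c, a) (d, a)) (T (c, a) (c, b)) (T (d, a) (d, b)) (T (c, b) (d, b))"
    if "a \<le> b" "b \<le> c" "c \<le> d" "d \<le> a + N" for a b c d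
  proof -
    have e: "a + int (nat (b - a)) = b" "c + int (nat (d - c)) = d" using that by auto
    have H: "T (c, i) (d, i) = path (h i) c (nat (d - c))" for i
      using arrD[OF pH[of i c "nat (d - c)"]] vd[of i d] e by (simp add: Tp id_cmp)
    have V: "T (j, a) (j, b) = path (?V j) a (nat (b - a))" for j
      using arrD[OF pV[of j a "nat (b - a)"]] e by (simp add: Tp cmp_id)
    show ?thesis unfolding H V using sq[of a "nat (b - a)" c "nat (d - c)"] that e by simp
  qed
  moreover have "zobj (T (i, i) (i, i))" "zobj (T (i + N, i) (i + N, i))" for i
    unfolding To using h2 by simp_all
  ultimately have "plus N T" unfolding plus_def by blast
  moreover have "T (j, 0) (j', 0) = path h0 j (nat (j' - j))" if "j \<le> j'" for j j'
    using arrD[OF pH[of 0 j "nat (j' - j)"]] vd[of 0 j'] that h0' by (simp add: Tp id_cmp)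
  ultimately show ?thesis by blast
qed

text \<open>
  The consecutive arrows of \<open>A\<close>, with zero objects at both ends, form a row that is
  extended to a grid. As \<open>A\<close> is a functor, its arrows are the composites of the
  consecutive ones.
\<close>

lemma plus_extends:
  assumes N: "N \<ge> 1" and A: "fnc {1..N - 1} (\<le>) A"
  shows "\<exists>X. plus N X \<and> (\<forall>i j. 1 \<le> i \<and> i \<le> j \<and> j \<le> N - 1 \<longrightarrow> X (i, 0) (j, 0) = A i j)"
proof -
  obtain Z where Z: "zobj Z" using zobj_exists by blast
  define O' where "O' j = (if 1 \<le> j \<and> j \<le> N - 1 then A j j else Z)" for j
  have O': "obj (O' j)" for j using fncD(1)[OF A] zobj_obj[OF Z] by (simp add: O'_def)
  define h where "h j = (if 1 \<le> j \<and> j + 1 \<le> N - 1 then A j (j + 1) else zer (O' j) (O' (j + 1)))" for j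
  have h: "arr (h j) (O' j) (O' (j + 1))" for j
  proof (cases "1 \<le> j \<and> j + 1 \<le> N - 1")
    case True
    then have "O' j = A j j" "O' (j + 1) = A (j + 1) (j + 1)" "h j = A j (j + 1)"
      by (simp_all add: O'_def h_def)
    then show ?thesis using fncD(2)[OF A, of j "j + 1"] True by simp
  next
    case False
    then have "h j = zer (O' j) (O' (j + 1))" unfolding h_def by (rule if_not_P)
    then show ?thesis using arr_zer[OF O' O'] by simp
  qed
  have "seq_row N 0 h"
    unfolding seq_row_def using arrD[OF h] Z by (auto simp: O'_def)
  then obtain X where X: "plus N X" "\<And>j j'. j \<le> j' \<Longrightarrow> X (j, 0) (j', 0) = path h j (nat (j' - j))"
    using plus_from_row[OF N] by blast
  have p: "path h i k = A i (i + int k)" if "1 \<le> i" "i + int k \<le> N - 1" for i k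
    using that
  proof (induction k)
    case 0
    then show ?case using arrD[OF h[of i]] by (simp add: O'_def)
  next
    case (Suc k)
    then have "path h i (Suc k) = A (i + int k) (i + int k + 1) \<cdot> A i (i + int k)"
      using h_def[of "i + int k"] by simp
    also have "\<dots> = A i (i + int k + 1)" by (rule fncD(3)[OF A]) (use Suc.prems in auto)
    finally show ?case by (simp add: algebra_simps)
  qed
  have "X (i, 0) (j, 0) = A i j" if "1 \<le> i" "i \<le> j" "j \<le> N - 1" for i j
    using X(2)[of i j] p[of i "nat (j - i)"] that by simp
  then show ?thesis using X(1) by blast
qed

end

section \<open>Sums of rectangles\<close>

context additive_arrows
begin

lemma biprod_codecomp:
  assumes "biprod X Y P i j p q" "ok f" "dm f = P" shows "f = (f \<cdot> i) \<cdot> p \<boxplus> (f \<cdot> j) \<cdot> q"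
proof -
  have "f \<cdot> (i \<cdot> p \<boxplus> j \<cdot> q) = f" using assms by (simp add: biprod_def cmp_id)
  then show ?thesis by (simp add: cmp_add cmp_assoc)
qed

lemma biprod_cmp:
  assumes "biprod X Y P i j p q" "arr a T X" "arr b T Y" "arr c X S" "arr d Y S"
  shows "(c \<cdot> p \<boxplus> d \<cdot> q) \<cdot> (i \<cdot> a \<boxplus> j \<cdot> b) = c \<cdot> a \<boxplus> d \<cdot> b"
  using biprod_in(2,3)[OF assms(1-3)] by (simp add: add_cmp cmp_assoc)

text \<open>
  A finite direct sum. Its universal properties on both sides are part of the definition, so that
  arrows are compared summand by summand and no sums of families of arrows are formed.
\<close>

definition bsum :: "'k set \<Rightarrow> ('k \<Rightarrow> 'a) \<Rightarrow> 'a \<Rightarrow> ('k \<Rightarrow> 'a) \<Rightarrow> ('k \<Rightarrow> 'a) \<Rightarrow> bool"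
  where "bsum F A P i p \<longleftrightarrow> obj P \<and>
    (\<forall>k\<in>F. arr (i k) (A k) P \<and> arr (p k) P (A k)) \<and>
    (\<forall>k\<in>F. \<forall>l\<in>F. p k \<cdot> i l = (if k = l then A k else zer (A l) (A k))) \<and>
    (\<forall>T f g. arr f T P \<and> arr g T P \<and> (\<forall>k\<in>F. p k \<cdot> f = p k \<cdot> g) \<longrightarrow> f = g) \<and>
    (\<forall>T f g. arr f P T \<and> arr g P T \<and> (\<forall>k\<in>F. f \<cdot> i k = g \<cdot> i k) \<longrightarrow> f = g) \<and>
    (\<forall>T \<phi>. obj T \<and> (\<forall>k\<in>F. arr (\<phi> k) T (A k)) \<longrightarrow> (\<exists>f. arr f T P \<and> (\<forall>k\<in>F. p k \<cdot> f = \<phi> k))) \<and>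
    (\<forall>T \<phi>. obj T \<and> (\<forall>k\<in>F. arr (\<phi> k) (A k) T) \<longrightarrow> (\<exists>f. arr f P T \<and> (\<forall>k\<in>F. f \<cdot> i k = \<phi> k)))"

lemma bsumD:
  assumes "bsum F A P i p"
  shows "obj P" "k \<in> F \<Longrightarrow> arr (i k) (A k) P" "k \<in> F \<Longrightarrow> arr (p k) P (A k)"
    "k \<in> F \<Longrightarrow> p k \<cdot> i k = A k" "k \<in> F \<Longrightarrow> l \<in> F \<Longrightarrow> k \<noteq> l \<Longrightarrow> p k \<cdot> i l = zer (A l) (A k)"
    "arr f T P \<Longrightarrow> arr g T P \<Longrightarrow> (\<And>k. k \<in> F \<Longrightarrow> p k \<cdot> f = p k \<cdot> g) \<Longrightarrow> f = g"
    "arr f P T \<Longrightarrow> arr g P T \<Longrightarrow> (\<And>k. k \<in> F \<Longrightarrow> f \<cdot> i k = g \<cdot> i k) \<Longrightarrow> f = g"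
    "obj T \<Longrightarrow> (\<And>k. k \<in> F \<Longrightarrow> arr (\<phi> k) T (A k)) \<Longrightarrow> \<exists>f. arr f T P \<and> (\<forall>k\<in>F. p k \<cdot> f = \<phi> k)"
    "obj T \<Longrightarrow> (\<And>k. k \<in> F \<Longrightarrow> arr (\<phi> k) (A k) T) \<Longrightarrow> \<exists>f. arr f P T \<and> (\<forall>k\<in>F. f \<cdot> i k = \<phi> k)"
proof -
  note a = assms[unfolded bsum_def]
  note c1 = conjunct1[OF a] and r1 = conjunct2[OF a]
  note c2 = conjunct1[OF r1] and r2 = conjunct2[OF r1]
  note c3 = conjunct1[OF r2] and r3 = conjunct2[OF r2]
  note c4 = conjunct1[OF r3] and r4 = conjunct2[OF r3]
  note c5 = conjunct1[OF r4] and r5 = conjunct2[OF r4]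
  note c6 = conjunct1[OF r5] and c7 = conjunct2[OF r5]
  show "obj P" by (rule c1)
  show "arr (i k) (A k) P" "arr (p k) P (A k)" if "k \<in> F" using c2 that by simp_all
  show "p k \<cdot> i k = A k" if "k \<in> F" using c3 that by simp
  show "p k \<cdot> i l = zer (A l) (A k)" if "k \<in> F" "l \<in> F" "k \<noteq> l" using c3 that by simp
  show "f = g" if "arr f T P" "arr g T P" "\<And>k. k \<in> F \<Longrightarrow> p k \<cdot> f = p k \<cdot> g"
    using c4[rule_format, of f T g] that by blast
  show "f = g" if "arr f P T" "arr g P T" "\<And>k. k \<in> F \<Longrightarrow> f \<cdot> i k = g \<cdot> i k"
    using c5[rule_format, of f T g] that by blast
  show "\<exists>f. arr f T P \<and> (\<forall>k\<in>F. p k \<cdot> f = \<phi> k)" if "obj T" "\<And>k. k \<in> F \<Longrightarrow> arr (\<phi> k) T (A k)"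
    using c6[rule_format, of T \<phi>] that by blast
  show "\<exists>f. arr f P T \<and> (\<forall>k\<in>F. f \<cdot> i k = \<phi> k)" if "obj T" "\<And>k. k \<in> F \<Longrightarrow> arr (\<phi> k) (A k) T"
    using c7[rule_format, of T \<phi>] that by blast
qed

lemma bsum_empty_zobj: assumes "bsum {} A P i p" shows "zobj P"
proof -
  have "P = zer P P"
    using bsumD(6)[OF assms arr_id[OF bsumD(1)[OF assms]] arr_zer[OF bsumD(1)[OF assms] bsumD(1)[OF assms]]] by simp
  then show ?thesis using isz_zer[of P P] bsumD(1)[OF assms] by (simp add: zobj_def)
qed

end

context weakly_abelian_arrows
begin

lemma bsum_exists:
  assumes "finite F" "\<And>k. k \<in> F \<Longrightarrow> obj (A k)"
  shows "\<exists>P i p. bsum F A P i p"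
  using assms
proof (induction F rule: finite_induct)
  case empty
  obtain Z where Z: "zobj Z" using zobj_exists by blast
  have "f = g" if "arr f T Z \<and> arr g T Z" for f g T
    using isz_to_zobj[OF Z] isz_eq that unfolding arr_def by metis
  moreover have "f = g" if "arr f Z T \<and> arr g Z T" for f g T
    using isz_from_zobj[OF Z] isz_eq that unfolding arr_def by metis
  moreover have "\<exists>f. arr f T Z" "\<exists>f. arr f Z T" if "obj T" for T
    using arr_zer[OF that zobj_obj[OF Z]] arr_zer[OF zobj_obj[OF Z] that] by blast+
  ultimately have "bsum {} A Z (\<lambda>k. Z) (\<lambda>k. Z)"
    unfolding bsum_def using zobj_obj[OF Z] by auto
  then show ?case by blast
next
  case (insert a F)
  then obtain P0 i0 p0 where "bsum F A P0 i0 p0" by auto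
  note B = bsumD[OF this]
  have oa: "obj (A a)" using insert.prems by simp
  obtain P i j p q where P: "biprod (A a) P0 P i j p q" using biprod_exists[OF oa B(1)] by blast
  note P' = P[unfolded biprod_def]
  define ii where "ii k = (if k = a then i else j \<cdot> i0 k)" for k
  define pp where "pp k = (if k = a then p else p0 k \<cdot> q)" for k
  have oA: "obj (A k)" if "k \<in> insert a F" for k using insert.prems that by blast
  have ia: "ii a = i" "pp a = p" by (simp_all add: ii_def pp_def)
  have iF: "ii k = j \<cdot> i0 k" "pp k = p0 k \<cdot> q" if "k \<in> F" for k
    using that insert.hyps by (auto simp: ii_def pp_def)
  have t: "arr (ii k) (A k) P \<and> arr (pp k) P (A k)" if "k \<in> insert a F" for k
  proof (cases "k = a")
    case True
    then show ?thesis using P' by (simp only: ia)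
  next
    case False
    then have k: "k \<in> F" using that by simp
    show ?thesis
      using arr_cmp[OF B(2)[OF k], of j P] arr_cmp[of q P P0, OF _ B(3)[OF k]] P' unfolding iF[OF k] by blast
  qed
  have d: "pp k \<cdot> ii l = (if k = l then A k else zer (A l) (A k))" if kl: "k \<in> insert a F" "l \<in> insert a F" for k l
  proof -
    consider "k = a" "l = a" | "k = a" "l \<in> F" | "k \<in> F" "l = a" | "k \<in> F" "l \<in> F" using kl by blast
    then show ?thesis
    proof cases
      case 1 then show ?thesis using P' by (simp add: ia)
    next
      case 2
      have "pp k \<cdot> ii l = zer P0 (A a) \<cdot> i0 l" using 2 P' by (simp add: ia iF flip: cmp_assoc)
      also have "\<dots> = zer (A l) (A a)" using arrD[OF B(2)[OF 2(2)]] oa by (simp add: zer_cmp)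
      finally show ?thesis using 2 insert.hyps by auto
    next
      case 3
      have "pp k \<cdot> ii l = p0 k \<cdot> zer (A a) P0" using 3 P' by (simp add: ia iF cmp_assoc)
      also have "\<dots> = zer (A a) (A k)" using arrD[OF B(3)[OF 3(1)]] oa by (simp add: cmp_zer)
      finally show ?thesis using 3 insert.hyps by auto
    next
      case 4
      have "pp k \<cdot> ii l = p0 k \<cdot> (q \<cdot> j) \<cdot> i0 l" using 4 by (simp add: iF cmp_assoc)
      also have "\<dots> = p0 k \<cdot> i0 l" using P' arrD[OF B(2)[OF 4(2)]] by (simp add: id_cmp)
      finally show ?thesis using 4 B(4,5) by auto
    qed
  qed
  have m: "f = g" if fg: "arr f T P" "arr g T P" "\<And>k. k \<in> insert a F \<Longrightarrow> pp k \<cdot> f = pp k \<cdot> g" for f g T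
  proof -
    have "arr (q \<cdot> f) T P0" "arr (q \<cdot> g) T P0" using fg P' arr_cmp by blast+
    moreover have "p0 k \<cdot> q \<cdot> f = p0 k \<cdot> q \<cdot> g" if "k \<in> F" for k
      using fg(3)[of k] that by (simp add: iF cmp_assoc)
    ultimately have "q \<cdot> f = q \<cdot> g" by (rule B(6))
    moreover have "p \<cdot> f = p \<cdot> g" using fg(3)[of a] by (simp add: ia)
    ultimately show ?thesis
      using biprod_decomp[OF P arrD(1,3)[OF fg(1)]] biprod_decomp[OF P arrD(1,3)[OF fg(2)]] by simp
  qed
  have e: "f = g" if fg: "arr f P T" "arr g P T" "\<And>k. k \<in> insert a F \<Longrightarrow> f \<cdot> ii k = g \<cdot> ii k" for f g T
  proof -
    have "arr (f \<cdot> j) P0 T" "arr (g \<cdot> j) P0 T" using fg P' arr_cmp by blast+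
    moreover have "(f \<cdot> j) \<cdot> i0 k = (g \<cdot> j) \<cdot> i0 k" if "k \<in> F" for k
      using fg(3)[of k] that by (simp add: iF cmp_assoc)
    ultimately have "f \<cdot> j = g \<cdot> j" by (rule B(7))
    moreover have "f \<cdot> i = g \<cdot> i" using fg(3)[of a] by (simp add: ia)
    ultimately show ?thesis
      using biprod_codecomp[OF P arrD(1,2)[OF fg(1)]] biprod_codecomp[OF P arrD(1,2)[OF fg(2)]] by simp
  qed
  have f: "\<exists>f. arr f T P \<and> (\<forall>k\<in>insert a F. pp k \<cdot> f = \<phi> k)"
    if T: "obj T" "\<And>k. k \<in> insert a F \<Longrightarrow> arr (\<phi> k) T (A k)" for T \<phi>
  proof -
    obtain f0 where f0: "arr f0 T P0" "\<And>k. k \<in> F \<Longrightarrow> p0 k \<cdot> f0 = \<phi> k" using B(8)[of T \<phi>] T by blast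
    have fa: "arr (\<phi> a) T (A a)" using T by blast
    note I = biprod_in[OF P fa f0(1)]
    have "pp k \<cdot> (i \<cdot> \<phi> a \<boxplus> j \<cdot> f0) = \<phi> k" if "k \<in> insert a F" for k
      using that I(2,3) f0(2) by (cases "k = a") (auto simp: ia iF cmp_assoc)
    then show ?thesis using I(1) by blast
  qed
  have g: "\<exists>f. arr f P T \<and> (\<forall>k\<in>insert a F. f \<cdot> ii k = \<phi> k)"
    if T: "obj T" "\<And>k. k \<in> insert a F \<Longrightarrow> arr (\<phi> k) (A k) T" for T \<phi>
  proof -
    obtain f0 where f0: "arr f0 P0 T" "\<And>k. k \<in> F \<Longrightarrow> f0 \<cdot> i0 k = \<phi> k" using B(9)[of T \<phi>] T by blast
    have fa: "arr (\<phi> a) (A a) T" using T by blast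
    note I = biprod_out[OF P fa f0(1)]
    have "(\<phi> a \<cdot> p \<boxplus> f0 \<cdot> q) \<cdot> ii k = \<phi> k" if "k \<in> insert a F" for k
    proof (cases "k = a")
      case True then show ?thesis using I(2) by (simp add: ia)
    next
      case False
      then have k: "k \<in> F" using that by simp
      have "(\<phi> a \<cdot> p \<boxplus> f0 \<cdot> q) \<cdot> ii k = ((\<phi> a \<cdot> p \<boxplus> f0 \<cdot> q) \<cdot> j) \<cdot> i0 k"
        unfolding iF[OF k] cmp_assoc ..
      then show ?thesis unfolding I(3) using f0(2)[OF k] by simp
    qed
    then show ?thesis using I(1) by blast
  qed
  have "obj P" using biprod_objs[OF P] by blast
  then have "bsum (insert a F) A P ii pp"
    unfolding bsum_def
  proof (intro conjI allI ballI impI)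
    show "arr (ii k) (A k) P" "arr (pp k) P (A k)" if "k \<in> insert a F" for k using t[OF that] by blast+
    show "pp k \<cdot> ii l = (if k = l then A k else zer (A l) (A k))" if "k \<in> insert a F" "l \<in> insert a F" for k l
      using d[OF that] .
    show "f = g" if "arr f T P \<and> arr g T P \<and> (\<forall>k\<in>insert a F. pp k \<cdot> f = pp k \<cdot> g)" for T f g
      by (rule m[of f T g]) (use that in blast)+
    show "f = g" if "arr f P T \<and> arr g P T \<and> (\<forall>k\<in>insert a F. f \<cdot> ii k = g \<cdot> ii k)" for T f g
      by (rule e[of f T g]) (use that in blast)+
    show "\<exists>f. arr f T P \<and> (\<forall>k\<in>insert a F. pp k \<cdot> f = \<phi> k)"
      if "obj T \<and> (\<forall>k\<in>insert a F. arr (\<phi> k) T (A k))" for T \<phi>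
      by (rule f[of T \<phi>]) (use that in blast)+
    show "\<exists>f. arr f P T \<and> (\<forall>k\<in>insert a F. f \<cdot> ii k = \<phi> k)"
      if "obj T \<and> (\<forall>k\<in>insert a F. arr (\<phi> k) (A k) T)" for T \<phi>
      by (rule g[of T \<phi>]) (use that in blast)+
  qed
  then show ?case by blast
qed

text \<open>
  The object at \<open>x\<close> is the sum of the \<open>A k\<close> with
  \<open>k \<in> K x\<close>, and a transition is the identity on common summands. A summand that
  occurs at \<open>x\<close> and at \<open>z\<close> also occurs in between, by convexity, and so a
  composite of transitions is the identity on all the summands that \<open>x\<close> and
  \<open>z\<close> share.
\<close>

lemma support_diagram:
  assumes fin: "\<And>x. x \<in> D \<Longrightarrow> finite (K x)" and A: "\<And>k. obj (A k)"
    and convex: "\<And>x y z. \<lbrakk>x \<in> D; y \<in> D; z \<in> D; lq x y; lq y z\<rbrakk> \<Longrightarrow> K x \<inter> K z \<subseteq> K y"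
  shows "\<exists>B i p. fnc D lq B \<and> (\<forall>x\<in>D. bsum (K x) A (B x x) (i x) (p x)) \<and>
    (\<forall>x\<in>D. \<forall>y\<in>D. lq x y \<longrightarrow> (\<forall>k\<in>K y. p y k \<cdot> B x y = (if k \<in> K x then p x k else zer (B x x) (A k))) \<and>
      (\<forall>k\<in>K x. B x y \<cdot> i x k = (if k \<in> K y then i y k else zer (A k) (B y y))))"
proof -
  have "\<exists>P i p. bsum (K x) A P i p" if "x \<in> D" for x using bsum_exists[OF fin[OF that], of A] A by blast
  then obtain P i p where P: "\<And>x. x \<in> D \<Longrightarrow> bsum (K x) A (P x) (i x) (p x)" by metis
  note B = bsumD[OF P]
  have "\<exists>f. arr f (P x) (P y) \<and> (\<forall>k\<in>K y. p y k \<cdot> f = (if k \<in> K x then p x k else zer (P x) (A k)))"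
    if "x \<in> D" "y \<in> D" for x y
    using B(8)[OF that(2) B(1)[OF that(1)], of "\<lambda>k. if k \<in> K x then p x k else zer (P x) (A k)"]
      B(3)[OF that(1)] arr_zer[OF B(1)[OF that(1)] A] by simp
  then have "\<forall>x y. \<exists>f. x \<in> D \<and> y \<in> D \<longrightarrow> arr f (P x) (P y) \<and>
    (\<forall>k\<in>K y. p y k \<cdot> f = (if k \<in> K x then p x k else zer (P x) (A k)))" by blast
  then obtain T where T: "\<And>x y. x \<in> D \<Longrightarrow> y \<in> D \<Longrightarrow> arr (T x y) (P x) (P y)"
    "\<And>x y k. x \<in> D \<Longrightarrow> y \<in> D \<Longrightarrow> k \<in> K y \<Longrightarrow> p y k \<cdot> T x y = (if k \<in> K x then p x k else zer (P x) (A k))"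
    by metis
  have Tid: "T x x = P x" if "x \<in> D" for x
  proof (rule B(6)[OF that T(1)[OF that that] arr_id[OF B(1)[OF that]]])
    fix k assume k: "k \<in> K x"
    show "p x k \<cdot> T x x = p x k \<cdot> P x" using T(2)[OF that that k] k arrD[OF B(3)[OF that k]] by (simp add: cmp_id)
  qed
  have Tc: "T y z \<cdot> T x y = T x z" if D: "x \<in> D" "y \<in> D" "z \<in> D" "lq x y" "lq y z" for x y z
  proof (rule B(6)[OF D(3) arr_cmp[OF T(1)[OF D(1,2)] T(1)[OF D(2,3)]] T(1)[OF D(1,3)]])
    fix k assume k: "k \<in> K z"
    have "p z k \<cdot> T y z \<cdot> T x y = (if k \<in> K y then p y k \<cdot> T x y else zer (P y) (A k) \<cdot> T x y)"
      using T(2)[OF D(2,3) k] by (simp flip: cmp_assoc)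
    also have "\<dots> = (if k \<in> K x then p x k else zer (P x) (A k))"
      using convex[OF D] T(2)[OF D(1,2)] arrD[OF T(1)[OF D(1,2)]] A k by (auto simp: zer_cmp)
    also have "\<dots> = p z k \<cdot> T x z" using T(2)[OF D(1,3) k] by simp
    finally show "p z k \<cdot> T y z \<cdot> T x y = p z k \<cdot> T x z" .
  qed
  have Ti: "T x y \<cdot> i x k = (if k \<in> K y then i y k else zer (A k) (P y))" if D: "x \<in> D" "y \<in> D" "k \<in> K x" for x y k
  proof (rule B(6)[OF D(2)])
    show "arr (T x y \<cdot> i x k) (A k) (P y)" using arr_cmp[OF B(2)[OF D(1,3)] T(1)[OF D(1,2)]] .
    show "arr (if k \<in> K y then i y k else zer (A k) (P y)) (A k) (P y)"
      using B(2)[OF D(2)] arr_zer[OF A B(1)[OF D(2)]] by simp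
    fix l assume l: "l \<in> K y"
    have "p y l \<cdot> T x y \<cdot> i x k = (if l \<in> K x then p x l \<cdot> i x k else zer (P x) (A l) \<cdot> i x k)"
      using T(2)[OF D(1,2) l] by (simp flip: cmp_assoc)
    also have "\<dots> = (if l = k then A k else zer (A k) (A l))"
      using B(4,5)[OF D(1)] arrD[OF B(2)[OF D(1,3)]] D(3) A by (auto simp: zer_cmp)
    also have "\<dots> = p y l \<cdot> (if k \<in> K y then i y k else zer (A k) (P y))"
      using B(4,5)[OF D(2)] l arrD[OF B(3)[OF D(2) l]] A by (auto simp: cmp_zer)
    finally show "p y l \<cdot> T x y \<cdot> i x k = p y l \<cdot> (if k \<in> K y then i y k else zer (A k) (P y))" .
  qed
  have "fnc D lq T" unfolding fnc_def using Tid Tc T(1) B(1) by simp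
  then show ?thesis using Tid Ti T(2) P by (intro exI[of _ T] exI[of _ i] exI[of _ p]) simp
qed

text \<open>
  The arrow is the projection to the common summands followed by their inclusion. Its transpose is a
  quasi-inverse.
\<close>

lemma support_regular:
  assumes "bsum (F) A P i p" "bsum (G) A Q j q" "arr f P Q"
    and f: "\<And>k. k \<in> G \<Longrightarrow> q k \<cdot> f = (if k \<in> F then p k else zer P (A k))" and A: "\<And>k. obj (A k)"
  shows "regular f"
proof -
  note X = bsumD[OF assms(1)] and Y = bsumD[OF assms(2)]
  have "arr (if k \<in> G then q k else zer Q (A k)) Q (A k)" for k
    using Y(3) arr_zer[OF Y(1) A] by simp
  from X(8)[OF Y(1) this]
  obtain g where g: "arr g Q P" "\<And>k. k \<in> F \<Longrightarrow> p k \<cdot> g = (if k \<in> G then q k else zer Q (A k))" by blast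
  have t: "arr (f \<cdot> g \<cdot> f) P Q" using arr_cmp[OF arr_cmp[OF assms(3) g(1)] assms(3)] .
  have "f \<cdot> g \<cdot> f = f"
  proof (rule Y(6)[OF t assms(3)])
    fix k assume k: "k \<in> G"
    show "q k \<cdot> f \<cdot> g \<cdot> f = q k \<cdot> f"
    proof (cases "k \<in> F")
      case True
      have "q k \<cdot> f \<cdot> g \<cdot> f = (p k \<cdot> g) \<cdot> f" using f[OF k] True by (simp flip: cmp_assoc)
      then show ?thesis using g(2)[OF True] k by simp
    next
      case False
      have "q k \<cdot> f \<cdot> g \<cdot> f = zer P (A k) \<cdot> g \<cdot> f" using f[OF k] False by (simp flip: cmp_assoc)
      then show ?thesis using f[OF k] False arrD[OF arr_cmp[OF assms(3) g(1)]] A by (simp add: zer_cmp)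
    qed
  qed
  then show ?thesis unfolding regular_def using arrD(1)[OF assms(3)] by blast
qed

text \<open>
  The inclusions say that the square is a sum of squares, one for each \<open>k\<close>, that have
  \<open>A k\<close> at all four corners, at two adjacent ones, only at \<open>u\<close>, or only at
  \<open>z\<close>, and zero elsewhere. These are weak pullbacks.
\<close>

lemma support_wpb:
  assumes fnc: "fnc D lq B" and D: "u \<in> D" "v \<in> D" "w \<in> D" "z \<in> D" "lq u v" "lq u w" "lq v z" "lq w z"
    and bs: "\<And>x. x \<in> D \<Longrightarrow> bsum (K x) A (B x x) (i x) (p x)" and A: "\<And>k. obj (A k)"
    and pB: "\<And>x y k. \<lbrakk>x \<in> D; y \<in> D; lq x y; k \<in> K y\<rbrakk> \<Longrightarrow> p y k \<cdot> B x y = (if k \<in> K x then p x k else zer (B x x) (A k))"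
    and K1: "K v - K u \<subseteq> K z - K w" and K2: "K w - K u \<subseteq> K z - K v" and K3: "K u \<inter> K v \<inter> K w \<subseteq> K z"
  shows "wpb (B u v) (B u w) (B v z) (B w z)"
proof -
  note f = fncD[OF fnc]
  have uv: "arr (B u v) (B u u) (B v v)" and uw: "arr (B u w) (B u u) (B w w)"
    and vz: "arr (B v z) (B v v) (B z z)" and wz: "arr (B w z) (B w w) (B z z)" using f(2) D by blast+
  have "\<exists>t. x = B u v \<cdot> t \<and> y = B u w \<cdot> t" if xy: "ok (B v z \<cdot> x)" "B v z \<cdot> x = B w z \<cdot> y" for x y
  proof -
    define T where "T = dm x"
    note e = cmp_eqD[OF xy(2,1)]
    have x: "arr x T (B v v)" and y: "arr y T (B w w)"
      using xy(1) e arrD[OF vz] arrD[OF wz] by (simp_all add: arr_def T_def)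
    have oT: "obj T" using arr_obj[OF x] by blast
    let ?\<phi> = "\<lambda>k. if k \<in> K v then p v k \<cdot> x else if k \<in> K w then p w k \<cdot> y else zer T (A k)"
    have "arr (?\<phi> k) T (A k)" for k
      using arr_cmp[OF x bsumD(3)[OF bs[OF D(2)]], of k] arr_cmp[OF y bsumD(3)[OF bs[OF D(3)]], of k] arr_zer[OF oT A] by simp
    then obtain t where t: "arr t T (B u u)" "\<And>k. k \<in> K u \<Longrightarrow> p u k \<cdot> t = ?\<phi> k"
      using bsumD(8)[OF bs[OF D(1)] oT, of ?\<phi>] by blast
    have pz: "p z k \<cdot> B v z \<cdot> x = p z k \<cdot> B w z \<cdot> y" for k using xy(2) by simp
    have zx: "p z k \<cdot> B v z \<cdot> x = (if k \<in> K v then p v k \<cdot> x else zer T (A k))" if "k \<in> K z" for k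
      using pB[OF D(2,4,7) that] arrD[OF x] A by (simp add: zer_cmp flip: cmp_assoc)
    have zy: "p z k \<cdot> B w z \<cdot> y = (if k \<in> K w then p w k \<cdot> y else zer T (A k))" if "k \<in> K z" for k
      using pB[OF D(3,4,8) that] arrD[OF y] A by (simp add: zer_cmp flip: cmp_assoc)
    have "x = B u v \<cdot> t"
    proof (rule bsumD(6)[OF bs[OF D(2)] x arr_cmp[OF t(1) uv]])
      fix k assume k: "k \<in> K v"
      have "p v k \<cdot> B u v \<cdot> t = (if k \<in> K u then p u k \<cdot> t else zer T (A k))"
        using pB[OF D(1,2,5) k] arrD[OF t(1)] A by (simp add: zer_cmp flip: cmp_assoc)
      also have "\<dots> = p v k \<cdot> x"
      proof (cases "k \<in> K u")
        case True then show ?thesis using t(2)[OF True] k by simp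
      next
        case False
        then have "k \<in> K z" "k \<notin> K w" using K1 k by auto
        then show ?thesis using pz[of k] zx zy k False by simp
      qed
      finally show "p v k \<cdot> x = p v k \<cdot> B u v \<cdot> t" by simp
    qed
    moreover have "y = B u w \<cdot> t"
    proof (rule bsumD(6)[OF bs[OF D(3)] y arr_cmp[OF t(1) uw]])
      fix k assume k: "k \<in> K w"
      have "p w k \<cdot> B u w \<cdot> t = (if k \<in> K u then p u k \<cdot> t else zer T (A k))"
        using pB[OF D(1,3,6) k] arrD[OF t(1)] A by (simp add: zer_cmp flip: cmp_assoc)
      also have "\<dots> = p w k \<cdot> y"
      proof (cases "k \<in> K u")
        case True
        show ?thesis
        proof (cases "k \<in> K v")
          case kv: True
          then have "k \<in> K z" using K3 k True by blast
          then have "p v k \<cdot> x = p w k \<cdot> y" using pz[of k] zx zy k kv by simp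
          then show ?thesis using t(2)[OF True] kv True by simp
        next
          case False
          then show ?thesis using t(2)[OF True] k True by simp
        qed
      next
        case False
        then have "k \<in> K z" "k \<notin> K v" using K2 k by auto
        then show ?thesis using pz[of k] zx zy k False by simp
      qed
      finally show "p w k \<cdot> y = p w k \<cdot> B u w \<cdot> t" by simp
    qed
    ultimately show ?thesis by blast
  qed
  moreover have "ok (B v z \<cdot> B u v)" using arrD[OF arr_cmp[OF uv vz]] by blast
  moreover have "B v z \<cdot> B u v = B w z \<cdot> B u w" using f(3) D by simp
  ultimately show ?thesis unfolding wpb_def by blast
qed

end

subsection \<open>Rectangles in the strip\<close>

text \<open>
  The points from \<open>k\<close> to \<open>top_of N k\<close> form the rectangle of those points
  that can be reached from an inner point \<open>k\<close> without passing through the boundary.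
\<close>

definition inner :: "int \<Rightarrow> int \<times> int \<Rightarrow> bool"
  where "inner N k \<longleftrightarrow> snd k < fst k \<and> fst k < snd k + N"

definition rect :: "int \<Rightarrow> int \<times> int \<Rightarrow> (int \<times> int) set"
  where "rect N k = {x. snd k \<le> snd x \<and> snd x < fst k \<and> fst k \<le> fst x \<and> fst x < snd k + N}"

definition top_of :: "int \<Rightarrow> int \<times> int \<Rightarrow> int \<times> int"
  where "top_of N k = (snd k + N - 1, fst k - 1)"

context additive_arrows
begin

definition split_strip :: "int \<Rightarrow> (int \<times> int \<Rightarrow> int \<times> int \<Rightarrow> 'a) \<Rightarrow> bool"
  where "split_strip N B \<longleftrightarrow> plus N B \<and> (\<forall>x\<in>zst N. \<forall>y\<in>zst N. zle x y \<longrightarrow> regular (B x y))"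

lemma inner_in: assumes "inner N k"
  shows "k \<in> zst N" "top_of N k \<in> zst N" "k \<in> rect N k" "top_of N k \<in> rect N k"
  using assms by (auto simp: inner_def rect_def top_of_def zst_def)

lemma rect_zle: assumes "x \<in> rect N k" shows "zle k x" "zle x (top_of N k)"
  using assms by (auto simp: rect_def top_of_def zle_def)

text \<open>
  An arrow that leaves the rectangle passes through the boundary, where the objects are zero.
\<close>

lemma rect_out:
  assumes Y: "plus N Y" and k: "inner N k" "zle k y" "y \<in> zst N" "y \<notin> rect N k"
  shows "isz (Y k y)"
proof -
  obtain q p j i where e: "k = (q, p)" "y = (j, i)" by (metis surj_pair)
  have "q \<le> i \<or> p + N \<le> j" using k by (auto simp: e rect_def)
  then show ?thesis
  proof
    assume "q \<le> i"
    then show ?thesis unfolding e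
      by (intro isz_between[OF plusD(1)[OF Y], of _ "(q, q)"] plusD(2)[OF Y]) (use k in \<open>auto simp: e inner_def\<close>)
  next
    assume "p + N \<le> j"
    then show ?thesis unfolding e
      by (intro isz_between[OF plusD(1)[OF Y], of _ "(p + N, p)"] plusD(3)[OF Y]) (use k in \<open>auto simp: e inner_def\<close>)
  qed
qed

lemma rect_in:
  assumes X: "plus N X" and k: "inner N k" "zle x (top_of N k)" "x \<in> zst N" "x \<notin> rect N k"
  shows "isz (X x (top_of N k))"
proof -
  obtain q p j i where e: "k = (q, p)" "x = (j, i)" by (metis surj_pair)
  have "i < p \<or> j < q" using k by (auto simp: e rect_def top_of_def)
  then show ?thesis
  proof
    assume "i < p"
    then show ?thesis unfolding e
      by (intro isz_between[OF plusD(1)[OF X], of _ "(i + N, i)"] plusD(3)[OF X]) (use k in \<open>auto simp: e inner_def top_of_def\<close>)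
  next
    assume "j < q"
    then show ?thesis unfolding e
      by (intro isz_between[OF plusD(1)[OF X], of _ "(j, j)"] plusD(2)[OF X]) (use k in \<open>auto simp: e inner_def top_of_def\<close>)
  qed
qed

text \<open>
  On the rectangle of \<open>k\<close> this is the composite of the arrow to the last object of the
  rectangle, of \<open>h\<close>, and of the arrow from the first one. It factors over the diagram
  that is constantly \<open>Y k k\<close> on the rectangle and zero elsewhere.
\<close>

definition contrib :: "int \<Rightarrow> (int \<times> int \<Rightarrow> int \<times> int \<Rightarrow> 'a) \<Rightarrow> (int \<times> int \<Rightarrow> int \<times> int \<Rightarrow> 'a) \<Rightarrow> int \<times> int
    \<Rightarrow> 'a \<Rightarrow> int \<times> int \<Rightarrow> 'a"
  where "contrib N X Y k h x =
    (if x \<in> rect N k then Y k x \<cdot> h \<cdot> X x (top_of N k) else zer (X x x) (Y x x))"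

end

context weakly_abelian_arrows
begin

text \<open>
  Rectangles are convex and avoid the boundary, so that sums of the diagrams that are constant on a
  rectangle and zero elsewhere satisfy all conditions. With the empty family this is a zero diagram.
\<close>

lemma rect_sum:
  assumes N: "N \<ge> 1" and e: "\<And>m. m \<in> M \<Longrightarrow> inner N (e m)" and fin: "\<And>x. x \<in> zst N \<Longrightarrow> finite {m \<in> M. x \<in> rect N (e m)}"
    and A: "\<And>m. obj (A m)"
  shows "\<exists>B i p. split_strip N B \<and> (\<forall>x\<in>zst N. bsum {m \<in> M. x \<in> rect N (e m)} A (B x x) (i x) (p x)) \<and>
    (\<forall>x\<in>zst N. \<forall>y\<in>zst N. zle x y \<longrightarrow>
      (\<forall>k \<in> {m \<in> M. y \<in> rect N (e m)}. p y k \<cdot> B x y = (if k \<in> {m \<in> M. x \<in> rect N (e m)} then p x k else zer (B x x) (A k))) \<and>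
      (\<forall>k \<in> {m \<in> M. x \<in> rect N (e m)}. B x y \<cdot> i x k = (if k \<in> {m \<in> M. y \<in> rect N (e m)} then i y k else zer (A k) (B y y))))"
proof -
  define K where "K x = {m \<in> M. x \<in> rect N (e m)}" for x
  have "K x \<inter> K z \<subseteq> K y" if "zle x y" "zle y z" for x y z
    using that by (auto simp: K_def rect_def zle_def)
  then obtain B i p where B: "fnc (zst N) zle B" "\<And>x. x \<in> zst N \<Longrightarrow> bsum (K x) A (B x x) (i x) (p x)"
    "\<And>x y k. \<lbrakk>x \<in> zst N; y \<in> zst N; zle x y; k \<in> K y\<rbrakk> \<Longrightarrow> p y k \<cdot> B x y = (if k \<in> K x then p x k else zer (B x x) (A k))"
    "\<And>x y k. \<lbrakk>x \<in> zst N; y \<in> zst N; zle x y; k \<in> K x\<rbrakk> \<Longrightarrow> B x y \<cdot> i x k = (if k \<in> K y then i y k else zer (A k) (B y y))"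
    using support_diagram[of "zst N" K A zle] fin A unfolding K_def[symmetric] by blast
  have K0: "K (i, i) = {}" "K (i + N, i) = {}" for i by (auto simp: K_def rect_def)
  have "zobj (B (i, i) (i, i))" "zobj (B (i + N, i) (i + N, i))" for i
    using B(2)[of "(i, i)"] B(2)[of "(i + N, i)"] N unfolding K0 by (auto intro: bsum_empty_zobj)
  moreover have "wpb (B (c, a) (d, a)) (B (c, a) (c, b)) (B (d, a) (d, b)) (B (c, b) (d, b))"
    if "a \<le> b" "b \<le> c" "c \<le> d" "d \<le> a + N" for a b c d
  proof (rule support_wpb[where K = K and A = A and i = i and p = p, OF B(1)])
    show "bsum (K x) A (B x x) (i x) (p x)" if "x \<in> zst N" for x using B(2) that .
    show "p y k \<cdot> B x y = (if k \<in> K x then p x k else zer (B x x) (A k))"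
      if "x \<in> zst N" "y \<in> zst N" "zle x y" "k \<in> K y" for x y k using B(3) that .
    show "K (d, a) - K (c, a) \<subseteq> K (d, b) - K (c, b)" "K (c, b) - K (c, a) \<subseteq> K (d, b) - K (d, a)"
      "K (c, a) \<inter> K (d, a) \<inter> K (c, b) \<subseteq> K (d, b)"
      using that by (auto simp: K_def rect_def)
  qed (use that A in auto)
  ultimately have "plus N B" unfolding plus_def using B(1) by blast
  moreover have "regular (B x y)" if "x \<in> zst N" "y \<in> zst N" "zle x y" for x y
    using support_regular[OF B(2)[OF that(1)] B(2)[OF that(2)] fncD(2)[OF B(1) that] B(3)[OF that] A] .
  ultimately have "split_strip N B" unfolding split_strip_def by blast
  then show ?thesis using B unfolding K_def[symmetric] by blast
qed

text \<open>
  The components are natural because the arrows of \<open>X\<close> to the end of a rectangle vanish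
  outside of it, and so do the arrows of \<open>Y\<close> from its beginning.
\<close>

lemma rect_factor:
  assumes N: "N \<ge> 1" and X: "plus N X" and Y: "plus N Y"
    and e: "\<And>m. m \<in> M \<Longrightarrow> inner N (e m)" and fin: "\<And>x. x \<in> zst N \<Longrightarrow> finite {m \<in> M. x \<in> rect N (e m)}"
    and h: "\<And>m. m \<in> M \<Longrightarrow> arr (h m) (X (top_of N (e m)) (top_of N (e m))) (Y (e m) (e m))"
  shows "\<exists>B u v i p A. split_strip N B \<and> nt (zst N) zle X B u \<and> nt (zst N) zle B Y v \<and>
    (\<forall>x\<in>zst N. bsum {m \<in> M. x \<in> rect N (e m)} A (B x x) (i x) (p x) \<and>
      (\<forall>m. m \<in> M \<and> x \<in> rect N (e m) \<longrightarrow>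
        p x m \<cdot> u x = h m \<cdot> X x (top_of N (e m)) \<and> v x \<cdot> i x m = Y (e m) x))"
proof -
  note fX = fncD[OF plusD(1)[OF X]] and fY = fncD[OF plusD(1)[OF Y]]
  define K where "K x = {m \<in> M. x \<in> rect N (e m)}" for x
  obtain Z where Z: "zobj Z" using zobj_exists by blast
  define A where "A m = (if m \<in> M then Y (e m) (e m) else Z)" for m
  have A: "obj (A m)" for m using e fY(1) inner_in(1) zobj_obj[OF Z] by (auto simp: A_def)
  obtain B i p where s: "split_strip N B" and B: "\<And>x. x \<in> zst N \<Longrightarrow> bsum (K x) A (B x x) (i x) (p x)"
    "\<And>x y k. \<lbrakk>x \<in> zst N; y \<in> zst N; zle x y; k \<in> K y\<rbrakk> \<Longrightarrow> p y k \<cdot> B x y = (if k \<in> K x then p x k else zer (B x x) (A k))"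
    "\<And>x y k. \<lbrakk>x \<in> zst N; y \<in> zst N; zle x y; k \<in> K x\<rbrakk> \<Longrightarrow> B x y \<cdot> i x k = (if k \<in> K y then i y k else zer (A k) (B y y))"
    using rect_sum[of N M e A, OF N e fin A] unfolding K_def[symmetric] by blast
  have fB: "fnc (zst N) zle B" using s plusD(1) unfolding split_strip_def by blast
  have KM: "m \<in> M" "inner N (e m)" "A m = Y (e m) (e m)" "x \<in> rect N (e m)" if "m \<in> K x" for m x
    using that e by (auto simp: K_def A_def)
  have hx: "arr (h m \<cdot> X x (top_of N (e m))) (X x x) (A m)" if "x \<in> zst N" "m \<in> K x" for x m
    using arr_cmp[OF fX(2)[OF that(1) inner_in(2)[OF KM(2)[OF that(2)]] rect_zle(2)[OF KM(4)[OF that(2)]]] h[OF KM(1)[OF that(2)]]]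
    unfolding KM(3)[OF that(2)] .
  have "\<exists>f. arr f (X x x) (B x x) \<and> (\<forall>m\<in>K x. p x m \<cdot> f = h m \<cdot> X x (top_of N (e m)))" if "x \<in> zst N" for x
    using bsumD(8)[OF B(1)[OF that] fX(1)[OF that], of "\<lambda>m. h m \<cdot> X x (top_of N (e m))"] hx[OF that] by blast
  then obtain u where u: "\<And>x. x \<in> zst N \<Longrightarrow> arr (u x) (X x x) (B x x)"
    "\<And>x m. x \<in> zst N \<Longrightarrow> m \<in> K x \<Longrightarrow> p x m \<cdot> u x = h m \<cdot> X x (top_of N (e m))" by metis
  have yx: "arr (Y (e m) x) (A m) (Y x x)" if "x \<in> zst N" "m \<in> K x" for x m
    using fY(2)[OF inner_in(1)[OF KM(2)[OF that(2)]] that(1) rect_zle(1)[OF KM(4)[OF that(2)]]]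
    unfolding KM(3)[OF that(2)] .
  have "\<exists>f. arr f (B x x) (Y x x) \<and> (\<forall>m\<in>K x. f \<cdot> i x m = Y (e m) x)" if "x \<in> zst N" for x
    using bsumD(9)[OF B(1)[OF that] fY(1)[OF that], of "\<lambda>m. Y (e m) x"] yx[OF that] by blast
  then obtain v where v: "\<And>x. x \<in> zst N \<Longrightarrow> arr (v x) (B x x) (Y x x)"
    "\<And>x m. x \<in> zst N \<Longrightarrow> m \<in> K x \<Longrightarrow> v x \<cdot> i x m = Y (e m) x" by metis
  have "u y \<cdot> X x y = B x y \<cdot> u x" if D: "x \<in> zst N" "y \<in> zst N" "zle x y" for x y
  proof (rule bsumD(6)[OF B(1)[OF D(2)] arr_cmp[OF fX(2)[OF D] u(1)[OF D(2)]] arr_cmp[OF u(1)[OF D(1)] fncD(2)[OF fB D]]])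
    fix m assume m: "m \<in> K y"
    let ?t = "top_of N (e m)"
    have t: "?t \<in> zst N" "zle y ?t" using inner_in(2)[OF KM(2)[OF m]] rect_zle(2)[OF KM(4)[OF m]] .
    have hm: "arr (h m) (X ?t ?t) (A m)" using h[OF KM(1)[OF m]] KM(3)[OF m] by simp
    have xt: "zle x ?t" using D(3) t(2) by (auto simp: zle_def)
    have "p y m \<cdot> u y \<cdot> X x y = h m \<cdot> X y ?t \<cdot> X x y" using u(2)[OF D(2) m] by (simp flip: cmp_assoc)
    also have "\<dots> = h m \<cdot> X x ?t" using fX(3)[OF D(1,2) t(1) D(3) t(2)] by simp
    also have "\<dots> = p y m \<cdot> B x y \<cdot> u x"
    proof (cases "m \<in> K x")
      case True
      then show ?thesis using B(2)[OF D m] u(2)[OF D(1)] by (simp flip: cmp_assoc)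
    next
      case False
      then have "x \<notin> rect N (e m)" using KM(1)[OF m] by (simp add: K_def)
      then have z: "isz (X x ?t)" using rect_in[OF X KM(2)[OF m] xt D(1)] by blast
      have hX: "arr (h m \<cdot> X x ?t) (X x x) (A m)" using arr_cmp[OF fX(2)[OF D(1) t(1) xt] hm] .
      have "h m \<cdot> X x ?t = zer (X x x) (A m)" using isz_eqI[OF hX isz_cmp_right[OF z arrD(1)[OF hX]]] .
      moreover have "p y m \<cdot> B x y \<cdot> u x = zer (X x x) (A m)"
        using B(2)[OF D m] False arrD[OF u(1)[OF D(1)]] A by (simp add: zer_cmp flip: cmp_assoc)
      ultimately show ?thesis by simp
    qed
    finally show "p y m \<cdot> u y \<cdot> X x y = p y m \<cdot> B x y \<cdot> u x" .
  qed
  then have ntu: "nt (zst N) zle X B u" unfolding nt_def using u(1) by blast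
  have "v y \<cdot> B x y = Y x y \<cdot> v x" if D: "x \<in> zst N" "y \<in> zst N" "zle x y" for x y
  proof (rule bsumD(7)[OF B(1)[OF D(1)] arr_cmp[OF fncD(2)[OF fB D] v(1)[OF D(2)]] arr_cmp[OF v(1)[OF D(1)] fY(2)[OF D]]])
    fix m assume m: "m \<in> K x"
    have k: "e m \<in> zst N" "zle (e m) x" using inner_in(1)[OF KM(2)[OF m]] rect_zle(1)[OF KM(4)[OF m]] .
    have ky: "zle (e m) y" using D(3) k(2) by (auto simp: zle_def)
    have "(Y x y \<cdot> v x) \<cdot> i x m = Y (e m) y"
      using v(2)[OF D(1) m] fY(3)[OF k(1) D(1,2) k(2) D(3)] by (simp add: cmp_assoc)
    also have "\<dots> = (v y \<cdot> B x y) \<cdot> i x m"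
    proof (cases "m \<in> K y")
      case True
      then show ?thesis using B(3)[OF D m] v(2)[OF D(2)] by (simp add: cmp_assoc)
    next
      case False
      then have "y \<notin> rect N (e m)" using KM(1)[OF m] by (simp add: K_def)
      then have z: "isz (Y (e m) y)" using rect_out[OF Y KM(2)[OF m] ky D(2)] by blast
      have "Y (e m) y = zer (A m) (Y y y)"
        using isz_eqI[OF fY(2)[OF k(1) D(2) ky] z] KM(3)[OF m] by simp
      moreover have "(v y \<cdot> B x y) \<cdot> i x m = zer (A m) (Y y y)"
        using B(3)[OF D m] False arrD[OF v(1)[OF D(2)]] A by (simp add: cmp_zer cmp_assoc)
      ultimately show ?thesis by simp
    qed
    finally show "(v y \<cdot> B x y) \<cdot> i x m = (Y x y \<cdot> v x) \<cdot> i x m" by simp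
  qed
  then have ntv: "nt (zst N) zle B Y v" unfolding nt_def using v(1) by blast
  have "bsum {m \<in> M. x \<in> rect N (e m)} A (B x x) (i x) (p x) \<and>
      (\<forall>m. m \<in> M \<and> x \<in> rect N (e m) \<longrightarrow>
        p x m \<cdot> u x = h m \<cdot> X x (top_of N (e m)) \<and> v x \<cdot> i x m = Y (e m) x)" if "x \<in> zst N" for x
    using B(1)[OF that] u(2)[OF that] v(2)[OF that] unfolding K_def by simp
  then show ?thesis using s ntu ntv by blast
qed

lemma contrib_nt:
  assumes X: "plus N X" and Y: "plus N Y" and k: "inner N k"
    and h: "arr h (X (top_of N k) (top_of N k)) (Y k k)"
  shows "nt (zst N) zle X Y (contrib N X Y k h)"
  unfolding nt_def
proof (intro conjI ballI impI)
  let ?t = "top_of N k"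
  note fX = fncD[OF plusD(1)[OF X]] and fY = fncD[OF plusD(1)[OF Y]] and i = inner_in[OF k]
  have c: "arr (contrib N X Y k h x) (X x x) (Y x x)" if x: "x \<in> zst N" for x
  proof (cases "x \<in> rect N k")
    case True
    note z = rect_zle[OF True]
    have "arr (Y k x \<cdot> h \<cdot> X x ?t) (X x x) (Y x x)"
      using arr_cmp[OF arr_cmp[OF fX(2)[OF x i(2) z(2)] h] fY(2)[OF i(1) x z(1)]] .
    then show ?thesis using True by (simp add: contrib_def)
  next
    case False
    then show ?thesis using arr_zer[OF fX(1)[OF x] fY(1)[OF x]] by (simp add: contrib_def)
  qed
  fix x assume x: "x \<in> zst N"
  show "arr (contrib N X Y k h x) (X x x) (Y x x)" by (rule c[OF x])
  fix y assume y: "y \<in> zst N" and xy: "zle x y"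
  have ax: "arr (X x y) (X x x) (X y y)" and ay: "arr (Y x y) (Y x x) (Y y y)"
    using fX(2)[OF x y xy] fY(2)[OF x y xy] .
  note L = arr_cmp[OF ax c[OF y]] and R = arr_cmp[OF c[OF x] ay]
  have zc: "isz (contrib N X Y k h w)" if "w \<in> zst N" "w \<notin> rect N k" for w
    using isz_zer[OF fX(1)[OF that(1)] fY(1)[OF that(1)]] that(2) by (simp add: contrib_def)
  show "contrib N X Y k h y \<cdot> X x y = Y x y \<cdot> contrib N X Y k h x"
  proof (cases "x \<in> rect N k"; cases "y \<in> rect N k")
    assume r: "x \<in> rect N k" "y \<in> rect N k"
    show ?thesis
      using r fX(3)[OF x y i(2) xy rect_zle(2)[OF r(2)]] fY(3)[OF i(1) x y rect_zle(1)[OF r(1)] xy]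
      by (simp add: contrib_def cmp_assoc) (simp flip: cmp_assoc)
  next
    assume r: "x \<in> rect N k" "y \<notin> rect N k"
    have ky: "zle k y" using rect_zle(1)[OF r(1)] xy by (auto simp: zle_def)
    have "Y x y \<cdot> contrib N X Y k h x = Y k y \<cdot> h \<cdot> X x ?t"
      using r fY(3)[OF i(1) x y rect_zle(1)[OF r(1)] xy] by (simp add: contrib_def flip: cmp_assoc)
    moreover have "isz (Y k y \<cdot> h \<cdot> X x ?t)"
      by (rule isz_cmp_left[OF rect_out[OF Y k ky y r(2)]])
        (use arrD(1)[OF arr_cmp[OF arr_cmp[OF fX(2)[OF x i(2) rect_zle(2)[OF r(1)]] h] fY(2)[OF i(1) y ky]]] in simp)
    ultimately have "isz (Y x y \<cdot> contrib N X Y k h x)" by simp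
    then show ?thesis
      using isz_eqI[OF R] isz_eqI[OF L isz_cmp_left[OF zc[OF y r(2)] arrD(1)[OF L]]] by simp
  next
    assume r: "x \<notin> rect N k" "y \<in> rect N k"
    have xt: "zle x ?t" using rect_zle(2)[OF r(2)] xy by (auto simp: zle_def)
    have "contrib N X Y k h y \<cdot> X x y = (Y k y \<cdot> h) \<cdot> X x ?t"
      using r fX(3)[OF x y i(2) xy rect_zle(2)[OF r(2)]] by (simp add: contrib_def cmp_assoc)
    moreover have "isz ((Y k y \<cdot> h) \<cdot> X x ?t)"
      by (rule isz_cmp_right[OF rect_in[OF X k xt x r(1)]])
        (use arrD(1)[OF arr_cmp[OF fX(2)[OF x i(2) xt] arr_cmp[OF h fY(2)[OF i(1) y rect_zle(1)[OF r(2)]]]]] in simp)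
    ultimately have "isz (contrib N X Y k h y \<cdot> X x y)" by simp
    then show ?thesis
      using isz_eqI[OF L] isz_eqI[OF R isz_cmp_right[OF zc[OF x r(1)] arrD(1)[OF R]]] by simp
  next
    assume r: "x \<notin> rect N k" "y \<notin> rect N k"
    show ?thesis
      using isz_eqI[OF L isz_cmp_left[OF zc[OF y r(2)] arrD(1)[OF L]]]
        isz_eqI[OF R isz_cmp_right[OF zc[OF x r(1)] arrD(1)[OF R]]] by simp
  qed
qed

end

section \<open>Morphisms that vanish on a row\<close>

context additive_arrows
begin

lemma arr_minus_zer: "arr f X Y \<Longrightarrow> isz z \<Longrightarrow> dm z = X \<Longrightarrow> cd z = Y \<Longrightarrow> f \<boxplus> neg z = f"
proof -
  assume f: "arr f X Y" and z: "isz z" "dm z = X" "cd z = Y"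
  have "neg z = z" using neg_unique[of z z] isz_add_self[OF z(1)] z(1) by simp
  then show "f \<boxplus> neg z = f" using add_isz[OF z(1), of f] f z isz_ok[OF z(1)] by (simp add: arr_def)
qed

lemma add_cancel_right: "arr f X Y \<Longrightarrow> arr g X Y \<Longrightarrow> (f \<boxplus> neg g) \<boxplus> g = f"
  by (intro add_neg_cancel) (auto simp: arr_def)

text \<open>
  Step \<open>m\<close> subtracts the component of \<open>v u\<close> along the \<open>m\<close>-th
  summand. If nothing remains in the end, \<open>g 0\<close> is the sum of these components, which is
  \<open>v u\<close>.
\<close>

lemma bsum_telescope:
  assumes B: "bsum F A P i p" and "F \<subseteq> {..<n}" and u: "arr u T P" and v: "arr v P S"
    and g: "\<And>m. arr (g m) T S" "\<And>m. m \<in> F \<Longrightarrow> g (Suc m) = g m \<boxplus> neg (v \<cdot> i m \<cdot> p m \<cdot> u)"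
      "\<And>m. m \<notin> F \<Longrightarrow> g (Suc m) = g m"
    and gn: "isz (g n)" and A: "\<And>k. k \<in> F \<Longrightarrow> obj (A k)"
  shows "g 0 = v \<cdot> u"
proof -
  note b = bsumD[OF B]
  have oT: "obj T" using arr_obj[OF u] by blast
  define \<phi> where "\<phi> k m = (if m < k then p m \<cdot> u else zer T (A m))" for k m :: nat
  have \<phi>: "arr (\<phi> k m) T (A m)" if "m \<in> F" for k m
    using arr_cmp[OF u b(3)[OF that]] arr_zer[OF oT A[OF that]] by (simp add: \<phi>_def)
  have "g 0 = v \<cdot> w \<boxplus> g k" if "arr w T P" "\<And>m. m \<in> F \<Longrightarrow> p m \<cdot> w = \<phi> k m" for k w
    using that
  proof (induction k arbitrary: w)
    case 0
    have "w = zer T P"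
    proof (rule b(6)[OF 0(1) arr_zer[OF oT b(1)]])
      fix m assume m: "m \<in> F"
      show "p m \<cdot> w = p m \<cdot> zer T P"
        using 0(2)[OF m] arrD[OF b(3)[OF m]] oT by (simp add: \<phi>_def cmp_zer)
    qed
    then have "isz (v \<cdot> w)" using isz_cmp_right[OF isz_zer[OF oT b(1)]] arrD(1)[OF arr_cmp[OF 0(1) v]] by simp
    then show ?case using isz_add[of "v \<cdot> w" "g 0"] arrD[OF arr_cmp[OF 0(1) v]] arrD[OF g(1)[of 0]] by simp
  next
    case (Suc k)
    obtain w' where w': "arr w' T P" "\<And>m. m \<in> F \<Longrightarrow> p m \<cdot> w' = \<phi> k m"
      using b(8)[OF oT, of "\<phi> k"] \<phi> by blast
    note IH = Suc.IH[OF w']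
    show ?case
    proof (cases "k \<in> F")
      case False
      have "w = w'"
      proof (rule b(6)[OF Suc.prems(1) w'(1)])
        fix m assume m: "m \<in> F"
        then have "m \<noteq> k" using False by blast
        then show "p m \<cdot> w = p m \<cdot> w'" using Suc.prems(2)[OF m] w'(2)[OF m] by (auto simp: \<phi>_def)
      qed
      then show ?thesis using IH g(3)[OF False] by simp
    next
      case True
      let ?c = "i k \<cdot> p k \<cdot> u"
      have c: "arr ?c T P" using arr_cmp[OF arr_cmp[OF u b(3)[OF True]] b(2)[OF True]] .
      have "w = w' \<boxplus> ?c"
      proof (rule b(6)[OF Suc.prems(1) arr_add[OF w'(1) c]])
        fix m assume m: "m \<in> F"
        have pu: "arr (p m \<cdot> u) T (A m)" using arr_cmp[OF u b(3)[OF m]] .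
        have puk: "arr (p k \<cdot> u) T (A k)" using arr_cmp[OF u b(3)[OF True]] .
        have "p m \<cdot> (w' \<boxplus> ?c) = \<phi> k m \<boxplus> (p m \<cdot> i k) \<cdot> p k \<cdot> u"
          using w'(2)[OF m] by (simp add: cmp_add cmp_assoc)
        also have "\<dots> = \<phi> (Suc k) m"
        proof (cases "m = k")
          case mk: True
          have "\<phi> k m \<boxplus> (p m \<cdot> i k) \<cdot> p k \<cdot> u = zer T (A k) \<boxplus> A k \<cdot> p k \<cdot> u"
            using mk b(4)[OF True] by (simp add: \<phi>_def)
          also have "\<dots> = p k \<cdot> u" using arrD[OF puk] zer_add[of "p k \<cdot> u"] by (simp add: id_cmp)
          finally show ?thesis using mk by (simp add: \<phi>_def)
        next
          case False
          have "(p m \<cdot> i k) \<cdot> p k \<cdot> u = zer T (A m)"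
            using b(5)[OF m True False] arrD[OF puk] A[OF m] by (simp add: zer_cmp)
          then have "\<phi> k m \<boxplus> (p m \<cdot> i k) \<cdot> p k \<cdot> u = \<phi> k m"
            using arrD[OF \<phi>[OF m, of k]] add_zer[of "\<phi> k m"] by simp
          also have "\<dots> = \<phi> (Suc k) m" using False by (auto simp: \<phi>_def)
          finally show ?thesis .
        qed
        finally show "p m \<cdot> w = p m \<cdot> (w' \<boxplus> ?c)" using Suc.prems(2)[OF m] by simp
      qed
      then have "v \<cdot> w = v \<cdot> w' \<boxplus> v \<cdot> ?c" by (simp add: cmp_add)
      moreover have "g (Suc k) = g k \<boxplus> neg (v \<cdot> ?c)" using g(2)[OF True] by simp
      moreover have "(v \<cdot> w' \<boxplus> v \<cdot> ?c) \<boxplus> (g k \<boxplus> neg (v \<cdot> ?c)) = v \<cdot> w' \<boxplus> g k"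
      proof -
        have vc: "arr (v \<cdot> ?c) T S" using arr_cmp[OF c v] .
        have "(v \<cdot> w' \<boxplus> v \<cdot> ?c) \<boxplus> (g k \<boxplus> neg (v \<cdot> ?c)) = v \<cdot> w' \<boxplus> ((g k \<boxplus> neg (v \<cdot> ?c)) \<boxplus> v \<cdot> ?c)"
          by (simp only: add_assoc add_comm[of "v \<cdot> ?c"])
        then show ?thesis using add_cancel_right[OF g(1) vc] by simp
      qed
      ultimately show ?thesis using IH by simp
    qed
  qed
  note tel = this
  have "p m \<cdot> u = \<phi> n m" if "m \<in> F" for m using that assms(2) by (auto simp: \<phi>_def)
  then have "g 0 = v \<cdot> u \<boxplus> g n" using tel[OF u] by blast
  also have "\<dots> = v \<cdot> u" using add_isz[OF gn] arrD[OF arr_cmp[OF u v]] arrD[OF g(1)[of n]] by simp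
  finally show ?thesis .
qed

text \<open>
  If one of the two middle objects is zero, a pair of arrows to be lifted along a weak pullback is a
  single arrow that is killed by \<open>d\<close>.
\<close>

lemma wpb_wker: assumes "wpb a b c d" "zobj (cd a)" shows "wker b d"
proof -
  have ca: "ok (c \<cdot> a)" "c \<cdot> a = d \<cdot> b" using assms(1) unfolding wpb_def by blast+
  have a: "ok c" "ok a" "dm c = cd a" using ca(1) by simp_all
  have "isz (d \<cdot> b)" using isz_cmp_right[OF isz_to_zobj[OF assms(2) a(2)] ca(1)] ca(2) by simp
  moreover have "\<exists>u. h = b \<cdot> u" if h: "isz (d \<cdot> h)" for h
  proof -
    have oh: "ok d" "ok h" "dm d = cd h" using isz_ok[OF h] by simp_all
    let ?x = "zer (dm h) (cd a)"
    have x: "ok ?x" "dm ?x = dm h" "cd ?x = cd a" using oh a by simp_all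
    have cx: "ok (c \<cdot> ?x)" using x a by simp
    have "isz (c \<cdot> ?x)" by (rule isz_cmp_right[OF _ cx]) (use oh a in \<open>simp add: isz_zer\<close>)
    moreover have "cd c = cd d" using cmp_eqD[OF ca(2,1)] by simp
    ultimately have "c \<cdot> ?x = d \<cdot> h" using isz_eq[OF _ h] cx oh x a by simp
    then show ?thesis using assms(1) cx unfolding wpb_def by blast
  qed
  ultimately show ?thesis unfolding wker_def by blast
qed

lemma wpo_wcok: assumes "wpo a b c d" "zobj (cd b)" shows "wcok a c"
proof -
  have ca: "ok (c \<cdot> a)" "c \<cdot> a = d \<cdot> b" using assms(1) unfolding wpo_def by blast+
  note e = cmp_eqD[OF ca(2,1)]
  have a: "ok c" "ok a" "dm c = cd a" using ca(1) by simp_all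
  have okdb: "ok (d \<cdot> b)" using e by simp
  have "isz (c \<cdot> a)" using isz_cmp_right[OF isz_to_zobj[OF assms(2) e(2)] okdb] ca(2) by simp
  moreover have "\<exists>u. h = u \<cdot> c" if h: "isz (h \<cdot> a)" for h
  proof -
    have oh: "ok h" "dm h = cd a" using isz_ok[OF h] by simp_all
    let ?y = "zer (cd b) (cd h)"
    have y: "ok ?y" "dm ?y = cd b" "cd ?y = cd h" using oh e by simp_all
    have yb: "ok (?y \<cdot> b)" using y e by simp
    have "isz (?y \<cdot> b)" by (rule isz_cmp_left[OF _ yb]) (use oh e in \<open>simp add: isz_zer\<close>)
    then have "h \<cdot> a = ?y \<cdot> b" using isz_eq[OF h] yb oh y a e by simp
    then show ?thesis using assms(1) isz_ok[OF h] unfolding wpo_def by blast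
  qed
  ultimately show ?thesis unfolding wcok_def by blast
qed

text \<open>
  An element \<open>x\<close> of the kernel of \<open>b s\<close> is to be recovered, up to the
  kernel of the composite, from the class of \<open>s x\<close> modulo the image of
  \<open>s a\<close>. A representative \<open>y\<close> of this class in the image of
  \<open>s\<close> has a preimage \<open>t y\<close> under \<open>s\<close>, with \<open>t\<close> a
  quasi-inverse of \<open>s\<close>. This preimage need not lie in the kernel of \<open>b s\<close>,
  but \<open>b y\<close> lies in the image of \<open>b s a\<close>: with \<open>m\<close> a
  quasi-inverse of \<open>b s a\<close>, the element \<open>(t - a m b) y\<close> lies in the
  kernel, and the correction does not change the class. The assumptions on \<open>s a\<close> and
  \<open>b s\<close> serve to split off cokernel and kernel.
\<close>

lemma regular_kernel_to_cokernel:
  assumes sa: "regular (s \<cdot> a)" and bs: "regular (b \<cdot> s)" and s: "regular s" and bsa: "regular (b \<cdot> s \<cdot> a)"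
    and k: "wker k (b \<cdot> s)" and c: "wcok (s \<cdot> a) c"
  shows "regular (c \<cdot> s \<cdot> k)"
proof -
  have kz: "isz ((b \<cdot> s) \<cdot> k)" and kf: "\<And>h. isz ((b \<cdot> s) \<cdot> h) \<Longrightarrow> \<exists>u. h = k \<cdot> u"
    using k unfolding wker_def by blast+
  have cz: "isz (c \<cdot> s \<cdot> a)" and cf: "\<And>h. isz (h \<cdot> s \<cdot> a) \<Longrightarrow> \<exists>u. h = u \<cdot> c"
    using c unfolding wcok_def by blast+
  have [simp]: "ok s" "ok a" "ok b" "ok k" "ok c" "cd a = dm s" "dm b = cd s"
    using isz_ok[OF kz] isz_ok[OF cz] by simp_all
  have [simp]: "cd k = dm s" "dm c = cd s"
    using isz_ok[OF kz] isz_ok[OF cz] by simp_all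
  obtain g where g: "arr g (cd s) (dm a)" "(s \<cdot> a) \<cdot> g \<cdot> s \<cdot> a = s \<cdot> a"
    using regularE[OF sa] by auto
  obtain G where G: "arr G (cd b) (dm s)" "(b \<cdot> s) \<cdot> G \<cdot> b \<cdot> s = b \<cdot> s"
    using regularE[OF bs] by auto
  obtain t where t: "arr t (cd s) (dm s)" "s \<cdot> t \<cdot> s = s"
    using regularE[OF s] by auto
  obtain m where m: "arr m (cd b) (dm a)" "(b \<cdot> s \<cdot> a) \<cdot> m \<cdot> b \<cdot> s \<cdot> a = b \<cdot> s \<cdot> a"
    using regularE[OF bsa] by auto
  note [simp] = arrD[OF g(1)] arrD[OF G(1)] arrD[OF t(1)] arrD[OF m(1)]
  have m': "b \<cdot> s \<cdot> a \<cdot> m \<cdot> b \<cdot> s \<cdot> a \<cdot> x = b \<cdot> s \<cdot> a \<cdot> x" for x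
    using arg_cong[OF m(2), of "\<lambda>y. y \<cdot> x"] by (simp only: cmp_assoc)
  have t': "s \<cdot> t \<cdot> s \<cdot> x = s \<cdot> x" for x
    using arg_cong[OF t(2), of "\<lambda>y. y \<cdot> x"] by (simp only: cmp_assoc)
  \<comment> \<open>\<open>1 - E\<close> factors through the cokernel \<open>c\<close>, \<open>1 - F\<close> through the kernel \<open>k\<close>\<close>
  let ?E = "s \<cdot> a \<cdot> g" and ?F = "G \<cdot> b \<cdot> s"
  have "isz ((cd s \<boxplus> neg ?E) \<cdot> s \<cdot> a)"
    using g(2) by (simp add: add_cmp neg_cmp id_cmp cmp_assoc isz_diff_iff)
  then obtain r where r: "cd s \<boxplus> neg ?E = r \<cdot> c" using cf by blast
  have "isz ((b \<cdot> s) \<cdot> (dm s \<boxplus> neg ?F))"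
    using G(2) by (simp add: cmp_add cmp_neg cmp_id cmp_assoc isz_diff_iff)
  then obtain l where l: "dm s \<boxplus> neg ?F = k \<cdot> l" using kf by blast
  let ?z = "t \<boxplus> neg (a \<cdot> m \<cdot> b)"
  let ?y = "(cd s \<boxplus> neg ?E) \<cdot> s \<cdot> k"
  let ?w = "?z \<cdot> ?y"
  have bsk: "isz (b \<cdot> s \<cdot> k)" using kz by (simp add: cmp_assoc)
  have y: "?y = s \<cdot> k \<boxplus> neg (?E \<cdot> s \<cdot> k)"
    by (simp add: add_cmp neg_cmp id_cmp cmp_assoc)
  have by_: "b \<cdot> ?y = neg (b \<cdot> s \<cdot> a \<cdot> g \<cdot> s \<cdot> k)"
  proof -
    have "b \<cdot> ?y = b \<cdot> s \<cdot> k \<boxplus> neg (b \<cdot> s \<cdot> a \<cdot> g \<cdot> s \<cdot> k)"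
      unfolding y by (simp add: cmp_add cmp_neg cmp_assoc)
    then show ?thesis using isz_add[OF bsk] by simp
  qed
  have w: "?w = (t \<cdot> s \<cdot> k \<boxplus> neg (t \<cdot> s \<cdot> a \<cdot> g \<cdot> s \<cdot> k)) \<boxplus> a \<cdot> m \<cdot> b \<cdot> s \<cdot> a \<cdot> g \<cdot> s \<cdot> k"
  proof -
    have "?w = t \<cdot> ?y \<boxplus> neg (a \<cdot> m \<cdot> b \<cdot> ?y)" by (simp add: add_cmp neg_cmp cmp_assoc)
    also have "t \<cdot> ?y = t \<cdot> s \<cdot> k \<boxplus> neg (t \<cdot> s \<cdot> a \<cdot> g \<cdot> s \<cdot> k)"
      unfolding y by (simp add: cmp_add cmp_neg cmp_assoc)
    also have "a \<cdot> m \<cdot> b \<cdot> ?y = neg (a \<cdot> m \<cdot> b \<cdot> s \<cdot> a \<cdot> g \<cdot> s \<cdot> k)"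
      unfolding by_ by (simp add: cmp_neg)
    finally show ?thesis by (simp add: neg_neg)
  qed
  have csa: "isz (c \<cdot> s \<cdot> a \<cdot> x)" if "ok x" "cd x = dm a" for x
  proof -
    have "isz ((c \<cdot> s \<cdot> a) \<cdot> x)" by (rule isz_cmp_left[OF cz]) (use that in simp)
    then show ?thesis by (simp add: cmp_assoc)
  qed
  have csw: "c \<cdot> s \<cdot> ?w = c \<cdot> s \<cdot> k"
  proof -
    have "c \<cdot> s \<cdot> ?w = (c \<cdot> s \<cdot> k \<boxplus> neg (c \<cdot> s \<cdot> a \<cdot> g \<cdot> s \<cdot> k)) \<boxplus> c \<cdot> s \<cdot> a \<cdot> m \<cdot> b \<cdot> s \<cdot> a \<cdot> g \<cdot> s \<cdot> k"
      unfolding w by (simp add: cmp_add cmp_neg t')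
    also have "c \<cdot> s \<cdot> k \<boxplus> neg (c \<cdot> s \<cdot> a \<cdot> g \<cdot> s \<cdot> k) = c \<cdot> s \<cdot> k"
      by (rule arr_minus_zer[of _ "dm k" "cd c"]) (simp_all add: arr_def csa)
    also have "\<dots> \<boxplus> c \<cdot> s \<cdot> a \<cdot> m \<cdot> b \<cdot> s \<cdot> a \<cdot> g \<cdot> s \<cdot> k = c \<cdot> s \<cdot> k"
      by (rule add_isz) (simp_all add: csa)
    finally show ?thesis .
  qed
  have bsw: "isz (b \<cdot> s \<cdot> ?w)"
  proof -
    let ?q = "b \<cdot> s \<cdot> a \<cdot> g \<cdot> s \<cdot> k"
    have "b \<cdot> s \<cdot> ?w = (b \<cdot> s \<cdot> k \<boxplus> neg ?q) \<boxplus> ?q"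
      unfolding w by (simp add: cmp_add cmp_neg t' m')
    also have "\<dots> = b \<cdot> s \<cdot> k" by (rule add_neg_cancel) simp_all
    finally show ?thesis using bsk by simp
  qed
  have lz: "ok l" "dm l = dm s" "cd l = dm k" and rz: "ok r" "dm r = cd c" "cd r = cd s"
  proof -
    have "ok (k \<cdot> l)" "ok (r \<cdot> c)" unfolding l[symmetric] r[symmetric] by simp_all
    then have o: "ok l" "dm k = cd l" "ok r" "dm r = cd c" by simp_all
    have "dm (k \<cdot> l) = dm s" "cd (r \<cdot> c) = cd s" unfolding l[symmetric] r[symmetric] by simp_all
    then show "ok l" "dm l = dm s" "cd l = dm k" "ok r" "dm r = cd c" "cd r = cd s" using o by simp_all
  qed
  have okz: "ok ?z" "dm ?z = cd s" "cd ?z = dm s" by simp_all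
  have okw: "ok ?w" "cd ?w = dm s" using okz by simp_all
  have "(c \<cdot> s \<cdot> k) \<cdot> (l \<cdot> ?z \<cdot> r) \<cdot> c \<cdot> s \<cdot> k = c \<cdot> s \<cdot> (k \<cdot> l) \<cdot> ?z \<cdot> (r \<cdot> c) \<cdot> s \<cdot> k"
    by (simp only: cmp_assoc)
  also have "\<dots> = c \<cdot> s \<cdot> (dm s \<boxplus> neg ?F) \<cdot> ?w" unfolding l[symmetric] r[symmetric] ..
  also have "\<dots> = c \<cdot> s \<cdot> ?w \<boxplus> neg (c \<cdot> s \<cdot> G \<cdot> b \<cdot> s \<cdot> ?w)"
  proof -
    have "(dm s \<boxplus> neg ?F) \<cdot> x = x \<boxplus> neg (G \<cdot> b \<cdot> s \<cdot> x)" if "ok x" "cd x = dm s" for x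
      using that by (simp add: add_cmp neg_cmp id_cmp cmp_assoc)
    moreover have "c \<cdot> s \<cdot> (x \<boxplus> neg (G \<cdot> b \<cdot> s \<cdot> x)) = c \<cdot> s \<cdot> x \<boxplus> neg (c \<cdot> s \<cdot> G \<cdot> b \<cdot> s \<cdot> x)" if "ok x" "cd x = dm s" for x
      using that by (simp add: cmp_add cmp_neg)
    ultimately show ?thesis using okw by presburger
  qed
  also have "\<dots> = c \<cdot> s \<cdot> ?w"
  proof (rule arr_minus_zer[of _ "dm k" "cd c"])
    have "isz ((c \<cdot> s \<cdot> G) \<cdot> b \<cdot> s \<cdot> ?w)" by (rule isz_cmp_right[OF bsw]) simp
    then show "isz (c \<cdot> s \<cdot> G \<cdot> b \<cdot> s \<cdot> ?w)" by (simp add: cmp_assoc)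
  qed (simp_all add: arr_def)
  also have "\<dots> = c \<cdot> s \<cdot> k" by (rule csw)
  finally show ?thesis unfolding regular_def by (intro conjI exI[of _ "l \<cdot> ?z \<cdot> r"]) simp_all
qed

end

subsection \<open>Sums of diagrams\<close>

context additive_arrows
begin

lemma biprod_regular:
  assumes P: "biprod X1 Y1 P i j p q" and Q: "biprod X2 Y2 Q i' j' p' q'"
    and f: "arr f X1 X2" "regular f" and g: "arr g Y1 Y2" "regular g"
  shows "regular (i' \<cdot> f \<cdot> p \<boxplus> j' \<cdot> g \<cdot> q)"
proof -
  note P' = P[unfolded biprod_def] and Q' = Q[unfolded biprod_def]
  obtain a where a: "arr a X2 X1" "f \<cdot> a \<cdot> f = f" using regularE[OF f(2)] arrD[OF f(1)] by metis
  obtain b where b: "arr b Y2 Y1" "g \<cdot> b \<cdot> g = g" using regularE[OF g(2)] arrD[OF g(1)] by metis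
  have fp: "arr (f \<cdot> p) P X2" and gq: "arr (g \<cdot> q) P Y2" using P' f(1) g(1) arr_cmp by blast+
  have i'f: "arr (i' \<cdot> f) X1 Q" and j'g: "arr (j' \<cdot> g) Y1 Q" using Q' f(1) g(1) arr_cmp by blast+
  have ia: "arr (i \<cdot> a) X2 P" and jb: "arr (j \<cdot> b) Y2 P" using P' a(1) b(1) arr_cmp by blast+
  have afp: "arr (a \<cdot> f \<cdot> p) P X1" and bgq: "arr (b \<cdot> g \<cdot> q) P Y1" using fp gq a(1) b(1) arr_cmp by blast+
  let ?F = "i' \<cdot> f \<cdot> p \<boxplus> j' \<cdot> g \<cdot> q" and ?G = "(i \<cdot> a) \<cdot> p' \<boxplus> (j \<cdot> b) \<cdot> q'"
  have "?G \<cdot> ?F = (i \<cdot> a) \<cdot> f \<cdot> p \<boxplus> (j \<cdot> b) \<cdot> g \<cdot> q" by (rule biprod_cmp[OF Q fp gq ia jb])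
  then have "?G \<cdot> ?F = i \<cdot> a \<cdot> f \<cdot> p \<boxplus> j \<cdot> b \<cdot> g \<cdot> q" by (simp only: cmp_assoc)
  moreover have "((i' \<cdot> f) \<cdot> p \<boxplus> (j' \<cdot> g) \<cdot> q) \<cdot> (i \<cdot> a \<cdot> f \<cdot> p \<boxplus> j \<cdot> b \<cdot> g \<cdot> q)
      = (i' \<cdot> f) \<cdot> a \<cdot> f \<cdot> p \<boxplus> (j' \<cdot> g) \<cdot> b \<cdot> g \<cdot> q" by (rule biprod_cmp[OF P afp bgq i'f j'g])
  moreover have "f \<cdot> a \<cdot> f \<cdot> x = f \<cdot> x" "g \<cdot> b \<cdot> g \<cdot> x = g \<cdot> x" for x
    using arg_cong[OF a(2), of "\<lambda>y. y \<cdot> x"] arg_cong[OF b(2), of "\<lambda>y. y \<cdot> x"] by (simp_all only: cmp_assoc)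
  ultimately have "?F \<cdot> ?G \<cdot> ?F = ?F" by (simp add: cmp_assoc)
  moreover have "ok ?F" using arrD(1)[OF biprod_in(1)[OF Q fp gq]] .
  ultimately show ?thesis unfolding regular_def by blast
qed

end

context weakly_abelian_arrows
begin

text \<open>
  If two morphisms factor over \<open>V\<close> and over \<open>W\<close>, their sum factors over the
  pointwise direct sum of \<open>V\<close> and \<open>W\<close>. Hence the morphisms that factor over
  split diagrams are closed under addition.
\<close>

lemma diagram_sum:
  assumes V: "fnc D lq V" and W: "fnc D lq W"
    and t: "nt D lq X V u" "nt D lq V Y v" "nt D lq X W u'" "nt D lq W Y v'"
  shows "\<exists>B r s. fnc D lq B \<and> nt D lq X B r \<and> nt D lq B Y s \<and>
    (\<forall>x\<in>D. s x \<cdot> r x = v x \<cdot> u x \<boxplus> v' x \<cdot> u' x) \<and>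
    (\<forall>x\<in>D. zobj (V x x) \<and> zobj (W x x) \<longrightarrow> zobj (B x x)) \<and>
    (\<forall>x\<in>D. \<forall>y\<in>D. lq x y \<longrightarrow> regular (V x y) \<and> regular (W x y) \<longrightarrow> regular (B x y)) \<and>
    (\<forall>w\<in>D. \<forall>x\<in>D. \<forall>y\<in>D. \<forall>z\<in>D. lq w x \<and> lq w y \<and> lq x z \<and> lq y z \<longrightarrow>
      wpb (V w x) (V w y) (V x z) (V y z) \<and> wpb (W w x) (W w y) (W x z) (W y z) \<longrightarrow>
      wpb (B w x) (B w y) (B x z) (B y z))"
proof -
  note fV = fncD[OF V] and fW = fncD[OF W]
  have "\<exists>P i j p q. biprod (V x x) (W x x) P i j p q" if "x \<in> D" for x
    using biprod_exists[OF fV(1)[OF that] fW(1)[OF that]] .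
  then obtain P i j p q where P: "\<And>x. x \<in> D \<Longrightarrow> biprod (V x x) (W x x) (P x) (i x) (j x) (p x) (q x)" by metis
  have P': "arr (i x) (V x x) (P x)" "arr (j x) (W x x) (P x)" "arr (p x) (P x) (V x x)" "arr (q x) (P x) (W x x)"
    "i x \<cdot> p x \<boxplus> j x \<cdot> q x = P x" if "x \<in> D" for x
    using P[OF that, unfolded biprod_def] by blast+
  define B where "B x y = i y \<cdot> V x y \<cdot> p x \<boxplus> j y \<cdot> W x y \<cdot> q x" for x y
  have B': "B x y = (i y \<cdot> V x y) \<cdot> p x \<boxplus> (j y \<cdot> W x y) \<cdot> q x" for x y by (simp add: B_def cmp_assoc)
  have Bxx: "B x x = P x" if x: "x \<in> D" for x
  proof -
    have "V x x \<cdot> p x = p x" "W x x \<cdot> q x = q x" using arrD[OF P'(3)[OF x]] arrD[OF P'(4)[OF x]] by (simp_all add: id_cmp)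
    then show ?thesis using P'(5)[OF x] by (simp add: B_def)
  qed
  have Vp: "arr (V x y \<cdot> p x) (P x) (V y y)" and Wq: "arr (W x y \<cdot> q x) (P x) (W y y)"
    and iV: "arr (i y \<cdot> V x y) (V x x) (P y)" and jW: "arr (j y \<cdot> W x y) (W x x) (P y)"
    if "x \<in> D" "y \<in> D" "lq x y" for x y
    using arr_cmp[OF P'(3)[OF that(1)] fV(2)[OF that]] arr_cmp[OF P'(4)[OF that(1)] fW(2)[OF that]]
      arr_cmp[OF fV(2)[OF that] P'(1)[OF that(2)]] arr_cmp[OF fW(2)[OF that] P'(2)[OF that(2)]] .
  have Ba: "arr (B x y) (P x) (P y)" if "x \<in> D" "y \<in> D" "lq x y" for x y
    unfolding B_def by (rule biprod_in(1)[OF P[OF that(2)] Vp[OF that] Wq[OF that]])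
  have Bt: "B x y \<cdot> (i x \<cdot> a \<boxplus> j x \<cdot> b) = i y \<cdot> V x y \<cdot> a \<boxplus> j y \<cdot> W x y \<cdot> b"
    if "x \<in> D" "y \<in> D" "lq x y" "arr a T (V x x)" "arr b T (W x x)" for x y a b T
    using biprod_cmp[OF P[OF that(1)] that(4,5) iV[OF that(1-3)] jW[OF that(1-3)]]
    unfolding B' by (simp add: cmp_assoc)
  have Bc: "B y z \<cdot> B x y = B x z" if D: "x \<in> D" "y \<in> D" "z \<in> D" "lq x y" "lq y z" for x y z
  proof -
    have "B y z \<cdot> B x y = i z \<cdot> V y z \<cdot> V x y \<cdot> p x \<boxplus> j z \<cdot> W y z \<cdot> W x y \<cdot> q x"
      unfolding B_def[of x y] by (rule Bt[OF D(2,3,5) Vp[OF D(1,2,4)] Wq[OF D(1,2,4)]])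
    then show ?thesis unfolding B_def[of x z] fV(3)[OF D, symmetric] fW(3)[OF D, symmetric] by (simp only: cmp_assoc)
  qed
  have fB: "fnc D lq B"
    unfolding fnc_def using Ba Bc Bxx arr_obj(1)[OF P'(3)] by simp
  have pB: "p y \<cdot> B x y = V x y \<cdot> p x" and qB: "q y \<cdot> B x y = W x y \<cdot> q x" if "x \<in> D" "y \<in> D" "lq x y" for x y
    unfolding B_def using biprod_in(2,3)[OF P[OF that(2)] Vp[OF that] Wq[OF that]] by blast+
  have Bi: "B x y \<cdot> i x = i y \<cdot> V x y" and Bj: "B x y \<cdot> j x = j y \<cdot> W x y" if "x \<in> D" "y \<in> D" "lq x y" for x y
    unfolding B' using biprod_out(2,3)[OF P[OF that(1)] iV[OF that] jW[OF that]] by blast+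
  have nti: "nt D lq V B i" and ntj: "nt D lq W B j" and ntp: "nt D lq B V p" and ntq: "nt D lq B W q"
    unfolding nt_def using P' Bxx Bi Bj pB qB by simp_all
  define r where "r x = i x \<cdot> u x \<boxplus> j x \<cdot> u' x" for x
  define s where "s x = v x \<cdot> p x \<boxplus> v' x \<cdot> q x" for x
  have r: "nt D lq X B r"
    unfolding r_def by (rule nt_add[OF nt_cmp[OF t(1) nti] nt_cmp[OF t(3) ntj]])
  have s: "nt D lq B Y s"
    unfolding s_def by (rule nt_add[OF nt_cmp[OF ntp t(2)] nt_cmp[OF ntq t(4)]])
  have sr: "s x \<cdot> r x = v x \<cdot> u x \<boxplus> v' x \<cdot> u' x" if x: "x \<in> D" for x
    unfolding s_def r_def
    by (rule biprod_cmp[OF P[OF x] ntD(1)[OF t(1) x] ntD(1)[OF t(3) x] ntD(1)[OF t(2) x] ntD(1)[OF t(4) x]])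
  have z: "zobj (B x x)" if x: "x \<in> D" "zobj (V x x)" "zobj (W x x)" for x
  proof -
    have 1: "isz (i x \<cdot> p x)" "isz (j x \<cdot> q x)"
      using isz_through_zobj[OF x(2) P'(3,1)[OF x(1)]] isz_through_zobj[OF x(3) P'(4,2)[OF x(1)]] .
    have "ok (i x \<cdot> p x \<boxplus> j x \<cdot> q x)" using P'(5)[OF x(1)] arr_obj(1)[OF P'(3)[OF x(1)]] by simp
    from add_isz[OF 1(2) this] have "isz (P x)" using 1(1) unfolding P'(5)[OF x(1)] by simp
    then show ?thesis unfolding zobj_def Bxx[OF x(1)] using arr_obj(1)[OF P'(3)[OF x(1)]] by blast
  qed
  have rg: "regular (B x y)" if "x \<in> D" "y \<in> D" "lq x y" "regular (V x y)" "regular (W x y)" for x y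
    unfolding B_def
    by (rule biprod_regular[OF P[OF that(1)] P[OF that(2)] fV(2)[OF that(1-3)] that(4) fW(2)[OF that(1-3)] that(5)])
  have sq: "wpb (B w x) (B w y) (B x z) (B y z)"
    if D: "w \<in> D" "x \<in> D" "y \<in> D" "z \<in> D" "lq w x" "lq w y" "lq x z" "lq y z"
      and sV: "wpb (V w x) (V w y) (V x z) (V y z)" and sW: "wpb (W w x) (W w y) (W x z) (W y z)" for w x y z
  proof -
    have "\<exists>t. a = B w x \<cdot> t \<and> b = B w y \<cdot> t" if ab: "ok (B x z \<cdot> a)" "B x z \<cdot> a = B y z \<cdot> b" for a b
    proof -
      note e = cmp_eqD[OF ab(2,1)]
      have a: "arr a (dm a) (P x)" and b: "arr b (dm a) (P y)"
        using ab(1) e arrD[OF Ba[OF D(2,4,7)]] arrD[OF Ba[OF D(3,4,8)]] by (simp_all add: arr_def)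
      have pa: "arr (p x \<cdot> a) (dm a) (V x x)" and qa: "arr (q x \<cdot> a) (dm a) (W x x)"
        using arr_cmp[OF a P'(3)[OF D(2)]] arr_cmp[OF a P'(4)[OF D(2)]] .
      have "V x z \<cdot> p x \<cdot> a = p z \<cdot> B x z \<cdot> a" using pB[OF D(2,4,7)] by (simp flip: cmp_assoc)
      also have "\<dots> = V y z \<cdot> p y \<cdot> b" unfolding ab(2) using pB[OF D(3,4,8)] by (simp flip: cmp_assoc)
      finally obtain t1 where t1: "p x \<cdot> a = V w x \<cdot> t1" "p y \<cdot> b = V w y \<cdot> t1"
        using sV arrD(1)[OF arr_cmp[OF pa fV(2)[OF D(2,4,7)]]] unfolding wpb_def by blast
      have "W x z \<cdot> q x \<cdot> a = q z \<cdot> B x z \<cdot> a" using qB[OF D(2,4,7)] by (simp flip: cmp_assoc)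
      also have "\<dots> = W y z \<cdot> q y \<cdot> b" unfolding ab(2) using qB[OF D(3,4,8)] by (simp flip: cmp_assoc)
      finally obtain t2 where t2: "q x \<cdot> a = W w x \<cdot> t2" "q y \<cdot> b = W w y \<cdot> t2"
        using sW arrD(1)[OF arr_cmp[OF qa fW(2)[OF D(2,4,7)]]] unfolding wpb_def by blast
      have "ok (V w x \<cdot> t1)" "dm (V w x \<cdot> t1) = dm a" "ok (W w x \<cdot> t2)" "dm (W w x \<cdot> t2) = dm a"
        using arrD[OF pa] arrD[OF qa] unfolding t1(1) t2(1) by blast+
      then have tt: "arr t1 (dm a) (V w w)" "arr t2 (dm a) (W w w)"
        using arrD[OF fV(2)[OF D(1,2,5)]] arrD[OF fW(2)[OF D(1,2,5)]] by (simp_all add: arr_def)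
      let ?t = "i w \<cdot> t1 \<boxplus> j w \<cdot> t2"
      have "B w x \<cdot> ?t = i x \<cdot> p x \<cdot> a \<boxplus> j x \<cdot> q x \<cdot> a"
        unfolding t1 t2 by (rule Bt[OF D(1,2,5) tt])
      moreover have "B w y \<cdot> ?t = i y \<cdot> p y \<cdot> b \<boxplus> j y \<cdot> q y \<cdot> b"
        unfolding t1 t2 by (rule Bt[OF D(1,3,6) tt])
      ultimately show ?thesis
        using biprod_decomp[OF P[OF D(2)] arrD(1,3)[OF a]] biprod_decomp[OF P[OF D(3)] arrD(1,3)[OF b]] by metis
    qed
    moreover have "ok (B x z \<cdot> B w x)" using arrD(1)[OF arr_cmp[OF Ba[OF D(1,2,5)] Ba[OF D(2,4,7)]]] .
    moreover have "B x z \<cdot> B w x = B y z \<cdot> B w y"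
    proof -
      have 1: "V x z \<cdot> V w x = V y z \<cdot> V w y" using sV unfolding wpb_def by blast
      have 2: "W x z \<cdot> W w x = W y z \<cdot> W w y" using sW unfolding wpb_def by blast
      have "B x z \<cdot> B w x = i z \<cdot> (V x z \<cdot> V w x) \<cdot> p w \<boxplus> j z \<cdot> (W x z \<cdot> W w x) \<cdot> q w"
        unfolding B_def[of w x] cmp_assoc by (rule Bt[OF D(2,4,7) Vp[OF D(1,2,5)] Wq[OF D(1,2,5)]])
      also have "\<dots> = B y z \<cdot> B w y"
        unfolding 1 2 B_def[of w y] cmp_assoc by (rule Bt[OF D(3,4,8) Vp[OF D(1,3,6)] Wq[OF D(1,3,6)], symmetric])
      finally show ?thesis .
    qed
    ultimately show ?thesis unfolding wpb_def by blast
  qed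
  show ?thesis
    using fB r s sr z rg sq by (intro exI[of _ B] exI[of _ r] exI[of _ s] conjI) blast+
qed

definition factors :: "int \<Rightarrow> (int \<times> int \<Rightarrow> int \<times> int \<Rightarrow> 'a) \<Rightarrow> (int \<times> int \<Rightarrow> int \<times> int \<Rightarrow> 'a)
    \<Rightarrow> (int \<times> int \<Rightarrow> 'a) \<Rightarrow> bool"
  where "factors N X Y g \<longleftrightarrow> (\<exists>B u v. split_strip N B \<and> nt (zst N) zle X B u \<and> nt (zst N) zle B Y v \<and>
    (\<forall>x\<in>zst N. g x = v x \<cdot> u x))"

lemma factorsI:
  "\<lbrakk>split_strip N B; nt (zst N) zle X B u; nt (zst N) zle B Y v; \<And>x. x \<in> zst N \<Longrightarrow> g x = v x \<cdot> u x\<rbrakk> \<Longrightarrow> factors N X Y g"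
  unfolding factors_def by blast

lemma factorsE:
  assumes "factors N X Y g"
  obtains B u v where "split_strip N B" "nt (zst N) zle X B u" "nt (zst N) zle B Y v"
    "\<And>x. x \<in> zst N \<Longrightarrow> g x = v x \<cdot> u x"
  using assms unfolding factors_def by blast

lemma split_stripD:
  assumes "split_strip N B"
  shows "plus N B" "fnc (zst N) zle B" "\<lbrakk>x \<in> zst N; y \<in> zst N; zle x y\<rbrakk> \<Longrightarrow> regular (B x y)"
  using assms plusD(1) unfolding split_strip_def by blast+

lemma factors_cong: "factors N X Y g \<Longrightarrow> (\<And>x. x \<in> zst N \<Longrightarrow> f x = g x) \<Longrightarrow> factors N X Y f"
  unfolding factors_def by metis

lemma factors_nt:
  assumes "factors N X Y g" shows "nt (zst N) zle X Y g"
  using assms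
proof (rule factorsE)
  fix B u v assume b: "nt (zst N) zle X B u" "nt (zst N) zle B Y v" "\<And>x. x \<in> zst N \<Longrightarrow> g x = v x \<cdot> u x"
  have "nt (zst N) zle X Y (\<lambda>x. v x \<cdot> u x)" by (rule nt_cmp[OF b(1,2)])
  then show ?thesis unfolding nt_def using b(3) by simp
qed

lemma factors_cmp_left:
  assumes "factors N X Y g" "nt (zst N) zle Y Z t" shows "factors N X Z (\<lambda>x. t x \<cdot> g x)"
  using assms(1)
proof (rule factorsE)
  fix B u v assume b: "split_strip N B" "nt (zst N) zle X B u" "nt (zst N) zle B Y v" "\<And>x. x \<in> zst N \<Longrightarrow> g x = v x \<cdot> u x"
  show ?thesis by (rule factorsI[OF b(1,2) nt_cmp[OF b(3) assms(2)]]) (simp add: b(4) cmp_assoc)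
qed

lemma factors_cmp_right:
  assumes "factors N Y Z g" "nt (zst N) zle X Y t" shows "factors N X Z (\<lambda>x. g x \<cdot> t x)"
  using assms(1)
proof (rule factorsE)
  fix B u v assume b: "split_strip N B" "nt (zst N) zle Y B u" "nt (zst N) zle B Z v" "\<And>x. x \<in> zst N \<Longrightarrow> g x = v x \<cdot> u x"
  show ?thesis by (rule factorsI[OF b(1) nt_cmp[OF assms(2) b(2)] b(3)]) (simp add: b(4) cmp_assoc)
qed

lemma factors_add:
  assumes N: "N \<ge> 0" and f: "factors N X Y f" and g: "factors N X Y g" shows "factors N X Y (\<lambda>x. f x \<boxplus> g x)"
proof -
  obtain V u v where V: "split_strip N V" "nt (zst N) zle X V u" "nt (zst N) zle V Y v" "\<And>x. x \<in> zst N \<Longrightarrow> f x = v x \<cdot> u x"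
    using f unfolding factors_def by blast
  obtain W u' v' where W: "split_strip N W" "nt (zst N) zle X W u'" "nt (zst N) zle W Y v'" "\<And>x. x \<in> zst N \<Longrightarrow> g x = v' x \<cdot> u' x"
    using g unfolding factors_def by blast
  note V' = split_stripD[OF V(1)] and W' = split_stripD[OF W(1)]
  obtain B r s where B: "fnc (zst N) zle B" "nt (zst N) zle X B r" "nt (zst N) zle B Y s"
    "\<forall>x\<in>zst N. s x \<cdot> r x = v x \<cdot> u x \<boxplus> v' x \<cdot> u' x"
    "\<forall>x\<in>zst N. zobj (V x x) \<and> zobj (W x x) \<longrightarrow> zobj (B x x)"
    "\<forall>x\<in>zst N. \<forall>y\<in>zst N. zle x y \<longrightarrow> regular (V x y) \<and> regular (W x y) \<longrightarrow> regular (B x y)"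
    "\<forall>w\<in>zst N. \<forall>x\<in>zst N. \<forall>y\<in>zst N. \<forall>z\<in>zst N. zle w x \<and> zle w y \<and> zle x z \<and> zle y z \<longrightarrow>
      wpb (V w x) (V w y) (V x z) (V y z) \<and> wpb (W w x) (W w y) (W x z) (W y z) \<longrightarrow>
      wpb (B w x) (B w y) (B x z) (B y z)"
    using diagram_sum[OF V'(2) W'(2) V(2,3) W(2,3)]
    by (elim exE conjE) (rule that)
  have "zobj (B (i, i) (i, i))" "zobj (B (i + N, i) (i + N, i))" for i
    using B(5) plusD(2,3)[OF V'(1)] plusD(2,3)[OF W'(1)] N by simp_all
  moreover have "wpb (B (c, a) (d, a)) (B (c, a) (c, b)) (B (d, a) (d, b)) (B (c, b) (d, b))"
    if "a \<le> b" "b \<le> c" "c \<le> d" "d \<le> a + N" for a b c d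
    using B(7)[rule_format, of "(c, a)" "(d, a)" "(c, b)" "(d, b)"]
      plusD(4)[OF V'(1) that] plusD(4)[OF W'(1) that] that by simp
  ultimately have "plus N B" unfolding plus_def using B(1) by blast
  then have "split_strip N B" unfolding split_strip_def using B(6) V'(3) W'(3) by blast
  then show ?thesis by (rule factorsI[OF _ B(2,3)]) (simp add: B(4) V(4) W(4))
qed

subsection \<open>Morphisms that vanish on a row factor over a split diagram\<close>

text \<open>
  By the weak pushout with corner \<open>(q - 1, q - 1)\<close>, an arrow that kills the object
  at \<open>(q - 1, p)\<close> factors through \<open>(q, q - 1)\<close>. By the one with corner
  \<open>(p - 1 + N, p - 1)\<close>, an arrow from there that kills the object at
  \<open>(q, p - 1)\<close> factors through the end of the rectangle.
\<close>

lemma factor_through_top: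
  assumes X: "plus N X" and k: "inner N (q, p)" and e: "ok e" "dm e = X (q, p) (q, p)"
    and z: "isz (e \<cdot> X (q, p - 1) (q, p))" "isz (e \<cdot> X (q - 1, p) (q, p))"
  shows "\<exists>h. arr h (X (top_of N (q, p)) (top_of N (q, p))) (cd e) \<and> e = h \<cdot> X (q, p) (top_of N (q, p))"
proof -
  note f = fncD[OF plusD(1)[OF X]]
  have k': "p < q" "q < p + N" using k by (auto simp: inner_def)
  have oe: "obj (cd e)" using e by simp
  have "wpo (X (q - 1, p) (q, p)) (X (q - 1, p) (q - 1, q - 1)) (X (q, p) (q, q - 1)) (X (q - 1, q - 1) (q, q - 1))"
    by (rule plus_wpo[OF X]) (use k' in auto)
  then have "wcok (X (q - 1, p) (q, p)) (X (q, p) (q, q - 1))"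
  proof (rule wpo_wcok)
    have "cd (X (q - 1, p) (q - 1, q - 1)) = X (q - 1, q - 1) (q - 1, q - 1)"
      using arrD(3)[OF f(2)] k' by simp
    then show "zobj (cd (X (q - 1, p) (q - 1, q - 1)))" using plusD(2)[OF X] by simp
  qed
  then obtain e1 where e1: "e = e1 \<cdot> X (q, p) (q, q - 1)" using z(2) unfolding wcok_def by blast
  have "wpo (X (q, p - 1) (p - 1 + N, p - 1)) (X (q, p - 1) (q, q - 1))
      (X (p - 1 + N, p - 1) (p - 1 + N, q - 1)) (X (q, q - 1) (p - 1 + N, q - 1))"
    by (rule plus_wpo[OF X]) (use k' in auto)
  then have "wpo (X (q, p - 1) (q, q - 1)) (X (q, p - 1) (p - 1 + N, p - 1))
      (X (q, q - 1) (p - 1 + N, q - 1)) (X (p - 1 + N, p - 1) (p - 1 + N, q - 1))"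
    using wpo_imp_wpb wpb_sym wpb_imp_wpo by blast
  then have "wcok (X (q, p - 1) (q, q - 1)) (X (q, q - 1) (p - 1 + N, q - 1))"
  proof (rule wpo_wcok)
    have "cd (X (q, p - 1) (p - 1 + N, p - 1)) = X (p - 1 + N, p - 1) (p - 1 + N, p - 1)"
      using arrD(3)[OF f(2)] k' by simp
    then show "zobj (cd (X (q, p - 1) (p - 1 + N, p - 1)))" using plusD(3)[OF X, of "p - 1"] by simp
  qed
  moreover have "isz (e1 \<cdot> X (q, p - 1) (q, q - 1))"
  proof -
    have "X (q, p - 1) (q, q - 1) = X (q, p) (q, q - 1) \<cdot> X (q, p - 1) (q, p)"
      by (rule f(3)[symmetric]) (use k' in auto)
    then show ?thesis using z(1) unfolding e1 by (simp add: cmp_assoc)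
  qed
  ultimately obtain h where h: "e1 = h \<cdot> X (q, q - 1) (p - 1 + N, q - 1)" unfolding wcok_def by blast
  have t: "top_of N (q, p) = (p - 1 + N, q - 1)" by (simp add: top_of_def)
  have "X (q, p) (p - 1 + N, q - 1) = X (q, q - 1) (p - 1 + N, q - 1) \<cdot> X (q, p) (q, q - 1)"
    by (rule f(3)[symmetric]) (use k' in auto)
  then have eh: "e = h \<cdot> X (q, p) (p - 1 + N, q - 1)" unfolding e1 h by (simp add: cmp_assoc)
  have Xa: "arr (X (q, p) (p - 1 + N, q - 1)) (X (q, p) (q, p)) (X (p - 1 + N, q - 1) (p - 1 + N, q - 1))"
    by (rule f(2)) (use k' in auto)
  have "ok (h \<cdot> X (q, p) (p - 1 + N, q - 1))" using e(1) unfolding eh .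
  then have "arr h (X (p - 1 + N, q - 1) (p - 1 + N, q - 1)) (cd e)"
    using arrD[OF Xa] unfolding eh by (simp add: arr_def)
  then show ?thesis unfolding t using eh by blast
qed

lemma contrib_factors:
  assumes N: "N \<ge> 1" and X: "plus N X" and Y: "plus N Y" and k: "inner N k"
    and h: "arr h (X (top_of N k) (top_of N k)) (Y k k)"
  shows "factors N X Y (contrib N X Y k h)"
proof -
  have fin: "finite {m \<in> {0::nat}. x \<in> rect N k}" for x by simp
  obtain B u v i p A where s: "split_strip N B" "nt (zst N) zle X B u" "nt (zst N) zle B Y v"
    and b0: "\<forall>x\<in>zst N. bsum {m \<in> {0::nat}. x \<in> rect N k} A (B x x) (i x) (p x) \<and>
      (\<forall>m. m \<in> {0::nat} \<and> x \<in> rect N k \<longrightarrow> p x m \<cdot> u x = h \<cdot> X x (top_of N k) \<and> v x \<cdot> i x m = Y k x)"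
    using rect_factor[OF N X Y, of "{0::nat}" "\<lambda>_. k" "\<lambda>_. h", OF k fin h]
    by (elim exE conjE) (rule that)
  have b: "bsum {m \<in> {0::nat}. x \<in> rect N k} A (B x x) (i x) (p x)"
    "\<lbrakk>m \<in> {0}; x \<in> rect N k\<rbrakk> \<Longrightarrow> p x m \<cdot> u x = h \<cdot> X x (top_of N k) \<and> v x \<cdot> i x m = Y k x"
    if "x \<in> zst N" for x m
    using bspec[OF b0 that] by blast+
  show ?thesis
  proof (rule factorsI[OF s])
    fix x assume x: "x \<in> zst N"
    note ux = ntD(1)[OF s(2) x] and vx = ntD(1)[OF s(3) x]
    show "contrib N X Y k h x = v x \<cdot> u x"
    proof (cases "x \<in> rect N k")
      case True
      then have F: "{m \<in> {0::nat}. x \<in> rect N k} = {0}" by auto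
      note bs = bsumD[OF b(1)[OF x, unfolded F]]
      have "i x 0 \<cdot> p x 0 \<cdot> u x = u x"
      proof (rule bs(6)[OF arr_cmp[OF arr_cmp[OF ux bs(3)] bs(2)] ux])
        fix m :: nat assume m: "m \<in> {0}"
        have "p x 0 \<cdot> i x 0 \<cdot> p x 0 \<cdot> u x = (p x 0 \<cdot> i x 0) \<cdot> p x 0 \<cdot> u x" by (simp only: cmp_assoc)
        also have "\<dots> = p x 0 \<cdot> u x" using bs(4)[of 0] arrD[OF arr_cmp[OF ux bs(3)[of 0]]] by (simp add: id_cmp)
        finally show "p x m \<cdot> i x 0 \<cdot> p x 0 \<cdot> u x = p x m \<cdot> u x" using m by simp
      qed auto
      then have "v x \<cdot> u x = (v x \<cdot> i x 0) \<cdot> p x 0 \<cdot> u x" by (simp add: cmp_assoc)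
      then show ?thesis using b(2)[OF x _ True, of 0] True by (simp add: contrib_def)
    next
      case False
      then have F: "{m \<in> {0::nat}. x \<in> rect N k} = {}" by auto
      have "zobj (B x x)" using bsum_empty_zobj b(1)[OF x, unfolded F] by blast
      then have "isz (v x \<cdot> u x)" using isz_through_zobj ux vx by blast
      then show ?thesis using isz_eqI[OF arr_cmp[OF ux vx]] False by (simp add: contrib_def)
    qed
  qed
qed

end

text \<open>
  The inner points above row \<open>0\<close> of the strip with \<open>N = n + 1\<close>, row by
  row. A point comes after all the points below it.
\<close>

definition enum :: "nat \<Rightarrow> nat \<Rightarrow> int \<times> int"
  where "enum n m = (2 + int (m div n) + int (m mod n), 1 + int (m div n))"

lemma inner_enum: "n > 0 \<Longrightarrow> inner (int n + 1) (enum n m)"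
  by (simp add: inner_def enum_def)

lemma enum_mono:
  assumes "zle (enum n m) (enum n m')" shows "m \<le> m'"
proof (rule ccontr)
  assume "\<not> m \<le> m'"
  then have "m' div n \<le> m div n" by (intro div_le_mono) simp
  then have d: "m div n = m' div n" using assms by (simp add: zle_def enum_def)
  then have "m mod n \<le> m' mod n" using assms by (simp add: zle_def enum_def)
  then have "m \<le> m'" using d by (metis add_le_cancel_left div_mult_mod_eq)
  then show False using \<open>\<not> m \<le> m'\<close> by simp
qed

lemma enum_surj:
  assumes "n > 0" "inner (int n + 1) (q, p)" "p \<ge> 1" shows "\<exists>m. enum n m = (q, p)"
proof
  define a where "a = nat (p - 1)" define b where "b = nat (q - p - 1)"
  have b: "b < n" and e: "p = 1 + int a" "q = 2 + int a + int b"
    using assms by (auto simp: inner_def a_def b_def)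
  have "(a * n + b) div n = a" "(a * n + b) mod n = b" using b by simp_all
  then show "enum n (a * n + b) = (q, p)" by (simp add: enum_def e)
qed

lemma finite_rect_enum:
  assumes "n > 0" shows "finite {m \<in> UNIV. x \<in> rect N (enum n m)}"
proof (rule finite_subset)
  show "{m \<in> UNIV. x \<in> rect N (enum n m)} \<subseteq> {..< nat (snd x) * n}"
  proof
    fix m assume "m \<in> {m \<in> UNIV. x \<in> rect N (enum n m)}"
    then have "m div n < nat (snd x)" by (auto simp: rect_def enum_def)
    then show "m \<in> {..< nat (snd x) * n}" using assms by (simp add: div_less_iff_less_mult)
  qed
qed simp

context weakly_abelian_arrows
begin

text \<open>
  The inner points above row \<open>0\<close> are treated one after the other. When it is the turn of
  \<open>k\<close>, the morphism vanishes at all points of that part strictly below \<open>k\<close>,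
  so its component at \<open>k\<close> kills the objects before \<open>k\<close> and factors through
  the end of the rectangle of \<open>k\<close>. Hence it agrees at \<open>k\<close> with a morphism
  that is supported on the rectangle, and the difference vanishes at \<open>k\<close>. Every point
  lies in finitely many of these rectangles, so that the sum of all these morphisms makes sense; it
  factors over the sum of the rectangle diagrams.
\<close>

lemma vanishing_factor_right:
  assumes N: "N \<ge> 1" and X: "plus N X" and Y: "plus N Y" and g: "nt (zst N) zle X Y g"
    and g0: "\<And>j. 0 \<le> j \<Longrightarrow> j \<le> N \<Longrightarrow> isz (g (j, 0))"
  shows "\<exists>f. factors N X Y f \<and> (\<forall>x\<in>zst N. (snd x \<ge> 0 \<longrightarrow> f x = g x) \<and> (snd x \<le> 0 \<longrightarrow> isz (f x)))"
proof (cases "N = 1")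
  case True
  \<comment> \<open>for \<open>N = 1\<close> the strip consists of its boundary, and all objects are zero\<close>
  have Xz: "zobj (X x x)" if "x \<in> zst N" for x
  proof -
    obtain j i where x: "x = (j, i)" by fastforce
    then have "j = i \<or> j = i + N" using that True by auto
    then show ?thesis using plusD(2,3)[OF X] by (auto simp: x)
  qed
  have z: "isz (X x y)" if "x \<in> zst N" "y \<in> zst N" "zle x y" for x y
    using isz_from_zobj[OF Xz[OF that(1)]] arrD[OF fncD(2)[OF plusD(1)[OF X] that]] by blast
  then have "split_strip N X" unfolding split_strip_def using X regular_isz by blast
  then have "factors N X Y g"
    by (rule factorsI[OF _ nt_id[OF plusD(1)[OF X]] g]) (use arrD[OF ntD(1)[OF g]] in \<open>simp add: cmp_id\<close>)
  moreover have "isz (g x)" if "x \<in> zst N" for x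
    using isz_from_zobj[OF Xz[OF that]] arrD[OF ntD(1)[OF g that]] by blast
  ultimately show ?thesis by blast
next
  case False
  define n where "n = nat (N - 1)"
  have n: "n > 0" "N = int n + 1" using N False by (auto simp: n_def)
  note fX = plusD(1)[OF X] and fY = plusD(1)[OF Y]
  let ?e = "enum n"
  have inn: "inner N (?e m)" for m using inner_enum[OF n(1)] n(2) by simp
  \<comment> \<open>\<open>r\<close> is what remains of \<open>g\<close> after the first \<open>m\<close> points\<close>
  let ?P = "\<lambda>m r. nt (zst N) zle X Y r \<and> (\<forall>j. 0 \<le> j \<and> j \<le> N \<longrightarrow> isz (r (j, 0))) \<and>
    (\<forall>m'<m. isz (r (?e m'))) \<and> (m = 0 \<longrightarrow> r = g)"
  let ?Q = "\<lambda>m r r'. \<exists>h. arr h (X (top_of N (?e m)) (top_of N (?e m))) (Y (?e m) (?e m)) \<and>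
    r' = (\<lambda>x. r x \<boxplus> neg (contrib N X Y (?e m) h x))"
  have "\<exists>r. \<forall>m. ?P m (r m) \<and> ?Q m (r m) (r (Suc m))"
  proof (rule dependent_nat_choice)
    show "\<exists>r. ?P 0 r" using g g0 by auto
  next
    fix r m assume P: "?P m r"
    then have r: "nt (zst N) zle X Y r" by blast
    obtain q p where k: "?e m = (q, p)" by fastforce
    have kin: "inner N (q, p)" using inn[of m] by (simp add: k)
    have k': "p < q" "q < p + N" "1 \<le> p" using kin k by (auto simp: inner_def enum_def)
    have kz: "(q, p) \<in> zst N" using inner_in(1)[OF kin] .
    \<comment> \<open>a predecessor of the \<open>m\<close>-th point lies on row \<open>0\<close>, on the boundary, or was enumerated before\<close>
    have pre: "isz (r (j, i))" if "(j, i) \<in> zst N" "0 \<le> i" "zle (j, i) (q, p)" "(j, i) \<noteq> (q, p)" for j i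
    proof -
      have "i = 0 \<or> j = i \<or> j = i + N \<or> 1 \<le> i \<and> inner N (j, i)"
        using that(1,2) by (auto simp: inner_def)
      then consider "i = 0" | "j = i" | "j = i + N" | "1 \<le> i" "inner N (j, i)" by blast
      then show ?thesis
      proof cases
        case 1 then show ?thesis using P that(1) by auto
      next
        case 2 then show ?thesis
          using isz_from_zobj[OF plusD(2)[OF X]] arrD[OF ntD(1)[OF r that(1)]] by blast
      next
        case 3 then show ?thesis
          using isz_from_zobj[OF plusD(3)[OF X]] arrD[OF ntD(1)[OF r that(1)]] by blast
      next
        case 4
        then obtain m' where m': "?e m' = (j, i)" using enum_surj[OF n(1)] n(2) by blast
        then have "m' \<le> m" "m' \<noteq> m" using enum_mono[of n m' m] that(3,4) k by auto
        then show ?thesis using P m' by (metis le_neq_implies_less)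
      qed
    qed
    have step: "isz (r (q, p) \<cdot> X x (q, p))" if "x \<in> zst N" "zle x (q, p)" "isz (r x)" for x
    proof -
      have "isz (Y x (q, p) \<cdot> r x)"
        by (rule isz_cmp_right[OF that(3)])
          (use arrD(1)[OF arr_cmp[OF ntD(1)[OF r that(1)] fncD(2)[OF fY that(1) kz that(2)]]] in simp)
      then show ?thesis using ntD(2)[OF r that(1) kz that(2)] by simp
    qed
    have "isz (r (q, p) \<cdot> X (q, p - 1) (q, p))" "isz (r (q, p) \<cdot> X (q - 1, p) (q, p))"
      by (rule step; (rule pre)?; use k' in simp)+
    from factor_through_top[OF X kin _ _ this]
    obtain h where h: "arr h (X (top_of N (q, p)) (top_of N (q, p))) (Y (q, p) (q, p))"
      "r (q, p) = h \<cdot> X (q, p) (top_of N (q, p))"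
      using arrD[OF ntD(1)[OF r kz]] by auto
    let ?c = "contrib N X Y (q, p) h" and ?r = "\<lambda>x. r x \<boxplus> neg (contrib N X Y (?e m) h x)"
    have c: "nt (zst N) zle X Y ?c" by (rule contrib_nt[OF X Y kin h(1)])
    have r': "nt (zst N) zle X Y ?r"
      unfolding k by (rule nt_add[OF r nt_neg[OF fX fY c]])
    have same: "?r x = r x" if "x \<in> zst N" "x \<notin> rect N (q, p)" for x
      unfolding k using that(2) isz_zer[OF fncD(1)[OF fX that(1)] fncD(1)[OF fY that(1)]]
        fncD(1)[OF fX that(1)] fncD(1)[OF fY that(1)]
      by (intro arr_minus_zer[OF ntD(1)[OF r that(1)]]) (simp_all add: contrib_def)
    have "isz (?r (j, 0))" if "0 \<le> j" "j \<le> N" for j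
    proof -
      have "(j, 0) \<in> zst N" "(j, 0) \<notin> rect N (q, p)" using that k' by (auto simp: rect_def)
      from same[OF this] show ?thesis using P that by simp
    qed
    moreover have "isz (?r (?e m'))" if "m' < Suc m" for m'
    proof (cases "m' = m")
      case True
      have "Y (q, p) (q, p) \<cdot> h \<cdot> X (q, p) (top_of N (q, p)) = r (q, p)"
        using arrD[OF ntD(1)[OF r kz]] h(2) by (metis id_cmp)
      then have "contrib N X Y (?e m) h (?e m) = r (q, p)"
        using inner_in(3)[OF kin] by (simp add: k contrib_def)
      then show ?thesis using True arrD[OF ntD(1)[OF r kz]] by (simp add: k isz_diff_iff)
    next
      case False
      then have m': "m' < m" using that by simp
      have "?e m' \<notin> rect N (q, p)"
      proof
        assume "?e m' \<in> rect N (q, p)"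
        then have "zle (?e m) (?e m')" using rect_zle(1) k by metis
        then show False using enum_mono m' by (metis not_le)
      qed
      from same[OF inner_in(1)[OF inn] this] show ?thesis using P m' by simp
    qed
    ultimately have "?P (Suc m) ?r \<and> ?Q m r ?r" using r' h(1) unfolding k by blast
    then show "\<exists>r'. ?P (Suc m) r' \<and> ?Q m r r'" by blast
  qed
  then obtain r where rP: "\<And>m. ?P m (r m)" and rQ: "\<And>m. ?Q m (r m) (r (Suc m))" by blast
  from rQ obtain h where h: "\<And>m. arr (h m) (X (top_of N (?e m)) (top_of N (?e m))) (Y (?e m) (?e m))"
    "\<And>m. r (Suc m) = (\<lambda>x. r m x \<boxplus> neg (contrib N X Y (?e m) (h m) x))" by metis
  have rnt: "nt (zst N) zle X Y (r m)" for m using rP by blast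
  obtain B u v i p A where s: "split_strip N B" "nt (zst N) zle X B u" "nt (zst N) zle B Y v"
    and b0: "\<forall>x\<in>zst N. bsum {m \<in> UNIV. x \<in> rect N (?e m)} A (B x x) (i x) (p x) \<and>
      (\<forall>m. m \<in> UNIV \<and> x \<in> rect N (?e m) \<longrightarrow>
        p x m \<cdot> u x = h m \<cdot> X x (top_of N (?e m)) \<and> v x \<cdot> i x m = Y (?e m) x)"
    using rect_factor[OF N X Y, of "UNIV :: nat set" ?e h, OF inn finite_rect_enum[OF n(1)] h(1)]
    by (elim exE conjE) (rule that)
  have b: "bsum {m \<in> UNIV. x \<in> rect N (?e m)} A (B x x) (i x) (p x)"
    "x \<in> rect N (?e m) \<Longrightarrow> p x m \<cdot> u x = h m \<cdot> X x (top_of N (?e m))"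
    "x \<in> rect N (?e m) \<Longrightarrow> v x \<cdot> i x m = Y (?e m) x" if "x \<in> zst N" for x m
    using bspec[OF b0 that] by blast+
  have fac: "factors N X Y (\<lambda>x. v x \<cdot> u x)" by (rule factorsI[OF s]) simp
  have low: "isz (v x \<cdot> u x)" if x: "x \<in> zst N" "snd x \<le> 0" for x
  proof -
    have "{m \<in> UNIV. x \<in> rect N (?e m)} = {}" using x(2) by (auto simp: rect_def enum_def)
    then have "zobj (B x x)" using bsum_empty_zobj b(1)[OF x(1)] by metis
    then show ?thesis using isz_through_zobj ntD(1)[OF s(2) x(1)] ntD(1)[OF s(3) x(1)] by blast
  qed
  have high: "v x \<cdot> u x = g x" if x: "x \<in> zst N" "snd x \<ge> 0" for x
  proof -
    let ?K = "{m \<in> UNIV. x \<in> rect N (?e m)}"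
    \<comment> \<open>a step of the enumeration by which all rectangles around \<open>x\<close> have been treated and nothing is left at \<open>x\<close>\<close>
    obtain M where M: "?K \<subseteq> {..<M}" "isz (r M x)"
    proof -
      obtain M0 where M0: "?K \<subseteq> {..<M0}" using finite_rect_enum[OF n(1), of x N] finite_nat_iff_bounded by blast
      obtain j k where xj: "x = (j, k)" by fastforce
      have "k = 0 \<or> j = k \<or> j = k + N \<or> 1 \<le> k \<and> inner N (j, k)"
        using x by (auto simp: inner_def xj)
      then consider "k = 0" | "j = k" | "j = k + N" | "1 \<le> k" "inner N (j, k)" by blast
      then show thesis
      proof cases
        case 1 then show thesis using that[OF M0] rP[of M0] x(1) by (auto simp: xj)
      next
        case 2 then show thesis using that[OF M0] xj
          isz_from_zobj[OF plusD(2)[OF X]] arrD[OF ntD(1)[OF rnt[of M0] x(1)]] by blast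
      next
        case 3 then show thesis using that[OF M0] xj
          isz_from_zobj[OF plusD(3)[OF X]] arrD[OF ntD(1)[OF rnt[of M0] x(1)]] by blast
      next
        case 4
        then obtain m where m: "?e m = x" using enum_surj[OF n(1)] n(2) xj by blast
        have "?K \<subseteq> {..<max M0 (Suc m)}" using M0 by auto
        moreover have "isz (r (max M0 (Suc m)) x)" using rP[of "max M0 (Suc m)"] m by (metis less_max_iff_disj lessI)
        ultimately show thesis by (rule that)
      qed
    qed
    note ux = ntD(1)[OF s(2) x(1)] and vx = ntD(1)[OF s(3) x(1)]
    have "r 0 x = v x \<cdot> u x"
    proof (rule bsum_telescope[OF b(1)[OF x(1)] M(1) ux vx, of "\<lambda>m. r m x"])
      show "arr (r m x) (X x x) (Y x x)" for m using ntD(1)[OF rnt x(1)] .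
      show "r (Suc m) x = r m x \<boxplus> neg (v x \<cdot> i x m \<cdot> p x m \<cdot> u x)" if "m \<in> ?K" for m
      proof -
        have "x \<in> rect N (?e m)" using that by simp
        moreover from this have "v x \<cdot> i x m \<cdot> p x m \<cdot> u x = Y (?e m) x \<cdot> h m \<cdot> X x (top_of N (?e m))"
          using b(2,3)[OF x(1)] by (simp flip: cmp_assoc)
        ultimately show ?thesis by (simp add: h(2) contrib_def)
      qed
      show "r (Suc m) x = r m x" if "m \<notin> ?K" for m
        using that isz_zer[OF fncD(1)[OF fX x(1)] fncD(1)[OF fY x(1)]]
          fncD(1)[OF fX x(1)] fncD(1)[OF fY x(1)] unfolding h(2)
        by (intro arr_minus_zer[OF ntD(1)[OF rnt x(1)]]) (simp_all add: contrib_def)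
      show "isz (r M x)" by (rule M(2))
      show "obj (A k)" if "k \<in> ?K" for k using arr_obj(2)[OF bsumD(3)[OF b(1)[OF x(1)] that]] .
    qed
    moreover have "r 0 = g" using rP[of 0] by blast
    ultimately show ?thesis by simp
  qed
  show ?thesis by (rule exI[of _ "\<lambda>x. v x \<cdot> u x"]) (use fac low high in blast)
qed

lemma vanishing_factor_left:
  assumes N: "N \<ge> 1" and X: "plus N X" and Y: "plus N Y" and g: "nt (zst N) zle X Y g"
    and g0: "\<And>j. 0 \<le> j \<Longrightarrow> j \<le> N \<Longrightarrow> isz (g (j, 0))"
  shows "\<exists>f. factors N X Y f \<and> (\<forall>x\<in>zst N. (snd x \<le> 0 \<longrightarrow> f x = g x) \<and> (snd x \<ge> 0 \<longrightarrow> isz (f x)))"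
proof -
  note dual = dual_additive_arrows and dwa = dual_weakly_abelian_arrows
  let ?X = "\<lambda>x y. X (flip N y) (flip N x)" and ?Y = "\<lambda>x y. Y (flip N y) (flip N x)"
  have g': "additive_arrows.nt ok (\<lambda>g f. f \<cdot> g) cd dm (zst N) zle ?Y ?X (\<lambda>x. g (flip N x))"
    by (rule dual_nt[OF g]) auto
  have "isz (g (flip N (j, 0)))" if "0 \<le> j" "j \<le> N" for j using g0[of "N - j"] that by simp
  from weakly_abelian_arrows.vanishing_factor_right[OF dwa N dual_plus[OF Y] dual_plus[OF X] g', unfolded dual_isz, OF this]
  obtain f where f: "weakly_abelian_arrows.factors ok (\<lambda>g f. f \<cdot> g) (\<lambda>X Y. zer Y X) cd dm N ?Y ?X f"
    "\<And>x. \<lbrakk>x \<in> zst N; 0 \<le> snd x\<rbrakk> \<Longrightarrow> f x = g (flip N x)" "\<And>x. \<lbrakk>x \<in> zst N; snd x \<le> 0\<rbrakk> \<Longrightarrow> isz (f x)" by blast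
  from f(1)[unfolded weakly_abelian_arrows.factors_def[OF dwa]]
  obtain B u v where B: "additive_arrows.split_strip ok (\<lambda>g f. f \<cdot> g) (\<lambda>X Y. zer Y X) cd dm N B"
    "additive_arrows.nt ok (\<lambda>g f. f \<cdot> g) cd dm (zst N) zle ?Y B u"
    "additive_arrows.nt ok (\<lambda>g f. f \<cdot> g) cd dm (zst N) zle B ?X v"
    "\<And>x. x \<in> zst N \<Longrightarrow> f x = u x \<cdot> v x" by blast
  define C where "C x y = B (flip N y) (flip N x)" for x y
  have BC: "B = (\<lambda>x y. C (flip N y) (flip N x))" by (simp add: C_def)
  have "plus N C"
    using weakly_abelian_arrows.dual_plus[OF dwa, of N B] B(1)[unfolded additive_arrows.split_strip_def[OF dual]]
    unfolding C_def by blast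
  moreover have "regular (C x y)" if "x \<in> zst N" "y \<in> zst N" "zle x y" for x y
    using B(1)[unfolded additive_arrows.split_strip_def[OF dual] dual_regular] that unfolding C_def by simp
  ultimately have C: "split_strip N C" unfolding split_strip_def by blast
  have fz: "{x. flip N x \<in> zst N} = zst N" by simp
  have "nt (zst N) zle X C (\<lambda>x. v (flip N x))" "nt (zst N) zle C Y (\<lambda>x. u (flip N x))"
    using nt_flip[OF B(3)[unfolded BC]] nt_flip[OF B(2)[unfolded BC]] unfolding fz .
  then have "factors N X Y (\<lambda>x. f (flip N x))"
    by (rule factorsI[OF C]) (simp add: B(4))
  moreover have "f (flip N x) = g x" if "x \<in> zst N" "snd x \<le> 0" for x
  proof -
    have "flip N x \<in> zst N" "0 \<le> snd (flip N x)" using that by (simp, simp add: flip_def)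
    from f(2)[OF this] show ?thesis by simp
  qed
  moreover have "isz (f (flip N x))" if "x \<in> zst N" "snd x \<ge> 0" for x
  proof (rule f(3))
    show "flip N x \<in> zst N" "snd (flip N x) \<le> 0" using that by (simp, simp add: flip_def)
  qed
  ultimately show ?thesis by blast
qed

text \<open>
  A morphism that vanishes on row \<open>0\<close> is the sum of its upper and its lower half.
\<close>

lemma vanishing_factors:
  assumes N: "N \<ge> 1" and X: "plus N X" and Y: "plus N Y" and g: "nt (zst N) zle X Y g"
    and g0: "\<And>j. 0 \<le> j \<Longrightarrow> j \<le> N \<Longrightarrow> isz (g (j, 0))"
  shows "factors N X Y g"
proof -
  obtain f where f: "factors N X Y f" "\<And>x. \<lbrakk>x \<in> zst N; snd x \<ge> 0\<rbrakk> \<Longrightarrow> f x = g x"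
      "\<And>x. \<lbrakk>x \<in> zst N; snd x \<le> 0\<rbrakk> \<Longrightarrow> isz (f x)"
    using vanishing_factor_right[OF assms] by blast
  obtain f' where f': "factors N X Y f'" "\<And>x. \<lbrakk>x \<in> zst N; snd x \<le> 0\<rbrakk> \<Longrightarrow> f' x = g x"
      "\<And>x. \<lbrakk>x \<in> zst N; snd x \<ge> 0\<rbrakk> \<Longrightarrow> isz (f' x)"
    using vanishing_factor_left[OF assms] by blast
  have "factors N X Y (\<lambda>x. f x \<boxplus> f' x)" using factors_add[OF _ f(1) f'(1)] N by simp
  then show ?thesis
  proof (rule factors_cong)
    fix x assume x: "x \<in> zst N"
    note t = arrD[OF ntD(1)[OF factors_nt[OF f(1)] x]] arrD[OF ntD(1)[OF factors_nt[OF f'(1)] x]]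
    show "g x = f x \<boxplus> f' x"
    proof (cases "snd x \<ge> 0")
      case True
      then show ?thesis using f(2)[OF x True] add_isz[OF f'(3)[OF x True], of "f x"] t by simp
    next
      case False
      then have l: "snd x \<le> 0" by simp
      show ?thesis using f'(2)[OF x l] isz_add[OF f(3)[OF x l], of "f' x"] t by simp
    qed
  qed
qed

text \<open>
  By the weak squares with a zero corner, the object at \<open>(q, p)\<close> is a weak kernel of the
  arrow of row \<open>0\<close> from \<open>q\<close> to \<open>p + N\<close>, and the end of the
  rectangle is a weak cokernel of the arrow from \<open>q - 1\<close> to
  \<open>p + N - 1\<close>. Hence regularity is inherited from row \<open>0\<close>.
\<close>

lemma regular_to_top:
  assumes X: "plus N X" and reg: "\<And>i j. \<lbrakk>0 \<le> i; i \<le> j; j \<le> N\<rbrakk> \<Longrightarrow> regular (X (i, 0) (j, 0))"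
    and k: "inner N (q, p)" "p \<le> 0" "0 < q"
  shows "regular (X (q, p) (top_of N (q, p)))"
proof -
  note f = fncD[OF plusD(1)[OF X]]
  define r where "r = p + N - 1"
  have k': "p < q" "q \<le> r" "r + 1 \<le> N" "r + 1 = p + N" using k by (auto simp: inner_def r_def)
  have t: "top_of N (q, p) = (r, q - 1)" by (simp add: top_of_def r_def)
  let ?a = "X (q - 1, 0) (q, 0)" and ?s = "X (q, 0) (r, 0)" and ?b = "X (r, 0) (r + 1, 0)"
  have sa: "?s \<cdot> ?a = X (q - 1, 0) (r, 0)" and bs: "?b \<cdot> ?s = X (q, 0) (r + 1, 0)"
    by (rule f(3); use k' k in simp)+
  have bsa: "?b \<cdot> ?s \<cdot> ?a = X (q - 1, 0) (r + 1, 0)"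
    unfolding sa by (rule f(3)) (use k' k in auto)
  have "wpb (X (q, p) (p + N, p)) (X (q, p) (q, 0)) (X (p + N, p) (p + N, 0)) (X (q, 0) (p + N, 0))"
    by (rule plusD(4)[OF X]) (use k' k in auto)
  then have "wker (X (q, p) (q, 0)) (X (q, 0) (p + N, 0))"
  proof (rule wpb_wker)
    have "cd (X (q, p) (p + N, p)) = X (p + N, p) (p + N, p)" by (rule arrD(3)[OF f(2)]) (use k' in auto)
    then show "zobj (cd (X (q, p) (p + N, p)))" using plusD(3)[OF X] by simp
  qed
  then have K: "wker (X (q, p) (q, 0)) (?b \<cdot> ?s)" unfolding bs by (simp only: k'(4))
  have "wpo (X (q - 1, 0) (r, 0)) (X (q - 1, 0) (q - 1, q - 1)) (X (r, 0) (r, q - 1)) (X (q - 1, q - 1) (r, q - 1))"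
    by (rule plus_wpo[OF X]) (use k' k in auto)
  then have "wcok (X (q - 1, 0) (r, 0)) (X (r, 0) (r, q - 1))"
  proof (rule wpo_wcok)
    have "cd (X (q - 1, 0) (q - 1, q - 1)) = X (q - 1, q - 1) (q - 1, q - 1)"
      by (rule arrD(3)[OF f(2)]) (use k' k in auto)
    then show "zobj (cd (X (q - 1, 0) (q - 1, q - 1)))" using plusD(2)[OF X] by simp
  qed
  then have C: "wcok (?s \<cdot> ?a) (X (r, 0) (r, q - 1))" unfolding sa .
  have "regular (X (r, 0) (r, q - 1) \<cdot> ?s \<cdot> X (q, p) (q, 0))"
  proof (rule regular_kernel_to_cokernel[OF _ _ _ _ K C])
    show "regular (?s \<cdot> ?a)" unfolding sa by (rule reg) (use k' k in auto)
    show "regular (?b \<cdot> ?s)" unfolding bs by (rule reg) (use k' k in auto)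
    show "regular ?s" by (rule reg) (use k' k in auto)
    show "regular (?b \<cdot> ?s \<cdot> ?a)" unfolding bsa by (rule reg) (use k' k in auto)
  qed
  moreover have "X (r, 0) (r, q - 1) \<cdot> ?s \<cdot> X (q, p) (q, 0) = X (q, p) (r, q - 1)"
  proof -
    have "?s \<cdot> X (q, p) (q, 0) = X (q, p) (r, 0)" by (rule f(3)) (use k' k in auto)
    moreover have "X (r, 0) (r, q - 1) \<cdot> X (q, p) (r, 0) = X (q, p) (r, q - 1)" by (rule f(3)) (use k' k in auto)
    ultimately show ?thesis by simp
  qed
  ultimately show ?thesis unfolding t by simp
qed

text \<open>
  Modulo morphisms that factor over split diagrams, the identity is replaced by an endomorphism
  \<open>e\<close> that vanishes on row \<open>0\<close>, and such an \<open>e\<close> factors itself.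
  Row \<open>0\<close> is treated from left to right. At the point \<open>p\<close>, \<open>e\<close>
  is made to vanish on the objects at \<open>(p, l)\<close>, for \<open>l\<close> from
  \<open>p - N\<close> up to \<open>0\<close>. There the composite of the arrow to
  \<open>(p, 0)\<close> with \<open>e\<close> kills the objects before \<open>(p, l)\<close>, so it
  is \<open>h t\<close> with \<open>t\<close> the arrow to the end of the rectangle. With
  \<open>g\<close> a quasi-inverse of \<open>t\<close>, the endomorphism \<open>c\<close> given by
  \<open>g\<close> on the rectangle satisfies \<open>h t c = h t g t = h t\<close> at
  \<open>(p, l)\<close>, and so \<open>e - e c\<close> vanishes there.
\<close>

lemma id_factors_if_row_regular:
  assumes N: "N \<ge> 1" and X: "plus N X" and reg: "\<And>i j. \<lbrakk>0 \<le> i; i \<le> j; j \<le> N\<rbrakk> \<Longrightarrow> regular (X (i, 0) (j, 0))"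
  shows "factors N X X (\<lambda>x. X x x)"
proof -
  note fX = plusD(1)[OF X]
  note f = fncD[OF fX]
  \<comment> \<open>the endomorphisms that can replace the identity\<close>
  define good where "good e \<longleftrightarrow> nt (zst N) zle X X e \<and> factors N X X (\<lambda>x. X x x \<boxplus> neg (e x))" for e
  have good_id: "good (\<lambda>x. X x x)"
  proof -
    have "nt (zst N) zle X X (\<lambda>x. X x x \<boxplus> neg (X x x))" by (rule nt_add[OF nt_id[OF fX] nt_neg[OF fX fX nt_id[OF fX]]])
    then have "factors N X X (\<lambda>x. X x x \<boxplus> neg (X x x))"
      by (rule vanishing_factors[OF N X X]) (use f(1) in \<open>simp add: isz_diff_iff\<close>)
    then show ?thesis unfolding good_def using nt_id[OF fX] by blast
  qed
  have good_step: "good (\<lambda>x. e x \<boxplus> neg (e x \<cdot> c x))" if e: "good e" and c: "factors N X X c" for e c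
  proof -
    have e1: "nt (zst N) zle X X e" and e2: "factors N X X (\<lambda>x. X x x \<boxplus> neg (e x))" using e by (auto simp: good_def)
    have ec: "nt (zst N) zle X X (\<lambda>x. e x \<cdot> c x)" using nt_cmp[OF factors_nt[OF c] e1] .
    have nte: "nt (zst N) zle X X (\<lambda>x. e x \<boxplus> neg (e x \<cdot> c x))" by (rule nt_add[OF e1 nt_neg[OF fX fX ec]])
    have "factors N X X (\<lambda>x. (X x x \<boxplus> neg (e x)) \<boxplus> e x \<cdot> c x)"
      using factors_add[OF _ e2 factors_cmp_left[OF c e1]] N by simp
    then have "factors N X X (\<lambda>x. X x x \<boxplus> neg (e x \<boxplus> neg (e x \<cdot> c x)))"
    proof (rule factors_cong)
      fix x assume x: "x \<in> zst N"
      let ?i = "X x x" and ?e = "e x" and ?d = "e x \<cdot> c x"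
      have t: "arr ?i ?i ?i" "arr ?e ?i ?i" "arr ?d ?i ?i"
        using arr_id[OF f(1)[OF x]] ntD(1)[OF e1 x] ntD(1)[OF ec x] by auto
      note [simp] = arrD[OF t(1)] arrD[OF t(2)] arrD[OF t(3)]
      have "neg (?e \<boxplus> neg ?d) = neg ?e \<boxplus> ?d"
      proof (rule neg_unique[symmetric])
        have "(?e \<boxplus> neg ?d) \<boxplus> (neg ?e \<boxplus> ?d) = ((?e \<boxplus> neg ?d) \<boxplus> ?d) \<boxplus> neg ?e"
          by (simp only: add_assoc add_comm[of "neg ?e" ?d])
        also have "\<dots> = ?e \<boxplus> neg ?e" using add_cancel_right[OF t(2,3)] by simp
        finally show "isz ((?e \<boxplus> neg ?d) \<boxplus> (neg ?e \<boxplus> ?d))" by (simp add: isz_diff_iff)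
      qed
      then show "?i \<boxplus> neg (?e \<boxplus> neg ?d) = (?i \<boxplus> neg ?e) \<boxplus> ?d" by (simp add: add_assoc)
    qed
    then show ?thesis unfolding good_def using nte by blast
  qed
  have mz: "isz (a \<boxplus> neg b)" if "isz a" "isz b" "dm a = dm b" "cd a = cd b" for a b
    using that isz_eq[OF that] isz_ok by (simp add: isz_diff_iff)
  have ezero: "isz (e x \<boxplus> neg (e x \<cdot> c x))" if "nt (zst N) zle X X e" "nt (zst N) zle X X c" "x \<in> zst N" "isz (e x)" for e c x
  proof (rule mz[OF that(4)])
    note t = arrD[OF ntD(1)[OF that(1,3)]] arrD[OF ntD(1)[OF that(2,3)]]
    show "isz (e x \<cdot> c x)" by (rule isz_cmp_left[OF that(4)]) (use t in simp)
    show "dm (e x) = dm (e x \<cdot> c x)" "cd (e x) = cd (e x \<cdot> c x)" using t by simp_all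
  qed
  have inner_loop: "\<exists>e. good e \<and> (\<forall>j. 0 \<le> j \<and> j < p \<longrightarrow> isz (e (j, 0))) \<and>
      isz (e (p, 0) \<cdot> X (p, p - N + int m) (p, 0))"
    if p: "1 \<le> p" "p < N" and e0: "\<exists>e. good e \<and> (\<forall>j. 0 \<le> j \<and> j < p \<longrightarrow> isz (e (j, 0)))"
      and "p - N + int m \<le> 0" for p m
    using that(4)
  proof (induction m)
    case 0
    obtain e where e: "good e" "\<forall>j. 0 \<le> j \<and> j < p \<longrightarrow> isz (e (j, 0))" using e0 by blast
    have e1: "nt (zst N) zle X X e" using e(1) by (simp add: good_def)
    have Xa: "arr (X (p, p - N) (p, 0)) (X (p, p - N) (p, p - N)) (X (p, 0) (p, 0))" by (rule f(2)) (use p in auto)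
    have "zobj (X (p, p - N) (p, p - N))" using plusD(3)[OF X, of "p - N"] by simp
    from isz_from_zobj[OF this] have "isz (e (p, 0) \<cdot> X (p, p - N) (p, 0))"
      using arrD[OF arr_cmp[OF Xa ntD(1)[OF e1]]] p by simp
    then show ?case using e by auto
  next
    case (Suc m)
    define l where "l = p - N + int m + 1"
    have l: "p - N + int (Suc m) = l" "p - N + int m = l - 1" "l \<le> 0" using Suc.prems by (auto simp: l_def)
    have "p - N + int m \<le> 0" using Suc.prems by simp
    from Suc.IH[OF this]
    obtain e where e: "good e" "\<forall>j. 0 \<le> j \<and> j < p \<longrightarrow> isz (e (j, 0))" "isz (e (p, 0) \<cdot> X (p, l - 1) (p, 0))"
      unfolding l(2) by blast
    have e1: "nt (zst N) zle X X e" using e(1) by (simp add: good_def)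
    have lN: "p \<le> l + N - 1" unfolding l_def by simp
    have kin: "inner N (p, l)" using l(3) lN p by (simp add: inner_def)
    have z: "(p, l) \<in> zst N" "(p, 0) \<in> zst N" using inner_in(1)[OF kin] p by auto
    have zl: "zle (p, l) (p, 0)" using l(3) by simp
    note ep = ntD(1)[OF e1 z(2)]
    let ?t = "top_of N (p, l)" and ?eps = "e (p, 0) \<cdot> X (p, l) (p, 0)"
    have eps: "arr ?eps (X (p, l) (p, l)) (X (p, 0) (p, 0))" by (rule arr_cmp[OF f(2)[OF z zl] ep])
    have "X (p, l) (p, 0) \<cdot> X (p, l - 1) (p, l) = X (p, l - 1) (p, 0)" by (rule f(3)) (use l(3) lN p in auto)
    then have z1: "isz (?eps \<cdot> X (p, l - 1) (p, l))" using e(3) by (simp add: cmp_assoc)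
    have z2: "isz (?eps \<cdot> X (p - 1, l) (p, l))"
    proof -
      have D: "(p - 1, l) \<in> zst N" "(p - 1, 0) \<in> zst N" using p l(3) lN by auto
      have "X (p, l) (p, 0) \<cdot> X (p - 1, l) (p, l) = X (p - 1, l) (p, 0)" by (rule f(3)) (use D z p l(3) in auto)
      moreover have "X (p - 1, 0) (p, 0) \<cdot> X (p - 1, l) (p - 1, 0) = X (p - 1, l) (p, 0)" by (rule f(3)) (use D z p l(3) in auto)
      ultimately have "?eps \<cdot> X (p - 1, l) (p, l) = (e (p, 0) \<cdot> X (p - 1, 0) (p, 0)) \<cdot> X (p - 1, l) (p - 1, 0)"
        by (simp add: cmp_assoc)
      also have "\<dots> = (X (p - 1, 0) (p, 0) \<cdot> e (p - 1, 0)) \<cdot> X (p - 1, l) (p - 1, 0)"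
        using ntD(2)[OF e1 D(2) z(2)] by simp
      finally have eq: "?eps \<cdot> X (p - 1, l) (p, l) = (X (p - 1, 0) (p, 0) \<cdot> e (p - 1, 0)) \<cdot> X (p - 1, l) (p - 1, 0)" .
      have a1: "arr (X (p - 1, 0) (p, 0) \<cdot> e (p - 1, 0)) (X (p - 1, 0) (p - 1, 0)) (X (p, 0) (p, 0))"
        by (rule arr_cmp[OF ntD(1)[OF e1 D(2)] f(2)[OF D(2) z(2)]]) simp
      have a2: "arr (X (p - 1, l) (p - 1, 0)) (X (p - 1, l) (p - 1, l)) (X (p - 1, 0) (p - 1, 0))"
        by (rule f(2)[OF D]) (use l(3) in simp)
      have "isz (X (p - 1, 0) (p, 0) \<cdot> e (p - 1, 0))"
        by (rule isz_cmp_right[OF _ arrD(1)[OF a1]]) (use e(2) p in simp)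
      from isz_cmp_left[OF this] show ?thesis unfolding eq using arrD(1)[OF arr_cmp[OF a2 a1]] by blast
    qed
    obtain h where h: "arr h (X ?t ?t) (X (p, 0) (p, 0))" "?eps = h \<cdot> X (p, l) ?t"
      using factor_through_top[OF X kin arrD(1,2)[OF eps] z1 z2] arrD(3)[OF eps] by auto
    have kt: "zle (p, l) ?t" "?t \<in> zst N" using rect_zle(2)[OF inner_in(3)[OF kin]] inner_in(2)[OF kin] .
    have Xt: "arr (X (p, l) ?t) (X (p, l) (p, l)) (X ?t ?t)" by (rule f(2)[OF z(1) kt(2,1)])
    have "regular (X (p, l) ?t)" by (rule regular_to_top[OF X reg kin]) (use l(3) p in auto)
    then obtain g where g: "arr g (X ?t ?t) (X (p, l) (p, l))" "X (p, l) ?t \<cdot> g \<cdot> X (p, l) ?t = X (p, l) ?t"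
      using regularE arrD[OF Xt] by metis
    let ?c = "contrib N X X (p, l) g" and ?e = "\<lambda>x. e x \<boxplus> neg (e x \<cdot> contrib N X X (p, l) g x)"
    have c: "factors N X X ?c" by (rule contrib_factors[OF N X X kin g(1)])
    note c1 = factors_nt[OF c]
    have G: "good ?e" by (rule good_step[OF e(1) c])
    have "isz (?e (j, 0))" if "0 \<le> j" "j < p" for j
      by (rule ezero[OF e1 c1]) (use that p e(2) in auto)
    moreover have "isz (?e (p, 0) \<cdot> X (p, l) (p, 0))"
    proof -
      have cc: "?c (p, l) = g \<cdot> X (p, l) ?t"
        using inner_in(3)[OF kin] arrD[OF arr_cmp[OF Xt g(1)]] by (simp add: contrib_def id_cmp)
      have "?eps \<cdot> ?c (p, l) = h \<cdot> X (p, l) ?t \<cdot> g \<cdot> X (p, l) ?t"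
        unfolding cc h(2) by (simp only: cmp_assoc)
      then have ee: "?eps \<cdot> ?c (p, l) = ?eps" unfolding g(2) h(2) .
      have "ok (e (p, 0) \<cdot> ?c (p, 0) \<cdot> X (p, l) (p, 0))"
        using arrD(1)[OF arr_cmp[OF f(2)[OF z zl] arr_cmp[OF ntD(1)[OF c1 z(2)] ep]]] by (simp only: cmp_assoc)
      then have "?e (p, 0) \<cdot> X (p, l) (p, 0) = ?eps \<boxplus> neg (e (p, 0) \<cdot> ?c (p, 0) \<cdot> X (p, l) (p, 0))"
        by (simp add: add_cmp neg_cmp cmp_assoc)
      also have "e (p, 0) \<cdot> ?c (p, 0) \<cdot> X (p, l) (p, 0) = ?eps \<cdot> ?c (p, l)"
        unfolding ntD(2)[OF c1 z zl] by (simp only: cmp_assoc)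
      finally show ?thesis unfolding ee using arrD(1)[OF eps] by (simp only: isz_diff_iff)
    qed
    ultimately show ?case unfolding l(1) using G by blast
  qed
  have "\<exists>e. good e \<and> (\<forall>j. 0 \<le> j \<and> j < 1 + int m \<longrightarrow> isz (e (j, 0)))" if "1 + int m \<le> N" for m
    using that
  proof (induction m)
    case 0
    have "isz (X (0, 0) (0, 0))" using plusD(2)[OF X] by (simp add: zobj_def)
    moreover have "j = 0" if "0 \<le> j \<and> j < 1 + int 0" for j :: int using that by simp
    ultimately have "isz (X (j, 0) (j, 0))" if "0 \<le> j \<and> j < 1 + int 0" for j using that by metis
    then show ?case using good_id by (intro exI[of _ "\<lambda>x. X x x"]) blast
  next
    case (Suc m)
    define p where "p = 1 + int m"
    have p: "1 \<le> p" "p < N" using Suc.prems by (auto simp: p_def)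
    have "p - N + int (nat (N - p)) = 0" using p by simp
    with inner_loop[OF p, of "nat (N - p)"] Suc.IH
    obtain e where e: "good e" "\<forall>j. 0 \<le> j \<and> j < p \<longrightarrow> isz (e (j, 0))" "isz (e (p, 0) \<cdot> X (p, 0) (p, 0))"
      using p by (auto simp: p_def)
    have "e (p, 0) \<cdot> X (p, 0) (p, 0) = e (p, 0)"
      using arrD[OF ntD(1), of "zst N" zle X X e "(p, 0)"] e(1) p by (simp add: good_def cmp_id)
    then have "isz (e (j, 0))" if "0 \<le> j \<and> j < 1 + int (Suc m)" for j
      using e(2,3) that by (cases "j = p") (auto simp: p_def)
    then show ?case using e(1) by blast
  qed
  from this[of "nat (N - 1)"] obtain e where e: "good e" "\<And>j. 0 \<le> j \<Longrightarrow> j < N \<Longrightarrow> isz (e (j, 0))" using N by auto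
  have e1: "nt (zst N) zle X X e" and e2: "factors N X X (\<lambda>x. X x x \<boxplus> neg (e x))" using e(1) by (auto simp: good_def)
  have "isz (e (j, 0))" if "0 \<le> j" "j \<le> N" for j
  proof (cases "j = N")
    case True
    have "zobj (X (N, 0) (N, 0))" using plusD(3)[OF X, of 0] by simp
    then show ?thesis using isz_from_zobj arrD[OF ntD(1)[OF e1, of "(N, 0)"]] N unfolding True by simp
  next
    case False
    then show ?thesis using e(2) that by simp
  qed
  then have "factors N X X e" by (rule vanishing_factors[OF N X X e1])
  then have "factors N X X (\<lambda>x. (X x x \<boxplus> neg (e x)) \<boxplus> e x)" using factors_add[OF _ e2] N by simp
  then show ?thesis
    by (rule factors_cong) (use add_cancel_right[OF arr_id[OF f(1)] ntD(1)[OF e1]] in simp)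
qed

text \<open>
  The objects at both ends of row \<open>0\<close> are zero, so a morphism of the inner part of the row extends
  to the row, and from there to the strip.
\<close>

lemma nt_extend_inner:
  assumes N: "N \<ge> 1" and U: "plus N U" and V: "plus N V"
    and s: "nt {1..N - 1} (\<le>) (\<lambda>i j. U (i, 0) (j, 0)) (\<lambda>i j. V (i, 0) (j, 0)) s"
  shows "\<exists>t. nt (zst N) zle U V t \<and> (\<forall>j. 1 \<le> j \<and> j \<le> N - 1 \<longrightarrow> t (j, 0) = s j)"
proof -
  note fU = fncD[OF plusD(1)[OF U]] and fV = fncD[OF plusD(1)[OF V]]
  define s' where "s' j = (if 1 \<le> j \<and> j \<le> N - 1 then s j else zer (U (j, 0) (j, 0)) (V (j, 0) (j, 0)))" for j
  have bnd: "zobj (U (j, 0) (j, 0)) \<and> zobj (V (j, 0) (j, 0))" if "j = 0 \<or> j = N" for j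
    using that plusD(2,3)[OF U, of 0] plusD(2,3)[OF V, of 0] by auto
  have s'a: "arr (s' j) (U (j, 0) (j, 0)) (V (j, 0) (j, 0))" if "0 \<le> j" "j \<le> N" for j
  proof -
    have "obj (U (j, 0) (j, 0))" "obj (V (j, 0) (j, 0))" using fU(1) fV(1) that by simp_all
    then show ?thesis using ntD(1)[OF s, of j] arr_zer by (simp add: s'_def)
  qed
  have "row_nt N U V 0 s'"
    unfolding row_nt_def
  proof (intro conjI allI impI)
    fix j assume "0 \<le> j \<and> j \<le> 0 + N" then show "arr (s' j) (U (j, 0) (j, 0)) (V (j, 0) (j, 0))" using s'a by simp
  next
    fix j j' assume j: "0 \<le> j \<and> j \<le> j' \<and> j' \<le> 0 + N"
    have Ua: "arr (U (j, 0) (j', 0)) (U (j, 0) (j, 0)) (U (j', 0) (j', 0))" by (rule fU(2)) (use j in auto)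
    have Va: "arr (V (j, 0) (j', 0)) (V (j, 0) (j, 0)) (V (j', 0) (j', 0))" by (rule fV(2)) (use j in auto)
    have L: "arr (s' j' \<cdot> U (j, 0) (j', 0)) (U (j, 0) (j, 0)) (V (j', 0) (j', 0))" by (rule arr_cmp[OF Ua s'a]) (use j in auto)
    have R: "arr (V (j, 0) (j', 0) \<cdot> s' j) (U (j, 0) (j, 0)) (V (j', 0) (j', 0))" by (rule arr_cmp[OF s'a Va]) (use j in auto)
    have "j = 0 \<or> j' = N \<or> 1 \<le> j \<and> j' \<le> N - 1" using j by linarith
    then consider "j = 0" | "j' = N" | "1 \<le> j" "j' \<le> N - 1" by blast
    then show "s' j' \<cdot> U (j, 0) (j', 0) = V (j, 0) (j', 0) \<cdot> s' j"
    proof cases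
      case 1
      then have z: "zobj (U (j, 0) (j, 0))" using bnd by blast
      show ?thesis using isz_eq[OF isz_from_zobj[OF z arrD(1,2)[OF L]] isz_from_zobj[OF z arrD(1,2)[OF R]]] arrD[OF L] arrD[OF R] by simp
    next
      case 2
      then have z: "zobj (V (j', 0) (j', 0))" using bnd by blast
      show ?thesis using isz_eq[OF isz_to_zobj[OF z arrD(1,3)[OF L]] isz_to_zobj[OF z arrD(1,3)[OF R]]] arrD[OF L] arrD[OF R] by simp
    next
      case 3
      then show ?thesis using ntD(2)[OF s, of j j'] j by (simp add: s'_def)
    qed
  qed
  then obtain t where "nt (zst N) zle U V t" "\<And>j. t (j, 0) = s' j" using nt_extend[OF U V N] by blast
  then show ?thesis by (intro exI[of _ t]) (simp add: s'_def)
qed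

text \<open>
  Extend \<open>A\<close> to a diagram \<open>S\<close>, and \<open>a\<close> and \<open>b\<close> to
  morphisms \<open>u : X \<rightarrow> S\<close> and \<open>v : S \<rightarrow> Y\<close>. The
  identity of \<open>S\<close> factors over a split diagram, as row \<open>0\<close> of
  \<open>S\<close> is regular, and hence so does \<open>v u\<close>. The difference
  \<open>g - v u\<close> vanishes on row \<open>0\<close>.
\<close>

theorem factors_if_row_factors:
  assumes N: "N \<ge> 1" and X: "plus N X" and Y: "plus N Y" and g: "nt (zst N) zle X Y g"
    and A: "fnc {1..N - 1} (\<le>) A" and reg: "\<And>i j. \<lbrakk>1 \<le> i; i \<le> j; j \<le> N - 1\<rbrakk> \<Longrightarrow> regular (A i j)"
    and a: "nt {1..N - 1} (\<le>) (\<lambda>i j. X (i, 0) (j, 0)) A a"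
    and b: "nt {1..N - 1} (\<le>) A (\<lambda>i j. Y (i, 0) (j, 0)) b"
    and gab: "\<And>j. \<lbrakk>1 \<le> j; j \<le> N - 1\<rbrakk> \<Longrightarrow> g (j, 0) = b j \<cdot> a j"
  shows "factors N X Y g"
proof -
  obtain S where S: "plus N S" "\<And>i j. \<lbrakk>1 \<le> i; i \<le> j; j \<le> N - 1\<rbrakk> \<Longrightarrow> S (i, 0) (j, 0) = A i j"
    using plus_extends[OF N A] by blast
  have a': "nt {1..N - 1} (\<le>) (\<lambda>i j. X (i, 0) (j, 0)) (\<lambda>i j. S (i, 0) (j, 0)) a"
    using a S(2) unfolding nt_def by simp
  have b': "nt {1..N - 1} (\<le>) (\<lambda>i j. S (i, 0) (j, 0)) (\<lambda>i j. Y (i, 0) (j, 0)) b"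
    using b S(2) unfolding nt_def by simp
  obtain u where u: "nt (zst N) zle X S u" "\<And>j. \<lbrakk>1 \<le> j; j \<le> N - 1\<rbrakk> \<Longrightarrow> u (j, 0) = a j"
    using nt_extend_inner[OF N X S(1) a'] by blast
  obtain v where v: "nt (zst N) zle S Y v" "\<And>j. \<lbrakk>1 \<le> j; j \<le> N - 1\<rbrakk> \<Longrightarrow> v (j, 0) = b j"
    using nt_extend_inner[OF N S(1) Y b'] by blast
  have "regular (S (i, 0) (j, 0))" if ij: "0 \<le> i" "i \<le> j" "j \<le> N" for i j
  proof -
    have Sa: "arr (S (i, 0) (j, 0)) (S (i, 0) (i, 0)) (S (j, 0) (j, 0))"
      by (rule fncD(2)[OF plusD(1)[OF S(1)]]) (use ij in auto)
    have "i = 0 \<or> j = N \<or> 1 \<le> i \<and> j \<le> N - 1" using ij by linarith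
    then consider "i = 0" | "j = N" | "1 \<le> i" "j \<le> N - 1" by blast
    then show ?thesis
    proof cases
      case 1
      then have "zobj (S (i, 0) (i, 0))" using plusD(2)[OF S(1), of 0] by simp
      then show ?thesis using regular_isz isz_from_zobj arrD[OF Sa] by blast
    next
      case 2
      then have "zobj (S (j, 0) (j, 0))" using plusD(3)[OF S(1), of 0] by simp
      then show ?thesis using regular_isz isz_to_zobj arrD[OF Sa] by blast
    next
      case 3
      then show ?thesis using S(2) reg ij by simp
    qed
  qed
  then have idS: "factors N S S (\<lambda>x. S x x)" by (rule id_factors_if_row_regular[OF N S(1)])
  have vu: "nt (zst N) zle X Y (\<lambda>x. v x \<cdot> u x)" by (rule nt_cmp[OF u(1) v(1)])
  have "factors N X Y (\<lambda>x. (v x \<cdot> S x x) \<cdot> u x)"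
    using factors_cmp_right[OF factors_cmp_left[OF idS v(1)] u(1)] .
  then have 1: "factors N X Y (\<lambda>x. v x \<cdot> u x)"
    by (rule factors_cong) (use arrD[OF ntD(1)[OF v(1)]] in \<open>simp add: cmp_id\<close>)
  have d: "nt (zst N) zle X Y (\<lambda>x. g x \<boxplus> neg (v x \<cdot> u x))"
    by (rule nt_add[OF g nt_neg[OF plusD(1)[OF X] plusD(1)[OF Y] vu]])
  have "isz (g (j, 0) \<boxplus> neg (v (j, 0) \<cdot> u (j, 0)))" if "0 \<le> j" "j \<le> N" for j
  proof (cases "j = 0 \<or> j = N")
    case True
    then have "zobj (X (j, 0) (j, 0))" using plusD(2,3)[OF X, of 0] by auto
    then show ?thesis using isz_from_zobj arrD[OF ntD(1)[OF d, of "(j, 0)"]] that by simp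
  next
    case False
    then show ?thesis using gab[of j] u(2)[of j] v(2)[of j] that arrD(1)[OF ntD(1)[OF g, of "(j, 0)"]]
      by (simp add: isz_diff_iff)
  qed
  then have 2: "factors N X Y (\<lambda>x. g x \<boxplus> neg (v x \<cdot> u x))" by (rule vanishing_factors[OF N X Y d])
  have "factors N X Y (\<lambda>x. (g x \<boxplus> neg (v x \<cdot> u x)) \<boxplus> v x \<cdot> u x)" using factors_add[OF _ 2 1] N by simp
  then show ?thesis
    by (rule factors_cong) (use add_cancel_right[OF ntD(1)[OF g] ntD(1)[OF vu]] in simp)
qed

end

section \<open>The arrows of a preadditive category\<close>

text \<open>
  The algebra of arrows of a category whose Hom sets need not be disjoint: arrows carry their domain
  and codomain, and \<open>None\<close> is the result of an undefined operation.
\<close>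

type_synonym ('o, 'm) arrow = "('o \<times> 'm \<times> 'o) option"

definition arrow_ok :: "('o, 'm) precat \<Rightarrow> ('o, 'm) arrow \<Rightarrow> bool"
  where "arrow_ok A a = (case a of None \<Rightarrow> False | Some (X, f, Y) \<Rightarrow> X \<in> Obj A \<and> Y \<in> Obj A \<and> f \<in> Mor A X Y)"

definition arrow_cmp :: "('o, 'm) precat \<Rightarrow> ('o, 'm) arrow \<Rightarrow> ('o, 'm) arrow \<Rightarrow> ('o, 'm) arrow"
  where "arrow_cmp A b a = (case b of None \<Rightarrow> None | Some (Y', g, Z) \<Rightarrow> (case a of None \<Rightarrow> None | Some (X, f, Y) \<Rightarrow>
    if X \<in> Obj A \<and> Y \<in> Obj A \<and> Z \<in> Obj A \<and> f \<in> Mor A X Y \<and> g \<in> Mor A Y Z \<and> Y' = Y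
    then Some (X, Cmp A X Y Z g f, Z) else None))"

definition arrow_add :: "('o, 'm) precat \<Rightarrow> ('o, 'm) arrow \<Rightarrow> ('o, 'm) arrow \<Rightarrow> ('o, 'm) arrow"
  where "arrow_add A a b = (case a of None \<Rightarrow> None | Some (X, f, Y) \<Rightarrow> (case b of None \<Rightarrow> None | Some (X', g, Y') \<Rightarrow>
    if X \<in> Obj A \<and> Y \<in> Obj A \<and> f \<in> Mor A X Y \<and> g \<in> Mor A X Y \<and> X' = X \<and> Y' = Y
    then Some (X, f \<otimes>\<^bsub>Hom A X Y\<^esub> g, Y) else None))"

definition arrow_neg :: "('o, 'm) precat \<Rightarrow> ('o, 'm) arrow \<Rightarrow> ('o, 'm) arrow"
  where "arrow_neg A a = (case a of None \<Rightarrow> None | Some (X, f, Y) \<Rightarrow>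
    if X \<in> Obj A \<and> Y \<in> Obj A \<and> f \<in> Mor A X Y then Some (X, inv\<^bsub>Hom A X Y\<^esub> f, Y) else None)"

definition arrow_dm :: "('o, 'm) precat \<Rightarrow> ('o, 'm) arrow \<Rightarrow> ('o, 'm) arrow"
  where "arrow_dm A a = (case a of None \<Rightarrow> None | Some (X, f, Y) \<Rightarrow> Some (X, Idm A X, X))"

definition arrow_cd :: "('o, 'm) precat \<Rightarrow> ('o, 'm) arrow \<Rightarrow> ('o, 'm) arrow"
  where "arrow_cd A a = (case a of None \<Rightarrow> None | Some (X, f, Y) \<Rightarrow> Some (Y, Idm A Y, Y))"

definition arrow_zer :: "('o, 'm) precat \<Rightarrow> ('o, 'm) arrow \<Rightarrow> ('o, 'm) arrow \<Rightarrow> ('o, 'm) arrow"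
  where "arrow_zer A a b = (case a of None \<Rightarrow> None | Some (X, f, X') \<Rightarrow> (case b of None \<Rightarrow> None | Some (Y, g, Y') \<Rightarrow>
    Some (X, Zmor A X Y, Y)))"

lemma arrow_simps [simp]:
  "arrow_ok A (Some (X, f, Y)) \<longleftrightarrow> X \<in> Obj A \<and> Y \<in> Obj A \<and> f \<in> Mor A X Y" "\<not> arrow_ok A None"
  "arrow_dm A (Some (X, f, Y)) = Some (X, Idm A X, X)"
  "arrow_cd A (Some (X, f, Y)) = Some (Y, Idm A Y, Y)"
  "arrow_zer A (Some (X, f, X')) (Some (Y, g, Y')) = Some (X, Zmor A X Y, Y)"
  "arrow_cmp A None a = None" "arrow_cmp A a None = None"
  "arrow_add A None a = None" "arrow_add A a None = None" "arrow_neg A None = None"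
  by (auto simp: arrow_ok_def arrow_dm_def arrow_cd_def arrow_zer_def arrow_cmp_def arrow_add_def arrow_neg_def
      split: option.split)

lemma arrow_cmp_Some: "arrow_cmp A (Some (Y', g, Z)) (Some (X, f, Y)) =
    (if X \<in> Obj A \<and> Y \<in> Obj A \<and> Z \<in> Obj A \<and> f \<in> Mor A X Y \<and> g \<in> Mor A Y Z \<and> Y' = Y
    then Some (X, Cmp A X Y Z g f, Z) else None)"
  by (simp add: arrow_cmp_def)

lemma arrow_add_Some: "arrow_add A (Some (X, f, Y)) (Some (X', g, Y')) =
    (if X \<in> Obj A \<and> Y \<in> Obj A \<and> f \<in> Mor A X Y \<and> g \<in> Mor A X Y \<and> X' = X \<and> Y' = Y
    then Some (X, f \<otimes>\<^bsub>Hom A X Y\<^esub> g, Y) else None)"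
  by (simp add: arrow_add_def)

lemma arrow_neg_Some: "arrow_neg A (Some (X, f, Y)) =
    (if X \<in> Obj A \<and> Y \<in> Obj A \<and> f \<in> Mor A X Y then Some (X, inv\<^bsub>Hom A X Y\<^esub> f, Y) else None)"
  by (simp add: arrow_neg_def)

lemma arrow_okE:
  assumes "arrow_ok A a" obtains X f Y where "a = Some (X, f, Y)" "X \<in> Obj A" "Y \<in> Obj A" "f \<in> Mor A X Y"
  using assms by (auto simp: arrow_ok_def split: option.splits)

lemma arrow_cases:
  obtains "a = None" | X f Y where "a = Some (X, f, Y)"
  by (cases a) auto

context preadditive_category
begin

lemma hom_group: "X \<in> Obj A \<Longrightarrow> Y \<in> Obj A \<Longrightarrow> group (Hom A X Y)"
  using hom_comm_group unfolding comm_group_def by blast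

lemma add_closed: "\<lbrakk>X \<in> Obj A; Y \<in> Obj A; f \<in> Mor A X Y; g \<in> Mor A X Y\<rbrakk> \<Longrightarrow> f \<otimes>\<^bsub>Hom A X Y\<^esub> g \<in> Mor A X Y"
  using hom_group group.is_monoid monoid.m_closed by metis

lemma inv_closed: "\<lbrakk>X \<in> Obj A; Y \<in> Obj A; f \<in> Mor A X Y\<rbrakk> \<Longrightarrow> inv\<^bsub>Hom A X Y\<^esub> f \<in> Mor A X Y"
  using hom_group group.inv_closed by metis

lemma zero_closed: "\<lbrakk>X \<in> Obj A; Y \<in> Obj A\<rbrakk> \<Longrightarrow> Zmor A X Y \<in> Mor A X Y"
  using hom_group group.is_monoid monoid.one_closed by metis

lemma arrow_cmp_assoc: "arrow_cmp A (arrow_cmp A c b) a = arrow_cmp A c (arrow_cmp A b a)"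
proof (cases a rule: arrow_cases; cases b rule: arrow_cases; cases c rule: arrow_cases)
  fix X f Y Y' g Z Z' h W
  assume e: "a = Some (X, f, Y)" "b = Some (Y', g, Z)" "c = Some (Z', h, W)"
  show ?thesis
  proof (cases "X \<in> Obj A \<and> Y \<in> Obj A \<and> Z \<in> Obj A \<and> W \<in> Obj A \<and> f \<in> Mor A X Y \<and> g \<in> Mor A Y Z \<and> h \<in> Mor A Z W \<and> Y' = Y \<and> Z' = Z")
    case True
    then show ?thesis unfolding e by (simp add: arrow_cmp_Some cmp_closed cmp_assoc)
  next
    case False
    then show ?thesis unfolding e by (auto simp: arrow_cmp_Some)
  qed
qed auto

lemma arrow_add_assoc: "arrow_add A (arrow_add A a b) c = arrow_add A a (arrow_add A b c)"
proof (cases a rule: arrow_cases; cases b rule: arrow_cases; cases c rule: arrow_cases)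
  fix X f Y X' g Y' X'' h Y''
  assume e: "a = Some (X, f, Y)" "b = Some (X', g, Y')" "c = Some (X'', h, Y'')"
  show ?thesis
  proof (cases "X \<in> Obj A \<and> Y \<in> Obj A \<and> f \<in> Mor A X Y \<and> g \<in> Mor A X Y \<and> h \<in> Mor A X Y \<and> X' = X \<and> Y' = Y \<and> X'' = X \<and> Y'' = Y")
    case True
    then show ?thesis unfolding e
      using monoid.m_assoc[OF group.is_monoid[OF hom_group]] by (simp add: arrow_add_Some add_closed)
  next
    case False
    then show ?thesis unfolding e by (auto simp: arrow_add_Some)
  qed
qed auto

lemma arrow_add_comm: "arrow_add A a b = arrow_add A b a"
  using comm_monoid.m_comm[OF comm_group.axioms(1)[OF hom_comm_group]]
  by (cases a rule: arrow_cases; cases b rule: arrow_cases) (auto simp: arrow_add_Some)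

lemma arrow_cmp_add: "arrow_cmp A c (arrow_add A a b) = arrow_add A (arrow_cmp A c a) (arrow_cmp A c b)"
proof (cases a rule: arrow_cases; cases b rule: arrow_cases; cases c rule: arrow_cases)
  fix X f Y X' g Y' Y'' h Z
  assume e: "a = Some (X, f, Y)" "b = Some (X', g, Y')" "c = Some (Y'', h, Z)"
  show ?thesis
  proof (cases "X \<in> Obj A \<and> Y \<in> Obj A \<and> Z \<in> Obj A \<and> f \<in> Mor A X Y \<and> g \<in> Mor A X Y \<and> h \<in> Mor A Y Z \<and> X' = X \<and> Y' = Y \<and> Y'' = Y")
    case True
    then show ?thesis unfolding e by (simp add: arrow_add_Some arrow_cmp_Some add_closed cmp_closed cmp_add_right)
  next
    case False
    then show ?thesis unfolding e by (auto simp: arrow_add_Some arrow_cmp_Some)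
  qed
qed auto

lemma arrow_add_cmp: "arrow_cmp A (arrow_add A a b) c = arrow_add A (arrow_cmp A a c) (arrow_cmp A b c)"
proof (cases a rule: arrow_cases; cases b rule: arrow_cases; cases c rule: arrow_cases)
  fix Y f Z Y' g Z' X h Y''
  assume e: "a = Some (Y, f, Z)" "b = Some (Y', g, Z')" "c = Some (X, h, Y'')"
  show ?thesis
  proof (cases "X \<in> Obj A \<and> Y \<in> Obj A \<and> Z \<in> Obj A \<and> f \<in> Mor A Y Z \<and> g \<in> Mor A Y Z \<and> h \<in> Mor A X Y \<and> Y' = Y \<and> Z' = Z \<and> Y'' = Y")
    case True
    then show ?thesis unfolding e by (simp add: arrow_add_Some arrow_cmp_Some add_closed cmp_closed cmp_add_left)
  next
    case False
    then show ?thesis unfolding e by (cases "Y' = Y"; cases "Z' = Z"; cases "Y'' = Y"; simp add: arrow_add_Some arrow_cmp_Some; blast?)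
  qed
qed auto

sublocale arr: additive_arrows "arrow_ok A" "arrow_cmp A" "arrow_add A" "arrow_neg A" "arrow_zer A" "arrow_dm A" "arrow_cd A"
proof (unfold_locales, goal_cases)
  case (1 g f)
  show ?case by (cases g rule: arrow_cases; cases f rule: arrow_cases) (auto simp: arrow_cmp_Some cmp_closed)
next
  case (2 g f) then show ?case by (elim arrow_okE) (auto simp: arrow_cmp_Some)
next
  case (3 g f) then show ?case by (elim arrow_okE) (auto simp: arrow_cmp_Some)
next
  case 4 show ?case by (rule arrow_cmp_assoc)
next
  case (5 f) then show ?case by (elim arrow_okE) (auto simp: id_closed)
next
  case (6 f) then show ?case by (elim arrow_okE) (auto simp: id_closed)
next
  case (7 f) then show ?case by (elim arrow_okE) auto
next
  case (8 f) then show ?case by (elim arrow_okE) auto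
next
  case (9 f) then show ?case by (elim arrow_okE) auto
next
  case (10 f) then show ?case by (elim arrow_okE) auto
next
  case (11 f) then show ?case by (elim arrow_okE) (auto simp: arrow_cmp_Some id_closed cmp_id_right)
next
  case (12 f) then show ?case by (elim arrow_okE) (auto simp: arrow_cmp_Some id_closed cmp_id_left)
next
  case (13 f g)
  show ?case by (cases f rule: arrow_cases; cases g rule: arrow_cases) (auto simp: arrow_add_Some add_closed)
next
  case (14 f g) then show ?case by (elim arrow_okE) (auto simp: arrow_add_Some)
next
  case (15 f g) then show ?case by (elim arrow_okE) (auto simp: arrow_add_Some)
next
  case 16 show ?case by (rule arrow_add_assoc)
next
  case 17 show ?case by (rule arrow_add_comm)
next
  case 18 show ?case by (rule arrow_cmp_add)
next
  case 19 show ?case by (rule arrow_add_cmp)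
next
  case (20 f) show ?case by (cases f rule: arrow_cases) (auto simp: arrow_neg_Some inv_closed)
next
  case (21 f) then show ?case by (elim arrow_okE) (auto simp: arrow_neg_Some)
next
  case (22 f) then show ?case by (elim arrow_okE) (auto simp: arrow_neg_Some)
next
  case (23 f) then show ?case
    by (elim arrow_okE) (auto simp: arrow_neg_Some arrow_add_Some inv_closed group.r_inv[OF hom_group])
next
  case (24 X Y) then show ?case by (elim arrow_okE) (auto simp: zero_closed)
next
  case (25 X Y) then show ?case by (elim arrow_okE) auto
next
  case (26 X Y) then show ?case by (elim arrow_okE) auto
next
  case (27 f) then show ?case
    by (elim arrow_okE) (auto simp: arrow_add_Some zero_closed monoid.r_one[OF group.is_monoid[OF hom_group]])
qed

abbreviation ida :: "'o \<Rightarrow> ('o, 'm) arrow"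
  where "ida X \<equiv> Some (X, Idm A X, X)"

lemma arr_obj_iff: "arr.obj a \<longleftrightarrow> (\<exists>X\<in>Obj A. a = ida X)"
  unfolding arr.obj_def by (cases a rule: arrow_cases) (auto simp: id_closed)

lemma arr_arr_iff: "arr.arr a (ida X) (ida Y) \<longleftrightarrow> X \<in> Obj A \<and> Y \<in> Obj A \<and> (\<exists>f\<in>Mor A X Y. a = Some (X, f, Y))"
  unfolding arr.arr_def by (cases a rule: arrow_cases) auto

lemma arr_isz_iff: "arr.isz (Some (X, f, Y)) \<longleftrightarrow> X \<in> Obj A \<and> Y \<in> Obj A \<and> f = Zmor A X Y"
  unfolding arr.isz_def by (auto simp: zero_closed)

lemma arr_zobj_iff: "arr.zobj (ida Z) \<longleftrightarrow> is_zero_object A Z"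
proof
  assume z: "arr.zobj (ida Z)"
  then have Z: "Z \<in> Obj A" unfolding arr.zobj_def arr_obj_iff by auto
  have "f = Zmor A X Z" if "X \<in> Obj A" "f \<in> Mor A X Z" for X f
    using arr.isz_to_zobj[OF z, of "Some (X, f, Z)"] that Z by (simp add: arr_isz_iff)
  moreover have "f = Zmor A Z X" if "X \<in> Obj A" "f \<in> Mor A Z X" for X f
    using arr.isz_from_zobj[OF z, of "Some (Z, f, X)"] that Z by (simp add: arr_isz_iff)
  ultimately show "is_zero_object A Z" unfolding is_zero_object_def using Z zero_closed by metis
next
  assume "is_zero_object A Z"
  then have Z: "Z \<in> Obj A" "Idm A Z = Zmor A Z Z"
    unfolding is_zero_object_def using zero_closed id_closed by metis+
  then show "arr.zobj (ida Z)" unfolding arr.zobj_def arr_obj_iff by (auto simp: arr_isz_iff)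
qed

lemma is_biproduct_iff:
  "is_biproduct A X Y P i j p q \<longleftrightarrow>
    arr.biprod (ida X) (ida Y) (ida P) (Some (X, i, P)) (Some (Y, j, P)) (Some (P, p, X)) (Some (P, q, Y))"
  unfolding is_biproduct_def arr.biprod_def arr_arr_iff
  by (auto simp: arrow_cmp_Some arrow_add_Some cmp_closed)

text \<open>A split morphism of the shape \<open>X \<oplus> Y \<rightarrow> Y \<oplus> Z\<close> has its transpose as a quasi-inverse.\<close>

lemma is_split_imp_regular:
  assumes f: "f \<in> Mor A V W" "V \<in> Obj A" "W \<in> Obj A" and s: "is_split A V f W"
  shows "arr.regular (Some (V, f, W))"
proof -
  obtain X Y Z P iX iY pX pY Q jY jZ qY qZ m where
    P0: "is_biproduct A X Y P iX iY pX pY" and Q0: "is_biproduct A Y Z Q jY jZ qY qZ" and m: "m \<in> Mor A P Q"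
    and mm: "Cmp A X P Y (Cmp A P Q Y qY m) iX = Zmor A X Y" "Cmp A Y P Y (Cmp A P Q Y qY m) iY = Idm A Y"
      "Cmp A X P Z (Cmp A P Q Z qZ m) iX = Zmor A X Z" "Cmp A Y P Z (Cmp A P Q Z qZ m) iY = Zmor A Y Z"
    and iso: "isomorphic (morphism_cat A) (V, f, W) (P, m, Q)"
    using s unfolding is_split_def by blast
  have o: "X \<in> Obj A" "Y \<in> Obj A" "Z \<in> Obj A" "P \<in> Obj A" "Q \<in> Obj A"
    "iX \<in> Mor A X P" "iY \<in> Mor A Y P" "pX \<in> Mor A P X" "pY \<in> Mor A P Y"
    "jY \<in> Mor A Y Q" "jZ \<in> Mor A Z Q" "qY \<in> Mor A Q Y" "qZ \<in> Mor A Q Z"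
    using P0 Q0 unfolding is_biproduct_def by blast+
  note P = P0[unfolded is_biproduct_iff] and Q = Q0[unfolded is_biproduct_iff]
  note P' = P[unfolded arr.biprod_def] and Q' = Q[unfolded arr.biprod_def]
  let ?m = "Some (P, m, Q)" and ?iX = "Some (X, iX, P)" and ?iY = "Some (Y, iY, P)" and ?pY = "Some (P, pY, Y)"
    and ?jY = "Some (Y, jY, Q)" and ?jZ = "Some (Z, jZ, Q)" and ?qY = "Some (Q, qY, Y)" and ?qZ = "Some (Q, qZ, Z)"
  let ?c = "arrow_cmp A"
  have M: "?c ?qY (?c ?m ?iX) = arrow_zer A (ida X) (ida Y)" "?c ?qY (?c ?m ?iY) = ida Y"
    "?c ?qZ (?c ?m ?iX) = arrow_zer A (ida X) (ida Z)" "?c ?qZ (?c ?m ?iY) = arrow_zer A (ida Y) (ida Z)"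
    unfolding arr.cmp_assoc[symmetric] using o m mm by (simp_all add: arrow_cmp_Some cmp_closed)
  have oi: "arr.obj (ida X)" "arr.obj (ida Y)" "arr.obj (ida Z)" "arr.obj (ida Q)" using o by (auto simp: arr_obj_iff)
  have miX: "arr.arr (?c ?m ?iX) (ida X) (ida Q)" and miY: "arr.arr (?c ?m ?iY) (ida Y) (ida Q)"
    using o m by (auto simp: arr_arr_iff arrow_cmp_Some cmp_closed)
  let ?n = "?c ?jY ?pY"
  have "?m = ?n"
  proof -
    have z: "?c (Some (Y', k, Q)) (arrow_zer A (ida X') (ida Y')) = arrow_zer A (ida X') (ida Q)"
      if "Y' \<in> Obj A" "X' \<in> Obj A" "k \<in> Mor A Y' Q" for k X' Y'
      using arr.cmp_zer[of "Some (Y', k, Q)" "ida Y'" "ida X'"] that o by (simp add: arr_obj_iff)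
    have zz: "arrow_add A (arrow_zer A (ida X') (ida Q)) (arrow_zer A (ida X') (ida Q)) = arrow_zer A (ida X') (ida Q)"
      if "X' \<in> Obj A" for X'
      using arr.isz_add_self[OF arr.isz_zer[of "ida X'" "ida Q"]] that o by (simp add: arr_obj_iff)
    have "?c ?m ?iX = arrow_add A (?c ?jY (?c ?qY (?c ?m ?iX))) (?c ?jZ (?c ?qZ (?c ?m ?iX)))"
      by (rule arr.biprod_decomp[OF Q arr.arrD(1,3)[OF miX]])
    also have "\<dots> = arrow_zer A (ida X) (ida Q)" unfolding M using o by (simp only: z zz)
    also have "\<dots> = ?c ?n ?iX" unfolding arr.cmp_assoc using P' z[of Y X jY] o by simp
    finally have 1: "?c ?m ?iX = ?c ?n ?iX" .
    have "?c ?m ?iY = arrow_add A (?c ?jY (?c ?qY (?c ?m ?iY))) (?c ?jZ (?c ?qZ (?c ?m ?iY)))"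
      by (rule arr.biprod_decomp[OF Q arr.arrD(1,3)[OF miY]])
    also have "\<dots> = arrow_add A (?c ?jY (ida Y)) (arrow_zer A (ida Y) (ida Q))" unfolding M using o by (simp only: z)
    also have "?c ?jY (ida Y) = ?jY" using arr.cmp_id[of ?jY "ida Y"] o by simp
    also have "arrow_add A ?jY (arrow_zer A (ida Y) (ida Q)) = ?jY"
      using arr.add_zer[of ?jY] o by simp
    also have "?jY = ?c ?n ?iY"
      unfolding arr.cmp_assoc using P' arr.cmp_id[of ?jY "ida Y"] o by simp
    finally have 2: "?c ?m ?iY = ?c ?n ?iY" .
    have "?n = arrow_add A (?c (?c ?n ?iX) (Some (P, pX, X))) (?c (?c ?n ?iY) ?pY)"
      by (rule arr.biprod_codecomp[OF P]) (use o in auto)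
    moreover have "?m = arrow_add A (?c (?c ?m ?iX) (Some (P, pX, X))) (?c (?c ?m ?iY) ?pY)"
      by (rule arr.biprod_codecomp[OF P]) (use o m in auto)
    ultimately show ?thesis unfolding 1 2 by simp
  qed
  note mn = this
  define n where "n = ?c ?iY ?qY"
  have mnm: "?c ?m (?c n ?m) = ?m"
  proof -
    have e: "?c (ida Y) ?pY = ?pY" using arr.id_cmp[of ?pY "ida Y"] o by simp
    have "?c ?n (?c n ?n) = ?c ?jY (?c (?c ?pY ?iY) (?c (?c ?qY ?jY) ?pY))"
      unfolding n_def by (simp only: arr.cmp_assoc)
    also have "\<dots> = ?n" using P' Q' e by simp
    finally show ?thesis unfolding mn .
  qed
  obtain u u' w w' where
    uw: "u \<in> Mor A V P" "u' \<in> Mor A W Q" "Cmp A V P Q m u = Cmp A V W Q u' f"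
      "w \<in> Mor A P V" "w' \<in> Mor A Q W" "Cmp A P V W f w = Cmp A P Q W w' m" "Cmp A W Q W w' u' = Idm A W"
    using iso unfolding isomorphic_def morphism_cat_def by auto
  let ?f = "Some (V, f, W)" and ?u = "Some (V, u, P)" and ?u' = "Some (W, u', Q)" and ?w = "Some (P, w, V)" and ?w' = "Some (Q, w', W)"
  have e1: "?c ?m ?u = ?c ?u' ?f" and e2: "?c ?f ?w = ?c ?w' ?m" and e3: "?c ?w' ?u' = ida W"
    using uw f o m by (simp_all add: arrow_cmp_Some)
  have e4: "?c ?w' (?c ?m ?u) = ?f"
  proof -
    have "?c ?w' (?c ?m ?u) = ?c (?c ?w' ?u') ?f" unfolding e1 by (simp only: arr.cmp_assoc)
    then show ?thesis unfolding e3 using arr.id_cmp[of ?f "ida W"] f by simp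
  qed
  have "?c ?f (?c (?c ?w (?c n ?u')) ?f) = ?c (?c ?f ?w) (?c n (?c ?u' ?f))" by (simp only: arr.cmp_assoc)
  also have "\<dots> = ?c ?w' (?c (?c ?m (?c n ?m)) ?u)" unfolding e1[symmetric] e2 by (simp only: arr.cmp_assoc)
  also have "\<dots> = ?f" unfolding mnm by (rule e4)
  finally show ?thesis unfolding arr.regular_def using f by auto
qed

end

context weakly_abelian_category
begin

lemma is_weak_kernel_imp_wker:
  assumes "is_weak_kernel A K i X f Y" shows "arr.wker (Some (K, i, X)) (Some (X, f, Y))"
proof -
  have t: "K \<in> Obj A" "X \<in> Obj A" "Y \<in> Obj A" "i \<in> Mor A K X" "f \<in> Mor A X Y"
    and e: "\<And>S. S \<in> Obj A \<Longrightarrow> Cmp A S K X i ` Mor A S K = {h \<in> Mor A S X. Cmp A S X Y f h = Zmor A S Y}"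
    using assms unfolding is_weak_kernel_def kernel_def by auto
  have "i \<in> Cmp A K K X i ` Mor A K K" using cmp_id_right[of K X i] id_closed[of K] t by (metis imageI)
  then have "Cmp A K X Y f i = Zmor A K Y" using e[OF t(1)] by blast
  then have "arr.isz (arrow_cmp A (Some (X, f, Y)) (Some (K, i, X)))" using t by (simp add: arrow_cmp_Some arr_isz_iff)
  moreover have "\<exists>u. h = arrow_cmp A (Some (K, i, X)) u" if h: "arr.isz (arrow_cmp A (Some (X, f, Y)) h)" for h
  proof -
    have "arrow_ok A h" "arrow_cd A h = ida X" using arr.isz_ok[OF h] by simp_all
    then obtain S k where k: "h = Some (S, k, X)" "S \<in> Obj A" "k \<in> Mor A S X"
      by (cases h rule: arrow_cases) auto
    then have "Cmp A S X Y f k = Zmor A S Y" using h t by (simp add: arrow_cmp_Some arr_isz_iff)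
    then obtain u where "u \<in> Mor A S K" "k = Cmp A S K X i u" using e[OF k(2)] k(3) by blast
    then show ?thesis using k t by (intro exI[of _ "Some (S, u, K)"]) (simp add: arrow_cmp_Some)
  qed
  ultimately show ?thesis unfolding arr.wker_def by blast
qed

lemma is_weak_cokernel_imp_wcok:
  assumes "is_weak_cokernel A X f Y c Q" shows "arr.wcok (Some (X, f, Y)) (Some (Y, c, Q))"
proof -
  have t: "X \<in> Obj A" "Y \<in> Obj A" "Q \<in> Obj A" "f \<in> Mor A X Y" "c \<in> Mor A Y Q"
    and e: "\<And>S. S \<in> Obj A \<Longrightarrow> (\<lambda>h. Cmp A Y Q S h c) ` Mor A Q S = {h \<in> Mor A Y S. Cmp A X Y S h f = Zmor A X S}"
    using assms unfolding is_weak_cokernel_def kernel_def by auto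
  have "c \<in> (\<lambda>h. Cmp A Y Q Q h c) ` Mor A Q Q" using cmp_id_left[of Y Q c] id_closed[of Q] t by (metis imageI)
  then have "Cmp A X Y Q c f = Zmor A X Q" using e[OF t(3)] by blast
  then have "arr.isz (arrow_cmp A (Some (Y, c, Q)) (Some (X, f, Y)))" using t by (simp add: arrow_cmp_Some arr_isz_iff)
  moreover have "\<exists>u. h = arrow_cmp A u (Some (Y, c, Q))" if h: "arr.isz (arrow_cmp A h (Some (X, f, Y)))" for h
  proof -
    have "arrow_ok A h" "arrow_dm A h = ida Y" using arr.isz_ok[OF h] by simp_all
    then obtain S k where k: "h = Some (Y, k, S)" "S \<in> Obj A" "k \<in> Mor A Y S"
      by (cases h rule: arrow_cases) auto
    then have "Cmp A X Y S k f = Zmor A X S" using h t by (simp add: arrow_cmp_Some arr_isz_iff)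
    then obtain u where "u \<in> Mor A Q S" "k = Cmp A Y Q S u c" using e[OF k(2)] k(3) by blast
    then show ?thesis using k t by (intro exI[of _ "Some (Q, u, S)"]) (simp add: arrow_cmp_Some)
  qed
  ultimately show ?thesis unfolding arr.wcok_def by blast
qed

sublocale arr: weakly_abelian_arrows "arrow_ok A" "arrow_cmp A" "arrow_add A" "arrow_neg A" "arrow_zer A" "arrow_dm A" "arrow_cd A"
proof (unfold_locales, goal_cases)
  case 1
  show ?case using zero_object_exists arr_zobj_iff by blast
next
  case (2 X Y)
  then show ?case using biproduct_exists unfolding arr_obj_iff is_biproduct_iff by blast
next
  case (3 g)
  then show ?case using weak_kernel_exists is_weak_kernel_imp_wker by (elim arrow_okE) blast
next
  case (4 f)
  then show ?case using weak_cokernel_exists is_weak_cokernel_imp_wcok by (elim arrow_okE) blast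
next
  case (5 f)
  then show ?case using is_some_weak_kernel is_weak_kernel_imp_wker by (elim arrow_okE) blast
next
  case (6 g)
  then show ?case using is_some_weak_cokernel is_weak_cokernel_imp_wcok by (elim arrow_okE) blast
qed

end

section \<open>Quotients of preadditive categories\<close>

context preadditive_category
begin

lemma cmp_inv_left:
  assumes "X \<in> Obj A" "Y \<in> Obj A" "Z \<in> Obj A" "f \<in> Mor A X Y" "g \<in> Mor A Y Z"
  shows "Cmp A X Y Z (inv\<^bsub>Hom A Y Z\<^esub> g) f = inv\<^bsub>Hom A X Z\<^esub> (Cmp A X Y Z g f)"
  using arr.neg_cmp[of "Some (Y, g, Z)" "Some (X, f, Y)"] assms
  by (simp add: arrow_neg_Some arrow_cmp_Some inv_closed cmp_closed)

lemma cmp_inv_right: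
  assumes "X \<in> Obj A" "Y \<in> Obj A" "Z \<in> Obj A" "f \<in> Mor A X Y" "g \<in> Mor A Y Z"
  shows "Cmp A X Y Z g (inv\<^bsub>Hom A X Y\<^esub> f) = inv\<^bsub>Hom A X Z\<^esub> (Cmp A X Y Z g f)"
  using arr.cmp_neg[of "Some (Y, g, Z)" "Some (X, f, Y)"] assms
  by (simp add: arrow_neg_Some arrow_cmp_Some inv_closed cmp_closed)

end

text \<open>
  The morphisms that factor over \<open>S\<close> are closed under addition if \<open>S\<close> has
  direct sums; it is the closure under addition that makes the residue classes form a category.
\<close>

locale additive_quotient = preadditive_category +
  fixes S :: "'a set"
  assumes objects: "S \<subseteq> Obj A"
    and factoring_subgroup: "\<lbrakk>X \<in> Obj A; Y \<in> Obj A\<rbrakk> \<Longrightarrow> subgroup (factoring A S X Y) (Hom A X Y)"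
begin

abbreviation rc :: "'a \<Rightarrow> 'a \<Rightarrow> 'b \<Rightarrow> 'b set"
  where "rc \<equiv> residue_class A S"

lemma factoring_normal: "\<lbrakk>X \<in> Obj A; Y \<in> Obj A\<rbrakk> \<Longrightarrow> normal (factoring A S X Y) (Hom A X Y)"
  using comm_group.subgroup_imp_normal[OF hom_comm_group factoring_subgroup] .

lemma factoring_left:
  assumes "X \<in> Obj A" "Y \<in> Obj A" "Z \<in> Obj A" "f \<in> factoring A S X Y" "g \<in> Mor A Y Z"
  shows "Cmp A X Y Z g f \<in> factoring A S X Z"
proof -
  obtain W u v where w: "f = Cmp A X W Y v u" "W \<in> S" "u \<in> Mor A X W" "v \<in> Mor A W Y"
    using assms(4) unfolding factoring_def by blast
  then have W: "W \<in> Obj A" using objects by blast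
  have "Cmp A X Y Z g f = Cmp A X W Z (Cmp A W Y Z g v) u"
    unfolding w(1) using cmp_assoc[OF assms(1) W assms(2,3) w(3,4) assms(5)] by simp
  moreover have "Cmp A W Y Z g v \<in> Mor A W Z" using cmp_closed[OF W assms(2,3) w(4) assms(5)] .
  ultimately show ?thesis unfolding factoring_def using w by blast
qed

lemma factoring_right:
  assumes "X \<in> Obj A" "Y \<in> Obj A" "Z \<in> Obj A" "f \<in> Mor A X Y" "g \<in> factoring A S Y Z"
  shows "Cmp A X Y Z g f \<in> factoring A S X Z"
proof -
  obtain W u v where w: "g = Cmp A Y W Z v u" "W \<in> S" "u \<in> Mor A Y W" "v \<in> Mor A W Z"
    using assms(5) unfolding factoring_def by blast
  then have W: "W \<in> Obj A" using objects by blast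
  have "Cmp A X Y Z g f = Cmp A X W Z v (Cmp A X Y W u f)"
    unfolding w(1) using cmp_assoc[OF assms(1,2) W assms(3,4) w(3,4)] by simp
  moreover have "Cmp A X Y W u f \<in> Mor A X W" using cmp_closed[OF assms(1,2) W assms(4) w(3)] .
  ultimately show ?thesis unfolding factoring_def using w by blast
qed

lemma rc_mem:
  assumes "X \<in> Obj A" "Y \<in> Obj A" "f \<in> Mor A X Y"
  shows "g \<in> rc X Y f \<longleftrightarrow> g \<in> Mor A X Y \<and> g \<otimes>\<^bsub>Hom A X Y\<^esub> inv\<^bsub>Hom A X Y\<^esub> f \<in> factoring A S X Y"
proof -
  note sg = factoring_subgroup[OF assms(1,2)] and G = hom_group[OF assms(1,2)]
  have "g \<in> Mor A X Y" if "g \<in> rc X Y f"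
    using subgroup.elemrcos_carrier[OF sg G assms(3)] that unfolding residue_class_def by blast
  then show ?thesis
    using subgroup.rcos_module[OF sg G assms(3)] unfolding residue_class_def by blast
qed

lemma rc_eq_iff:
  assumes "X \<in> Obj A" "Y \<in> Obj A" "f \<in> Mor A X Y" "g \<in> Mor A X Y"
  shows "rc X Y g = rc X Y f \<longleftrightarrow> g \<otimes>\<^bsub>Hom A X Y\<^esub> inv\<^bsub>Hom A X Y\<^esub> f \<in> factoring A S X Y"
proof -
  note sg = factoring_subgroup[OF assms(1,2)] and G = hom_group[OF assms(1,2)]
  have "g \<in> rc X Y f \<longleftrightarrow> rc X Y g = rc X Y f"
    using group.repr_independence[OF G _ assms(3) sg, of g] group.rcos_self[OF G assms(4) sg]
    unfolding residue_class_def by metis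
  then show ?thesis using rc_mem[OF assms(1-3)] assms(4) by blast
qed

lemma rc_self: "\<lbrakk>X \<in> Obj A; Y \<in> Obj A; f \<in> Mor A X Y\<rbrakk> \<Longrightarrow> f \<in> rc X Y f"
  unfolding residue_class_def by (rule group.rcos_self[OF hom_group _ factoring_subgroup])

lemma rc_memD:
  assumes "X \<in> Obj A" "Y \<in> Obj A" "f \<in> Mor A X Y" "g \<in> rc X Y f"
  shows "g \<in> Mor A X Y" "rc X Y g = rc X Y f"
  using assms rc_mem rc_eq_iff by blast+

lemma quotient_simps:
  "Obj (quotient_cat A S) = Obj A"
  "Idm (quotient_cat A S) X = rc X X (Idm A X)"
  "Mor (quotient_cat A S) X Y = rc X Y ` Mor A X Y"
  by (auto simp: quotient_cat_def residue_class_def carrier_FactGroup)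

lemma quotient_mult:
  assumes "X \<in> Obj A" "Y \<in> Obj A" "f \<in> Mor A X Y" "g \<in> Mor A X Y"
  shows "rc X Y f \<otimes>\<^bsub>Hom (quotient_cat A S) X Y\<^esub> rc X Y g = rc X Y (f \<otimes>\<^bsub>Hom A X Y\<^esub> g)"
  using normal.rcos_sum[OF factoring_normal[OF assms(1,2)] assms(3,4)]
  by (simp add: quotient_cat_def residue_class_def)

lemma quotient_one:
  assumes "X \<in> Obj A" "Y \<in> Obj A" shows "Zmor (quotient_cat A S) X Y = rc X Y (Zmor A X Y)"
  using group.coset_mult_one[OF hom_group[OF assms] subgroup.subset[OF factoring_subgroup[OF assms]]]
  by (simp add: quotient_cat_def residue_class_def)

lemma rc_cmp_cong:
  assumes o: "X \<in> Obj A" "Y \<in> Obj A" "Z \<in> Obj A" and f: "f \<in> Mor A X Y" "f' \<in> Mor A X Y" "rc X Y f' = rc X Y f"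
    and g: "g \<in> Mor A Y Z" "g' \<in> Mor A Y Z" "rc Y Z g' = rc Y Z g"
  shows "rc X Z (Cmp A X Y Z g' f') = rc X Z (Cmp A X Y Z g f)"
proof -
  have "rc X Z (Cmp A X Y Z g' f') = rc X Z (Cmp A X Y Z g f')"
  proof -
    have "g' \<otimes>\<^bsub>Hom A Y Z\<^esub> inv\<^bsub>Hom A Y Z\<^esub> g \<in> factoring A S Y Z" using rc_eq_iff[OF o(2,3) g(1,2)] g(3) by blast
    from factoring_right[OF o f(2) this]
    have "Cmp A X Y Z g' f' \<otimes>\<^bsub>Hom A X Z\<^esub> inv\<^bsub>Hom A X Z\<^esub> Cmp A X Y Z g f' \<in> factoring A S X Z"
      using cmp_add_left[OF o f(2) g(2) inv_closed[OF o(2,3) g(1)]] cmp_inv_left[OF o f(2) g(1)] by simp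
    then show ?thesis using rc_eq_iff[OF o(1,3) cmp_closed[OF o f(2) g(1)] cmp_closed[OF o f(2) g(2)]] by blast
  qed
  also have "\<dots> = rc X Z (Cmp A X Y Z g f)"
  proof -
    have "f' \<otimes>\<^bsub>Hom A X Y\<^esub> inv\<^bsub>Hom A X Y\<^esub> f \<in> factoring A S X Y" using rc_eq_iff[OF o(1,2) f(1,2)] f(3) by blast
    from factoring_left[OF o this g(1)]
    have "Cmp A X Y Z g f' \<otimes>\<^bsub>Hom A X Z\<^esub> inv\<^bsub>Hom A X Z\<^esub> Cmp A X Y Z g f \<in> factoring A S X Z"
      using cmp_add_right[OF o f(2) inv_closed[OF o(1,2) f(1)] g(1)] cmp_inv_right[OF o f(1) g(1)] by simp
    then show ?thesis using rc_eq_iff[OF o(1,3) cmp_closed[OF o f(1) g(1)] cmp_closed[OF o f(2) g(1)]] by blast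
  qed
  finally show ?thesis .
qed

lemma quotient_cmp:
  assumes o: "X \<in> Obj A" "Y \<in> Obj A" "Z \<in> Obj A" and f: "f \<in> Mor A X Y" and g: "g \<in> Mor A Y Z"
  shows "Cmp (quotient_cat A S) X Y Z (rc Y Z g) (rc X Y f) = rc X Z (Cmp A X Y Z g f)"
proof -
  have "rc X Z (Cmp A X Y Z g' f') = rc X Z (Cmp A X Y Z g f)" if "g' \<in> rc Y Z g" "f' \<in> rc X Y f" for g' f'
    using rc_cmp_cong[OF o f rc_memD[OF o(1,2) f that(2)] g rc_memD[OF o(2,3) g that(1)]] .
  then have "(\<Union>g'\<in>rc Y Z g. \<Union>f'\<in>rc X Y f. rc X Z (Cmp A X Y Z g' f')) = rc X Z (Cmp A X Y Z g f)"
    using rc_self[OF o(1,2) f] rc_self[OF o(2,3) g] by blast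
  then show ?thesis by (simp add: quotient_cat_def)
qed

lemma preadditive_quotient: "preadditive_category (quotient_cat A S)"
proof (rule preadditive_category.intro, goal_cases)
  case (1 X Y)
  then show ?case
    using comm_group.abelian_FactGroup[OF hom_comm_group factoring_subgroup] by (simp add: quotient_cat_def)
next
  case (2 X) then show ?case using id_closed by (simp add: quotient_simps)
next
  case (3 X Y Z f g)
  then show ?case by (auto simp: quotient_simps quotient_cmp intro!: imageI cmp_closed)
next
  case (4 X Y f)
  then show ?case by (auto simp: quotient_simps quotient_cmp id_closed cmp_id_left)
next
  case (5 X Y f)
  then show ?case by (auto simp: quotient_simps quotient_cmp id_closed cmp_id_right)
next
  case (6 W X Y Z f g h)
  then show ?case by (auto simp: quotient_simps quotient_cmp cmp_closed cmp_assoc)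
next
  case (7 X Y Z f g g')
  then show ?case by (auto simp: quotient_simps quotient_cmp quotient_mult add_closed cmp_closed cmp_add_left)
next
  case (8 X Y Z f f' g)
  then show ?case by (auto simp: quotient_simps quotient_cmp quotient_mult add_closed cmp_closed cmp_add_right)
qed

end

lemma comm_group_subgroup:
  assumes "comm_group G" "subgroup H G" shows "comm_group (G\<lparr>carrier := H\<rparr>)"
proof -
  interpret G: comm_group G by (rule assms(1))
  have "group (G\<lparr>carrier := H\<rparr>)" by (rule subgroup.subgroup_is_group[OF assms(2) G.group_axioms])
  then show ?thesis
    using subgroup.subset[OF assms(2)] by (intro group.group_comm_groupI) (auto simp: G.m_comm subset_iff)
qed

subsection \<open>The category of morphisms and the Freyd category\<close>

lemma DirProd_comm_group:
  assumes "comm_group G" "comm_group H" shows "comm_group (G \<times>\<times> H)"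
proof -
  interpret G: comm_group G by (rule assms(1))
  interpret H: comm_group H by (rule assms(2))
  show ?thesis
    by (intro group.group_comm_groupI DirProd_group G.group_axioms H.group_axioms)
      (auto simp: G.m_comm H.m_comm)
qed

context preadditive_category
begin

abbreviation MC :: "('o \<times> 'm \<times> 'o, 'm \<times> 'm) precat"
  where "MC \<equiv> morphism_cat A"

lemma morphism_cat_Obj: "(X, a, X') \<in> Obj MC \<longleftrightarrow> X \<in> Obj A \<and> X' \<in> Obj A \<and> a \<in> Mor A X X'"
  by (simp add: morphism_cat_def)

lemma morphism_cat_Mor: "(f, f') \<in> Mor MC (X, a, X') (Y, b, Y') \<longleftrightarrow>
    f \<in> Mor A X Y \<and> f' \<in> Mor A X' Y' \<and> Cmp A X Y Y' b f = Cmp A X X' Y' f' a"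
  by (simp add: morphism_cat_def)

lemma morphism_cat_simps:
  "Idm MC (X, a, X') = (Idm A X, Idm A X')"
  "Cmp MC (X, a, X') (Y, b, Y') (Z, c, Z') (g, g') (f, f') = (Cmp A X Y Z g f, Cmp A X' Y' Z' g' f')"
  "(f, f') \<otimes>\<^bsub>Hom MC (X, a, X') (Y, b, Y')\<^esub> (g, g') = (f \<otimes>\<^bsub>Hom A X Y\<^esub> g, f' \<otimes>\<^bsub>Hom A X' Y'\<^esub> g')"
  "Zmor MC (X, a, X') (Y, b, Y') = (Zmor A X Y, Zmor A X' Y')"
  by (simp_all add: morphism_cat_def)

lemma cmp_zero_right: "\<lbrakk>X \<in> Obj A; Y \<in> Obj A; Z \<in> Obj A; g \<in> Mor A Y Z\<rbrakk> \<Longrightarrow> Cmp A X Y Z g (Zmor A X Y) = Zmor A X Z"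
  using arr.cmp_zer[of "Some (Y, g, Z)" "Some (Y, Idm A Y, Y)" "Some (X, Idm A X, X)"]
  by (simp add: arr_obj_iff arrow_cmp_Some zero_closed)

lemma cmp_zero_left: "\<lbrakk>X \<in> Obj A; Y \<in> Obj A; Z \<in> Obj A; f \<in> Mor A X Y\<rbrakk> \<Longrightarrow> Cmp A X Y Z (Zmor A Y Z) f = Zmor A X Z"
  using arr.zer_cmp[of "Some (X, f, Y)" "Some (Y, Idm A Y, Y)" "Some (Z, Idm A Z, Z)"]
  by (simp add: arr_obj_iff arrow_cmp_Some zero_closed)

lemma morphism_cat_squares_subgroup:
  assumes "(X, a, X') \<in> Obj MC" "(Y, b, Y') \<in> Obj MC"
  shows "subgroup {(f, f'). f \<in> Mor A X Y \<and> f' \<in> Mor A X' Y' \<and> Cmp A X Y Y' b f = Cmp A X X' Y' f' a}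
    (Hom A X Y \<times>\<times> Hom A X' Y')"
proof -
  have o: "X \<in> Obj A" "X' \<in> Obj A" "a \<in> Mor A X X'" "Y \<in> Obj A" "Y' \<in> Obj A" "b \<in> Mor A Y Y'"
    using assms by (auto simp: morphism_cat_Obj)
  let ?H = "{(f, f'). f \<in> Mor A X Y \<and> f' \<in> Mor A X' Y' \<and> Cmp A X Y Y' b f = Cmp A X X' Y' f' a}"
  have "(Zmor A X Y, Zmor A X' Y') \<in> ?H" using o by (simp add: zero_closed cmp_zero_left cmp_zero_right)
  then have ne: "?H \<noteq> {}" by blast
  show ?thesis
    by (rule group.subgroupI[OF DirProd_group[OF hom_group hom_group] _ ne])
      (use o in \<open>auto simp: add_closed inv_closed cmp_add_left cmp_add_right
        cmp_inv_left cmp_inv_right inv_DirProd[OF hom_group hom_group] cmp_zero_left cmp_zero_right\<close>)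
qed

lemma preadditive_morphism_cat: "preadditive_category MC"
proof (rule preadditive_category.intro, goal_cases)
  case (1 X Y)
  then show ?case
    using comm_group_subgroup[OF DirProd_comm_group[OF hom_comm_group hom_comm_group] morphism_cat_squares_subgroup]
    by (cases X; cases Y) (auto simp: morphism_cat_def)
next
  case (2 X)
  then show ?case
    by (cases X) (auto simp: morphism_cat_simps morphism_cat_Mor morphism_cat_Obj id_closed cmp_id_left cmp_id_right)
next
  case (3 X Y Z f g)
  obtain X0 x X1 Y0 y Y1 Z0 z Z1 f0 f1 g0 g1 where e: "X = (X0, x, X1)" "Y = (Y0, y, Y1)" "Z = (Z0, z, Z1)" "f = (f0, f1)" "g = (g0, g1)"
    by (metis surj_pair)
  note b = 3[unfolded e morphism_cat_Obj morphism_cat_Mor]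
  have "Cmp A X0 Z0 Z1 z (Cmp A X0 Y0 Z0 g0 f0) = Cmp A X0 Y0 Z1 (Cmp A Y0 Z0 Z1 z g0) f0"
    by (rule cmp_assoc[symmetric]) (use b in auto)
  also have "Cmp A Y0 Z0 Z1 z g0 = Cmp A Y0 Y1 Z1 g1 y" using b by blast
  also have "Cmp A X0 Y0 Z1 (Cmp A Y0 Y1 Z1 g1 y) f0 = Cmp A X0 Y1 Z1 g1 (Cmp A X0 Y0 Y1 y f0)"
    by (rule cmp_assoc) (use b in auto)
  also have "Cmp A X0 Y0 Y1 y f0 = Cmp A X0 X1 Y1 f1 x" using b by blast
  also have "Cmp A X0 Y1 Z1 g1 (Cmp A X0 X1 Y1 f1 x) = Cmp A X0 X1 Z1 (Cmp A X1 Y1 Z1 g1 f1) x"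
    by (rule cmp_assoc[symmetric]) (use b in auto)
  finally show ?case
    using b by (simp add: e morphism_cat_simps morphism_cat_Mor cmp_closed)
next
  case (4 X Y f)
  then show ?case
    by (cases X; cases Y; cases f) (simp add: morphism_cat_simps morphism_cat_Obj morphism_cat_Mor cmp_id_left)
next
  case (5 X Y f)
  then show ?case
    by (cases X; cases Y; cases f) (simp add: morphism_cat_simps morphism_cat_Obj morphism_cat_Mor cmp_id_right)
next
  case (6 W X Y Z f g h)
  then show ?case
    by (cases W; cases X; cases Y; cases Z; cases f; cases g; cases h)
      (simp add: morphism_cat_simps morphism_cat_Obj morphism_cat_Mor cmp_assoc)
next
  case (7 X Y Z f g g')
  then show ?case
    by (cases X; cases Y; cases Z; cases f; cases g; cases g')
      (simp add: morphism_cat_simps morphism_cat_Obj morphism_cat_Mor cmp_add_left)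
next
  case (8 X Y Z f f' g)
  then show ?case
    by (cases X; cases Y; cases Z; cases f; cases f'; cases g)
      (simp add: morphism_cat_simps morphism_cat_Obj morphism_cat_Mor cmp_add_right)
qed

text \<open>
  If its diagonal vanishes, a square factors over the zero morphism from its upper left to its lower
  right corner.
\<close>

lemma factoring_zero_morphisms:
  assumes "(X, a, X') \<in> Obj MC" "(Y, b, Y') \<in> Obj MC"
  shows "factoring MC (zero_morphisms A) (X, a, X') (Y, b, Y')
    = {(f, f') \<in> Mor MC (X, a, X') (Y, b, Y'). Cmp A X Y Y' b f = Zmor A X Y'}" (is "?L = ?R")
proof
  have o: "X \<in> Obj A" "X' \<in> Obj A" "a \<in> Mor A X X'" "Y \<in> Obj A" "Y' \<in> Obj A" "b \<in> Mor A Y Y'"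
    using assms by (auto simp: morphism_cat_Obj)
  show "?L \<subseteq> ?R"
  proof
    fix s assume "s \<in> ?L"
    then obtain W w W' u u' v v' where w: "(W, w, W') \<in> zero_morphisms A"
      "(u, u') \<in> Mor MC (X, a, X') (W, w, W')" "(v, v') \<in> Mor MC (W, w, W') (Y, b, Y')"
      "s = Cmp MC (X, a, X') (W, w, W') (Y, b, Y') (v, v') (u, u')"
      unfolding factoring_def by (auto 0 3)
    then have W: "W \<in> Obj A" "W' \<in> Obj A" "w = Zmor A W W'" by (auto simp: zero_morphisms_def)
    have WM: "(W, w, W') \<in> Obj MC" using W zero_closed by (simp add: morphism_cat_Obj)
    have sM: "s \<in> Mor MC (X, a, X') (Y, b, Y')"
      unfolding w(4) by (rule preadditive_category.cmp_closed[OF preadditive_morphism_cat assms(1) WM assms(2) w(2,3)])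
    note t = w(2)[unfolded morphism_cat_Mor] w(3)[unfolded morphism_cat_Mor]
    have "Cmp A X Y Y' b (Cmp A X W Y v u) = Cmp A X W Y' (Cmp A W Y Y' b v) u" by (rule cmp_assoc[symmetric]) (use t o W in auto)
    also have "\<dots> = Zmor A X Y'" using t o W by (simp add: cmp_zero_right cmp_zero_left)
    finally show "s \<in> ?R" using sM by (simp add: w(4) morphism_cat_simps)
  qed
  show "?R \<subseteq> ?L"
  proof
    fix s assume "s \<in> ?R"
    then obtain f f' where s: "s = (f, f')" "f \<in> Mor A X Y" "f' \<in> Mor A X' Y'"
      "Cmp A X Y Y' b f = Cmp A X X' Y' f' a" "Cmp A X Y Y' b f = Zmor A X Y'"
      by (auto simp: morphism_cat_Mor)
    let ?W = "(X, Zmor A X Y', Y')"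
    have W: "?W \<in> zero_morphisms A" using o by (simp add: zero_morphisms_def)
    have 1: "(Idm A X, f') \<in> Mor MC (X, a, X') ?W"
      using s o zero_closed[of X Y'] by (simp add: morphism_cat_Mor id_closed cmp_id_right)
    have 2: "(f, Idm A Y') \<in> Mor MC ?W (Y, b, Y')"
      using s o zero_closed[of X Y'] by (simp add: morphism_cat_Mor id_closed cmp_id_left)
    have "s = Cmp MC (X, a, X') ?W (Y, b, Y') (f, Idm A Y') (Idm A X, f')"
      using s o by (simp add: morphism_cat_simps cmp_id_left cmp_id_right)
    then show "s \<in> ?L" unfolding factoring_def using W 1 2 by blast
  qed
qed

end

context preadditive_category
begin

abbreviation FC :: "('o \<times> 'm \<times> 'o, ('m \<times> 'm) set) precat"
  where "FC \<equiv> freyd A"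

abbreviation fcl :: "'o \<times> 'm \<times> 'o \<Rightarrow> 'o \<times> 'm \<times> 'o \<Rightarrow> 'm \<times> 'm \<Rightarrow> ('m \<times> 'm) set"
  where "fcl \<equiv> residue_class MC (zero_morphisms A)"

text \<open>
  Squares are added by adding their diagonals, so those that factor over zero morphisms, being the
  ones with zero diagonal, form a subgroup.
\<close>

lemma freyd_quotient: "additive_quotient MC (zero_morphisms A)"
proof (intro additive_quotient.intro preadditive_morphism_cat additive_quotient_axioms.intro)
  show "zero_morphisms A \<subseteq> Obj MC" using zero_closed by (auto simp: zero_morphisms_def morphism_cat_Obj)
next
  fix X Y assume o: "X \<in> Obj MC" "Y \<in> Obj MC"
  obtain X0 a X1 Y0 b Y1 where e: "X = (X0, a, X1)" "Y = (Y0, b, Y1)" by (metis surj_pair)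
  have o': "X0 \<in> Obj A" "X1 \<in> Obj A" "a \<in> Mor A X0 X1" "Y0 \<in> Obj A" "Y1 \<in> Obj A" "b \<in> Mor A Y0 Y1"
    using o by (auto simp: e morphism_cat_Obj)
  interpret M: preadditive_category MC by (rule preadditive_morphism_cat)
  let ?H = "factoring MC (zero_morphisms A) X Y"
  have H: "?H = {(f, f') \<in> Mor MC X Y. Cmp A X0 Y0 Y1 b f = Zmor A X0 Y1}"
    using factoring_zero_morphisms[of X0 a X1 Y0 b Y1] o unfolding e by simp
  have inv: "inv\<^bsub>Hom MC X Y\<^esub> (f, f') = (inv\<^bsub>Hom A X0 Y0\<^esub> f, inv\<^bsub>Hom A X1 Y1\<^esub> f')" if f: "(f, f') \<in> Mor MC X Y" for f f'
  proof (rule group.inv_equality[OF M.hom_group[OF o]])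
    show "(f, f') \<in> Mor MC X Y" by (rule f)
    note f' = f[unfolded e morphism_cat_Mor]
    show "(inv\<^bsub>Hom A X0 Y0\<^esub> f, inv\<^bsub>Hom A X1 Y1\<^esub> f') \<in> Mor MC X Y"
      using f' o' unfolding e morphism_cat_Mor by (simp add: inv_closed cmp_inv_left cmp_inv_right)
    show "(inv\<^bsub>Hom A X0 Y0\<^esub> f, inv\<^bsub>Hom A X1 Y1\<^esub> f') \<otimes>\<^bsub>Hom MC X Y\<^esub> (f, f') = Zmor MC X Y"
      using f' o' unfolding e morphism_cat_simps by (simp add: group.l_inv[OF hom_group])
  qed
  have idZ: "Zmor A X0 Y1 \<otimes>\<^bsub>Hom A X0 Y1\<^esub> Zmor A X0 Y1 = Zmor A X0 Y1"
    using monoid.l_one[OF group.is_monoid[OF hom_group]] o' zero_closed by simp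
  show "subgroup ?H (Hom MC X Y)"
  proof (rule group.subgroupI[OF M.hom_group[OF o]])
    show "?H \<subseteq> Mor MC X Y" unfolding H by auto
    have "Zmor MC X Y = (Zmor A X0 Y0, Zmor A X1 Y1)" by (simp add: e morphism_cat_simps)
    then have "Zmor MC X Y \<in> ?H"
      unfolding H using M.zero_closed[OF o] o' by (simp add: cmp_zero_right)
    then show "?H \<noteq> {}" by blast
  next
    fix s assume s: "s \<in> ?H"
    then obtain f f' where f: "s = (f, f')" "(f, f') \<in> Mor MC X Y" "Cmp A X0 Y0 Y1 b f = Zmor A X0 Y1" unfolding H by auto
    have "inv\<^bsub>Hom MC X Y\<^esub> (f, f') \<in> Mor MC X Y" by (rule M.inv_closed[OF o f(2)])
    moreover have "Cmp A X0 Y0 Y1 b (inv\<^bsub>Hom A X0 Y0\<^esub> f) = Zmor A X0 Y1"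
    proof -
      have "f \<in> Mor A X0 Y0" using f(2) by (simp add: e morphism_cat_Mor)
      from cmp_inv_right[OF o'(1,4,5) this o'(6)] show ?thesis
        using f(3) monoid.inv_one[OF group.is_monoid[OF hom_group[OF o'(1,5)]]] by simp
    qed
    ultimately show "inv\<^bsub>Hom MC X Y\<^esub> s \<in> ?H" unfolding H f(1) inv[OF f(2)] by simp
  next
    fix s t assume "s \<in> ?H" "t \<in> ?H"
    then obtain f f' g g' where f: "s = (f, f')" "(f, f') \<in> Mor MC X Y" "Cmp A X0 Y0 Y1 b f = Zmor A X0 Y1"
      and g: "t = (g, g')" "(g, g') \<in> Mor MC X Y" "Cmp A X0 Y0 Y1 b g = Zmor A X0 Y1" unfolding H by auto
    have m: "s \<otimes>\<^bsub>Hom MC X Y\<^esub> t \<in> Mor MC X Y" unfolding f g by (rule M.add_closed[OF o f(2) g(2)])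
    have st: "s \<otimes>\<^bsub>Hom MC X Y\<^esub> t = (f \<otimes>\<^bsub>Hom A X0 Y0\<^esub> g, f' \<otimes>\<^bsub>Hom A X1 Y1\<^esub> g')"
      unfolding f g e morphism_cat_simps ..
    have "Cmp A X0 Y0 Y1 b (f \<otimes>\<^bsub>Hom A X0 Y0\<^esub> g) = Zmor A X0 Y1"
    proof -
      have "f \<in> Mor A X0 Y0" "g \<in> Mor A X0 Y0" using f(2) g(2) by (simp_all add: e morphism_cat_Mor)
      from cmp_add_right[OF o'(1,4,5) this o'(6)] show ?thesis using f(3) g(3) idZ by simp
    qed
    then show "s \<otimes>\<^bsub>Hom MC X Y\<^esub> t \<in> ?H" using m unfolding H st by simp
  qed
qed

lemma freyd_eq_iff:
  assumes o: "(X, a, X') \<in> Obj MC" "(Y, b, Y') \<in> Obj MC"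
    and s: "(s, s') \<in> Mor MC (X, a, X') (Y, b, Y')" and t: "(t, t') \<in> Mor MC (X, a, X') (Y, b, Y')"
  shows "fcl (X, a, X') (Y, b, Y') (s, s') = fcl (X, a, X') (Y, b, Y') (t, t') \<longleftrightarrow> Cmp A X Y Y' b s = Cmp A X Y Y' b t"
proof -
  interpret M: additive_quotient MC "zero_morphisms A" by (rule freyd_quotient)
  let ?O = "(X, a, X')" and ?P = "(Y, b, Y')"
  have o': "X \<in> Obj A" "X' \<in> Obj A" "a \<in> Mor A X X'" "Y \<in> Obj A" "Y' \<in> Obj A" "b \<in> Mor A Y Y'"
    using o by (auto simp: morphism_cat_Obj)
  note t' = t[unfolded morphism_cat_Mor] and s' = s[unfolded morphism_cat_Mor]
  let ?i = "(inv\<^bsub>Hom A X Y\<^esub> t, inv\<^bsub>Hom A X' Y'\<^esub> t')"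
  have im: "?i \<in> Mor MC ?O ?P"
    using t' o' unfolding morphism_cat_Mor by (simp add: inv_closed cmp_inv_left cmp_inv_right)
  have inv: "inv\<^bsub>Hom MC ?O ?P\<^esub> (t, t') = ?i"
    by (rule group.inv_equality[OF M.hom_group[OF o] _ t im])
      (use t' o' in \<open>simp add: morphism_cat_simps group.l_inv[OF hom_group]\<close>)
  have d: "(s, s') \<otimes>\<^bsub>Hom MC ?O ?P\<^esub> ?i \<in> Mor MC ?O ?P" by (rule M.add_closed[OF o s im])
  have "fcl ?O ?P (s, s') = fcl ?O ?P (t, t') \<longleftrightarrow> (s, s') \<otimes>\<^bsub>Hom MC ?O ?P\<^esub> ?i \<in> factoring MC (zero_morphisms A) ?O ?P"
    unfolding inv[symmetric] by (rule M.rc_eq_iff[OF o t s])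
  also have "\<dots> \<longleftrightarrow> Cmp A X Y Y' b (s \<otimes>\<^bsub>Hom A X Y\<^esub> inv\<^bsub>Hom A X Y\<^esub> t) = Zmor A X Y'"
    using d unfolding factoring_zero_morphisms[OF o] morphism_cat_simps by simp
  also have "\<dots> \<longleftrightarrow> Cmp A X Y Y' b s \<otimes>\<^bsub>Hom A X Y'\<^esub> inv\<^bsub>Hom A X Y'\<^esub> Cmp A X Y Y' b t = Zmor A X Y'"
    using s' t' o' by (simp add: cmp_add_right inv_closed cmp_inv_right)
  also have "\<dots> \<longleftrightarrow> Cmp A X Y Y' b s = Cmp A X Y Y' b t"
  proof
    have m: "Cmp A X Y Y' b s \<in> Mor A X Y'" "Cmp A X Y Y' b t \<in> Mor A X Y'" using s' t' o' cmp_closed by simp_all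
    note G = hom_group[OF o'(1,5)]
    show "Cmp A X Y Y' b s = Cmp A X Y Y' b t"
      if "Cmp A X Y Y' b s \<otimes>\<^bsub>Hom A X Y'\<^esub> inv\<^bsub>Hom A X Y'\<^esub> Cmp A X Y Y' b t = Zmor A X Y'"
      using group.inv_equality[OF G that] m group.inv_inv[OF G] inv_closed[OF o'(1,5)] by simp
    show "Cmp A X Y Y' b s \<otimes>\<^bsub>Hom A X Y'\<^esub> inv\<^bsub>Hom A X Y'\<^esub> Cmp A X Y Y' b t = Zmor A X Y'"
      if "Cmp A X Y Y' b s = Cmp A X Y Y' b t"
      unfolding that using group.r_inv[OF G] m by simp
  qed
  finally show ?thesis .
qed

lemma freyd_simps:
  "Obj FC = Obj MC" "Mor FC X Y = fcl X Y ` Mor MC X Y" "Idm FC X = fcl X X (Idm MC X)"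
proof -
  interpret M: additive_quotient MC "zero_morphisms A" by (rule freyd_quotient)
  show "Obj FC = Obj MC" "Mor FC X Y = fcl X Y ` Mor MC X Y" "Idm FC X = fcl X X (Idm MC X)"
    unfolding freyd_def by (rule M.quotient_simps)+
qed

lemma freyd_Mor_iff: "F \<in> Mor FC (X, a, X') (Y, b, Y') \<longleftrightarrow>
    (\<exists>f f'. (f, f') \<in> Mor MC (X, a, X') (Y, b, Y') \<and> F = fcl (X, a, X') (Y, b, Y') (f, f'))"
  unfolding freyd_simps by auto

lemma freyd_cmp:
  assumes "(X, a, X') \<in> Obj MC" "(Y, b, Y') \<in> Obj MC" "(Z, c, Z') \<in> Obj MC"
    "(f, f') \<in> Mor MC (X, a, X') (Y, b, Y')" "(g, g') \<in> Mor MC (Y, b, Y') (Z, c, Z')"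
  shows "Cmp FC (X, a, X') (Y, b, Y') (Z, c, Z') (fcl (Y, b, Y') (Z, c, Z') (g, g')) (fcl (X, a, X') (Y, b, Y') (f, f'))
    = fcl (X, a, X') (Z, c, Z') (Cmp A X Y Z g f, Cmp A X' Y' Z' g' f')"
    and "(Cmp A X Y Z g f, Cmp A X' Y' Z' g' f') \<in> Mor MC (X, a, X') (Z, c, Z')"
proof -
  interpret M: additive_quotient MC "zero_morphisms A" by (rule freyd_quotient)
  show "Cmp FC (X, a, X') (Y, b, Y') (Z, c, Z') (fcl (Y, b, Y') (Z, c, Z') (g, g')) (fcl (X, a, X') (Y, b, Y') (f, f'))
    = fcl (X, a, X') (Z, c, Z') (Cmp A X Y Z g f, Cmp A X' Y' Z' g' f')"
    unfolding freyd_def M.quotient_cmp[OF assms] by (simp add: morphism_cat_simps)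
  show "(Cmp A X Y Z g f, Cmp A X' Y' Z' g' f') \<in> Mor MC (X, a, X') (Z, c, Z')"
    using M.cmp_closed[OF assms] by (simp add: morphism_cat_simps)
qed

lemma freyd_zero:
  assumes "(X, a, X') \<in> Obj MC" "(Y, b, Y') \<in> Obj MC"
  shows "Zmor FC (X, a, X') (Y, b, Y') = fcl (X, a, X') (Y, b, Y') (Zmor A X Y, Zmor A X' Y')"
    and "(Zmor A X Y, Zmor A X' Y') \<in> Mor MC (X, a, X') (Y, b, Y')"
proof -
  interpret M: additive_quotient MC "zero_morphisms A" by (rule freyd_quotient)
  show "Zmor FC (X, a, X') (Y, b, Y') = fcl (X, a, X') (Y, b, Y') (Zmor A X Y, Zmor A X' Y')"
    unfolding freyd_def M.quotient_one[OF assms] by (simp add: morphism_cat_simps)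
  show "(Zmor A X Y, Zmor A X' Y') \<in> Mor MC (X, a, X') (Y, b, Y')"
    using M.zero_closed[OF assms] by (simp add: morphism_cat_simps)
qed

lemma freyd_cmp_eq:
  assumes o: "(X, a, X') \<in> Obj MC" "(Y, b, Y') \<in> Obj MC" "(Z, c, Z') \<in> Obj MC"
    and f: "(f, f') \<in> Mor MC (X, a, X') (Y, b, Y')" "(g, g') \<in> Mor MC (Y, b, Y') (Z, c, Z')"
      "(h, h') \<in> Mor MC (X, a, X') (Z, c, Z')"
  shows "Cmp FC (X, a, X') (Y, b, Y') (Z, c, Z') (fcl (Y, b, Y') (Z, c, Z') (g, g')) (fcl (X, a, X') (Y, b, Y') (f, f'))
      = fcl (X, a, X') (Z, c, Z') (h, h') \<longleftrightarrow> Cmp A X Z Z' c (Cmp A X Y Z g f) = Cmp A X Z Z' c h"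
  unfolding freyd_cmp(1)[OF o f(1,2)] by (rule freyd_eq_iff[OF o(1,3) freyd_cmp(2)[OF o f(1,2)] f(3)])

lemma preadditive_freyd: "preadditive_category FC"
  unfolding freyd_def by (rule additive_quotient.preadditive_quotient[OF freyd_quotient])

lemma freyd_embedding:
  assumes "X \<in> Obj A" shows "(X, Idm A X, X) \<in> Obj MC"
  using assms by (simp add: morphism_cat_Obj id_closed)

lemma freyd_embedding_Mor:
  assumes "X \<in> Obj A" "Y \<in> Obj A" "f \<in> Mor A X Y" shows "(f, f) \<in> Mor MC (X, Idm A X, X) (Y, Idm A Y, Y)"
  using assms by (simp add: morphism_cat_Mor cmp_id_left cmp_id_right)

text \<open>
  The embedding into the Freyd category is full and faithful, so a quasi-inverse of \<open>f\<close>
  there comes from one in the category itself.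
\<close>

lemma freyd_split_imp_regular:
  assumes o: "V \<in> Obj A" "W \<in> Obj A" "f \<in> Mor A V W" and s: "freyd_split A V f W"
  shows "arr.regular (Some (V, f, W))"
proof -
  interpret F: preadditive_category FC by (rule preadditive_freyd)
  let ?V = "(V, Idm A V, V)" and ?W = "(W, Idm A W, W)" and ?f = "freyd_mor A V W f"
  have fm: "?f = fcl ?V ?W (f, f)" by (simp add: freyd_mor_def freyd_obj_def)
  have V: "?V \<in> Obj MC" "?W \<in> Obj MC" using freyd_embedding o by blast+
  have fM: "(f, f) \<in> Mor MC ?V ?W" using freyd_embedding_Mor o by blast
  have fF: "?f \<in> Mor FC ?V ?W" unfolding freyd_Mor_iff fm using fM by blast
  have "is_split FC ?V ?f ?W" using s by (simp add: freyd_split_def freyd_obj_def)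
  then have reg: "F.arr.regular (Some (?V, ?f, ?W))"
    using F.is_split_imp_regular[OF fF] V by (simp add: freyd_simps)
  then obtain g where g: "F.arr.arr g (arrow_cd FC (Some (?V, ?f, ?W))) (arrow_dm FC (Some (?V, ?f, ?W)))"
    "arrow_cmp FC (Some (?V, ?f, ?W)) (arrow_cmp FC g (Some (?V, ?f, ?W))) = Some (?V, ?f, ?W)"
    using F.arr.regularE by blast
  then obtain G where G: "g = Some (?W, G, ?V)" "G \<in> Mor FC ?W ?V" using F.arr_arr_iff by auto
  obtain h h' where h: "(h, h') \<in> Mor MC ?W ?V" "G = fcl ?W ?V (h, h')" using G(2) unfolding freyd_Mor_iff by blast
  have "Cmp FC ?V ?W ?V G ?f \<in> Mor FC ?V ?V" using F.cmp_closed fF G(2) V by (simp add: freyd_simps(1))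
  then have e: "Cmp FC ?V ?V ?W ?f (Cmp FC ?V ?W ?V G ?f) = ?f"
    using g(2) fF G V unfolding G(1) by (simp add: arrow_cmp_Some freyd_simps(1) split: if_splits)
  have c1: "Cmp FC ?V ?W ?V G ?f = fcl ?V ?V (Cmp A V W V h f, Cmp A V W V h' f)"
    and c2: "(Cmp A V W V h f, Cmp A V W V h' f) \<in> Mor MC ?V ?V"
    unfolding h(2) fm using freyd_cmp[OF V(1,2) V(1) fM h(1)] by blast+
  have "Cmp A V W W (Idm A W) (Cmp A V V W f (Cmp A V W V h f)) = Cmp A V W W (Idm A W) f"
    using e unfolding c1 unfolding fm freyd_cmp_eq[OF V(1) V(1) V(2) c2 fM fM] .
  moreover have hA: "h \<in> Mor A W V" using h(1) by (simp add: morphism_cat_Mor)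
  ultimately have "Cmp A V V W f (Cmp A V W V h f) = f" using o by (simp add: cmp_id_left cmp_closed)
  then have "arrow_cmp A (Some (V, f, W)) (arrow_cmp A (Some (W, h, V)) (Some (V, f, W))) = Some (V, f, W)"
    using o hA by (simp add: arrow_cmp_Some cmp_closed)
  then show ?thesis unfolding arr.regular_def using o by auto
qed

lemma idempotent_complement:
  assumes V: "V \<in> Obj A" and e: "e \<in> Mor A V V" "Cmp A V V V e e = e"
  defines "d \<equiv> Idm A V \<otimes>\<^bsub>Hom A V V\<^esub> inv\<^bsub>Hom A V V\<^esub> e"
  shows "d \<in> Mor A V V" "d \<otimes>\<^bsub>Hom A V V\<^esub> e = Idm A V"
    "\<And>f W. \<lbrakk>W \<in> Obj A; f \<in> Mor A V W; Cmp A V V W f e = f\<rbrakk> \<Longrightarrow> Cmp A V V W f d = Zmor A V W"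
    "\<And>g W. \<lbrakk>W \<in> Obj A; g \<in> Mor A W V; Cmp A W V V e g = g\<rbrakk> \<Longrightarrow> Cmp A W V V d g = Zmor A W V"
    "Cmp A V V V d d = d"
proof -
  note ic = id_closed[OF V] inv_closed[OF V V e(1)]
  have dM: "Idm A V \<otimes>\<^bsub>Hom A V V\<^esub> inv\<^bsub>Hom A V V\<^esub> e \<in> Mor A V V" using add_closed[OF V V ic] .
  then show "d \<in> Mor A V V" by (simp add: d_def)
  interpret G: comm_group "Hom A V V" by (rule hom_comm_group[OF V V])
  show "d \<otimes>\<^bsub>Hom A V V\<^esub> e = Idm A V" unfolding d_def using ic e(1) by (simp add: G.m_assoc)
  show fd: "Cmp A V V W f d = Zmor A V W" if "W \<in> Obj A" "f \<in> Mor A V W" "Cmp A V V W f e = f" for f W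
    unfolding d_def cmp_add_right[OF V V that(1) ic that(2)] cmp_inv_right[OF V V that(1) e(1) that(2)] that(3)
      cmp_id_right[OF V that(1,2)] using group.r_inv[OF hom_group[OF V that(1)] that(2)] .
  show dg: "Cmp A W V V d g = Zmor A W V" if "W \<in> Obj A" "g \<in> Mor A W V" "Cmp A W V V e g = g" for g W
    unfolding d_def cmp_add_left[OF that(1) V V that(2) ic] cmp_inv_left[OF that(1) V V that(2) e(1)] that(3)
      cmp_id_left[OF that(1) V that(2)] using group.r_inv[OF hom_group[OF that(1) V] that(2)] .
  have de: "Cmp A V V V d e = Zmor A V V" by (rule dg[OF V e])
  have "Cmp A V V V d (Idm A V \<otimes>\<^bsub>Hom A V V\<^esub> inv\<^bsub>Hom A V V\<^esub> e)
      = Cmp A V V V d (Idm A V) \<otimes>\<^bsub>Hom A V V\<^esub> Cmp A V V V d (inv\<^bsub>Hom A V V\<^esub> e)"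
    by (rule cmp_add_right[OF V V V ic]) (use dM in \<open>simp add: d_def\<close>)
  also have "Cmp A V V V d (Idm A V) = d" using cmp_id_right[OF V V] dM by (simp add: d_def)
  also have "Cmp A V V V d (inv\<^bsub>Hom A V V\<^esub> e) = inv\<^bsub>Hom A V V\<^esub> (Zmor A V V)"
    using cmp_inv_right[OF V V V e(1), of d] dM de by (simp add: d_def)
  also have "d \<otimes>\<^bsub>Hom A V V\<^esub> inv\<^bsub>Hom A V V\<^esub> (Zmor A V V) = d" using dM by (simp add: d_def)
  finally show "Cmp A V V V d d = d" by (simp add: d_def)
qed

text \<open>
  The direct summands that a regular morphism \<open>f\<close> with quasi-inverse \<open>g\<close> requires exist in the
  Freyd category: the image of an idempotent \<open>e\<close> of \<open>V\<close> is the object \<open>e : V \<rightarrow> V\<close>.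
\<close>

lemma regular_imp_freyd_split:
  assumes V: "V \<in> Obj A" and W: "W \<in> Obj A" and f: "f \<in> Mor A V W" and r: "arr.regular (Some (V, f, W))"
  shows "freyd_split A V f W"
proof -
  obtain g0' where "arr.arr g0' (ida W) (ida V)" "arrow_cmp A (Some (V, f, W)) (arrow_cmp A g0' (Some (V, f, W))) = Some (V, f, W)"
    using arr.regularE[OF r] by auto
  then obtain g0 where g0: "g0 \<in> Mor A W V"
    "arrow_cmp A (Some (V, f, W)) (arrow_cmp A (Some (W, g0, V)) (Some (V, f, W))) = Some (V, f, W)"
    unfolding arr_arr_iff by blast
  let ?F = "Some (V, f, W)" and ?G0 = "Some (W, g0, V)"
  \<comment> \<open>this quasi-inverse also satisfies \<open>g f g = g\<close>\<close>
  define g where "g = Cmp A W W V g0 (Cmp A W V W f g0)"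
  have g: "g \<in> Mor A W V" unfolding g_def using V W f g0 cmp_closed by simp
  have G: "Some (W, g, V) = arrow_cmp A ?G0 (arrow_cmp A ?F ?G0)"
    unfolding g_def using V W f g0(1) by (simp add: arrow_cmp_Some cmp_closed)
  have red: "arrow_cmp A ?F (arrow_cmp A ?G0 (arrow_cmp A ?F x)) = arrow_cmp A ?F x" for x
    using arg_cong[OF g0(2), of "\<lambda>y. arrow_cmp A y x"] by (simp only: arr.cmp_assoc)
  have "arrow_cmp A ?F (arrow_cmp A (Some (W, g, V)) ?F) = ?F"
    unfolding G arr.cmp_assoc red by (rule g0(2))
  then have fgf: "Cmp A V V W f (Cmp A V W V g f) = f"
    using V W f g by (simp add: arrow_cmp_Some cmp_closed)
  have "arrow_cmp A (Some (W, g, V)) (arrow_cmp A ?F (Some (W, g, V))) = Some (W, g, V)"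
    unfolding G arr.cmp_assoc red ..
  then have gfg: "Cmp A W W V g (Cmp A W V W f g) = g"
    using V W f g by (simp add: arrow_cmp_Some cmp_closed)
  define e where "e = Cmp A V W V g f"
  define e' where "e' = Cmp A W V W f g"
  have e: "e \<in> Mor A V V" "Cmp A V V W f e = f" "Cmp A W V V e g = g"
    using V W f g fgf gfg cmp_closed cmp_assoc[OF W V W V g f g] by (simp_all add: e_def)
  have e': "e' \<in> Mor A W W" "Cmp A W W V g e' = g" "Cmp A V W W e' f = f"
    using V W f g fgf gfg cmp_closed cmp_assoc[OF V W V W f g f] by (simp_all add: e'_def)
  have ee: "Cmp A V V V e e = e"
    using cmp_assoc[OF V V W V e(1) f g] e(2) by (simp add: e_def)
  have e'e': "Cmp A W W W e' e' = e'"
    using cmp_assoc[OF W W V W e'(1) g f] e'(2) by (simp add: e'_def)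
  define d where "d = Idm A V \<otimes>\<^bsub>Hom A V V\<^esub> inv\<^bsub>Hom A V V\<^esub> e"
  define d' where "d' = Idm A W \<otimes>\<^bsub>Hom A W W\<^esub> inv\<^bsub>Hom A W W\<^esub> e'"
  note D = idempotent_complement[OF V e(1) ee, folded d_def] and D' = idempotent_complement[OF W e'(1) e'e', folded d'_def]
  have de: "Cmp A V V V d e = Zmor A V V" "Cmp A V V V e d = Zmor A V V" "Cmp A V V W f d = Zmor A V W"
    "Cmp A W V V d g = Zmor A W V"
    using D(3)[OF V e(1) ee] D(4)[OF V e(1) ee] D(3)[OF W f e(2)] D(4)[OF W g e(3)] by blast+
  have de': "Cmp A W W W d' e' = Zmor A W W" "Cmp A W W W e' d' = Zmor A W W" "Cmp A V W W d' f = Zmor A V W"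
    "Cmp A W W V g d' = Zmor A W V"
    using D'(3)[OF W e'(1) e'e'] D'(4)[OF W e'(1) e'e'] D'(4)[OF V f e'(3)] D'(3)[OF V g e'(2)] by blast+
  note iV = id_closed[OF V] and iW = id_closed[OF W]
  note ids = cmp_id_left[OF V V] cmp_id_right[OF V V] cmp_id_left[OF W W] cmp_id_right[OF W W]
    cmp_id_left[OF V W f] cmp_id_right[OF V W f] cmp_id_left[OF W V g] cmp_id_right[OF W V g]
  \<comment> \<open>\<open>X\<close>, \<open>Y\<close>, \<open>Z\<close> are the images of \<open>1 - e\<close>, \<open>e\<close>, \<open>1 - f g\<close>; the inclusion of the image of \<open>e\<close> into \<open>W\<close> is \<open>f\<close>\<close>
  let ?X = "(V, d, V)" and ?Y = "(V, e, V)" and ?Z = "(W, d', W)" and ?P = "(V, Idm A V, V)" and ?Q = "(W, Idm A W, W)"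
  have O: "?X \<in> Obj MC" "?Y \<in> Obj MC" "?Z \<in> Obj MC" "?P \<in> Obj MC" "?Q \<in> Obj MC"
    using V W D(1) D'(1) e(1) iV iW by (simp_all add: morphism_cat_Obj)
  note X = O(1) and Y = O(2) and Z = O(3) and P = O(4) and Q = O(5)
  have mo: "(d, Idm A V) \<in> Mor MC ?X ?P" "(e, Idm A V) \<in> Mor MC ?Y ?P" "(Idm A V, d) \<in> Mor MC ?P ?X" "(Idm A V, e) \<in> Mor MC ?P ?Y"
    "(f, f) \<in> Mor MC ?Y ?Q" "(d', Idm A W) \<in> Mor MC ?Z ?Q" "(g, g) \<in> Mor MC ?Q ?Y" "(Idm A W, d') \<in> Mor MC ?Q ?Z"
    "(f, f) \<in> Mor MC ?P ?Q"
    using D(1) D'(1) e e' f g iV iW ids by (simp_all add: morphism_cat_Mor)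
  note iX = mo(1) and iY = mo(2) and pX = mo(3) and pY = mo(4) and jY = mo(5) and jZ = mo(6) and qY = mo(7) and qZ = mo(8) and m = mo(9)
  interpret M: additive_quotient MC "zero_morphisms A" by (rule freyd_quotient)
  have idM: "(Idm A V, Idm A V) \<in> Mor MC ?X ?X" "(Idm A V, Idm A V) \<in> Mor MC ?Y ?Y" "(Idm A W, Idm A W) \<in> Mor MC ?Z ?Z"
    "(Idm A V, Idm A V) \<in> Mor MC ?P ?P" "(Idm A W, Idm A W) \<in> Mor MC ?Q ?Q"
    using D(1) D'(1) e(1) iV iW ids by (simp_all add: morphism_cat_Mor)
  have FI: "Idm FC ?X = fcl ?X ?X (Idm A V, Idm A V)" "Idm FC ?Y = fcl ?Y ?Y (Idm A V, Idm A V)"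
    "Idm FC ?Z = fcl ?Z ?Z (Idm A W, Idm A W)" "Idm FC ?P = fcl ?P ?P (Idm A V, Idm A V)" "Idm FC ?Q = fcl ?Q ?Q (Idm A W, Idm A W)"
    by (simp_all add: freyd_simps morphism_cat_simps)
  have fm: "fcl S T s \<in> Mor FC S T" if "s \<in> Mor MC S T" for S T s using that unfolding freyd_simps by blast
  have add: "fcl S T s \<otimes>\<^bsub>Hom FC S T\<^esub> fcl S T t = fcl S T (s \<otimes>\<^bsub>Hom MC S T\<^esub> t)"
    if "S \<in> Obj MC" "T \<in> Obj MC" "s \<in> Mor MC S T" "t \<in> Mor MC S T" for S T s t
    unfolding freyd_def by (rule M.quotient_mult[OF that])
  have B1: "is_biproduct FC ?X ?Y ?P (fcl ?X ?P (d, Idm A V)) (fcl ?Y ?P (e, Idm A V)) (fcl ?P ?X (Idm A V, d)) (fcl ?P ?Y (Idm A V, e))"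
    unfolding is_biproduct_def
  proof (intro conjI)
    show "?X \<in> Obj FC" "?Y \<in> Obj FC" "?P \<in> Obj FC" using O by (simp_all add: freyd_simps)
    show "Cmp FC ?X ?P ?X (fcl ?P ?X (Idm A V, d)) (fcl ?X ?P (d, Idm A V)) = Idm FC ?X"
      unfolding FI freyd_cmp_eq[OF X P X iX pX idM(1)] using D(1,5) ids by simp
    show "Cmp FC ?Y ?P ?Y (fcl ?P ?Y (Idm A V, e)) (fcl ?Y ?P (e, Idm A V)) = Idm FC ?Y"
      unfolding FI freyd_cmp_eq[OF Y P Y iY pY idM(2)] using e(1) ee ids by simp
    show "Cmp FC ?Y ?P ?X (fcl ?P ?X (Idm A V, d)) (fcl ?Y ?P (e, Idm A V)) = Zmor FC ?Y ?X"
      unfolding freyd_zero(1)[OF Y X] freyd_cmp_eq[OF Y P X iY pX freyd_zero(2)[OF Y X]]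
      using e(1) de ids cmp_zero_right[OF V V V D(1)] by simp
    show "Cmp FC ?X ?P ?Y (fcl ?P ?Y (Idm A V, e)) (fcl ?X ?P (d, Idm A V)) = Zmor FC ?X ?Y"
      unfolding freyd_zero(1)[OF X Y] freyd_cmp_eq[OF X P Y iX pY freyd_zero(2)[OF X Y]]
      using D(1) de ids cmp_zero_right[OF V V V e(1)] by simp
    note c1 = freyd_cmp[OF P X P pX iX] and c2 = freyd_cmp[OF P Y P pY iY]
    show "Cmp FC ?P ?X ?P (fcl ?X ?P (d, Idm A V)) (fcl ?P ?X (Idm A V, d)) \<otimes>\<^bsub>Hom FC ?P ?P\<^esub>
        Cmp FC ?P ?Y ?P (fcl ?Y ?P (e, Idm A V)) (fcl ?P ?Y (Idm A V, e)) = Idm FC ?P"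
      unfolding c1(1) c2(1) add[OF P P c1(2) c2(2)] unfolding morphism_cat_simps
      using D(1,2) e(1) ids by (simp add: FI)
  qed (use mo fm in blast)+
  have B2: "is_biproduct FC ?Y ?Z ?Q (fcl ?Y ?Q (f, f)) (fcl ?Z ?Q (d', Idm A W)) (fcl ?Q ?Y (g, g)) (fcl ?Q ?Z (Idm A W, d'))"
    unfolding is_biproduct_def
  proof (intro conjI)
    show "?Y \<in> Obj FC" "?Z \<in> Obj FC" "?Q \<in> Obj FC" using O by (simp_all add: freyd_simps)
    show "Cmp FC ?Y ?Q ?Y (fcl ?Q ?Y (g, g)) (fcl ?Y ?Q (f, f)) = Idm FC ?Y"
      unfolding FI freyd_cmp_eq[OF Y Q Y jY qY idM(2)] using e(1) ee ids by (simp flip: e_def)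
    show "Cmp FC ?Z ?Q ?Z (fcl ?Q ?Z (Idm A W, d')) (fcl ?Z ?Q (d', Idm A W)) = Idm FC ?Z"
      unfolding FI freyd_cmp_eq[OF Z Q Z jZ qZ idM(3)] using D'(1,5) ids by simp
    show "Cmp FC ?Z ?Q ?Y (fcl ?Q ?Y (g, g)) (fcl ?Z ?Q (d', Idm A W)) = Zmor FC ?Z ?Y"
      unfolding freyd_zero(1)[OF Z Y] freyd_cmp_eq[OF Z Q Y jZ qY freyd_zero(2)[OF Z Y]]
      using de' by simp
    show "Cmp FC ?Y ?Q ?Z (fcl ?Q ?Z (Idm A W, d')) (fcl ?Y ?Q (f, f)) = Zmor FC ?Y ?Z"
      unfolding freyd_zero(1)[OF Y Z] freyd_cmp_eq[OF Y Q Z jY qZ freyd_zero(2)[OF Y Z]]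
      using de' ids cmp_zero_right[OF V W W D'(1)] by simp
    note c1 = freyd_cmp[OF Q Y Q qY jY] and c2 = freyd_cmp[OF Q Z Q qZ jZ]
    have "e' \<otimes>\<^bsub>Hom A W W\<^esub> d' = Idm A W"
      using D'(2) comm_monoid.m_comm[OF comm_group.axioms(1)[OF hom_comm_group[OF W W]] D'(1) e'(1)] by simp
    then show "Cmp FC ?Q ?Y ?Q (fcl ?Y ?Q (f, f)) (fcl ?Q ?Y (g, g)) \<otimes>\<^bsub>Hom FC ?Q ?Q\<^esub>
        Cmp FC ?Q ?Z ?Q (fcl ?Z ?Q (d', Idm A W)) (fcl ?Q ?Z (Idm A W, d')) = Idm FC ?Q"
      unfolding c1(1) c2(1) add[OF Q Q c1(2) c2(2)] unfolding morphism_cat_simps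
      using D'(1) ids by (simp add: FI flip: e'_def)
  qed (use mo fm in blast)+
  let ?m = "fcl ?P ?Q (f, f)"
  note qm = freyd_cmp[OF P Q Y m qY] and qm' = freyd_cmp[OF P Q Z m qZ]
  have m1: "Cmp FC ?X ?P ?Y (Cmp FC ?P ?Q ?Y (fcl ?Q ?Y (g, g)) ?m) (fcl ?X ?P (d, Idm A V)) = Zmor FC ?X ?Y"
    unfolding qm(1) freyd_zero(1)[OF X Y] freyd_cmp_eq[OF X P Y iX qm(2) freyd_zero(2)[OF X Y]]
    using de by (simp flip: e_def)
  have m2: "Cmp FC ?Y ?P ?Y (Cmp FC ?P ?Q ?Y (fcl ?Q ?Y (g, g)) ?m) (fcl ?Y ?P (e, Idm A V)) = Idm FC ?Y"
    unfolding qm(1) FI freyd_cmp_eq[OF Y P Y iY qm(2) idM(2)] using ee e(1) ids by (simp flip: e_def)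
  have m3: "Cmp FC ?X ?P ?Z (Cmp FC ?P ?Q ?Z (fcl ?Q ?Z (Idm A W, d')) ?m) (fcl ?X ?P (d, Idm A V)) = Zmor FC ?X ?Z"
    unfolding qm'(1) freyd_zero(1)[OF X Z] freyd_cmp_eq[OF X P Z iX qm'(2) freyd_zero(2)[OF X Z]]
    using de ids by simp
  have m4: "Cmp FC ?Y ?P ?Z (Cmp FC ?P ?Q ?Z (fcl ?Q ?Z (Idm A W, d')) ?m) (fcl ?Y ?P (e, Idm A V)) = Zmor FC ?Y ?Z"
    unfolding qm'(1) freyd_zero(1)[OF Y Z] freyd_cmp_eq[OF Y P Z iY qm'(2) freyd_zero(2)[OF Y Z]]
    using e(2) ids de'(3) cmp_zero_right[OF V W W D'(1)] by simp
  interpret F: preadditive_category FC by (rule preadditive_freyd)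
  have mF: "?m \<in> Mor FC ?P ?Q" using fm m by blast
  interpret FM: preadditive_category "morphism_cat FC" by (rule F.preadditive_morphism_cat)
  have PQ: "(?P, ?m, ?Q) \<in> Obj (morphism_cat FC)" using mF P Q by (simp add: F.morphism_cat_Obj freyd_simps)
  have "isomorphic (morphism_cat FC) (?P, ?m, ?Q) (?P, ?m, ?Q)"
    unfolding isomorphic_def using FM.id_closed[OF PQ] FM.cmp_id_left[OF PQ PQ] by blast
  then have "is_split FC ?P ?m ?Q"
    unfolding is_split_def using B1 B2 mF m1 m2 m3 m4 by blast
  then show ?thesis by (simp add: freyd_split_def freyd_obj_def freyd_mor_def)
qed

end

context weakly_abelian_category
begin

text \<open>
  The object \<open>f : U \<rightarrow> P\<close> of the Freyd category is a kernel of
  \<open>g\<close>. A morphism to \<open>P\<close> is determined by its first component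
  \<open>h\<close>, and if \<open>g h = 0\<close>, then \<open>h\<close> factors through the weak
  kernel \<open>f\<close>; two factorizations agree since only their composites with \<open>f\<close>
  matter in the Freyd category. The morphism from \<open>U\<close> to this kernel is epi as its first
  component is an identity.
\<close>

lemma wker_imp_exact_at_freyd:
  assumes o: "U \<in> Obj A" "P \<in> Obj A" "X \<in> Obj A" "f \<in> Mor A U P" "g \<in> Mor A P X"
    and w: "arr.wker (Some (U, f, P)) (Some (P, g, X))"
  shows "exact_at FC (freyd_obj A U) (freyd_mor A U P f) (freyd_obj A P) (freyd_mor A P X g) (freyd_obj A X)"
proof -
  let ?U = "(U, Idm A U, U)" and ?P = "(P, Idm A P, P)" and ?X = "(X, Idm A X, X)" and ?K = "(U, f, P)"
  have O: "?U \<in> Obj MC" "?P \<in> Obj MC" "?X \<in> Obj MC" "?K \<in> Obj MC"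
    using o freyd_embedding by (simp_all add: morphism_cat_Obj id_closed)
  note iU = id_closed[OF o(1)] and iP = id_closed[OF o(2)] and iX = id_closed[OF o(3)]
  have fM: "(f, f) \<in> Mor MC ?U ?P" and gM: "(g, g) \<in> Mor MC ?P ?X" using freyd_embedding_Mor o by blast+
  have kM: "(f, Idm A P) \<in> Mor MC ?K ?P" using o iP by (simp add: morphism_cat_Mor)
  have eM: "(Idm A U, f) \<in> Mor MC ?U ?K" using o iU by (simp add: morphism_cat_Mor)
  let ?f = "fcl ?U ?P (f, f)" and ?g = "fcl ?P ?X (g, g)" and ?k = "fcl ?K ?P (f, Idm A P)" and ?e = "fcl ?U ?K (Idm A U, f)"
  have fm: "fcl S T s \<in> Mor FC S T" if "s \<in> Mor MC S T" for S T s using that unfolding freyd_simps by blast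
  have gf: "Cmp A U P X g f = Zmor A U X"
    using w o unfolding arr.wker_def by (simp add: arrow_cmp_Some arr_isz_iff)
  have kernel: "is_kernel FC ?K ?k ?P ?g ?X"
    unfolding is_kernel_def
  proof (intro conjI ballI impI)
    show "?K \<in> Obj FC" using O by (simp add: freyd_simps)
    show "?k \<in> Mor FC ?K ?P" by (rule fm[OF kM])
    show "Cmp FC ?K ?P ?X ?g ?k = Zmor FC ?K ?X"
      unfolding freyd_zero(1)[OF O(4,3)] freyd_cmp_eq[OF O(4,2,3) kM gM freyd_zero(2)[OF O(4,3)]] gf ..
  next
    fix T H assume T: "T \<in> Obj FC" and H: "H \<in> Mor FC T ?P" and z: "Cmp FC T ?P ?X ?g H = Zmor FC T ?X"
    obtain T0 t T1 where e: "T = (T0, t, T1)" by (metis surj_pair)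
    have TM: "(T0, t, T1) \<in> Obj MC" using T by (simp add: e freyd_simps)
    then have t: "T0 \<in> Obj A" "T1 \<in> Obj A" "t \<in> Mor A T0 T1" by (auto simp: morphism_cat_Obj)
    obtain h h' where h: "(h, h') \<in> Mor MC (T0, t, T1) ?P" "H = fcl (T0, t, T1) ?P (h, h')"
      using H unfolding e freyd_Mor_iff by blast
    have hA: "h \<in> Mor A T0 P" "h' \<in> Mor A T1 P" "Cmp A T0 P P (Idm A P) h = Cmp A T0 T1 P h' t"
      using h(1) by (simp_all add: morphism_cat_Mor)
    then have hsq: "h = Cmp A T0 T1 P h' t" using cmp_id_left[OF t(1) o(2)] by simp
    have "Cmp A T0 X X (Idm A X) (Cmp A T0 P X g h) = Cmp A T0 X X (Idm A X) (Zmor A T0 X)"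
      using z unfolding e h(2) freyd_zero(1)[OF TM O(3)] freyd_cmp_eq[OF TM O(2,3) h(1) gM freyd_zero(2)[OF TM O(3)]] .
    then have "Cmp A T0 P X g h = Zmor A T0 X"
      using cmp_id_left[OF t(1) o(3)] cmp_closed[OF t(1) o(2,3) hA(1) o(5)] zero_closed[OF t(1) o(3)] by simp
    then have "arr.isz (arrow_cmp A (Some (P, g, X)) (Some (T0, h, P)))"
      using o t hA by (simp add: arrow_cmp_Some arr_isz_iff)
    then obtain u where u: "Some (T0, h, P) = arrow_cmp A (Some (U, f, P)) u" using w unfolding arr.wker_def by blast
    obtain u0 where u0: "u0 \<in> Mor A T0 U" "h = Cmp A T0 U P f u0"
      using u by (cases u rule: arrow_cases) (auto simp: arrow_cmp_Some split: if_splits)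
    have uM: "(u0, h') \<in> Mor MC (T0, t, T1) ?K" using u0 hA hsq by (simp add: morphism_cat_Mor)
    have ku: "Cmp FC T ?K ?P ?k (fcl (T0, t, T1) ?K (u0, h')) = H"
    proof -
      have "Cmp A T0 P P (Idm A P) (Cmp A T0 U P f u0) = Cmp A T0 P P (Idm A P) h" using u0(2) by simp
      then show ?thesis unfolding e h(2) freyd_cmp_eq[OF TM O(4,2) uM kM h(1)] .
    qed
    show "\<exists>!u. u \<in> Mor FC T ?K \<and> Cmp FC T ?K ?P ?k u = H"
    proof (rule ex1I[of _ "fcl (T0, t, T1) ?K (u0, h')"])
      show "fcl (T0, t, T1) ?K (u0, h') \<in> Mor FC T ?K \<and> Cmp FC T ?K ?P ?k (fcl (T0, t, T1) ?K (u0, h')) = H"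
        using ku fm[OF uM] unfolding e by blast
      fix v assume v: "v \<in> Mor FC T ?K \<and> Cmp FC T ?K ?P ?k v = H"
      then obtain v0 v1 where vM: "(v0, v1) \<in> Mor MC (T0, t, T1) ?K" "v = fcl (T0, t, T1) ?K (v0, v1)"
        unfolding e freyd_Mor_iff by blast
      have "Cmp A T0 P P (Idm A P) (Cmp A T0 U P f v0) = Cmp A T0 P P (Idm A P) h"
        using v unfolding e h(2) vM(2) freyd_cmp_eq[OF TM O(4,2) vM(1) kM h(1)] by blast
      moreover have "v0 \<in> Mor A T0 U" using vM(1) by (simp add: morphism_cat_Mor)
      ultimately have "Cmp A T0 U P f v0 = h"
        using cmp_id_left[OF t(1) o(2)] cmp_closed[OF t(1) o(1,2)] hA(1) o(4) by simp
      then show "v = fcl (T0, t, T1) ?K (u0, h')"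
        unfolding vM(2) freyd_eq_iff[OF TM O(4) vM(1) uM] u0(2) .
    qed
  qed
  have epi: "is_epi FC ?U ?e ?K"
    unfolding is_epi_def
  proof (intro conjI ballI impI)
    show "?e \<in> Mor FC ?U ?K" by (rule fm[OF eM])
    fix Z p q assume Z: "Z \<in> Obj FC" and p: "p \<in> Mor FC ?K Z" and q: "q \<in> Mor FC ?K Z"
      and eq: "Cmp FC ?U ?K Z p ?e = Cmp FC ?U ?K Z q ?e"
    obtain Z0 z Z1 where e: "Z = (Z0, z, Z1)" by (metis surj_pair)
    have ZM: "(Z0, z, Z1) \<in> Obj MC" using Z by (simp add: e freyd_simps)
    then have z: "Z0 \<in> Obj A" by (auto simp: morphism_cat_Obj)
    obtain p0 p1 where pM: "(p0, p1) \<in> Mor MC ?K (Z0, z, Z1)" "p = fcl ?K (Z0, z, Z1) (p0, p1)"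
      using p unfolding e freyd_Mor_iff by blast
    obtain q0 q1 where qM: "(q0, q1) \<in> Mor MC ?K (Z0, z, Z1)" "q = fcl ?K (Z0, z, Z1) (q0, q1)"
      using q unfolding e freyd_Mor_iff by blast
    note qe = freyd_cmp[OF O(1,4) ZM eM qM(1)]
    have "Cmp A U Z0 Z1 z (Cmp A U U Z0 p0 (Idm A U)) = Cmp A U Z0 Z1 z (Cmp A U U Z0 q0 (Idm A U))"
      using eq unfolding e pM(2) qM(2) qe(1) freyd_cmp_eq[OF O(1,4) ZM eM pM(1) qe(2)] .
    then show "p = q"
      unfolding e pM(2) qM(2) freyd_eq_iff[OF O(4) ZM pM(1) qM(1)]
      using pM(1) qM(1) cmp_id_right[OF o(1) z] by (simp add: morphism_cat_Mor)
  qed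
  have ke: "?f = Cmp FC ?U ?K ?P ?k ?e"
    using freyd_cmp_eq[OF O(1,4,2) eM kM fM] cmp_id_right[OF o(1,2,4)] by simp
  show ?thesis
    unfolding exact_at_def freyd_obj_def freyd_mor_def
    using O fm[OF fM] fm[OF gM] kernel epi ke by (simp add: freyd_simps(1)) blast
qed

text \<open>
  Conversely, let \<open>f = k e\<close> with \<open>k\<close> a kernel of \<open>g\<close>, given by \<open>K\<^sub>0 \<rightarrow> K\<^sub>1\<close>, and \<open>e\<close> an epimorphism.
  The morphism \<open>U \<rightarrow> K\<^sub>1\<close> is a weak kernel of its weak cokernel \<open>c\<close>. As \<open>e\<close> is epi, \<open>c\<close> kills \<open>K\<^sub>0\<close>,
  and so \<open>K\<^sub>0 \<rightarrow> K\<^sub>1\<close> factors through \<open>U\<close>.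
\<close>

lemma exact_at_freyd_imp_wker:
  assumes o: "U \<in> Obj A" "P \<in> Obj A" "X \<in> Obj A" "f \<in> Mor A U P" "g \<in> Mor A P X"
    and ex: "exact_at FC (freyd_obj A U) (freyd_mor A U P f) (freyd_obj A P) (freyd_mor A P X g) (freyd_obj A X)"
  shows "arr.wker (Some (U, f, P)) (Some (P, g, X))"
proof -
  let ?U = "(U, Idm A U, U)" and ?P = "(P, Idm A P, P)" and ?X = "(X, Idm A X, X)"
  have O: "?U \<in> Obj MC" "?P \<in> Obj MC" "?X \<in> Obj MC" using o freyd_embedding by blast+
  have fM: "(f, f) \<in> Mor MC ?U ?P" and gM: "(g, g) \<in> Mor MC ?P ?X" using freyd_embedding_Mor o by blast+
  let ?f = "fcl ?U ?P (f, f)" and ?g = "fcl ?P ?X (g, g)"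
  obtain K k e where K: "is_kernel FC K k ?P ?g ?X" and ep: "is_epi FC ?U e K" and fke: "?f = Cmp FC ?U K ?P k e"
    using ex unfolding exact_at_def freyd_obj_def freyd_mor_def by blast
  obtain K0 \<kappa> K1 where Ke: "K = (K0, \<kappa>, K1)" by (metis surj_pair)
  have KM: "(K0, \<kappa>, K1) \<in> Obj MC" using K unfolding is_kernel_def Ke by (simp add: freyd_simps)
  then have Ko: "K0 \<in> Obj A" "K1 \<in> Obj A" "\<kappa> \<in> Mor A K0 K1" by (auto simp: morphism_cat_Obj)
  obtain k0 k1 where kM: "(k0, k1) \<in> Mor MC (K0, \<kappa>, K1) ?P" "k = fcl (K0, \<kappa>, K1) ?P (k0, k1)"
  proof -
    have "k \<in> Mor FC K ?P" using K unfolding is_kernel_def by (elim conjE)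
    then show thesis using that unfolding Ke freyd_Mor_iff by blast
  qed
  obtain e0 e1 where eM: "(e0, e1) \<in> Mor MC ?U (K0, \<kappa>, K1)" "e = fcl ?U (K0, \<kappa>, K1) (e0, e1)"
  proof -
    have "e \<in> Mor FC ?U K" using ep unfolding is_epi_def by (elim conjE)
    then show thesis using that unfolding Ke freyd_Mor_iff by blast
  qed
  have kA: "k0 \<in> Mor A K0 P" "k1 \<in> Mor A K1 P" and ksq0: "Cmp A K0 P P (Idm A P) k0 = Cmp A K0 K1 P k1 \<kappa>"
    using kM(1) by (simp_all add: morphism_cat_Mor)
  have ksq: "k0 = Cmp A K0 K1 P k1 \<kappa>" using ksq0 cmp_id_left[OF Ko(1) o(2) kA(1)] by simp
  have eA: "e0 \<in> Mor A U K0" "e1 \<in> Mor A U K1" using eM(1) by (simp_all add: morphism_cat_Mor)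
  have "Cmp A U P P (Idm A P) (Cmp A U K0 P k0 e0) = Cmp A U P P (Idm A P) f"
    using fke[symmetric] unfolding Ke kM(2) eM(2) freyd_cmp_eq[OF O(1) KM O(2) eM(1) kM(1) fM] .
  then have f: "f = Cmp A U K0 P k0 e0"
    using cmp_id_left[OF o(1,2)] cmp_closed[OF o(1) Ko(1) o(2) eA(1) kA(1)] o(4) by simp
  have "Cmp FC (K0, \<kappa>, K1) ?P ?X ?g k = Zmor FC (K0, \<kappa>, K1) ?X" using K unfolding is_kernel_def Ke by blast
  then have "Cmp A K0 X X (Idm A X) (Cmp A K0 P X g k0) = Cmp A K0 X X (Idm A X) (Zmor A K0 X)"
    unfolding kM(2) freyd_zero(1)[OF KM O(3)] freyd_cmp_eq[OF KM O(2,3) kM(1) gM freyd_zero(2)[OF KM O(3)]] .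
  then have gk: "Cmp A K0 P X g k0 = Zmor A K0 X"
    using cmp_id_left[OF Ko(1) o(3)] cmp_closed[OF Ko(1) o(2,3) kA(1) o(5)] zero_closed[OF Ko(1) o(3)] by simp
  let ?ae = "Some (U, e0, K0)" and ?a\<kappa> = "Some (K0, \<kappa>, K1)" and ?ak = "Some (K0, k0, P)" and ?ak1 = "Some (K1, k1, P)"
  let ?c = "arrow_cmp A"
  have ae: "?c ?a\<kappa> ?ae = Some (U, Cmp A U K0 K1 \<kappa> e0, K1)" using o Ko eA by (simp add: arrow_cmp_Some)
  have af: "Some (U, f, P) = ?c ?ak ?ae" and akk: "?ak = ?c ?ak1 ?a\<kappa>"
    using o Ko eA kA f ksq by (simp_all add: arrow_cmp_Some)
  have okae: "arrow_ok A (?c ?a\<kappa> ?ae)" using o Ko eA by (simp add: ae cmp_closed)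
  obtain c where c: "arr.wcok (?c ?a\<kappa> ?ae) c" using arr.wcok_exists[OF okae] by blast
  then have cz: "arr.isz (?c c (?c ?a\<kappa> ?ae))" unfolding arr.wcok_def by blast
  obtain Q c0 where Q: "c = Some (K1, c0, Q)" "Q \<in> Obj A" "c0 \<in> Mor A K1 Q"
    using arr.isz_ok[OF cz] unfolding ae by (cases c rule: arrow_cases) auto
  have ck: "Cmp A K0 K1 Q c0 \<kappa> \<in> Mor A K0 Q" using cmp_closed[OF Ko(1,2) Q(2) Ko(3) Q(3)] .
  \<comment> \<open>the pair \<open>(1, c)\<close> is a morphism from \<open>K\<close> to \<open>?Z\<close> that is killed by \<open>e\<close>\<close>
  let ?Z = "(K0, Cmp A K0 K1 Q c0 \<kappa>, Q)"
  have ZM: "?Z \<in> Obj MC" using Ko Q ck by (simp add: morphism_cat_Obj)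
  have yM: "(Idm A K0, c0) \<in> Mor MC (K0, \<kappa>, K1) ?Z"
    using Ko Q ck id_closed[OF Ko(1)] cmp_id_right[OF Ko(1) Q(2) ck] by (simp add: morphism_cat_Mor)
  have zM: "(Zmor A K0 K0, Zmor A K1 Q) \<in> Mor MC (K0, \<kappa>, K1) ?Z" by (rule freyd_zero(2)[OF KM ZM])
  have c\<kappa>e: "Cmp A U K0 Q (Cmp A K0 K1 Q c0 \<kappa>) e0 = Zmor A U Q"
  proof -
    have "Cmp A U K1 Q c0 (Cmp A U K0 K1 \<kappa> e0) = Zmor A U Q"
      using cz o Ko eA Q unfolding ae Q(1) by (simp add: arrow_cmp_Some cmp_closed arr_isz_iff)
    then show ?thesis using cmp_assoc[OF o(1) Ko(1,2) Q(2) eA(1) Ko(3) Q(3)] by simp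
  qed
  let ?y = "fcl (K0, \<kappa>, K1) ?Z (Idm A K0, c0)" and ?z = "fcl (K0, \<kappa>, K1) ?Z (Zmor A K0 K0, Zmor A K1 Q)"
  note ze = freyd_cmp[OF O(1) KM ZM eM(1) zM]
  have "Cmp FC ?U (K0, \<kappa>, K1) ?Z ?y e = Cmp FC ?U (K0, \<kappa>, K1) ?Z ?z e"
    unfolding eM(2) ze(1) freyd_cmp_eq[OF O(1) KM ZM eM(1) yM ze(2)]
    using c\<kappa>e cmp_id_left[OF o(1) Ko(1) eA(1)] cmp_zero_left[OF o(1) Ko(1) Ko(1) eA(1)]
      cmp_zero_right[OF o(1) Ko(1) Q(2) ck] by simp
  moreover have "?y \<in> Mor FC (K0, \<kappa>, K1) ?Z" "?z \<in> Mor FC (K0, \<kappa>, K1) ?Z" "?Z \<in> Obj FC"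
    using yM zM ZM unfolding freyd_simps by blast+
  ultimately have "?y = ?z" using ep unfolding is_epi_def Ke by blast
  then have "Cmp A K0 K0 Q (Cmp A K0 K1 Q c0 \<kappa>) (Idm A K0) = Cmp A K0 K0 Q (Cmp A K0 K1 Q c0 \<kappa>) (Zmor A K0 K0)"
    unfolding freyd_eq_iff[OF KM ZM yM zM] .
  then have "Cmp A K0 K1 Q c0 \<kappa> = Zmor A K0 Q"
    using cmp_id_right[OF Ko(1) Q(2) ck] cmp_zero_right[OF Ko(1,1) Q(2) ck] by simp
  then have "arr.isz (?c c ?a\<kappa>)" using Ko Q by (simp add: arrow_cmp_Some arr_isz_iff)
  then obtain s where s: "?a\<kappa> = ?c (?c ?a\<kappa> ?ae) s" using arr.wcok_imp_wker[OF c] unfolding arr.wker_def by blast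
  have gz: "arr.isz (?c (Some (P, g, X)) ?ak)" using gk o Ko kA by (simp add: arrow_cmp_Some arr_isz_iff)
  have "arr.isz (?c (?c (Some (P, g, X)) ?ak) ?ae)" by (rule arr.isz_cmp_left[OF gz]) (use o Ko kA eA in simp)
  then have "arr.isz (?c (Some (P, g, X)) (Some (U, f, P)))" unfolding af by (simp only: arr.cmp_assoc)
  moreover have "\<exists>u. h = ?c (Some (U, f, P)) u" if hz: "arr.isz (?c (Some (P, g, X)) h)" for h
  proof -
    obtain S h0 where h: "h = Some (S, h0, P)" "S \<in> Obj A" "h0 \<in> Mor A S P"
      using arr.isz_ok[OF hz] by (cases h rule: arrow_cases) auto
    then have gh: "Cmp A S P X g h0 = Zmor A S X" using hz o by (simp add: arrow_cmp_Some arr_isz_iff)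
    let ?S = "(S, Idm A S, S)"
    have SM: "?S \<in> Obj MC" by (rule freyd_embedding[OF h(2)])
    have hM: "(h0, h0) \<in> Mor MC ?S ?P" using freyd_embedding_Mor o h by blast
    have "Cmp FC ?S ?P ?X ?g (fcl ?S ?P (h0, h0)) = Zmor FC ?S ?X"
      unfolding freyd_zero(1)[OF SM O(3)] freyd_cmp_eq[OF SM O(2,3) hM gM freyd_zero(2)[OF SM O(3)]] gh ..
    moreover have "fcl ?S ?P (h0, h0) \<in> Mor FC ?S ?P" "?S \<in> Obj FC" using hM SM unfolding freyd_simps by blast+
    ultimately obtain u where u: "u \<in> Mor FC ?S K" "Cmp FC ?S K ?P k u = fcl ?S ?P (h0, h0)"
      using K unfolding is_kernel_def by blast
    obtain u0 u1 where uM: "(u0, u1) \<in> Mor MC ?S (K0, \<kappa>, K1)" "u = fcl ?S (K0, \<kappa>, K1) (u0, u1)"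
      using u(1) unfolding Ke freyd_Mor_iff by blast
    have uA: "u0 \<in> Mor A S K0" using uM(1) by (simp add: morphism_cat_Mor)
    have "Cmp A S P P (Idm A P) (Cmp A S K0 P k0 u0) = Cmp A S P P (Idm A P) h0"
      using u(2) unfolding Ke kM(2) uM(2) freyd_cmp_eq[OF SM KM O(2) uM(1) kM(1) hM] .
    then have "h0 = Cmp A S K0 P k0 u0"
      using cmp_id_left[OF h(2) o(2)] cmp_closed[OF h(2) Ko(1) o(2) uA kA(1)] h(3) by simp
    then have "h = ?c ?ak (Some (S, u0, K0))" using h Ko o kA uA by (simp add: arrow_cmp_Some)
    also have "\<dots> = ?c (?c ?ak1 ?a\<kappa>) (Some (S, u0, K0))" unfolding akk ..
    also have "\<dots> = ?c ?ak1 (?c (?c (?c ?a\<kappa> ?ae) s) (Some (S, u0, K0)))"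
      using s by (simp add: arr.cmp_assoc)
    also have "\<dots> = ?c (Some (U, f, P)) (?c s (Some (S, u0, K0)))"
      unfolding af akk by (simp only: arr.cmp_assoc)
    finally show ?thesis by blast
  qed
  ultimately show ?thesis unfolding arr.wker_def by blast
qed

text \<open>
  Exactness at the direct sum means that the first arrow is a weak kernel of the second, for any
  choice of the direct sum.
\<close>

lemma is_weak_square_iff:
  "is_weak_square A U V W X a b c d \<longleftrightarrow>
    U \<in> Obj A \<and> V \<in> Obj A \<and> W \<in> Obj A \<and> X \<in> Obj A \<and>
    a \<in> Mor A U V \<and> b \<in> Mor A U W \<and> c \<in> Mor A V X \<and> d \<in> Mor A W X \<and>
    arr.wpb (Some (U, a, V)) (Some (U, b, W)) (Some (V, c, X)) (Some (W, d, X))"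
proof -
  have key: "(Cmp A U V X c a = Cmp A U W X d b \<and> exact_at FC
        (freyd_obj A U) (freyd_mor A U P (Cmp A U V P i a \<otimes>\<^bsub>Hom A U P\<^esub> Cmp A U W P j b)) (freyd_obj A P)
        (freyd_mor A P X (Cmp A P V X c p \<otimes>\<^bsub>Hom A P X\<^esub> inv\<^bsub>Hom A P X\<^esub> Cmp A P W X d q)) (freyd_obj A X))
      \<longleftrightarrow> arr.wpb (Some (U, a, V)) (Some (U, b, W)) (Some (V, c, X)) (Some (W, d, X))"
    if o: "U \<in> Obj A" "V \<in> Obj A" "W \<in> Obj A" "X \<in> Obj A" "a \<in> Mor A U V" "b \<in> Mor A U W" "c \<in> Mor A V X" "d \<in> Mor A W X"
      and P: "is_biproduct A V W P i j p q" for P i j p q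
  proof -
    have Po: "P \<in> Obj A" "i \<in> Mor A V P" "j \<in> Mor A W P" "p \<in> Mor A P V" "q \<in> Mor A P W"
      using P unfolding is_biproduct_def by blast+
    let ?f = "Cmp A U V P i a \<otimes>\<^bsub>Hom A U P\<^esub> Cmp A U W P j b"
    let ?g = "Cmp A P V X c p \<otimes>\<^bsub>Hom A P X\<^esub> inv\<^bsub>Hom A P X\<^esub> Cmp A P W X d q"
    have fm: "?f \<in> Mor A U P" "?g \<in> Mor A P X" using o Po by (simp_all add: add_closed cmp_closed inv_closed)
    have fa: "arrow_add A (arrow_cmp A (Some (V, i, P)) (Some (U, a, V))) (arrow_cmp A (Some (W, j, P)) (Some (U, b, W))) = Some (U, ?f, P)"
      using o Po by (simp add: arrow_cmp_Some arrow_add_Some cmp_closed)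
    have ga: "arrow_add A (arrow_cmp A (Some (V, c, X)) (Some (P, p, V))) (arrow_neg A (arrow_cmp A (Some (W, d, X)) (Some (P, q, W)))) = Some (P, ?g, X)"
      using o Po by (simp add: arrow_cmp_Some arrow_add_Some arrow_neg_Some cmp_closed inv_closed)
    have w: "arr.wpb (Some (U, a, V)) (Some (U, b, W)) (Some (V, c, X)) (Some (W, d, X)) \<longleftrightarrow> arr.wker (Some (U, ?f, P)) (Some (P, ?g, X))"
      using arr.wpb_iff_wker[OF P[unfolded is_biproduct_iff], of "Some (U, a, V)" "ida U" "Some (U, b, W)" "Some (V, c, X)" "ida X" "Some (W, d, X)"] o
      unfolding fa ga by (simp add: arr_arr_iff)
    have "exact_at FC (freyd_obj A U) (freyd_mor A U P ?f) (freyd_obj A P) (freyd_mor A P X ?g) (freyd_obj A X)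
        \<longleftrightarrow> arr.wker (Some (U, ?f, P)) (Some (P, ?g, X))"
      using wker_imp_exact_at_freyd[OF o(1) Po(1) o(4) fm] exact_at_freyd_imp_wker[OF o(1) Po(1) o(4) fm] by blast
    moreover have "Cmp A U V X c a = Cmp A U W X d b" if "arr.wpb (Some (U, a, V)) (Some (U, b, W)) (Some (V, c, X)) (Some (W, d, X))"
      using that o unfolding arr.wpb_def by (simp add: arrow_cmp_Some)
    ultimately show ?thesis using w by blast
  qed
  have ex: "\<exists>P i j p q. is_biproduct A V W P i j p q" if "V \<in> Obj A" "W \<in> Obj A" using biproduct_exists[OF that] .
  show ?thesis
  proof
    assume s: "is_weak_square A U V W X a b c d"
    then obtain P i j p q where P: "is_biproduct A V W P i j p q"
      and e: "exact_at FC (freyd_obj A U) (freyd_mor A U P (Cmp A U V P i a \<otimes>\<^bsub>Hom A U P\<^esub> Cmp A U W P j b)) (freyd_obj A P)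
        (freyd_mor A P X (Cmp A P V X c p \<otimes>\<^bsub>Hom A P X\<^esub> inv\<^bsub>Hom A P X\<^esub> Cmp A P W X d q)) (freyd_obj A X)"
      unfolding is_weak_square_def by blast
    have o: "U \<in> Obj A" "V \<in> Obj A" "W \<in> Obj A" "X \<in> Obj A" "a \<in> Mor A U V" "b \<in> Mor A U W" "c \<in> Mor A V X" "d \<in> Mor A W X"
      and eq: "Cmp A U V X c a = Cmp A U W X d b" using s unfolding is_weak_square_def by blast+
    show "U \<in> Obj A \<and> V \<in> Obj A \<and> W \<in> Obj A \<and> X \<in> Obj A \<and>
      a \<in> Mor A U V \<and> b \<in> Mor A U W \<and> c \<in> Mor A V X \<and> d \<in> Mor A W X \<and>
      arr.wpb (Some (U, a, V)) (Some (U, b, W)) (Some (V, c, X)) (Some (W, d, X))"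
      using o key[OF o P] eq e by blast
  next
    assume r: "U \<in> Obj A \<and> V \<in> Obj A \<and> W \<in> Obj A \<and> X \<in> Obj A \<and>
      a \<in> Mor A U V \<and> b \<in> Mor A U W \<and> c \<in> Mor A V X \<and> d \<in> Mor A W X \<and>
      arr.wpb (Some (U, a, V)) (Some (U, b, W)) (Some (V, c, X)) (Some (W, d, X))"
    then have o: "U \<in> Obj A" "V \<in> Obj A" "W \<in> Obj A" "X \<in> Obj A" "a \<in> Mor A U V" "b \<in> Mor A U W" "c \<in> Mor A V X" "d \<in> Mor A W X"
      by blast+
    obtain P i j p q where P: "is_biproduct A V W P i j p q" using ex[OF o(2,3)] by blast
    show "is_weak_square A U V W X a b c d"
      unfolding is_weak_square_def using o key[OF o P] r P by blast
  qed
qed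

end

section \<open>Equivalences\<close>

lemma is_functorD:
  assumes "is_functor A B F"
  shows "X \<in> Obj A \<Longrightarrow> FObj F X \<in> Obj B"
    "\<lbrakk>X \<in> Obj A; Y \<in> Obj A; f \<in> Mor A X Y\<rbrakk> \<Longrightarrow> FMor F X Y f \<in> Mor B (FObj F X) (FObj F Y)"
    "X \<in> Obj A \<Longrightarrow> FMor F X X (Idm A X) = Idm B (FObj F X)"
    "\<lbrakk>X \<in> Obj A; Y \<in> Obj A; Z \<in> Obj A; f \<in> Mor A X Y; g \<in> Mor A Y Z\<rbrakk> \<Longrightarrow> FMor F X Z (Cmp A X Y Z g f)
        = Cmp B (FObj F X) (FObj F Y) (FObj F Z) (FMor F Y Z g) (FMor F X Y f)"
  using assms unfolding is_functor_def by blast+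

text \<open>
  A preimage of every object and the unique preimages of morphisms define an inverse functor, and the
  preimages of identities define the natural isomorphism.
\<close>

lemma equivalence_if_full_faithful_surjective:
  assumes A: "preadditive_category A" and B: "preadditive_category B" and F: "is_functor A B F"
    and surj: "\<And>Z. Z \<in> Obj B \<Longrightarrow> \<exists>X\<in>Obj A. FObj F X = Z"
    and full: "\<And>X Y h. \<lbrakk>X \<in> Obj A; Y \<in> Obj A; h \<in> Mor B (FObj F X) (FObj F Y)\<rbrakk> \<Longrightarrow> \<exists>f\<in>Mor A X Y. FMor F X Y f = h"
    and faithful: "\<And>X Y f g. \<lbrakk>X \<in> Obj A; Y \<in> Obj A; f \<in> Mor A X Y; g \<in> Mor A X Y; FMor F X Y f = FMor F X Y g\<rbrakk> \<Longrightarrow> f = g"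
  shows "is_equivalence A B F"
proof -
  interpret A: preadditive_category A by (rule A)
  interpret B: preadditive_category B by (rule B)
  note F' = is_functorD[OF F]
  obtain g where g: "\<And>Z. Z \<in> Obj B \<Longrightarrow> g Z \<in> Obj A" "\<And>Z. Z \<in> Obj B \<Longrightarrow> FObj F (g Z) = Z" using surj by metis
  define L where "L X Y h = (SOME f. f \<in> Mor A X Y \<and> FMor F X Y f = h)" for X Y h
  have L: "L X Y h \<in> Mor A X Y" "FMor F X Y (L X Y h) = h"
    if "X \<in> Obj A" "Y \<in> Obj A" "h \<in> Mor B (FObj F X) (FObj F Y)" for X Y h
    using someI_ex[of "\<lambda>f. f \<in> Mor A X Y \<and> FMor F X Y f = h"] full[OF that] unfolding L_def by blast+
  define G where "G = \<lparr>FObj = g, FMor = (\<lambda>X Y h. L (g X) (g Y) h)\<rparr>"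
  have Gm: "L (g X) (g Y) h \<in> Mor A (g X) (g Y)" "FMor F (g X) (g Y) (L (g X) (g Y) h) = h"
    if "X \<in> Obj B" "Y \<in> Obj B" "h \<in> Mor B X Y" for X Y h
    using L[OF g(1)[OF that(1)] g(1)[OF that(2)]] g(2) that by simp_all
  have G: "is_functor B A G"
    unfolding is_functor_def
  proof (intro conjI ballI)
    fix X assume X: "X \<in> Obj B"
    show "FObj G X \<in> Obj A" using g X by (simp add: G_def)
    show "FMor G X X (Idm B X) = Idm A (FObj G X)"
      unfolding G_def functr.simps
      by (rule faithful[OF g(1)[OF X] g(1)[OF X] Gm(1)[OF X X B.id_closed[OF X]] A.id_closed[OF g(1)[OF X]]])
        (use Gm(2)[OF X X B.id_closed[OF X]] F'(3)[OF g(1)[OF X]] g(2)[OF X] in simp)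
    fix Y assume Y: "Y \<in> Obj B"
    show "FMor G X Y f \<in> Mor A (FObj G X) (FObj G Y)" if "f \<in> Mor B X Y" for f
      using Gm(1)[OF X Y that] by (simp add: G_def)
    fix Z f h assume Z: "Z \<in> Obj B" and f: "f \<in> Mor B X Y" and h: "h \<in> Mor B Y Z"
    note o = g(1)[OF X] g(1)[OF Y] g(1)[OF Z]
    note m = Gm[OF X Y f] Gm[OF Y Z h] Gm[OF X Z B.cmp_closed[OF X Y Z f h]]
    show "FMor G X Z (Cmp B X Y Z h f) = Cmp A (FObj G X) (FObj G Y) (FObj G Z) (FMor G Y Z h) (FMor G X Y f)"
      unfolding G_def functr.simps
      by (rule faithful[OF o(1,3) m(5) A.cmp_closed[OF o m(1,3)]])
        (simp add: F'(4)[OF o m(1,3)] m g(2) X Y Z)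
  qed
  have gF: "g (FObj F X) \<in> Obj A" "FObj F (g (FObj F X)) = FObj F X" if "X \<in> Obj A" for X
    using g F'(1)[OF that] by blast+
  define t where "t X = L (g (FObj F X)) X (Idm B (FObj F X))" for X
  define s where "s X = L X (g (FObj F X)) (Idm B (FObj F X))" for X
  have t: "t X \<in> Mor A (g (FObj F X)) X" "FMor F (g (FObj F X)) X (t X) = Idm B (FObj F X)"
    and s: "s X \<in> Mor A X (g (FObj F X))" "FMor F X (g (FObj F X)) (s X) = Idm B (FObj F X)" if X: "X \<in> Obj A" for X
    using L[OF gF(1)[OF X] X] L[OF X gF(1)[OF X]] B.id_closed[OF F'(1)[OF X]] gF(2)[OF X]
    unfolding t_def s_def by simp_all
  have BI: "Cmp B Y Y Y (Idm B Y) (Idm B Y) = Idm B Y" if "Y \<in> Obj B" for Y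
    using B.cmp_id_left[OF that that B.id_closed[OF that]] .
  have 1: "naturally_isomorphic A A (comp_functor G F) id_functor"
    unfolding naturally_isomorphic_def
  proof (rule exI[of _ t], rule exI[of _ s], intro conjI ballI)
    fix X assume X: "X \<in> Obj A"
    note o = gF[OF X] and FX = F'(1)[OF X]
    have GF: "FObj (comp_functor G F) X = g (FObj F X)" "FObj id_functor X = X"
      by (simp_all add: comp_functor_def id_functor_def G_def)
    show "t X \<in> Mor A (FObj (comp_functor G F) X) (FObj id_functor X)" "s X \<in> Mor A (FObj id_functor X) (FObj (comp_functor G F) X)"
      unfolding GF using t s X by blast+
    show "Cmp A (FObj (comp_functor G F) X) (FObj id_functor X) (FObj (comp_functor G F) X) (s X) (t X) = Idm A (FObj (comp_functor G F) X)"
      unfolding GF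
      by (rule faithful[OF o(1) o(1) A.cmp_closed[OF o(1) X o(1) t(1)[OF X] s(1)[OF X]] A.id_closed[OF o(1)]])
        (simp add: F'(4)[OF o(1) X o(1) t(1)[OF X] s(1)[OF X]] F'(3)[OF o(1)] t(2)[OF X] s(2)[OF X] o(2) BI[OF FX])
    show "Cmp A (FObj id_functor X) (FObj (comp_functor G F) X) (FObj id_functor X) (t X) (s X) = Idm A (FObj id_functor X)"
      unfolding GF
      by (rule faithful[OF X X A.cmp_closed[OF X o(1) X s(1)[OF X] t(1)[OF X]] A.id_closed[OF X]])
        (simp add: F'(4)[OF X o(1) X s(1)[OF X] t(1)[OF X]] F'(3)[OF X] t(2)[OF X] s(2)[OF X] o(2) BI[OF FX])
    fix Y f assume Y: "Y \<in> Obj A" and f: "f \<in> Mor A X Y"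
    note oY = gF[OF Y] and FY = F'(1)[OF Y] and Ff = F'(2)[OF X Y f]
    have GFY: "FObj (comp_functor G F) Y = g (FObj F Y)" "FObj id_functor Y = Y"
      "FMor (comp_functor G F) X Y f = L (g (FObj F X)) (g (FObj F Y)) (FMor F X Y f)" "FMor id_functor X Y f = f"
      by (simp_all add: comp_functor_def id_functor_def G_def)
    note Lf = Gm[OF FX FY Ff]
    show "Cmp A (FObj (comp_functor G F) X) (FObj (comp_functor G F) Y) (FObj id_functor Y) (t Y) (FMor (comp_functor G F) X Y f)
       = Cmp A (FObj (comp_functor G F) X) (FObj id_functor X) (FObj id_functor Y) (FMor id_functor X Y f) (t X)"
      unfolding GF GFY
      by (rule faithful[OF o(1) Y A.cmp_closed[OF o(1) oY(1) Y Lf(1) t(1)[OF Y]] A.cmp_closed[OF o(1) X Y t(1)[OF X] f]])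
        (simp add: F'(4)[OF o(1) oY(1) Y Lf(1) t(1)[OF Y]] F'(4)[OF o(1) X Y t(1)[OF X] f] Lf(2) t(2)[OF X] t(2)[OF Y]
          o(2) oY(2) B.cmp_id_left[OF FX FY Ff] B.cmp_id_right[OF FX FY Ff])
  qed
  have 2: "naturally_isomorphic B B (comp_functor F G) id_functor"
    unfolding naturally_isomorphic_def
  proof (intro exI[of _ "\<lambda>X. Idm B X"] conjI ballI)
    fix X assume X: "X \<in> Obj B"
    have FG: "FObj (comp_functor F G) X = X" "FObj id_functor X = X"
      using g(2)[OF X] by (simp_all add: comp_functor_def id_functor_def G_def)
    show "Idm B X \<in> Mor B (FObj (comp_functor F G) X) (FObj id_functor X)"
      "Idm B X \<in> Mor B (FObj id_functor X) (FObj (comp_functor F G) X)"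
      "Cmp B (FObj (comp_functor F G) X) (FObj id_functor X) (FObj (comp_functor F G) X) (Idm B X) (Idm B X) = Idm B (FObj (comp_functor F G) X)"
      "Cmp B (FObj id_functor X) (FObj (comp_functor F G) X) (FObj id_functor X) (Idm B X) (Idm B X) = Idm B (FObj id_functor X)"
      unfolding FG using B.id_closed[OF X] BI[OF X] by blast+
    fix Y f assume Y: "Y \<in> Obj B" and f: "f \<in> Mor B X Y"
    have FGY: "FObj (comp_functor F G) Y = Y" "FObj id_functor Y = Y" "FMor (comp_functor F G) X Y f = f" "FMor id_functor X Y f = f"
      using g(2)[OF Y] Gm(2)[OF X Y f] by (simp_all add: comp_functor_def id_functor_def G_def)
    show "Cmp B (FObj (comp_functor F G) X) (FObj (comp_functor F G) Y) (FObj id_functor Y) (Idm B Y) (FMor (comp_functor F G) X Y f)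
       = Cmp B (FObj (comp_functor F G) X) (FObj id_functor X) (FObj id_functor Y) (FMor id_functor X Y f) (Idm B X)"
      unfolding FG FGY using B.cmp_id_left[OF X Y f] B.cmp_id_right[OF X Y f] by simp
  qed
  show ?thesis unfolding is_equivalence_def using F G 1 2 by blast
qed

text \<open>
  The condition on the morphisms that factor is the faithfulness of the induced functor: by
  additivity, two morphisms have the same class iff their difference factors.
\<close>

lemma induced_equivalence:
  assumes A: "additive_quotient A S" and B: "additive_quotient B T" and F: "is_functor A B F"
    and add: "\<And>X Y f g. \<lbrakk>X \<in> Obj A; Y \<in> Obj A; f \<in> Mor A X Y; g \<in> Mor A X Y\<rbrakk> \<Longrightarrow>
      FMor F X Y (f \<otimes>\<^bsub>Hom A X Y\<^esub> g) = FMor F X Y f \<otimes>\<^bsub>Hom B (FObj F X) (FObj F Y)\<^esub> FMor F X Y g"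
    and surj: "\<And>Z. Z \<in> Obj B \<Longrightarrow> \<exists>X\<in>Obj A. FObj F X = Z"
    and full: "\<And>X Y h. \<lbrakk>X \<in> Obj A; Y \<in> Obj A; h \<in> Mor B (FObj F X) (FObj F Y)\<rbrakk> \<Longrightarrow> \<exists>f\<in>Mor A X Y. FMor F X Y f = h"
    and ker: "\<And>X Y f. \<lbrakk>X \<in> Obj A; Y \<in> Obj A; f \<in> Mor A X Y\<rbrakk> \<Longrightarrow>
      FMor F X Y f \<in> factoring B T (FObj F X) (FObj F Y) \<longleftrightarrow> f \<in> factoring A S X Y"
  shows "is_equivalence (quotient_cat A S) (quotient_cat B T) (induced_functor B T F)"
proof -
  interpret A: additive_quotient A S by (rule A)
  interpret B: additive_quotient B T by (rule B)
  note F' = is_functorD[OF F]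
  let ?Q = "induced_functor B T F"
  have QO: "FObj ?Q X = FObj F X" for X by (simp add: induced_functor_def)
  have rc_iff: "A.rc X Y f = A.rc X Y g \<longleftrightarrow> B.rc (FObj F X) (FObj F Y) (FMor F X Y f) = B.rc (FObj F X) (FObj F Y) (FMor F X Y g)"
    if o: "X \<in> Obj A" "Y \<in> Obj A" and f: "f \<in> Mor A X Y" and g: "g \<in> Mor A X Y" for X Y f g
  proof -
    note ig = A.inv_closed[OF o g] and oF = F'(1)[OF o(1)] F'(1)[OF o(2)]
    interpret h: group_hom "Hom A X Y" "Hom B (FObj F X) (FObj F Y)" "FMor F X Y"
      by (intro group_hom.intro A.hom_group[OF o] B.hom_group[OF oF] group_hom_axioms.intro homI) (use F'(2)[OF o] add[OF o] in auto)
    have "A.rc X Y f = A.rc X Y g \<longleftrightarrow> f \<otimes>\<^bsub>Hom A X Y\<^esub> inv\<^bsub>Hom A X Y\<^esub> g \<in> factoring A S X Y"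
      by (rule A.rc_eq_iff[OF o g f])
    also have "\<dots> \<longleftrightarrow> FMor F X Y (f \<otimes>\<^bsub>Hom A X Y\<^esub> inv\<^bsub>Hom A X Y\<^esub> g) \<in> factoring B T (FObj F X) (FObj F Y)"
      using ker[OF o A.add_closed[OF o f ig]] by blast
    also have "FMor F X Y (f \<otimes>\<^bsub>Hom A X Y\<^esub> inv\<^bsub>Hom A X Y\<^esub> g)
        = FMor F X Y f \<otimes>\<^bsub>Hom B (FObj F X) (FObj F Y)\<^esub> inv\<^bsub>Hom B (FObj F X) (FObj F Y)\<^esub> FMor F X Y g"
      using add[OF o f ig] h.hom_inv[OF g] by simp
    also have "\<dots> \<in> factoring B T (FObj F X) (FObj F Y) \<longleftrightarrow>
        B.rc (FObj F X) (FObj F Y) (FMor F X Y f) = B.rc (FObj F X) (FObj F Y) (FMor F X Y g)"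
      using B.rc_eq_iff[OF oF F'(2)[OF o g] F'(2)[OF o f]] by blast
    finally show ?thesis .
  qed
  have Qm: "FMor ?Q X Y (A.rc X Y f) = B.rc (FObj F X) (FObj F Y) (FMor F X Y f)"
    if o: "X \<in> Obj A" "Y \<in> Obj A" and f: "f \<in> Mor A X Y" for X Y f
  proof -
    have "B.rc (FObj F X) (FObj F Y) (FMor F X Y g) = B.rc (FObj F X) (FObj F Y) (FMor F X Y f)" if "g \<in> A.rc X Y f" for g
      using rc_iff[OF o A.rc_memD(1)[OF o f that] f] A.rc_memD(2)[OF o f that] by blast
    then have "(\<Union>g\<in>A.rc X Y f. B.rc (FObj F X) (FObj F Y) (FMor F X Y g)) = B.rc (FObj F X) (FObj F Y) (FMor F X Y f)"
      using A.rc_self[OF o f] by blast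
    then show ?thesis by (simp add: induced_functor_def)
  qed
  show ?thesis
  proof (rule equivalence_if_full_faithful_surjective[OF A.preadditive_quotient B.preadditive_quotient])
    show "is_functor (quotient_cat A S) (quotient_cat B T) ?Q"
      unfolding is_functor_def
    proof (intro conjI ballI; unfold A.quotient_simps B.quotient_simps QO)
      fix X assume X: "X \<in> Obj A"
      show "FObj F X \<in> Obj B" by (rule F'(1)[OF X])
      show "FMor ?Q X X (A.rc X X (Idm A X)) = B.rc (FObj F X) (FObj F X) (Idm B (FObj F X))"
        using Qm[OF X X A.id_closed[OF X]] F'(3)[OF X] by simp
      fix Y assume Y: "Y \<in> Obj A"
      show "FMor ?Q X Y f \<in> B.rc (FObj F X) (FObj F Y) ` Mor B (FObj F X) (FObj F Y)" if "f \<in> A.rc X Y ` Mor A X Y" for f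
        using that Qm[OF X Y] F'(2)[OF X Y] by auto
      fix Z f h assume Z: "Z \<in> Obj A" and fh: "f \<in> A.rc X Y ` Mor A X Y" "h \<in> A.rc Y Z ` Mor A Y Z"
      obtain f0 h0 where f0: "f0 \<in> Mor A X Y" "f = A.rc X Y f0" and h0: "h0 \<in> Mor A Y Z" "h = A.rc Y Z h0"
        using fh by blast
      show "FMor ?Q X Z (Cmp (quotient_cat A S) X Y Z h f)
          = Cmp (quotient_cat B T) (FObj F X) (FObj F Y) (FObj F Z) (FMor ?Q Y Z h) (FMor ?Q X Y f)"
        unfolding f0(2) h0(2) A.quotient_cmp[OF X Y Z f0(1) h0(1)] Qm[OF X Y f0(1)] Qm[OF Y Z h0(1)]
          Qm[OF X Z A.cmp_closed[OF X Y Z f0(1) h0(1)]] F'(4)[OF X Y Z f0(1) h0(1)]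
          B.quotient_cmp[OF F'(1)[OF X] F'(1)[OF Y] F'(1)[OF Z] F'(2)[OF X Y f0(1)] F'(2)[OF Y Z h0(1)]] ..
    qed
    show "\<exists>X\<in>Obj (quotient_cat A S). FObj ?Q X = Z" if "Z \<in> Obj (quotient_cat B T)" for Z
      using surj that by (simp add: A.quotient_simps B.quotient_simps QO)
    show "\<exists>f\<in>Mor (quotient_cat A S) X Y. FMor ?Q X Y f = h"
      if o: "X \<in> Obj (quotient_cat A S)" "Y \<in> Obj (quotient_cat A S)" and h: "h \<in> Mor (quotient_cat B T) (FObj ?Q X) (FObj ?Q Y)" for X Y h
    proof -
      have o': "X \<in> Obj A" "Y \<in> Obj A" using o by (simp_all add: A.quotient_simps)
      obtain h0 where h0: "h0 \<in> Mor B (FObj F X) (FObj F Y)" "h = B.rc (FObj F X) (FObj F Y) h0"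
        using h unfolding QO B.quotient_simps by blast
      obtain f where "f \<in> Mor A X Y" "FMor F X Y f = h0" using full[OF o' h0(1)] by blast
      then show ?thesis using Qm[OF o'] h0(2) unfolding A.quotient_simps by auto
    qed
    show "f = g" if o: "X \<in> Obj (quotient_cat A S)" "Y \<in> Obj (quotient_cat A S)"
      and fg: "f \<in> Mor (quotient_cat A S) X Y" "g \<in> Mor (quotient_cat A S) X Y" "FMor ?Q X Y f = FMor ?Q X Y g" for X Y f g
    proof -
      have o': "X \<in> Obj A" "Y \<in> Obj A" using o by (simp_all add: A.quotient_simps)
      obtain f0 g0 where f0: "f0 \<in> Mor A X Y" "f = A.rc X Y f0" and g0: "g0 \<in> Mor A X Y" "g = A.rc X Y g0"
        using fg(1,2) unfolding A.quotient_simps by blast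
      show ?thesis using fg(3) unfolding f0(2) g0(2) Qm[OF o' f0(1)] Qm[OF o' g0(1)] rc_iff[OF o' f0(1) g0(1)] .
    qed
  qed
qed

lemma (in preadditive_category) additive_quotientI:
  assumes S: "S \<subseteq> Obj A" "S \<noteq> {}"
    and add: "\<And>X Y f g. \<lbrakk>X \<in> Obj A; Y \<in> Obj A; f \<in> factoring A S X Y; g \<in> factoring A S X Y\<rbrakk> \<Longrightarrow>
      f \<otimes>\<^bsub>Hom A X Y\<^esub> g \<in> factoring A S X Y"
  shows "additive_quotient A S"
proof (intro additive_quotient.intro additive_quotient_axioms.intro S(1))
  show "preadditive_category A" by unfold_locales
  fix X Y assume o: "X \<in> Obj A" "Y \<in> Obj A"
  show "subgroup (factoring A S X Y) (Hom A X Y)"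
  proof (rule group.subgroupI[OF hom_group[OF o]])
    show "factoring A S X Y \<subseteq> Mor A X Y"
      unfolding factoring_def using o S(1) cmp_closed by auto
    obtain W where W: "W \<in> S" using S(2) by blast
    then have "Cmp A X W Y (Zmor A W Y) (Zmor A X W) \<in> factoring A S X Y"
      unfolding factoring_def using zero_closed o S(1) by blast
    then show "factoring A S X Y \<noteq> {}" by blast
    show "inv\<^bsub>Hom A X Y\<^esub> f \<in> factoring A S X Y" if f: "f \<in> factoring A S X Y" for f
    proof -
      obtain W u v where w: "f = Cmp A X W Y v u" "W \<in> S" "u \<in> Mor A X W" "v \<in> Mor A W Y"
        using f unfolding factoring_def by blast
      then have "W \<in> Obj A" using S(1) by blast
      from cmp_inv_left[OF o(1) this o(2) w(3,4)] inv_closed[OF this o(2) w(4)] show ?thesis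
        unfolding factoring_def w(1) using w(2,3) by force
    qed
  qed (rule add[OF o])
qed

lemma preadditive_full_subcat:
  assumes "preadditive_category A" shows "preadditive_category (full_subcat A S)"
proof -
  interpret preadditive_category A by (rule assms)
  show ?thesis
    by (rule preadditive_category.intro)
      (simp_all add: full_subcat_def hom_comm_group id_closed cmp_closed cmp_id_left cmp_id_right cmp_assoc cmp_add_left cmp_add_right)
qed

section \<open>Categories of diagrams\<close>

lemma product_comm_group:
  assumes "\<And>i. i \<in> I \<Longrightarrow> comm_group (G i)" shows "comm_group (product_group I G)"
proof (rule group.group_comm_groupI)
  show "group (product_group I G)" using assms by (auto intro: product_group comm_group.axioms(2))
  fix x y assume "x \<in> carrier (product_group I G)" "y \<in> carrier (product_group I G)"
  then show "x \<otimes>\<^bsub>product_group I G\<^esub> y = y \<otimes>\<^bsub>product_group I G\<^esub> x"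
    using comm_monoid.m_comm[OF comm_group.axioms(1)[OF assms]] by (auto simp: PiE_iff intro!: restrict_ext)
qed

context preadditive_category
begin

abbreviation DC :: "'d set \<Rightarrow> ('d \<Rightarrow> 'd \<Rightarrow> bool) \<Rightarrow> (('d, 'o, 'm) diagram, 'd \<Rightarrow> 'm) precat"
  where "DC \<equiv> diagram_cat A"

lemma DC_ObjD:
  assumes "X \<in> Obj (DC D lq)"
  shows "x \<in> D \<Longrightarrow> Vtx X x \<in> Obj A" "x \<notin> D \<Longrightarrow> Vtx X x = undefined"
    "\<lbrakk>x \<in> D; y \<in> D; lq x y\<rbrakk> \<Longrightarrow> Tr X x y \<in> Mor A (Vtx X x) (Vtx X y)"
    "\<not> (x \<in> D \<and> y \<in> D \<and> lq x y) \<Longrightarrow> Tr X x y = undefined"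
    "x \<in> D \<Longrightarrow> Tr X x x = Idm A (Vtx X x)"
    "\<lbrakk>x \<in> D; y \<in> D; z \<in> D; lq x y; lq y z\<rbrakk> \<Longrightarrow>
      Cmp A (Vtx X x) (Vtx X y) (Vtx X z) (Tr X y z) (Tr X x y) = Tr X x z"
  using assms by (auto simp: diagram_cat_def PiE_iff extensional_def)

lemma DC_Mor_iff:
  "t \<in> Mor (DC D lq) X Y \<longleftrightarrow> t \<in> (\<Pi>\<^sub>E x\<in>D. Mor A (Vtx X x) (Vtx Y x)) \<and>
    (\<forall>x\<in>D. \<forall>y\<in>D. lq x y \<longrightarrow> Cmp A (Vtx X x) (Vtx X y) (Vtx Y y) (t y) (Tr X x y)
      = Cmp A (Vtx X x) (Vtx Y x) (Vtx Y y) (Tr Y x y) (t x))"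
  by (simp add: diagram_cat_def)

lemma DC_simps:
  "Idm (DC D lq) X = (\<lambda>x\<in>D. Idm A (Vtx X x))"
  "Cmp (DC D lq) X Y Z s t = (\<lambda>x\<in>D. Cmp A (Vtx X x) (Vtx Y x) (Vtx Z x) (s x) (t x))"
  "s \<otimes>\<^bsub>Hom (DC D lq) X Y\<^esub> t = (\<lambda>x\<in>D. s x \<otimes>\<^bsub>Hom A (Vtx X x) (Vtx Y x)\<^esub> t x)"
  by (simp_all add: diagram_cat_def)

definition darr :: "('d, 'o, 'm) diagram \<Rightarrow> 'd \<Rightarrow> 'd \<Rightarrow> ('o, 'm) arrow"
  where "darr X x y = Some (Vtx X x, Tr X x y, Vtx X y)"

definition tarr :: "('d, 'o, 'm) diagram \<Rightarrow> ('d, 'o, 'm) diagram \<Rightarrow> ('d \<Rightarrow> 'm) \<Rightarrow> 'd \<Rightarrow> ('o, 'm) arrow"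
  where "tarr X Y t x = Some (Vtx X x, t x, Vtx Y x)"

lemma darr_id: "X \<in> Obj (DC D lq) \<Longrightarrow> x \<in> D \<Longrightarrow> darr X x x = ida (Vtx X x)"
  by (simp add: darr_def DC_ObjD(5))

lemma darr_fnc: assumes X: "X \<in> Obj (DC D lq)" shows "arr.fnc D lq (darr X)"
  unfolding arr.fnc_def
proof (intro conjI ballI impI)
  note d = DC_ObjD[OF X]
  fix x assume x: "x \<in> D"
  show "arr.obj (darr X x x)" unfolding darr_id[OF X x] arr_obj_iff using d(1)[OF x] by blast
  fix y assume y: "y \<in> D"
  show "arr.arr (darr X x y) (darr X x x) (darr X y y)" if "lq x y"
    unfolding darr_id[OF X x] darr_id[OF X y] arr_arr_iff using d(1)[OF x] d(1)[OF y] d(3)[OF x y that] by (auto simp: darr_def)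
  fix z assume z: "z \<in> D"
  show "arrow_cmp A (darr X y z) (darr X x y) = darr X x z" if "lq x y" "lq y z"
    using d(1)[OF x] d(1)[OF y] d(1)[OF z] d(3)[OF x y that(1)] d(3)[OF y z that(2)] d(6)[OF x y z that]
    by (simp add: darr_def arrow_cmp_Some)
qed

lemma tarr_nt:
  assumes X: "X \<in> Obj (DC D lq)" and Y: "Y \<in> Obj (DC D lq)" and t: "t \<in> Mor (DC D lq) X Y"
  shows "arr.nt D lq (darr X) (darr Y) (tarr X Y t)"
  unfolding arr.nt_def
proof (intro conjI ballI impI)
  note t' = t[unfolded DC_Mor_iff PiE_iff]
  fix x assume x: "x \<in> D"
  show "arr.arr (tarr X Y t x) (darr X x x) (darr Y x x)"
    unfolding darr_id[OF X x] darr_id[OF Y x] arr_arr_iff using t' x DC_ObjD(1)[OF X x] DC_ObjD(1)[OF Y x] by (auto simp: tarr_def)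
  fix y assume y: "y \<in> D" "lq x y"
  show "arrow_cmp A (tarr X Y t y) (darr X x y) = arrow_cmp A (darr Y x y) (tarr X Y t x)"
    using t' x y DC_ObjD(1,3)[OF X] DC_ObjD(1,3)[OF Y] by (simp add: tarr_def darr_def arrow_cmp_Some)
qed

lemma fnc_darr:
  assumes Z: "arr.fnc D lq Z" and refl: "\<And>x. x \<in> D \<Longrightarrow> lq x x"
    and trans: "\<And>x y z. \<lbrakk>x \<in> D; y \<in> D; z \<in> D; lq x y; lq y z\<rbrakk> \<Longrightarrow> lq x z"
  shows "\<exists>X\<in>Obj (DC D lq). \<forall>x\<in>D. \<forall>y\<in>D. lq x y \<longrightarrow> darr X x y = Z x y"
proof -
  note z = arr.fncD[OF Z]
  define V where "V x = fst (the (Z x x))" for x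
  define T where "T x y = fst (snd (the (Z x y)))" for x y
  have Vx: "V x \<in> Obj A" "Z x x = ida (V x)" if "x \<in> D" for x
    using z(1)[OF that] unfolding arr_obj_iff by (auto simp: V_def)
  have Txy: "T x y \<in> Mor A (V x) (V y)" "Z x y = Some (V x, T x y, V y)" if "x \<in> D" "y \<in> D" "lq x y" for x y
    using z(2)[OF that] unfolding Vx(2)[OF that(1)] Vx(2)[OF that(2)] arr_arr_iff by (auto simp: T_def)
  define X where "X = \<lparr>Vtx = (\<lambda>x\<in>D. V x), Tr = (\<lambda>x y. if x \<in> D \<and> y \<in> D \<and> lq x y then T x y else undefined)\<rparr>"
  have id: "T x x = Idm A (V x)" if "x \<in> D" for x using Txy(2)[OF that that refl[OF that]] Vx(2)[OF that] by simp
  have comp: "Cmp A (V x) (V y) (V z) (T y z) (T x y) = T x z" if "x \<in> D" "y \<in> D" "z \<in> D" "lq x y" "lq y z" for x y z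
    using z(3)[OF that] Txy[OF that(1,2,4)] Txy[OF that(2,3,5)] Txy(2)[OF that(1,3) trans[OF that]] Vx(1) that by (simp add: arrow_cmp_Some)
  have X: "X \<in> Obj (DC D lq)"
    unfolding diagram_cat_def precat.simps mem_Collect_eq
  proof (intro conjI ballI impI allI)
    show "Vtx X \<in> D \<rightarrow>\<^sub>E Obj A" using Vx(1) by (auto simp: X_def)
    show "Tr X x y \<in> Mor A (Vtx X x) (Vtx X y)" if "x \<in> D" "y \<in> D" "lq x y" for x y
      using Txy(1)[OF that] that by (simp add: X_def)
    show "Tr X x y = undefined" if "\<not> (x \<in> D \<and> y \<in> D \<and> lq x y)" for x y using that unfolding X_def by auto
    show "Tr X x x = Idm A (Vtx X x)" if "x \<in> D" for x using id[OF that] refl[OF that] that by (simp add: X_def)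
    show "Cmp A (Vtx X x) (Vtx X y) (Vtx X z) (Tr X y z) (Tr X x y) = Tr X x z"
      if "x \<in> D" "y \<in> D" "z \<in> D" "lq x y" "lq y z" for x y z
      using comp[OF that] trans[OF that] that by (simp add: X_def)
  qed
  have "darr X x y = Z x y" if "x \<in> D" "y \<in> D" "lq x y" for x y
    using Txy(2)[OF that] that by (simp add: X_def darr_def)
  with X show ?thesis by blast
qed

lemma nt_tarr:
  assumes X: "X \<in> Obj (DC D lq)" and Y: "Y \<in> Obj (DC D lq)" and s: "arr.nt D lq (darr X) (darr Y) s"
  shows "\<exists>t\<in>Mor (DC D lq) X Y. \<forall>x\<in>D. tarr X Y t x = s x"
proof -
  define t where "t = (\<lambda>x\<in>D. fst (snd (the (s x))))"
  have t: "t x \<in> Mor A (Vtx X x) (Vtx Y x)" "s x = Some (Vtx X x, t x, Vtx Y x)" if "x \<in> D" for x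
    using arr.ntD(1)[OF s that] that unfolding darr_id[OF X that] darr_id[OF Y that] arr_arr_iff by (auto simp: t_def)
  have "t \<in> Mor (DC D lq) X Y"
    unfolding DC_Mor_iff
  proof (intro conjI ballI impI)
    show "t \<in> (\<Pi>\<^sub>E x\<in>D. Mor A (Vtx X x) (Vtx Y x))" using t(1) by (auto simp: t_def)
    fix x y assume xy: "x \<in> D" "y \<in> D" "lq x y"
    show "Cmp A (Vtx X x) (Vtx X y) (Vtx Y y) (t y) (Tr X x y) = Cmp A (Vtx X x) (Vtx Y x) (Vtx Y y) (Tr Y x y) (t x)"
      using arr.ntD(2)[OF s xy] t[OF xy(1)] t[OF xy(2)] DC_ObjD(1)[OF X] DC_ObjD(1)[OF Y] DC_ObjD(3)[OF X xy] DC_ObjD(3)[OF Y xy] xy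
      by (simp add: darr_def arrow_cmp_Some)
  qed
  then show ?thesis using t(2) by (auto simp: tarr_def)
qed

lemma DC_MorD: "t \<in> Mor (DC D lq) X Y \<Longrightarrow> x \<in> D \<Longrightarrow> t x \<in> Mor A (Vtx X x) (Vtx Y x)"
  by (auto simp: DC_Mor_iff)

lemma DC_mor_eqI:
  assumes "s \<in> Mor (DC D lq) X Y" "t \<in> Mor (DC D lq) X Y" "\<And>x. x \<in> D \<Longrightarrow> s x = t x" shows "s = t"
  using PiE_ext[of s D "\<lambda>x. Mor A (Vtx X x) (Vtx Y x)" t] assms by (simp add: DC_Mor_iff)

lemma tarr_cmp:
  assumes "X \<in> Obj (DC D lq)" "Y \<in> Obj (DC D lq)" "Z \<in> Obj (DC D lq)"
    and "t \<in> Mor (DC D lq) X Y" "s \<in> Mor (DC D lq) Y Z" "x \<in> D"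
  shows "tarr X Z (Cmp (DC D lq) X Y Z s t) x = arrow_cmp A (tarr Y Z s x) (tarr X Y t x)"
  using assms DC_MorD[OF assms(4,6)] DC_MorD[OF assms(5,6)] DC_ObjD(1)[OF assms(1,6)] DC_ObjD(1)[OF assms(2,6)] DC_ObjD(1)[OF assms(3,6)]
  by (simp add: tarr_def DC_simps arrow_cmp_Some)

lemma tarr_add:
  assumes "X \<in> Obj (DC D lq)" "Y \<in> Obj (DC D lq)"
    and "s \<in> Mor (DC D lq) X Y" "t \<in> Mor (DC D lq) X Y" "x \<in> D"
  shows "tarr X Y (s \<otimes>\<^bsub>Hom (DC D lq) X Y\<^esub> t) x = arrow_add A (tarr X Y s x) (tarr X Y t x)"
  using assms DC_MorD[OF assms(3,5)] DC_MorD[OF assms(4,5)] DC_ObjD(1)[OF assms(1,5)] DC_ObjD(1)[OF assms(2,5)]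
  by (simp add: tarr_def DC_simps arrow_add_Some)

lemma DC_Mor_subgroup:
  assumes X: "X \<in> Obj (DC D lq)" and Y: "Y \<in> Obj (DC D lq)"
  shows "subgroup (Mor (DC D lq) X Y) (product_group D (\<lambda>x. Hom A (Vtx X x) (Vtx Y x)))"
proof (rule group.subgroupI)
  let ?G = "product_group D (\<lambda>x. Hom A (Vtx X x) (Vtx Y x))"
  note oX = DC_ObjD(1)[OF X] and oY = DC_ObjD(1)[OF Y] and mX = DC_ObjD(3)[OF X] and mY = DC_ObjD(3)[OF Y]
  have gr: "\<And>x. x \<in> D \<Longrightarrow> group (Hom A (Vtx X x) (Vtx Y x))" using oX oY hom_group by blast
  show "group ?G" using gr by (rule product_group)
  show "Mor (DC D lq) X Y \<subseteq> carrier ?G" by (auto simp: DC_Mor_iff)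
  have "(\<lambda>x\<in>D. Zmor A (Vtx X x) (Vtx Y x)) \<in> Mor (DC D lq) X Y"
    using oX oY mX mY by (auto simp: DC_Mor_iff zero_closed cmp_zero_left cmp_zero_right)
  then show "Mor (DC D lq) X Y \<noteq> {}" by blast
  fix s assume s: "s \<in> Mor (DC D lq) X Y"
  note s' = s[unfolded DC_Mor_iff, THEN conjunct2, rule_format] and sm = DC_MorD[OF s]
  have inv: "inv\<^bsub>?G\<^esub> s = (\<lambda>x\<in>D. inv\<^bsub>Hom A (Vtx X x) (Vtx Y x)\<^esub> s x)"
    using s gr by (intro inv_product_group) (auto simp: DC_Mor_iff)
  show "inv\<^bsub>?G\<^esub> s \<in> Mor (DC D lq) X Y"
    unfolding inv DC_Mor_iff
  proof (intro conjI ballI impI)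
    show "(\<lambda>x\<in>D. inv\<^bsub>Hom A (Vtx X x) (Vtx Y x)\<^esub> s x) \<in> (\<Pi>\<^sub>E x\<in>D. Mor A (Vtx X x) (Vtx Y x))"
      using inv_closed[OF oX oY sm] by auto
    fix x y assume xy: "x \<in> D" "y \<in> D" "lq x y"
    show "Cmp A (Vtx X x) (Vtx X y) (Vtx Y y) ((\<lambda>x\<in>D. inv\<^bsub>Hom A (Vtx X x) (Vtx Y x)\<^esub> s x) y) (Tr X x y)
      = Cmp A (Vtx X x) (Vtx Y x) (Vtx Y y) (Tr Y x y) ((\<lambda>x\<in>D. inv\<^bsub>Hom A (Vtx X x) (Vtx Y x)\<^esub> s x) x)"
      using xy cmp_inv_left[OF oX[OF xy(1)] oX[OF xy(2)] oY[OF xy(2)] mX[OF xy] sm[OF xy(2)]]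
        cmp_inv_right[OF oX[OF xy(1)] oY[OF xy(1)] oY[OF xy(2)] sm[OF xy(1)] mY[OF xy]] s'[OF xy] by simp
  qed
  fix t assume t: "t \<in> Mor (DC D lq) X Y"
  note t' = t[unfolded DC_Mor_iff, THEN conjunct2, rule_format] and tm = DC_MorD[OF t]
  have add: "s \<otimes>\<^bsub>?G\<^esub> t = (\<lambda>x\<in>D. s x \<otimes>\<^bsub>Hom A (Vtx X x) (Vtx Y x)\<^esub> t x)" by simp
  show "s \<otimes>\<^bsub>?G\<^esub> t \<in> Mor (DC D lq) X Y"
    unfolding add DC_Mor_iff
  proof (intro conjI ballI impI)
    show "(\<lambda>x\<in>D. s x \<otimes>\<^bsub>Hom A (Vtx X x) (Vtx Y x)\<^esub> t x) \<in> (\<Pi>\<^sub>E x\<in>D. Mor A (Vtx X x) (Vtx Y x))"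
      using add_closed[OF oX oY sm tm] by auto
    fix x y assume xy: "x \<in> D" "y \<in> D" "lq x y"
    show "Cmp A (Vtx X x) (Vtx X y) (Vtx Y y) ((\<lambda>x\<in>D. s x \<otimes>\<^bsub>Hom A (Vtx X x) (Vtx Y x)\<^esub> t x) y) (Tr X x y)
      = Cmp A (Vtx X x) (Vtx Y x) (Vtx Y y) (Tr Y x y) ((\<lambda>x\<in>D. s x \<otimes>\<^bsub>Hom A (Vtx X x) (Vtx Y x)\<^esub> t x) x)"
      using xy cmp_add_left[OF oX[OF xy(1)] oX[OF xy(2)] oY[OF xy(2)] mX[OF xy] sm[OF xy(2)] tm[OF xy(2)]]
        cmp_add_right[OF oX[OF xy(1)] oY[OF xy(1)] oY[OF xy(2)] sm[OF xy(1)] tm[OF xy(1)] mY[OF xy]] s'[OF xy] t'[OF xy] by simp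
  qed
qed

lemma preadditive_diagram_cat: "preadditive_category (DC D lq)"
proof (rule preadditive_category.intro, goal_cases)
  case (1 X Y)
  have "Hom (DC D lq) X Y = (product_group D (\<lambda>x. Hom A (Vtx X x) (Vtx Y x)))\<lparr>carrier := Mor (DC D lq) X Y\<rparr>"
    by (simp add: diagram_cat_def)
  moreover have "comm_group (product_group D (\<lambda>x. Hom A (Vtx X x) (Vtx Y x)))"
    using hom_comm_group DC_ObjD(1)[OF 1(1)] DC_ObjD(1)[OF 1(2)] by (intro product_comm_group) blast
  ultimately show ?case using comm_group_subgroup[OF _ DC_Mor_subgroup[OF 1]] by simp
next
  case (2 X)
  note o = DC_ObjD(1)[OF 2] and m = DC_ObjD(3)[OF 2]
  then show ?case by (auto simp: DC_Mor_iff DC_simps id_closed cmp_id_left cmp_id_right)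
next
  case (3 X Y Z f g)
  have "arr.nt D lq (darr X) (darr Z) (\<lambda>x. arrow_cmp A (tarr Y Z g x) (tarr X Y f x))"
    by (rule arr.nt_cmp[OF tarr_nt[OF 3(1,2,4)] tarr_nt[OF 3(2,3,5)]])
  then obtain t where t: "t \<in> Mor (DC D lq) X Z" "\<forall>x\<in>D. tarr X Z t x = arrow_cmp A (tarr Y Z g x) (tarr X Y f x)"
    using nt_tarr[OF 3(1,3)] by blast
  have "Cmp (DC D lq) X Y Z g f x = t x" for x
  proof (cases "x \<in> D")
    case True
    then have "tarr X Z (Cmp (DC D lq) X Y Z g f) x = tarr X Z t x" using t(2) tarr_cmp[OF 3 True] by simp
    then show ?thesis unfolding tarr_def by simp
  next
    case False
    then show ?thesis using t(1) by (auto simp: DC_simps DC_Mor_iff PiE_iff extensional_def)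
  qed
  then have "Cmp (DC D lq) X Y Z g f = t" by (rule ext)
  then show ?case using t(1) by simp
next
  case (4 X Y f)
  then show ?case using DC_MorD[OF 4(3)] DC_ObjD(1)[OF 4(1)] DC_ObjD(1)[OF 4(2)]
    by (auto simp: DC_simps DC_Mor_iff PiE_iff extensional_def cmp_id_left)
next
  case (5 X Y f)
  then show ?case using DC_MorD[OF 5(3)] DC_ObjD(1)[OF 5(1)] DC_ObjD(1)[OF 5(2)]
    by (auto simp: DC_simps DC_Mor_iff PiE_iff extensional_def cmp_id_right)
next
  case (6 W X Y Z f g h)
  then show ?case using DC_MorD[OF 6(5)] DC_MorD[OF 6(6)] DC_MorD[OF 6(7)]
      DC_ObjD(1)[OF 6(1)] DC_ObjD(1)[OF 6(2)] DC_ObjD(1)[OF 6(3)] DC_ObjD(1)[OF 6(4)]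
    by (auto simp: DC_simps cmp_assoc intro!: restrict_ext)
next
  case (7 X Y Z f g g')
  then show ?case using DC_MorD[OF 7(4)] DC_MorD[OF 7(5)] DC_MorD[OF 7(6)]
      DC_ObjD(1)[OF 7(1)] DC_ObjD(1)[OF 7(2)] DC_ObjD(1)[OF 7(3)]
    by (auto simp: DC_simps cmp_add_left intro!: restrict_ext)
next
  case (8 X Y Z f f' g)
  then show ?case using DC_MorD[OF 8(4)] DC_MorD[OF 8(5)] DC_MorD[OF 8(6)]
      DC_ObjD(1)[OF 8(1)] DC_ObjD(1)[OF 8(2)] DC_ObjD(1)[OF 8(3)]
    by (auto simp: DC_simps cmp_add_right intro!: restrict_ext)
qed

end

context weakly_abelian_category
begin

lemma split_diagrams_iff:
  "X \<in> split_diagrams A D lq \<longleftrightarrow> X \<in> Obj (DC D lq) \<and> (\<forall>x\<in>D. \<forall>y\<in>D. lq x y \<longrightarrow> arr.regular (darr X x y))"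
proof -
  have "freyd_split A (Vtx X x) (Tr X x y) (Vtx X y) \<longleftrightarrow> arr.regular (darr X x y)"
    if X: "X \<in> Obj (DC D lq)" and xy: "x \<in> D" "y \<in> D" "lq x y" for x y
    using freyd_split_imp_regular regular_imp_freyd_split DC_ObjD(1)[OF X xy(1)] DC_ObjD(1)[OF X xy(2)] DC_ObjD(3)[OF X xy]
    unfolding darr_def by blast
  then show ?thesis unfolding split_diagrams_def by blast
qed

end

section \<open>Change of the index poset\<close>

context additive_arrows
begin

lemma fnc_reindex:
  assumes "fnc D lq U" "\<And>x. x \<in> D' \<Longrightarrow> e x \<in> D" "\<And>x y. \<lbrakk>x \<in> D'; y \<in> D'; lq' x y\<rbrakk> \<Longrightarrow> lq (e x) (e y)"
  shows "fnc D' lq' (\<lambda>x y. U (e x) (e y))"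
  unfolding fnc_def
proof (intro conjI ballI impI)
  note u = fncD[OF assms(1)]
  fix x assume x: "x \<in> D'"
  show "obj (U (e x) (e x))" by (rule u(1)) (rule assms x)+
  fix y assume y: "y \<in> D'"
  show "arr (U (e x) (e y)) (U (e x) (e x)) (U (e y) (e y))" if "lq' x y"
    by (rule u(2)) (rule assms x y that)+
  fix z assume z: "z \<in> D'"
  show "U (e y) (e z) \<cdot> U (e x) (e y) = U (e x) (e z)" if "lq' x y" "lq' y z"
    by (rule u(3)) (rule assms x y z that)+
qed

lemma nt_reindex:
  assumes "nt D lq U V t" "\<And>x. x \<in> D' \<Longrightarrow> e x \<in> D" "\<And>x y. \<lbrakk>x \<in> D'; y \<in> D'; lq' x y\<rbrakk> \<Longrightarrow> lq (e x) (e y)"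
  shows "nt D' lq' (\<lambda>x y. U (e x) (e y)) (\<lambda>x y. V (e x) (e y)) (\<lambda>x. t (e x))"
  unfolding nt_def
proof (intro conjI ballI impI)
  note u = ntD[OF assms(1)]
  fix x assume x: "x \<in> D'"
  show "arr (t (e x)) (U (e x) (e x)) (V (e x) (e x))" by (rule u(1)) (rule assms x)+
  fix y assume y: "y \<in> D'" "lq' x y"
  show "t (e y) \<cdot> U (e x) (e y) = V (e x) (e y) \<cdot> t (e x)" by (rule u(2)) (rule assms x y)+
qed

lemma nt_cong:
  assumes t: "nt D lq U V t" and refl: "\<And>x. x \<in> D \<Longrightarrow> lq x x"
    and eq: "\<And>x y. \<lbrakk>x \<in> D; y \<in> D; lq x y\<rbrakk> \<Longrightarrow> U' x y = U x y"
      "\<And>x y. \<lbrakk>x \<in> D; y \<in> D; lq x y\<rbrakk> \<Longrightarrow> V' x y = V x y" "\<And>x. x \<in> D \<Longrightarrow> t' x = t x"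
  shows "nt D lq U' V' t'"
  unfolding nt_def
proof (intro conjI ballI impI)
  fix x assume x: "x \<in> D"
  show "arr (t' x) (U' x x) (V' x x)"
    using ntD(1)[OF t x] unfolding eq(1)[OF x x refl[OF x]] eq(2)[OF x x refl[OF x]] eq(3)[OF x] .
  fix y assume y: "y \<in> D" "lq x y"
  show "t' y \<cdot> U' x y = V' x y \<cdot> t' x"
    using ntD(2)[OF t x y] unfolding eq(1)[OF x y] eq(2)[OF x y] eq(3)[OF x] eq(3)[OF y(1)] .
qed

lemma fnc_cong:
  assumes U: "fnc D lq U" and refl: "\<And>x. x \<in> D \<Longrightarrow> lq x x"
    and trans: "\<And>x y z. \<lbrakk>x \<in> D; y \<in> D; z \<in> D; lq x y; lq y z\<rbrakk> \<Longrightarrow> lq x z"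
    and eq: "\<And>x y. \<lbrakk>x \<in> D; y \<in> D; lq x y\<rbrakk> \<Longrightarrow> U' x y = U x y"
  shows "fnc D lq U'"
  unfolding fnc_def
proof (intro conjI ballI impI)
  fix x assume x: "x \<in> D"
  note ex = eq[OF x x refl[OF x]]
  show "obj (U' x x)" using fncD(1)[OF U x] unfolding ex .
  fix y assume y: "y \<in> D"
  note ey = eq[OF y y refl[OF y]]
  show "arr (U' x y) (U' x x) (U' y y)" if "lq x y" using fncD(2)[OF U x y that] unfolding ex ey eq[OF x y that] .
  fix z assume z: "z \<in> D"
  show "U' y z \<cdot> U' x y = U' x z" if l: "lq x y" "lq y z"
    using fncD(3)[OF U x y z l] unfolding eq[OF x y l(1)] eq[OF y z l(2)] eq[OF x z trans[OF x y z l]] .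
qed

lemma plus_cong:
  assumes N: "N \<ge> 0" and X: "plus N X" and eq: "\<And>x y. \<lbrakk>x \<in> zst N; y \<in> zst N; zle x y\<rbrakk> \<Longrightarrow> Y x y = X x y"
  shows "plus N Y"
  unfolding plus_def
proof (intro conjI allI impI)
  show "fnc (zst N) zle Y" by (rule fnc_cong[OF plusD(1)[OF X] _ _ eq]) (auto simp: zle_def)
  fix i show "zobj (Y (i, i) (i, i))" "zobj (Y (i + N, i) (i + N, i))"
    using plusD(2,3)[OF X] eq N by (simp_all add: zst_def zle_def)
next
  fix a b c d assume l: "a \<le> b \<and> b \<le> c \<and> c \<le> d \<and> d \<le> a + N"
  have "Y (c, a) (d, a) = X (c, a) (d, a)" "Y (c, a) (c, b) = X (c, a) (c, b)"
    "Y (d, a) (d, b) = X (d, a) (d, b)" "Y (c, b) (d, b) = X (c, b) (d, b)"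
    using l by (intro eq; simp add: zst_def zle_def)+
  then show "wpb (Y (c, a) (d, a)) (Y (c, a) (c, b)) (Y (d, a) (d, b)) (Y (c, b) (d, b))"
    using plusD(4)[OF X, of a b c d] l by simp
qed

lemma split_strip_cong:
  assumes "N \<ge> 0" "split_strip N X" "\<And>x y. \<lbrakk>x \<in> zst N; y \<in> zst N; zle x y\<rbrakk> \<Longrightarrow> Y x y = X x y"
  shows "split_strip N Y"
  using plus_cong[OF assms(1) _ assms(3)] assms(2,3) unfolding split_strip_def by simp

end

section \<open>The strip in integer coordinates\<close>

text \<open>The inverse of \<open>(z, a) \<mapsto> z (n + 1) + a\<close>.\<close>

definition bar_of :: "nat \<Rightarrow> int \<Rightarrow> bar"
  where "bar_of n k = (k div (int n + 1), nat (k mod (int n + 1)))"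

lemma bar_of_in: "bar_of n k \<in> bar_carrier n"
proof -
  have "k mod (int n + 1) < int n + 1" by (rule pos_mod_bound) simp
  then show ?thesis by (simp add: bar_of_def bar_carrier_def)
qed

lemma bar_of_eq: "a \<le> n \<Longrightarrow> bar_of n (z * (int n + 1) + int a) = (z, a)"
  by (simp add: bar_of_def)

lemma bar_carrier_eq: "bar_carrier n = range (bar_of n)"
proof
  show "bar_carrier n \<subseteq> range (bar_of n)"
  proof
    fix b assume "b \<in> bar_carrier n"
    then obtain z a where "b = (z, a)" "a \<le> n" by (auto simp: bar_carrier_def)
    then show "b \<in> range (bar_of n)" using bar_of_eq by (metis rangeI)
  qed
qed (use bar_of_in in blast)

lemma bar_of_le: "bar_le (bar_of n i) (bar_of n j) \<longleftrightarrow> i \<le> j"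
proof -
  let ?N = "int n + 1"
  have N: "0 < ?N" by simp
  note e = div_mult_mod_eq[of i ?N] div_mult_mod_eq[of j ?N]
  note m = pos_mod_sign[OF N, of i] pos_mod_sign[OF N, of j]
  have lt: "i < j" if "i div ?N < j div ?N"
    using zdiv_mono1[OF _ N, of j i] that by linarith
  have gt: "j < i" if "j div ?N < i div ?N"
    using zdiv_mono1[OF _ N, of i j] that by linarith
  have eq: "i \<le> j \<longleftrightarrow> i mod ?N \<le> j mod ?N" if "i div ?N = j div ?N"
    using e unfolding that by linarith
  consider "i div ?N < j div ?N" | "j div ?N < i div ?N" | "i div ?N = j div ?N" by linarith
  then show ?thesis
  proof cases
    case 1 then show ?thesis using lt by (simp add: bar_of_def)
  next
    case 2 then show ?thesis using gt by (simp add: bar_of_def)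
  next
    case 3 then show ?thesis using eq m by (simp add: bar_of_def nat_le_eq_zle)
  qed
qed

lemma shift_bar_of: "shift (bar_of n k) = bar_of n (k + (int n + 1))" "unshift (bar_of n k) = bar_of n (k - (int n + 1))"
proof -
  have N: "int n + 1 \<noteq> 0" by simp
  have up: "bar_of n (l + (int n + 1)) = shift (bar_of n l)" for l
    using div_add_self2[OF N, of l] by (simp add: bar_of_def)
  then show "shift (bar_of n k) = bar_of n (k + (int n + 1))" by simp
  have "bar_of n k = shift (bar_of n (k - (int n + 1)))" using up[of "k - (int n + 1)"] by simp
  then show "unshift (bar_of n k) = bar_of n (k - (int n + 1))" by (simp add: bar_of_def)
qed

lemma bar_of_inject: "bar_of n i = bar_of n j \<longleftrightarrow> i = j"
  using bar_of_le[of n i j] bar_of_le[of n j i] bar_of_le[of n j j] by force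

definition cell :: "nat \<Rightarrow> int \<times> int \<Rightarrow> bar \<times> bar"
  where "cell n x = (bar_of n (fst x), bar_of n (snd x))"

lemma cell_in_strip: "cell n x \<in> strip n \<longleftrightarrow> x \<in> zst (int n + 1)"
  by (cases x) (auto simp: cell_def strip_def zst_def bar_of_in shift_bar_of bar_of_le)

lemma cell_le: "strip_le (cell n x) (cell n y) \<longleftrightarrow> zle x y"
  by (cases x; cases y) (auto simp: cell_def zle_def bar_of_le)

lemma strip_eq: "strip n = cell n ` zst (int n + 1)"
proof
  show "strip n \<subseteq> cell n ` zst (int n + 1)"
  proof
    fix y assume y: "y \<in> strip n"
    then have "fst y \<in> range (bar_of n)" "snd y \<in> range (bar_of n)"
      unfolding bar_carrier_eq[symmetric] by (auto simp: strip_def)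
    then obtain j i where "y = cell n (j, i)" by (auto simp: cell_def prod_eq_iff)
    then show "y \<in> cell n ` zst (int n + 1)" using y cell_in_strip by blast
  qed
qed (use cell_in_strip in blast)

lemma inj_cell: "inj (cell n)"
  by (rule injI) (simp add: cell_def bar_of_inject prod_eqI)

lemma dot_embedding_eq: "i \<le> n \<Longrightarrow> dot_embedding i = cell n (int i, 0)"
  using bar_of_eq[of i n 0] bar_of_eq[of 0 n 0] by (simp add: dot_embedding_def cell_def)

lemma strip_le_refl: "strip_le x x"
  by (cases x; cases "fst x"; cases "snd x") auto

lemma strip_le_trans: "strip_le x y \<Longrightarrow> strip_le y z \<Longrightarrow> strip_le x z"
  by (cases x; cases y; cases z; cases "fst x"; cases "snd x"; cases "fst y"; cases "snd y"; cases "fst z"; cases "snd z") auto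

context weakly_abelian_category
begin

abbreviation SC :: "nat \<Rightarrow> ((bar \<times> bar, 'a, 'b) diagram, bar \<times> bar \<Rightarrow> 'b) precat"
  where "SC n \<equiv> strip_cat A n"

definition sarr :: "nat \<Rightarrow> (bar \<times> bar, 'a, 'b) diagram \<Rightarrow> int \<times> int \<Rightarrow> int \<times> int \<Rightarrow> ('a, 'b) arrow"
  where "sarr n X x y = darr X (cell n x) (cell n y)"

definition starr :: "nat \<Rightarrow> (bar \<times> bar, 'a, 'b) diagram \<Rightarrow> (bar \<times> bar, 'a, 'b) diagram
    \<Rightarrow> (bar \<times> bar \<Rightarrow> 'b) \<Rightarrow> int \<times> int \<Rightarrow> ('a, 'b) arrow"
  where "starr n X Y t x = tarr X Y t (cell n x)"

lemma sarr_fnc: "X \<in> Obj (SC n) \<Longrightarrow> arr.fnc (zst (int n + 1)) zle (sarr n X)"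
  unfolding sarr_def strip_cat_def by (erule arr.fnc_reindex[OF darr_fnc]) (simp_all add: cell_in_strip cell_le)

lemma starr_nt:
  "\<lbrakk>X \<in> Obj (SC n); Y \<in> Obj (SC n); t \<in> Mor (SC n) X Y\<rbrakk> \<Longrightarrow> arr.nt (zst (int n + 1)) zle (sarr n X) (sarr n Y) (starr n X Y t)"
  unfolding sarr_def starr_def strip_cat_def by (erule (2) arr.nt_reindex[OF tarr_nt]) (simp_all add: cell_in_strip cell_le)

lemma fnc_sarr:
  assumes Z: "arr.fnc (zst (int n + 1)) zle Z"
  shows "\<exists>X\<in>Obj (SC n). \<forall>x\<in>zst (int n + 1). \<forall>y\<in>zst (int n + 1). zle x y \<longrightarrow> sarr n X x y = Z x y"
proof -
  define u where "u = inv_into UNIV (cell n)"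
  have u: "u (cell n x) = x" for x unfolding u_def by (rule inv_f_f[OF inj_cell])
  have "arr.fnc (strip n) strip_le (\<lambda>x y. Z (u x) (u y))"
    by (rule arr.fnc_reindex[OF Z]) (auto simp: strip_eq u cell_le)
  then have "\<exists>X\<in>Obj (DC (strip n) strip_le). \<forall>x\<in>strip n. \<forall>y\<in>strip n. strip_le x y \<longrightarrow> darr X x y = Z (u x) (u y)"
    by (rule fnc_darr) (rule strip_le_refl, erule (1) strip_le_trans)
  then obtain X where "X \<in> Obj (DC (strip n) strip_le)"
    "\<forall>x\<in>strip n. \<forall>y\<in>strip n. strip_le x y \<longrightarrow> darr X x y = Z (u x) (u y)" by blast
  then show ?thesis by (intro bexI[of _ X]) (simp_all add: strip_cat_def sarr_def cell_in_strip cell_le u)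
qed

lemma nt_starr:
  assumes X: "X \<in> Obj (SC n)" and Y: "Y \<in> Obj (SC n)" and s: "arr.nt (zst (int n + 1)) zle (sarr n X) (sarr n Y) s"
  shows "\<exists>t\<in>Mor (SC n) X Y. \<forall>x\<in>zst (int n + 1). starr n X Y t x = s x"
proof -
  define u where "u = inv_into UNIV (cell n)"
  have u: "u (cell n x) = x" for x unfolding u_def by (rule inv_f_f[OF inj_cell])
  have "arr.nt (strip n) strip_le (\<lambda>x y. sarr n X (u x) (u y)) (\<lambda>x y. sarr n Y (u x) (u y)) (\<lambda>x. s (u x))"
    by (rule arr.nt_reindex[OF s]) (auto simp: strip_eq u cell_le)
  then have "arr.nt (strip n) strip_le (darr X) (darr Y) (\<lambda>x. s (u x))"
    by (rule arr.nt_cong) (auto simp: strip_le_refl strip_eq u sarr_def)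
  then obtain t where "t \<in> Mor (DC (strip n) strip_le) X Y" "\<forall>x\<in>strip n. tarr X Y t x = s (u x)"
    using nt_tarr X Y unfolding strip_cat_def by blast
  then show ?thesis by (intro bexI[of _ t]) (simp_all add: strip_cat_def starr_def cell_in_strip u)
qed

lemma strip_plus_iff: "X \<in> strip_plus A n \<longleftrightarrow> X \<in> Obj (SC n) \<and> arr.plus (int n + 1) (sarr n X)"
proof (cases "X \<in> Obj (SC n)")
  case X: True
  let ?N = "int n + 1"
  note X' = X[unfolded strip_cat_def]
  have ob: "(bar_of n j, bar_of n i) \<in> strip n \<longleftrightarrow> i \<le> j \<and> j \<le> i + ?N" for i j
    using cell_in_strip[of n "(j, i)"] by (simp add: cell_def zst_def)
  have z: "is_zero_object A (Vtx X (bar_of n j, bar_of n i)) \<longleftrightarrow> arr.zobj (sarr n X (j, i) (j, i))"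
    if "i \<le> j" "j \<le> i + ?N" for i j
    using darr_id[OF X', of "(bar_of n j, bar_of n i)"] that ob by (simp add: sarr_def cell_def arr_zobj_iff)
  have w: "is_weak_square A (Vtx X (bar_of n c, bar_of n a)) (Vtx X (bar_of n d, bar_of n a)) (Vtx X (bar_of n c, bar_of n b)) (Vtx X (bar_of n d, bar_of n b))
        (Tr X (bar_of n c, bar_of n a) (bar_of n d, bar_of n a)) (Tr X (bar_of n c, bar_of n a) (bar_of n c, bar_of n b))
        (Tr X (bar_of n d, bar_of n a) (bar_of n d, bar_of n b)) (Tr X (bar_of n c, bar_of n b) (bar_of n d, bar_of n b))
      \<longleftrightarrow> arr.wpb (sarr n X (c, a) (d, a)) (sarr n X (c, a) (c, b)) (sarr n X (d, a) (d, b)) (sarr n X (c, b) (d, b))"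
    if "a \<le> b" "b \<le> c" "c \<le> d" "d \<le> a + ?N" for a b c d
  proof -
    have s: "(bar_of n c, bar_of n a) \<in> strip n" "(bar_of n d, bar_of n a) \<in> strip n"
      "(bar_of n c, bar_of n b) \<in> strip n" "(bar_of n d, bar_of n b) \<in> strip n" using that ob by simp_all
    show ?thesis
      unfolding is_weak_square_iff sarr_def cell_def fst_conv snd_conv darr_def
      using s that by (simp add: DC_ObjD(1,3)[OF X'] bar_of_le)
  qed
  have "X \<in> strip_plus A n \<longleftrightarrow>
      (\<forall>i. is_zero_object A (Vtx X (bar_of n i, bar_of n i)) \<and> is_zero_object A (Vtx X (bar_of n (i + ?N), bar_of n i))) \<and>
      (\<forall>a b c d. a \<le> b \<and> b \<le> c \<and> c \<le> d \<and> d \<le> a + ?N \<longrightarrow>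
        is_weak_square A (Vtx X (bar_of n c, bar_of n a)) (Vtx X (bar_of n d, bar_of n a)) (Vtx X (bar_of n c, bar_of n b)) (Vtx X (bar_of n d, bar_of n b))
        (Tr X (bar_of n c, bar_of n a) (bar_of n d, bar_of n a)) (Tr X (bar_of n c, bar_of n a) (bar_of n c, bar_of n b))
        (Tr X (bar_of n d, bar_of n a) (bar_of n d, bar_of n b)) (Tr X (bar_of n c, bar_of n b) (bar_of n d, bar_of n b)))"
  proof -
    have l: "d - ?N \<le> a \<longleftrightarrow> d \<le> a + ?N" for a d :: int by linarith
    have l': "(d \<le> a + ?N \<and> a \<le> b \<and> b \<le> c \<and> c \<le> d \<and> d \<le> a + ?N) = (a \<le> b \<and> b \<le> c \<and> c \<le> d \<and> d \<le> a + ?N)" for a b c d :: int by blast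
    show ?thesis
      unfolding strip_plus_def bar_carrier_eq mem_Collect_eq ball_simps(9) shift_bar_of bar_of_le l l' ball_UNIV using X by blast
  qed
  also have "\<dots> \<longleftrightarrow> arr.plus ?N (sarr n X)"
    unfolding arr.plus_def using sarr_fnc[OF X] z w by simp
  finally show ?thesis using X by blast
qed (simp add: strip_plus_def)

lemma split_plus_iff: "X \<in> split_plus A n \<longleftrightarrow> X \<in> Obj (SC n) \<and> arr.split_strip (int n + 1) (sarr n X)"
  unfolding split_plus_def Int_iff strip_plus_iff split_diagrams_iff arr.split_strip_def
  by (auto simp: strip_cat_def sarr_def strip_eq cell_le)

lemma plus_cat_simps:
  "Obj (plus_cat A n) = strip_plus A n" "Hom (plus_cat A n) = Hom (SC n)"
  "Idm (plus_cat A n) = Idm (SC n)" "Cmp (plus_cat A n) = Cmp (SC n)"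
  by (auto simp: plus_cat_def full_subcat_def strip_plus_def)

lemma strip_plusD: "X \<in> strip_plus A n \<Longrightarrow> X \<in> Obj (SC n)"
  by (simp add: strip_plus_def)

lemma starr_cmp:
  assumes "X \<in> Obj (SC n)" "Y \<in> Obj (SC n)" "Z \<in> Obj (SC n)"
    and "t \<in> Mor (SC n) X Y" "s \<in> Mor (SC n) Y Z" "x \<in> zst (int n + 1)"
  shows "starr n X Z (Cmp (SC n) X Y Z s t) x = arrow_cmp A (starr n Y Z s x) (starr n X Y t x)"
  unfolding starr_def strip_cat_def
  by (rule tarr_cmp[OF assms(1-5)[unfolded strip_cat_def]]) (simp add: cell_in_strip assms)

lemma starr_add:
  assumes "X \<in> Obj (SC n)" "Y \<in> Obj (SC n)"
    and "s \<in> Mor (SC n) X Y" "t \<in> Mor (SC n) X Y" "x \<in> zst (int n + 1)"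
  shows "starr n X Y (s \<otimes>\<^bsub>Hom (SC n) X Y\<^esub> t) x = arrow_add A (starr n X Y s x) (starr n X Y t x)"
  unfolding starr_def strip_cat_def
  by (rule tarr_add[OF assms(1-4)[unfolded strip_cat_def]]) (simp add: cell_in_strip assms)

lemma SC_mor_eqI:
  assumes "s \<in> Mor (SC n) X Y" "t \<in> Mor (SC n) X Y" "\<And>x. x \<in> zst (int n + 1) \<Longrightarrow> starr n X Y s x = starr n X Y t x"
  shows "s = t"
  by (rule DC_mor_eqI[OF assms(1,2)[unfolded strip_cat_def]]) (use assms(3) in \<open>auto simp: strip_eq starr_def tarr_def\<close>)

lemma preadditive_SC: "preadditive_category (SC n)"
  unfolding strip_cat_def by (rule preadditive_diagram_cat)

lemma factoring_plus_iff:
  assumes X: "X \<in> Obj (SC n)" and Y: "Y \<in> Obj (SC n)" and f: "f \<in> Mor (SC n) X Y"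
  shows "f \<in> factoring (plus_cat A n) (split_plus A n) X Y \<longleftrightarrow> arr.factors (int n + 1) (sarr n X) (sarr n Y) (starr n X Y f)"
proof
  interpret SC: preadditive_category "SC n" by (rule preadditive_SC)
  assume "f \<in> factoring (plus_cat A n) (split_plus A n) X Y"
  then obtain W u v where w: "f = Cmp (SC n) X W Y v u" "W \<in> split_plus A n" "u \<in> Mor (SC n) X W" "v \<in> Mor (SC n) W Y"
    unfolding factoring_def plus_cat_simps by blast
  have W: "W \<in> Obj (SC n)" "arr.split_strip (int n + 1) (sarr n W)" using w(2) split_plus_iff by blast+
  show "arr.factors (int n + 1) (sarr n X) (sarr n Y) (starr n X Y f)"
    by (rule arr.factorsI[OF W(2) starr_nt[OF X W(1) w(3)] starr_nt[OF W(1) Y w(4)]])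
      (simp add: w(1) starr_cmp[OF X W(1) Y w(3,4)])
next
  interpret SC: preadditive_category "SC n" by (rule preadditive_SC)
  have N: "int n + 1 \<ge> 0" by simp
  have zr: "zle x x" for x by (simp add: zle_def)
  assume "arr.factors (int n + 1) (sarr n X) (sarr n Y) (starr n X Y f)"
  then obtain B u v where B: "arr.split_strip (int n + 1) B" "arr.nt (zst (int n + 1)) zle (sarr n X) B u"
    "arr.nt (zst (int n + 1)) zle B (sarr n Y) v" "\<And>x. x \<in> zst (int n + 1) \<Longrightarrow> starr n X Y f x = arrow_cmp A (v x) (u x)"
    by (rule arr.factorsE) blast
  obtain W where W: "W \<in> Obj (SC n)" "\<And>x y. \<lbrakk>x \<in> zst (int n + 1); y \<in> zst (int n + 1); zle x y\<rbrakk> \<Longrightarrow> sarr n W x y = B x y"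
    using fnc_sarr[OF arr.split_stripD(2)[OF B(1)]] by blast
  have "arr.split_strip (int n + 1) (sarr n W)" by (rule arr.split_strip_cong[OF N B(1) W(2)])
  then have Wp: "W \<in> split_plus A n" using W(1) split_plus_iff by blast
  have "arr.nt (zst (int n + 1)) zle (sarr n X) (sarr n W) u" by (rule arr.nt_cong[OF B(2) zr]) (simp_all add: W(2))
  then obtain u' where u': "u' \<in> Mor (SC n) X W" "\<And>x. x \<in> zst (int n + 1) \<Longrightarrow> starr n X W u' x = u x"
    using nt_starr[OF X W(1)] by blast
  have "arr.nt (zst (int n + 1)) zle (sarr n W) (sarr n Y) v" by (rule arr.nt_cong[OF B(3) zr]) (simp_all add: W(2))
  then obtain v' where v': "v' \<in> Mor (SC n) W Y" "\<And>x. x \<in> zst (int n + 1) \<Longrightarrow> starr n W Y v' x = v x"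
    using nt_starr[OF W(1) Y] by blast
  have "f = Cmp (SC n) X W Y v' u'"
    by (rule SC_mor_eqI[OF f SC.cmp_closed[OF X W(1) Y u'(1) v'(1)]])
      (simp add: starr_cmp[OF X W(1) Y u'(1) v'(1)] u'(2) v'(2) B(4))
  then show "f \<in> factoring (plus_cat A n) (split_plus A n) X Y"
    unfolding factoring_def plus_cat_simps using Wp u'(1) v'(1) by blast
qed

lemma additive_quotient_plus: "additive_quotient (plus_cat A n) (split_plus A n)"
proof -
  interpret SC: preadditive_category "SC n" by (rule preadditive_SC)
  have PC: "preadditive_category (plus_cat A n)"
    unfolding plus_cat_def by (rule preadditive_full_subcat[OF preadditive_SC])
  show ?thesis
  proof (rule preadditive_category.additive_quotientI[OF PC])
    show sub: "split_plus A n \<subseteq> Obj (plus_cat A n)" by (simp add: plus_cat_simps split_plus_def)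
    have N: "int n + 1 \<ge> 0" "int n + 1 \<ge> 1" by simp_all
    obtain Z where Z: "arr.zobj Z" using arr.zobj_exists by blast
    \<comment> \<open>the sum of the empty family of rectangles\<close>
    obtain B where B: "arr.split_strip (int n + 1) B"
      using arr.rect_sum[OF N(2), of "{}" "\<lambda>_. (0, 0)" "\<lambda>_. Z"] arr.zobj_obj[OF Z] by auto
    obtain W where W: "W \<in> Obj (SC n)" "\<And>x y. \<lbrakk>x \<in> zst (int n + 1); y \<in> zst (int n + 1); zle x y\<rbrakk> \<Longrightarrow> sarr n W x y = B x y"
      using fnc_sarr[OF arr.split_stripD(2)[OF B]] by blast
    have "arr.split_strip (int n + 1) (sarr n W)" by (rule arr.split_strip_cong[OF N(1) B W(2)])
    then show "split_plus A n \<noteq> {}" using W(1) split_plus_iff by blast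
    fix X Y f g assume o: "X \<in> Obj (plus_cat A n)" "Y \<in> Obj (plus_cat A n)"
      and fg: "f \<in> factoring (plus_cat A n) (split_plus A n) X Y" "g \<in> factoring (plus_cat A n) (split_plus A n) X Y"
    have X: "X \<in> Obj (SC n)" and Y: "Y \<in> Obj (SC n)" using o by (simp_all add: plus_cat_simps strip_plusD)
    have "factoring (plus_cat A n) (split_plus A n) X Y \<subseteq> Mor (SC n) X Y"
      unfolding factoring_def plus_cat_simps using SC.cmp_closed[OF X _ Y] split_plus_iff by auto
    then have m: "f \<in> Mor (SC n) X Y" "g \<in> Mor (SC n) X Y" using fg by blast+
    have "arr.factors (int n + 1) (sarr n X) (sarr n Y) (\<lambda>x. arrow_add A (starr n X Y f x) (starr n X Y g x))"
      using arr.factors_add[OF N(1)] fg factoring_plus_iff[OF X Y m(1)] factoring_plus_iff[OF X Y m(2)] by blast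
    then have "arr.factors (int n + 1) (sarr n X) (sarr n Y) (starr n X Y (f \<otimes>\<^bsub>Hom (SC n) X Y\<^esub> g))"
      by (rule arr.factors_cong) (rule starr_add[OF X Y m])
    then show "f \<otimes>\<^bsub>Hom (plus_cat A n) X Y\<^esub> g \<in> factoring (plus_cat A n) (split_plus A n) X Y"
      unfolding plus_cat_simps using factoring_plus_iff[OF X Y SC.add_closed[OF X Y m]] by blast
  qed
qed

text \<open>
  Constant diagrams on a zero object are split, and sums are obtained from pointwise direct sums.
\<close>

lemma additive_quotient_split_diagrams:
  assumes refl: "\<And>x. x \<in> D \<Longrightarrow> lq x x" and trans: "\<And>x y z. \<lbrakk>x \<in> D; y \<in> D; z \<in> D; lq x y; lq y z\<rbrakk> \<Longrightarrow> lq x z"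
  shows "additive_quotient (DC D lq) (split_diagrams A D lq)"
proof (rule preadditive_category.additive_quotientI[OF preadditive_diagram_cat])
  interpret DC: preadditive_category "DC D lq" by (rule preadditive_diagram_cat)
  show "split_diagrams A D lq \<subseteq> Obj (DC D lq)" by (auto simp: split_diagrams_def)
  obtain Z where "is_zero_object A Z" using zero_object_exists by blast
  then have Z: "Z \<in> Obj A" by (simp add: is_zero_object_def)
  have iZ: "arrow_cmp A (ida Z) (ida Z) = ida Z"
    using Z by (simp add: arrow_cmp_Some id_closed cmp_id_left)
  have aZ: "arr.arr (ida Z) (ida Z) (ida Z)" "arr.obj (ida Z)" unfolding arr_arr_iff arr_obj_iff using Z id_closed by blast+
  have ex: "\<exists>X\<in>Obj (DC D lq). \<forall>x\<in>D. \<forall>y\<in>D. lq x y \<longrightarrow> darr X x y = F x y" if "arr.fnc D lq F" for F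
    by (rule fnc_darr[OF that], erule refl, erule (4) trans)
  have "arr.fnc D lq (\<lambda>_ _. ida Z)" unfolding arr.fnc_def using iZ aZ by simp
  then obtain X where X: "X \<in> Obj (DC D lq)" "\<And>x y. \<lbrakk>x \<in> D; y \<in> D; lq x y\<rbrakk> \<Longrightarrow> darr X x y = ida Z"
    using ex by blast
  have "arr.regular (ida Z)" unfolding arr.regular_def using iZ aZ(1) arr.arrD(1) by metis
  then have "X \<in> split_diagrams A D lq" unfolding split_diagrams_iff using X by simp
  then show "split_diagrams A D lq \<noteq> {}" by blast
  fix X Y f g assume X: "X \<in> Obj (DC D lq)" and Y: "Y \<in> Obj (DC D lq)"
    and fg: "f \<in> factoring (DC D lq) (split_diagrams A D lq) X Y" "g \<in> factoring (DC D lq) (split_diagrams A D lq) X Y"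
  obtain V u v where V: "f = Cmp (DC D lq) X V Y v u" "V \<in> split_diagrams A D lq" "u \<in> Mor (DC D lq) X V" "v \<in> Mor (DC D lq) V Y"
    using fg(1) unfolding factoring_def by blast
  obtain W u' v' where W: "g = Cmp (DC D lq) X W Y v' u'" "W \<in> split_diagrams A D lq" "u' \<in> Mor (DC D lq) X W" "v' \<in> Mor (DC D lq) W Y"
    using fg(2) unfolding factoring_def by blast
  have Vo: "V \<in> Obj (DC D lq)" and Wo: "W \<in> Obj (DC D lq)" using V(2) W(2) split_diagrams_iff by blast+
  have m: "f \<in> Mor (DC D lq) X Y" "g \<in> Mor (DC D lq) X Y"
    unfolding V(1) W(1) by (rule DC.cmp_closed[OF X Vo Y V(3,4)], rule DC.cmp_closed[OF X Wo Y W(3,4)])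
  obtain B r s where B: "arr.fnc D lq B" "arr.nt D lq (darr X) B r" "arr.nt D lq B (darr Y) s"
    "\<forall>x\<in>D. arrow_cmp A (s x) (r x) = arrow_add A (arrow_cmp A (tarr V Y v x) (tarr X V u x)) (arrow_cmp A (tarr W Y v' x) (tarr X W u' x))"
    "\<forall>x\<in>D. \<forall>y\<in>D. lq x y \<longrightarrow> arr.regular (darr V x y) \<and> arr.regular (darr W x y) \<longrightarrow> arr.regular (B x y)"
    using arr.diagram_sum[OF darr_fnc[OF Vo] darr_fnc[OF Wo] tarr_nt[OF X Vo V(3)] tarr_nt[OF Vo Y V(4)] tarr_nt[OF X Wo W(3)] tarr_nt[OF Wo Y W(4)]]
    by (elim exE conjE) (rule that)
  obtain P where P: "P \<in> Obj (DC D lq)" "\<And>x y. \<lbrakk>x \<in> D; y \<in> D; lq x y\<rbrakk> \<Longrightarrow> darr P x y = B x y"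
    using ex[OF B(1)] by blast
  have "arr.nt D lq (darr X) (darr P) r" by (rule arr.nt_cong[OF B(2) refl]) (simp_all add: P(2))
  then obtain r' where r': "r' \<in> Mor (DC D lq) X P" "\<And>x. x \<in> D \<Longrightarrow> tarr X P r' x = r x" using nt_tarr[OF X P(1)] by blast
  have "arr.nt D lq (darr P) (darr Y) s" by (rule arr.nt_cong[OF B(3) refl]) (simp_all add: P(2))
  then obtain s' where s': "s' \<in> Mor (DC D lq) P Y" "\<And>x. x \<in> D \<Longrightarrow> tarr P Y s' x = s x" using nt_tarr[OF P(1) Y] by blast
  have Ps: "P \<in> split_diagrams A D lq"
    unfolding split_diagrams_iff using P B(5) V(2) W(2) unfolding split_diagrams_iff by simp
  have "f \<otimes>\<^bsub>Hom (DC D lq) X Y\<^esub> g = Cmp (DC D lq) X P Y s' r'"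
  proof (rule DC_mor_eqI[OF DC.add_closed[OF X Y m] DC.cmp_closed[OF X P(1) Y r'(1) s'(1)]])
    fix x assume x: "x \<in> D"
    have "tarr X Y (f \<otimes>\<^bsub>Hom (DC D lq) X Y\<^esub> g) x = arrow_add A (tarr X Y f x) (tarr X Y g x)" by (rule tarr_add[OF X Y m x])
    also have "\<dots> = arrow_cmp A (s x) (r x)"
      unfolding V(1) W(1) tarr_cmp[OF X Vo Y V(3,4) x] tarr_cmp[OF X Wo Y W(3,4) x] using B(4) x by simp
    also have "\<dots> = tarr X Y (Cmp (DC D lq) X P Y s' r') x"
      unfolding tarr_cmp[OF X P(1) Y r'(1) s'(1) x] r'(2)[OF x] s'(2)[OF x] ..
    finally show "(f \<otimes>\<^bsub>Hom (DC D lq) X Y\<^esub> g) x = Cmp (DC D lq) X P Y s' r' x" unfolding tarr_def by simp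
  qed
  then show "f \<otimes>\<^bsub>Hom (DC D lq) X Y\<^esub> g \<in> factoring (DC D lq) (split_diagrams A D lq) X Y"
    unfolding factoring_def using Ps r'(1) s'(1) by blast
qed

section \<open>Restriction to the row\<close>

lemma tarr_restriction:
  "x \<in> D' \<Longrightarrow> tarr (FObj (restriction D' lq' e) X) (FObj (restriction D' lq' e) Y) (FMor (restriction D' lq' e) X Y t) x = tarr X Y t (e x)"
  by (simp add: tarr_def restriction_def)

lemma darr_restriction:
  "\<lbrakk>x \<in> D'; y \<in> D'; lq' x y\<rbrakk> \<Longrightarrow> darr (FObj (restriction D' lq' e) X) x y = darr X (e x) (e y)"
  by (simp add: darr_def restriction_def)

lemma DC_obj_eqI:
  assumes X: "X \<in> Obj (DC D lq)" and Y: "Y \<in> Obj (DC D lq)" and refl: "\<And>x. x \<in> D \<Longrightarrow> lq x x"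
    and eq: "\<And>x y. \<lbrakk>x \<in> D; y \<in> D; lq x y\<rbrakk> \<Longrightarrow> darr X x y = darr Y x y"
  shows "X = Y"
proof (rule diagram.equality)
  show "Vtx X = Vtx Y"
  proof
    fix x show "Vtx X x = Vtx Y x"
    proof (cases "x \<in> D")
      case True then show ?thesis using eq[OF True True refl[OF True]] by (simp add: darr_def)
    qed (simp add: DC_ObjD(2)[OF X] DC_ObjD(2)[OF Y])
  qed
  show "Tr X = Tr Y"
  proof (intro HOL.ext)
    fix x y show "Tr X x y = Tr Y x y"
    proof (cases "x \<in> D \<and> y \<in> D \<and> lq x y")
      case True then show ?thesis using eq[of x y] by (simp add: darr_def)
    next
      case False then show ?thesis using DC_ObjD(4)[OF X False] DC_ObjD(4)[OF Y False] by simp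
    qed
  qed
qed simp

lemma restriction_functor:
  assumes e: "\<And>x. x \<in> D' \<Longrightarrow> e x \<in> D" and mono: "\<And>x y. \<lbrakk>x \<in> D'; y \<in> D'; lq' x y\<rbrakk> \<Longrightarrow> lq (e x) (e y)"
    and refl: "\<And>x. x \<in> D' \<Longrightarrow> lq' x x" and trans: "\<And>x y z. \<lbrakk>x \<in> D'; y \<in> D'; z \<in> D'; lq' x y; lq' y z\<rbrakk> \<Longrightarrow> lq' x z"
  shows "is_functor (DC D lq) (DC D' lq') (restriction D' lq' e)"
proof -
  let ?F = "restriction D' lq' e"
  have V: "Vtx (FObj ?F X) x = Vtx X (e x)" if "x \<in> D'" for X x using that by (simp add: restriction_def)
  have T: "Tr (FObj ?F X) x y = Tr X (e x) (e y)" if "x \<in> D'" "y \<in> D'" "lq' x y" for X x y using that by (simp add: restriction_def)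
  have M: "FMor ?F X Y t x = t (e x)" if "x \<in> D'" for X Y t x using that by (simp add: restriction_def)
  show ?thesis
    unfolding is_functor_def
  proof (intro conjI ballI)
    fix X assume X: "X \<in> Obj (DC D lq)"
    note d = DC_ObjD[OF X]
    show "FObj ?F X \<in> Obj (DC D' lq')"
      unfolding diagram_cat_def precat.simps mem_Collect_eq
    proof (intro conjI ballI impI allI)
      show "Vtx (FObj ?F X) \<in> D' \<rightarrow>\<^sub>E Obj A" using d(1) e by (auto simp: restriction_def)
      show "Tr (FObj ?F X) x y = undefined" if "\<not> (x \<in> D' \<and> y \<in> D' \<and> lq' x y)" for x y
        using that unfolding restriction_def by auto
      fix x assume x: "x \<in> D'"
      show "Tr (FObj ?F X) x x = Idm A (Vtx (FObj ?F X) x)"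
        unfolding V[OF x] T[OF x x refl[OF x]] by (rule d(5)[OF e[OF x]])
      fix y assume y: "y \<in> D'"
      show "Tr (FObj ?F X) x y \<in> Mor A (Vtx (FObj ?F X) x) (Vtx (FObj ?F X) y)" if l: "lq' x y"
        unfolding V[OF x] V[OF y] T[OF x y l] by (rule d(3)[OF e[OF x] e[OF y] mono[OF x y l]])
      fix z assume z: "z \<in> D'"
      show "Cmp A (Vtx (FObj ?F X) x) (Vtx (FObj ?F X) y) (Vtx (FObj ?F X) z) (Tr (FObj ?F X) y z) (Tr (FObj ?F X) x y) = Tr (FObj ?F X) x z"
        if l: "lq' x y" "lq' y z"
        unfolding V[OF x] V[OF y] V[OF z] T[OF x y l(1)] T[OF y z l(2)] T[OF x z trans[OF x y z l]]
        by (rule d(6)[OF e[OF x] e[OF y] e[OF z] mono[OF x y l(1)] mono[OF y z l(2)]])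
    qed
    show "FMor ?F X X (Idm (DC D lq) X) = Idm (DC D' lq') (FObj ?F X)"
      using e by (auto simp: DC_simps restriction_def)
    fix Y assume Y: "Y \<in> Obj (DC D lq)"
    show "FMor ?F X Y t \<in> Mor (DC D' lq') (FObj ?F X) (FObj ?F Y)" if t: "t \<in> Mor (DC D lq) X Y" for t
      unfolding DC_Mor_iff
    proof (intro conjI ballI impI)
      show "FMor ?F X Y t \<in> (\<Pi>\<^sub>E x\<in>D'. Mor A (Vtx (FObj ?F X) x) (Vtx (FObj ?F Y) x))"
        using DC_MorD[OF t e] V by (auto simp: restriction_def)
      fix x y assume x: "x \<in> D'" and y: "y \<in> D'" and l: "lq' x y"
      show "Cmp A (Vtx (FObj ?F X) x) (Vtx (FObj ?F X) y) (Vtx (FObj ?F Y) y) (FMor ?F X Y t y) (Tr (FObj ?F X) x y)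
        = Cmp A (Vtx (FObj ?F X) x) (Vtx (FObj ?F Y) x) (Vtx (FObj ?F Y) y) (Tr (FObj ?F Y) x y) (FMor ?F X Y t x)"
        unfolding V[OF x] V[OF y] T[OF x y l] M[OF x] M[OF y]
        using t e[OF x] e[OF y] mono[OF x y l] unfolding DC_Mor_iff by blast
    qed
    fix Z t s assume Z: "Z \<in> Obj (DC D lq)" and t: "t \<in> Mor (DC D lq) X Y" and s: "s \<in> Mor (DC D lq) Y Z"
    show "FMor ?F X Z (Cmp (DC D lq) X Y Z s t) = Cmp (DC D' lq') (FObj ?F X) (FObj ?F Y) (FObj ?F Z) (FMor ?F Y Z s) (FMor ?F X Y t)"
      using e by (intro HOL.ext) (simp add: DC_simps restriction_def)
  qed
qed

lemma restriction_add:
  assumes e: "\<And>x. x \<in> D' \<Longrightarrow> e x \<in> D"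
  shows "FMor (restriction D' lq' e) X Y (s \<otimes>\<^bsub>Hom (DC D lq) X Y\<^esub> t) =
    FMor (restriction D' lq' e) X Y s \<otimes>\<^bsub>Hom (DC D' lq') (FObj (restriction D' lq' e) X) (FObj (restriction D' lq' e) Y)\<^esub> FMor (restriction D' lq' e) X Y t"
  using e by (simp add: DC_simps restriction_def cong: restrict_cong)

text \<open>
  Already before the passage to quotients, restriction is surjective on objects, by
  \<open>plus_extends\<close>, and full, by \<open>nt_extend_inner\<close>. It preserves split
  diagrams, and by \<open>factors_if_row_factors\<close> a morphism factors over a split diagram as
  soon as its restriction does.
\<close>

theorem stable_restriction_equivalence:
  "is_equivalence (stable_plus_cat A n) (stable_dot_cat A n) (stable_restriction A n)"
proof -
  define F where "F = (restriction {1..n} (\<le>) dot_embedding :: ((bar \<times> bar, 'a, 'b) diagram, bar \<times> bar \<Rightarrow> 'b, (nat, 'a, 'b) diagram, nat \<Rightarrow> 'b) functr)"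
  let ?N = "int n + 1"
  let ?D = "DC {1..n} (\<le>)"
  have N: "?N \<ge> 1" "?N \<ge> 0" by simp_all
  have nr: "nat i \<in> {1..n}" if "i \<in> {1..?N - 1}" for i using that by auto
  have nm: "nat i \<le> nat j" if "i \<le> j" for i j :: int using that by simp
  have emb: "dot_embedding i = cell n (int i, 0)" if "i \<in> {1..n}" for i using dot_embedding_eq that by simp
  have e: "dot_embedding i \<in> strip n" if "i \<in> {1..n}" for i
    unfolding emb[OF that] cell_in_strip using that by (simp add: zst_def)
  have em: "strip_le (dot_embedding i) (dot_embedding j)" if "i \<in> {1..n}" "j \<in> {1..n}" "i \<le> j" for i j
    unfolding emb[OF that(1)] emb[OF that(2)] cell_le using that by (simp add: zle_def)
  interpret SC: preadditive_category "SC n" by (rule preadditive_SC)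
  interpret D: preadditive_category ?D by (rule preadditive_diagram_cat)
  have F0: "is_functor (SC n) ?D F"
    unfolding strip_cat_def F_def by (rule restriction_functor) (use e em in auto)
  note F' = is_functorD[OF F0]
  have F: "is_functor (plus_cat A n) ?D F"
    unfolding is_functor_def plus_cat_simps using F' strip_plusD by simp
  \<comment> \<open>row \<open>0\<close> of \<open>X\<close>, in integer coordinates, is the restriction of \<open>X\<close>\<close>
  have row: "darr (FObj F X) (nat i) (nat j) = sarr n X (i, 0) (j, 0)"
    if "i \<in> {1..?N - 1}" "j \<in> {1..?N - 1}" "i \<le> j" for X i j
    unfolding F_def darr_restriction[of _ "{1..n}" _ "(\<le>)", OF nr[OF that(1)] nr[OF that(2)] nm[OF that(3)]]
      emb[OF nr[OF that(1)]] emb[OF nr[OF that(2)]] sarr_def using that by simp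
  have rowm: "tarr (FObj F X) (FObj F Y) (FMor F X Y t) (nat i) = starr n X Y t (i, 0)"
    if "i \<in> {1..?N - 1}" for X Y t i
    unfolding F_def tarr_restriction[OF nr[OF that]] emb[OF nr[OF that]] starr_def using that by simp
  have nti: "arr.nt {1..?N - 1} (\<le>) (\<lambda>i j. darr U (nat i) (nat j)) (\<lambda>i j. darr V (nat i) (nat j)) (\<lambda>i. tarr U V t (nat i))"
    if "U \<in> Obj ?D" "V \<in> Obj ?D" "t \<in> Mor ?D U V" for U V t
    by (rule arr.nt_reindex[OF tarr_nt[OF that]]) (use nr nm in auto)
  show ?thesis
    unfolding stable_plus_cat_def stable_dot_cat_def stable_restriction_def dot_cat_def split_dot_def F_def[symmetric]
  proof (rule induced_equivalence[OF additive_quotient_plus _ F], unfold plus_cat_simps)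
    show "additive_quotient ?D (split_diagrams A {1..n} (\<le>))"
      by (rule additive_quotient_split_diagrams) auto
    show "FMor F X Y (f \<otimes>\<^bsub>Hom (SC n) X Y\<^esub> g) = FMor F X Y f \<otimes>\<^bsub>Hom ?D (FObj F X) (FObj F Y)\<^esub> FMor F X Y g" for X Y f g
      unfolding strip_cat_def F_def by (rule restriction_add) (rule e)
  next
    fix Z assume Z: "Z \<in> Obj ?D"
    have "arr.fnc {1..?N - 1} (\<le>) (\<lambda>i j. darr Z (nat i) (nat j))"
      by (rule arr.fnc_reindex[OF darr_fnc[OF Z]]) (use nr nm in auto)
    then obtain B where B: "arr.plus ?N B" "\<forall>i j. 1 \<le> i \<and> i \<le> j \<and> j \<le> ?N - 1 \<longrightarrow> B (i, 0) (j, 0) = darr Z (nat i) (nat j)"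
      using arr.plus_extends[OF N(1)] by blast
    obtain X where X: "X \<in> Obj (SC n)" "\<And>x y. \<lbrakk>x \<in> zst ?N; y \<in> zst ?N; zle x y\<rbrakk> \<Longrightarrow> sarr n X x y = B x y"
      using fnc_sarr[OF arr.plusD(1)[OF B(1)]] by blast
    have "arr.plus ?N (sarr n X)" by (rule arr.plus_cong[OF N(2) B(1) X(2)])
    then have Xp: "X \<in> strip_plus A n" using X(1) strip_plus_iff by blast
    have "FObj F X = Z"
    proof (rule DC_obj_eqI[OF F'(1)[OF X(1)] Z])
      fix i j assume ij: "i \<in> {1..n}" "j \<in> {1..n}" "i \<le> j"
      have "darr (FObj F X) i j = sarr n X (int i, 0) (int j, 0)" using row[of "int i" "int j" X] ij by simp
      also have "\<dots> = B (int i, 0) (int j, 0)" by (rule X(2)) (use ij in \<open>simp_all add: zst_def zle_def\<close>)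
      also have "\<dots> = darr Z i j" using B(2)[rule_format, of "int i" "int j"] ij by simp
      finally show "darr (FObj F X) i j = darr Z i j" .
    qed simp
    then show "\<exists>X\<in>strip_plus A n. FObj F X = Z" using Xp by blast
  next
    fix X Y h assume X: "X \<in> strip_plus A n" and Y: "Y \<in> strip_plus A n" and h: "h \<in> Mor ?D (FObj F X) (FObj F Y)"
    have pX: "X \<in> Obj (SC n)" "arr.plus ?N (sarr n X)" and pY: "Y \<in> Obj (SC n)" "arr.plus ?N (sarr n Y)"
      using X Y strip_plus_iff by blast+
    have "arr.nt {1..?N - 1} (\<le>) (\<lambda>i j. sarr n X (i, 0) (j, 0)) (\<lambda>i j. sarr n Y (i, 0) (j, 0)) (\<lambda>i. tarr (FObj F X) (FObj F Y) h (nat i))"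
      by (rule arr.nt_cong[OF nti[OF F'(1)[OF pX(1)] F'(1)[OF pY(1)] h]]) (simp_all add: row)
    then obtain s where s: "arr.nt (zst ?N) zle (sarr n X) (sarr n Y) s"
      "\<forall>j. 1 \<le> j \<and> j \<le> ?N - 1 \<longrightarrow> s (j, 0) = tarr (FObj F X) (FObj F Y) h (nat j)"
      using arr.nt_extend_inner[OF N(1) pX(2) pY(2)] by blast
    obtain t where t: "t \<in> Mor (SC n) X Y" "\<And>x. x \<in> zst ?N \<Longrightarrow> starr n X Y t x = s x"
      using nt_starr[OF pX(1) pY(1) s(1)] by blast
    have "FMor F X Y t = h"
    proof (rule DC_mor_eqI[OF F'(2)[OF pX(1) pY(1) t(1)] h])
      fix i assume i: "i \<in> {1..n}"
      have "tarr (FObj F X) (FObj F Y) (FMor F X Y t) i = s (int i, 0)"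
        using rowm[of "int i" X Y t] t(2)[of "(int i, 0)"] i by (simp add: zst_def)
      also have "\<dots> = tarr (FObj F X) (FObj F Y) h i" using s(2)[rule_format, of "int i"] i by simp
      finally show "FMor F X Y t i = h i" unfolding tarr_def by simp
    qed
    then show "\<exists>f\<in>Mor (SC n) X Y. FMor F X Y f = h" using t(1) by blast
  next
    fix X Y f assume X: "X \<in> strip_plus A n" and Y: "Y \<in> strip_plus A n" and f: "f \<in> Mor (SC n) X Y"
    have pX: "X \<in> Obj (SC n)" "arr.plus ?N (sarr n X)" and pY: "Y \<in> Obj (SC n)" "arr.plus ?N (sarr n Y)"
      using X Y strip_plus_iff by blast+
    note FX = F'(1)[OF pX(1)] and FY = F'(1)[OF pY(1)]
    show "FMor F X Y f \<in> factoring ?D (split_diagrams A {1..n} (\<le>)) (FObj F X) (FObj F Y)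
      \<longleftrightarrow> f \<in> factoring (plus_cat A n) (split_plus A n) X Y"
    proof
      assume "f \<in> factoring (plus_cat A n) (split_plus A n) X Y"
      then obtain W u v where w: "f = Cmp (SC n) X W Y v u" "W \<in> split_plus A n" "u \<in> Mor (SC n) X W" "v \<in> Mor (SC n) W Y"
        unfolding factoring_def plus_cat_simps by blast
      have W: "W \<in> Obj (SC n)" using w(2) split_plus_iff by blast
      have "arr.regular (darr W x y)" if "x \<in> strip n" "y \<in> strip n" "strip_le x y" for x y
        using w(2) that unfolding split_plus_def Int_iff split_diagrams_iff by blast
      then have "FObj F W \<in> split_diagrams A {1..n} (\<le>)"
        unfolding split_diagrams_iff using F'(1)[OF W] e em unfolding F_def by (simp add: darr_restriction del: atLeastAtMost_iff)
      then show "FMor F X Y f \<in> factoring ?D (split_diagrams A {1..n} (\<le>)) (FObj F X) (FObj F Y)"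
        unfolding factoring_def w(1) F'(4)[OF pX(1) W pY(1) w(3,4)] using F'(2)[OF pX(1) W w(3)] F'(2)[OF W pY(1) w(4)] by blast
    next
      assume "FMor F X Y f \<in> factoring ?D (split_diagrams A {1..n} (\<le>)) (FObj F X) (FObj F Y)"
      then obtain W u v where w: "FMor F X Y f = Cmp ?D (FObj F X) W (FObj F Y) v u" "W \<in> split_diagrams A {1..n} (\<le>)"
        "u \<in> Mor ?D (FObj F X) W" "v \<in> Mor ?D W (FObj F Y)"
        unfolding factoring_def by blast
      have W: "W \<in> Obj ?D" using w(2) split_diagrams_iff by blast
      have "arr.factors ?N (sarr n X) (sarr n Y) (starr n X Y f)"
      proof (rule arr.factors_if_row_factors[OF N(1) pX(2) pY(2) starr_nt[OF pX(1) pY(1) f]])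
        show "arr.fnc {1..?N - 1} (\<le>) (\<lambda>i j. darr W (nat i) (nat j))"
          by (rule arr.fnc_reindex[OF darr_fnc[OF W]]) (use nr nm in auto)
        show "arr.regular (darr W (nat i) (nat j))" if "1 \<le> i" "i \<le> j" "j \<le> ?N - 1" for i j
          using w(2) nr[of i] nr[of j] nm[OF that(2)] that unfolding split_diagrams_iff by auto
        show "arr.nt {1..?N - 1} (\<le>) (\<lambda>i j. sarr n X (i, 0) (j, 0)) (\<lambda>i j. darr W (nat i) (nat j)) (\<lambda>i. tarr (FObj F X) W u (nat i))"
          by (rule arr.nt_cong[OF nti[OF FX W w(3)]]) (simp_all add: row)
        show "arr.nt {1..?N - 1} (\<le>) (\<lambda>i j. darr W (nat i) (nat j)) (\<lambda>i j. sarr n Y (i, 0) (j, 0)) (\<lambda>i. tarr W (FObj F Y) v (nat i))"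
          by (rule arr.nt_cong[OF nti[OF W FY w(4)]]) (simp_all add: row)
        show "starr n X Y f (j, 0) = arrow_cmp A (tarr W (FObj F Y) v (nat j)) (tarr (FObj F X) W u (nat j))"
          if "1 \<le> j" "j \<le> ?N - 1" for j
        proof -
          have j: "j \<in> {1..?N - 1}" using that by simp
          show ?thesis using rowm[OF j, of X Y f] unfolding w(1) tarr_cmp[OF FX W FY w(3,4) nr[OF j]] by simp
        qed
      qed
      then show "f \<in> factoring (plus_cat A n) (split_plus A n) X Y" using factoring_plus_iff[OF pX(1) pY(1) f] by blast
    qed
  qed
qed

end

theorem proposition12:
  fixes C :: "('o, 'm) precat" and n :: nat
  assumes "weakly_abelian_category C"
  shows "is_equivalence (stable_plus_cat C n) (stable_dot_cat C n) (stable_restriction C n)"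
  by (rule weakly_abelian_category.stable_restriction_equivalence[OF assms])

end
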